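(* Let $\pi$ be an irreducible representation of $C(SU_0(n+1))$ on a Hilbert space $\mathcal H$, and let $r\equiv r(\pi)=\min\{i: 1\le i\le n+1,\ \pi(z_{n+1,i})\neq 0\}$. Assume $r\le n$. Then there is an irreducible representation $\pi_1$ of $C(SU_0(n+1))$ acting on a Hilbert space $\mathcal H_1$ such that $r(\pi_1)=r+1$ and $\pi$ is unitarily equivalent to the representation $\pi_1*\psi_{s_r}$ acting on $\mathcal H_1\otimes \ell^2(\mathbb N)$ given by $$(\pi_1*\psi_{s_r})(z_{i,j})=\sum_{k=\min\{i,j\}}^{\max\{i,j\}}\pi_1(z_{i,k})\otimes\psi_{s_r}(z_{k,j}),\qquad 1\le i,j\le n+1 .$$
   Context: Fix an integer $n\ge 2$. $C(SU_0(n+1))$ denotes the universal unital $C^*$-algebra generated by elements $z_{i,j}$, $1\le i,j\le n+1$, subject to the following relations (empty products are $1$): (1) $z_{i,j}z_{i,l}=0$ if $j<l$; (2) $z_{i,j}z_{k,j}=0$ if $i<k$; (3) $z_{i,l}z_{k,j}=z_{k,j}z_{i,l}$ if $i<k$ and $j<l$; (4) $z_{i,l}z_{k,j}=0$ if $i<k$, $j<l$ and $\max\{i,j\}\ge\min\{k,l\}$; (5) $z_{i,j}z_{k,l}-z_{k,l}z_{i,j}=z_{i,l}z_{k,j}$ if $i<k$, $j<l$ and $\max\{i,j\}+1=\min\{k,l\}$; (6) $z_{i,j}z_{k,l}=z_{k,l}z_{i,j}$ if $i<k$, $j<l$ and $\max\{i,j\}+1<\min\{k,l\}$; (7) $z_{1,1}z_{2,2}\cdots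 z_{n+1,n+1}=1$; (8) $z_{i,j}z_{r,s}^*=z_{r,s}^*z_{i,j}$ if $i\ne r$ and $j\neq s$; (9) $z_{r,s}^*=(z_{1,1}\cdots z_{s-1,s-1})(z_{s,s+1}z_{s+1,s+2}\cdots z_{r-1,r})(z_{r+1,r+1}\cdots z_{n+1,n+1})$ if $r>s$; $z_{r,s}^*=(z_{1,1}\cdots z_{r-1,r-1})(z_{r+1,r}z_{r+2,r+1}\cdots z_{s,s-1})(z_{s+1,s+1}\cdots z_{n+1,n+1})$ if $r<s$; $z_{r,r}^*=(z_{1,1}\cdots z_{r-1,r-1})(z_{r+1,r+1}\cdots z_{n+1,n+1})$. Representations are unital $*$-representations on Hilbert spaces. For any representation $\pi$, $r(\pi):=\min\{i:1\le i\le n+1,\ \pi(z_{n+1,i})\ne0\}$. $\mathbb N=\{0,1,2,\dots\}$; $S$ is the left shift on $\ell^2(\mathbb N)$: $Se_m=e_{m-1}$ for $m\ge1$, $Se_0=0$; $P_0=I-S^*S$ is the projection onto $\mathbb C e_0$. For $1\le r\le n$, $\psi_{s_r}$ is the representation of $C(SU_0(n+1))$ on $\ell^2(\mathbb N)$ with $\psi_{s_r}(z_{r,r})=S$, $\psi_{s_r}(z_{r+1,r+1})=S^*$, $\psi_{s_r}(z_{r,r+1})=\psi_{s_r}(z_{r+1,r})=P_0$, and $\psi_{s_r}(z_{i,j})=\delta_{i,j}I$ for all other $(i,j)$. *)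

theory Defs
  imports "HOL-Analysis.Analysis" "HOL-Algebra.Module"
begin

section \<open>Complex Hilbert spaces\<close>

text \<open>The scalar product is linear in the second argument.  Completeness comes from
  \<^class>\<open>complete_space\<close>, positive definiteness from \<^class>\<open>real_inner\<close>.\<close>

class chilbert_space = real_inner + complete_space +
  fixes scaleC :: "complex \<Rightarrow> 'a \<Rightarrow> 'a" (infixr "*\<^sub>C" 75)
    and cinner :: "'a \<Rightarrow> 'a \<Rightarrow> complex"
  assumes scaleR_scaleC: "r *\<^sub>R x = complex_of_real r *\<^sub>C x"
    and scaleC_add_right: "c *\<^sub>C (x + y) = c *\<^sub>C x + c *\<^sub>C y"
    and scaleC_add_left: "(c + d) *\<^sub>C x = c *\<^sub>C x + d *\<^sub>C x"
    and scaleC_scaleC: "c *\<^sub>C d *\<^sub>C x = (c * d) *\<^sub>C x"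
    and inner_cinner: "inner x y = Re (cinner x y)"
    and cinner_commute: "cinner x y = cnj (cinner y x)"
    and cinner_add_right: "cinner x (y + z) = cinner x y + cinner x z"
    and cinner_scaleC_right: "cinner x (c *\<^sub>C y) = c * cinner x y"

lemma scaleC_one: "1 *\<^sub>C x = (x::'a::chilbert_space)"
  using scaleR_scaleC[of 1 x] by simp

global_interpretation cvec: Vector_Spaces.vector_space "scaleC :: complex \<Rightarrow> 'a \<Rightarrow> 'a::chilbert_space"
  defines csubspace = cvec.subspace and cspan = cvec.span
  by unfold_locales (simp_all add: scaleC_add_right scaleC_add_left scaleC_scaleC scaleC_one)

lemma cinner_scaleC_left: "cinner (c *\<^sub>C x) y = cnj c * cinner (x::'a::chilbert_space) y"
  using cinner_commute[of "c *\<^sub>C x" y] cinner_commute[of y x] by (simp add: cinner_scaleC_right)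

lemma cinner_add_left: "cinner (x + y) z = cinner x z + cinner (y::'a::chilbert_space) z"
  using cinner_commute[of "x + y" z] cinner_commute[of z x] cinner_commute[of z y]
  by (simp add: cinner_add_right)

lemma cinner_self: "cinner x x = complex_of_real ((norm (x::'a::chilbert_space))\<^sup>2)"
proof -
  have "Im (cinner x x) = 0"
    using arg_cong[OF cinner_commute[of x x], of Im] by simp
  moreover have "Re (cinner x x) = (norm x)\<^sup>2"
    by (simp add: power2_norm_eq_inner inner_cinner)
  ultimately show ?thesis by (simp add: complex_eq_iff)
qed

lemma norm_scaleC: "norm (c *\<^sub>C x) = cmod c * norm (x::'a::chilbert_space)"
proof -
  have "complex_of_real ((norm (c *\<^sub>C x))\<^sup>2) = cnj c * c * complex_of_real ((norm x)\<^sup>2)"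
    by (simp only: cinner_self[symmetric] cinner_scaleC_left cinner_scaleC_right) simp
  also have "\<dots> = complex_of_real ((cmod c * norm x)\<^sup>2)"
    by (simp add: power_mult_distrib complex_norm_square mult.commute del: of_real_power)
  finally have "(norm (c *\<^sub>C x))\<^sup>2 = (cmod c * norm x)\<^sup>2"
    by (simp only: of_real_eq_iff)
  then show ?thesis by (simp add: power2_eq_iff_nonneg)
qed

lemma cinner_Cauchy_Schwarz: "cmod (cinner x y) \<le> norm x * norm (y::'a::chilbert_space)"
proof (cases "cinner x y = 0")
  case False
  let ?c = "cinner x y"
  have "cmod ?c * cmod ?c = Re (cnj ?c * ?c)"
    by (simp add: cmod_power2 flip: power2_eq_square)
  also have "\<dots> = inner (?c *\<^sub>C x) y"
    by (simp only: inner_cinner cinner_scaleC_left)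
  also have "\<dots> \<le> norm (?c *\<^sub>C x) * norm y" by (rule norm_cauchy_schwarz)
  also have "\<dots> = cmod ?c * (norm x * norm y)" by (simp add: norm_scaleC)
  finally show ?thesis using False by simp
qed simp

instantiation complex :: chilbert_space
begin

definition scaleC_complex :: "complex \<Rightarrow> complex \<Rightarrow> complex" where
  "scaleC_complex c x = c * x"

definition cinner_complex :: "complex \<Rightarrow> complex \<Rightarrow> complex" where
  "cinner_complex x y = cnj x * y"

instance
  by standard (simp_all add: scaleC_complex_def cinner_complex_def inner_complex_def scaleR_conv_of_real
      algebra_simps)

end

text \<open>A Hilbert space is given by a closed complex subspace of a type of class
  \<^class>\<open>chilbert_space\<close>, the whole type being one of them.\<close>

definition hilbert_subspace :: "'h::chilbert_space set \<Rightarrow> bool" where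
  "hilbert_subspace H \<longleftrightarrow> closed H \<and> csubspace H"


section \<open>The Hilbert space of square-summable sequences in a Hilbert space\<close>

typedef (overloaded) 'h ell2 = "{f :: nat \<Rightarrow> 'h::chilbert_space. summable (\<lambda>m. (norm (f m))\<^sup>2)}"
  morphisms ell2_nth Abs_ell2
  by (rule exI[of _ "\<lambda>_. 0"]) simp

setup_lifting type_definition_ell2

lemma summable_ell2: "summable (\<lambda>m. (norm (ell2_nth f m))\<^sup>2)"
  using ell2_nth[of f] by simp

lemma ell2_eqI: "(\<And>m. ell2_nth f m = ell2_nth g m) \<Longrightarrow> f = g"
  by transfer auto

lemma summable_sq_add:
  fixes f g :: "nat \<Rightarrow> 'h::real_normed_vector"
  assumes "summable (\<lambda>m. (norm (f m))\<^sup>2)" "summable (\<lambda>m. (norm (g m))\<^sup>2)"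
  shows "summable (\<lambda>m. (norm (f m + g m))\<^sup>2)"
proof (rule summable_comparison_test')
  show "summable (\<lambda>m. 2 * (norm (f m))\<^sup>2 + 2 * (norm (g m))\<^sup>2)"
    using assms by (intro summable_add summable_mult)
  show "norm ((norm (f m + g m))\<^sup>2) \<le> 2 * (norm (f m))\<^sup>2 + 2 * (norm (g m))\<^sup>2" if "m \<ge> 0" for m
  proof -
    have "(norm (f m + g m))\<^sup>2 \<le> (norm (f m) + norm (g m))\<^sup>2"
      by (intro power_mono norm_triangle_ineq) simp
    also have "\<dots> \<le> 2 * (norm (f m))\<^sup>2 + 2 * (norm (g m))\<^sup>2"
      using sum_squares_bound[of "norm (f m)" "norm (g m)"] by (simp add: power2_sum)
    finally show ?thesis by simp
  qed
qed

lemma summable_sq_scaleC: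
  fixes f :: "nat \<Rightarrow> 'h::chilbert_space"
  assumes "summable (\<lambda>m. (norm (f m))\<^sup>2)"
  shows "summable (\<lambda>m. (norm (c *\<^sub>C f m))\<^sup>2)"
  using summable_mult[OF assms, of "(cmod c)\<^sup>2"] by (simp add: norm_scaleC power_mult_distrib)

lemma summable_ell2_cinner:
  "summable (\<lambda>m. cinner (ell2_nth f m) (ell2_nth g m))"
proof (rule summable_comparison_test')
  show "summable (\<lambda>m. (norm (ell2_nth f m))\<^sup>2 + (norm (ell2_nth g m))\<^sup>2)"
    by (intro summable_add summable_ell2)
  show "norm (cinner (ell2_nth f m) (ell2_nth g m)) \<le> (norm (ell2_nth f m))\<^sup>2 + (norm (ell2_nth g m))\<^sup>2"
    if "m \<ge> 0" for m
  proof -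
    let ?a = "norm (ell2_nth f m)" and ?b = "norm (ell2_nth g m)"
    have "norm (cinner (ell2_nth f m) (ell2_nth g m)) \<le> ?a * ?b" by (rule cinner_Cauchy_Schwarz)
    moreover have "2 * (?a * ?b) \<le> ?a\<^sup>2 + ?b\<^sup>2" using sum_squares_bound[of ?a ?b] by simp
    moreover have "0 \<le> ?a * ?b" by simp
    ultimately show ?thesis by linarith
  qed
qed

instantiation ell2 :: (chilbert_space) real_inner
begin

lift_definition zero_ell2 :: "'a ell2" is "\<lambda>_. 0" by simp
lift_definition plus_ell2 :: "'a ell2 \<Rightarrow> 'a ell2 \<Rightarrow> 'a ell2" is "\<lambda>f g m. f m + g m"
  by (rule summable_sq_add)
lift_definition uminus_ell2 :: "'a ell2 \<Rightarrow> 'a ell2" is "\<lambda>f m. - f m" by simp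
lift_definition minus_ell2 :: "'a ell2 \<Rightarrow> 'a ell2 \<Rightarrow> 'a ell2" is "\<lambda>f g m. f m - g m"
  using summable_sq_add[where g = "\<lambda>m. - g m" for g] by fastforce
lift_definition scaleR_ell2 :: "real \<Rightarrow> 'a ell2 \<Rightarrow> 'a ell2" is "\<lambda>r f m. r *\<^sub>R f m"
  using summable_mult by (fastforce simp: power_mult_distrib)

definition inner_ell2 :: "'a ell2 \<Rightarrow> 'a ell2 \<Rightarrow> real" where
  "inner_ell2 f g = (\<Sum>m. inner (ell2_nth f m) (ell2_nth g m))"

definition norm_ell2 :: "'a ell2 \<Rightarrow> real" where
  "norm_ell2 f = sqrt (inner f f)"

definition sgn_ell2 :: "'a ell2 \<Rightarrow> 'a ell2" where
  "sgn_ell2 f = scaleR (inverse (norm f)) f"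

definition dist_ell2 :: "'a ell2 \<Rightarrow> 'a ell2 \<Rightarrow> real" where
  "dist_ell2 f g = norm (f - g)"

definition uniformity_ell2 :: "('a ell2 \<times> 'a ell2) filter" where
  "uniformity_ell2 = (INF e\<in>{0<..}. principal {(f, g). dist f g < e})"

definition open_ell2 :: "'a ell2 set \<Rightarrow> bool" where
  "open_ell2 U \<longleftrightarrow> (\<forall>f\<in>U. eventually (\<lambda>(f', g). f' = f \<longrightarrow> g \<in> U) uniformity)"

lemma summable_ell2_inner: "summable (\<lambda>m. inner (ell2_nth f m) (ell2_nth g m))"
  using summable_Re[OF summable_ell2_cinner[of f g]] by (simp add: inner_cinner)

instance
proof
  fix f g h :: "'a ell2" and r s :: real
  show "f + g + h = f + (g + h)" by transfer (auto simp: algebra_simps)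
  show "f + g = g + f" by transfer (auto simp: algebra_simps)
  show "0 + f = f" by transfer auto
  show "- f + f = 0" by transfer auto
  show "f - g = f + - g" by transfer auto
  show "r *\<^sub>R (f + g) = r *\<^sub>R f + r *\<^sub>R g" by transfer (auto simp: algebra_simps)
  show "(r + s) *\<^sub>R f = r *\<^sub>R f + s *\<^sub>R f" by transfer (auto simp: algebra_simps)
  show "r *\<^sub>R s *\<^sub>R f = (r * s) *\<^sub>R f" by transfer auto
  show "1 *\<^sub>R f = f" by transfer auto
  show "sgn f = scaleR (inverse (norm f)) f" by (rule sgn_ell2_def)
  show "dist f g = norm (f - g)" by (rule dist_ell2_def)
  show "uniformity = (INF e\<in>{0<..}. principal {(f, g). dist (f :: 'a ell2) g < e})"
    by (rule uniformity_ell2_def)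
  show "open U \<longleftrightarrow> (\<forall>f\<in>U. eventually (\<lambda>(f', g). f' = f \<longrightarrow> g \<in> U) uniformity)" for U :: "'a ell2 set"
    by (rule open_ell2_def)
  show "inner f g = inner g f" by (simp add: inner_ell2_def inner_commute)
  show "inner (f + g) h = inner f h + inner g h"
    by (simp add: inner_ell2_def plus_ell2.rep_eq inner_add_left suminf_add summable_ell2_inner)
  show "inner (r *\<^sub>R f) g = r * inner f g"
    by (simp add: inner_ell2_def scaleR_ell2.rep_eq suminf_mult summable_ell2_inner)
  show "0 \<le> inner f f"
    unfolding inner_ell2_def by (intro suminf_nonneg summable_ell2_inner) simp
  show "(inner f f = 0) = (f = 0)"
  proof
    assume "inner f f = 0"
    then have "\<forall>m. inner (ell2_nth f m) (ell2_nth f m) = 0"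
      unfolding inner_ell2_def by (subst (asm) suminf_eq_zero_iff) (auto intro: summable_ell2_inner)
    then show "f = 0" by (intro ell2_eqI) (simp add: zero_ell2.rep_eq)
  qed (simp add: inner_ell2_def zero_ell2.rep_eq)
  show "norm f = sqrt (inner f f)" by (rule norm_ell2_def)
qed

end

lemma norm_ell2_sq: "(norm f)\<^sup>2 = (\<Sum>m. (norm (ell2_nth f m))\<^sup>2)"
  by (simp add: power2_norm_eq_inner inner_ell2_def)

lemma norm_ell2_partial: "(\<Sum>m<M. (norm (ell2_nth f m))\<^sup>2) \<le> (norm f)\<^sup>2"
  unfolding norm_ell2_sq by (rule sum_le_suminf) (auto intro: summable_ell2)

lemma norm_ell2_nth_le: "norm (ell2_nth f m) \<le> norm f"
proof -
  have "(norm (ell2_nth f m))\<^sup>2 \<le> (\<Sum>k<Suc m. (norm (ell2_nth f k))\<^sup>2)"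
    by (rule member_le_sum) auto
  also have "\<dots> \<le> (norm f)\<^sup>2" by (rule norm_ell2_partial)
  finally show ?thesis by (rule power2_le_imp_le) simp
qed

lemma ell2_complete:
  fixes X :: "nat \<Rightarrow> 'a::chilbert_space ell2"
  assumes X: "Cauchy X"
  shows "convergent X"
proof -
  have "Cauchy (\<lambda>p. ell2_nth (X p) m)" for m
  proof (rule metric_CauchyI)
    fix e :: real assume "e > 0"
    then obtain N where N: "\<And>p q. p \<ge> N \<Longrightarrow> q \<ge> N \<Longrightarrow> dist (X p) (X q) < e"
      using metric_CauchyD[OF X \<open>e > 0\<close>] by blast
    have "dist (ell2_nth (X p) m) (ell2_nth (X q) m) < e" if "p \<ge> N" "q \<ge> N" for p q
      using norm_ell2_nth_le[of "X p - X q" m] N[OF that] by (simp add: dist_norm minus_ell2.rep_eq)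
    then show "\<exists>N. \<forall>p\<ge>N. \<forall>q\<ge>N. dist (ell2_nth (X p) m) (ell2_nth (X q) m) < e" by blast
  qed
  then have "\<forall>m. \<exists>l. (\<lambda>p. ell2_nth (X p) m) \<longlonglongrightarrow> l"
    using Cauchy_convergent convergent_def by blast
  then obtain l where l: "\<And>m. (\<lambda>p. ell2_nth (X p) m) \<longlonglongrightarrow> l m" by metis
  have tail: "\<exists>N. \<forall>p\<ge>N. \<forall>M. (\<Sum>m<M. (norm (ell2_nth (X p) m - l m))\<^sup>2) \<le> e\<^sup>2" if e: "e > 0" for e :: real
  proof -
    obtain N where N: "\<And>p q. p \<ge> N \<Longrightarrow> q \<ge> N \<Longrightarrow> dist (X p) (X q) < e"
      using metric_CauchyD[OF X e] by blast
    have "(\<Sum>m<M. (norm (ell2_nth (X p) m - l m))\<^sup>2) \<le> e\<^sup>2" if p: "p \<ge> N" for p M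
    proof (rule tendsto_upperbound)
      show "(\<lambda>q. \<Sum>m<M. (norm (ell2_nth (X p) m - ell2_nth (X q) m))\<^sup>2)
          \<longlonglongrightarrow> (\<Sum>m<M. (norm (ell2_nth (X p) m - l m))\<^sup>2)"
        by (intro tendsto_intros l)
      show "\<forall>\<^sub>F q in sequentially. (\<Sum>m<M. (norm (ell2_nth (X p) m - ell2_nth (X q) m))\<^sup>2) \<le> e\<^sup>2"
        unfolding eventually_sequentially
      proof (intro exI allI impI)
        fix q assume q: "N \<le> q"
        have "(\<Sum>m<M. (norm (ell2_nth (X p) m - ell2_nth (X q) m))\<^sup>2) \<le> (norm (X p - X q))\<^sup>2"
          using norm_ell2_partial[of "X p - X q" M] by (simp add: minus_ell2.rep_eq)
        also have "\<dots> \<le> e\<^sup>2"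
          using N[OF p q] by (intro power_mono) (auto simp: dist_norm)
        finally show "(\<Sum>m<M. (norm (ell2_nth (X p) m - ell2_nth (X q) m))\<^sup>2) \<le> e\<^sup>2" .
      qed
    qed simp
    then show ?thesis by blast
  qed
  obtain N1 where N1: "\<And>M. (\<Sum>m<M. (norm (ell2_nth (X N1) m - l m))\<^sup>2) \<le> 1\<^sup>2"
    using tail[OF zero_less_one] by blast
  have s: "summable (\<lambda>m. (norm (ell2_nth (X N1) m - l m))\<^sup>2)"
  proof (rule bounded_imp_summable)
    show "(\<Sum>m\<le>M. (norm (ell2_nth (X N1) m - l m))\<^sup>2) \<le> 1\<^sup>2" for M
      using N1[of "Suc M"] unfolding lessThan_Suc_atMost .
  qed simp
  then have "summable (\<lambda>m. (norm (l m - ell2_nth (X N1) m))\<^sup>2)" by (simp add: norm_minus_commute)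
  from summable_sq_add[OF this summable_ell2[of "X N1"]]
  have ls: "summable (\<lambda>m. (norm (l m))\<^sup>2)" by simp
  define L where "L = Abs_ell2 l"
  have L: "ell2_nth L = l" unfolding L_def by (rule Abs_ell2_inverse) (simp add: ls)
  have "X \<longlonglongrightarrow> L"
  proof (rule metric_LIMSEQ_I)
    fix e :: real assume e: "e > 0"
    obtain N where N: "\<And>p M. p \<ge> N \<Longrightarrow> (\<Sum>m<M. (norm (ell2_nth (X p) m - l m))\<^sup>2) \<le> (e/2)\<^sup>2"
      using tail[OF half_gt_zero[OF e]] by blast
    have "dist (X p) L < e" if "p \<ge> N" for p
    proof -
      have "(norm (X p - L))\<^sup>2 \<le> (e/2)\<^sup>2"
        unfolding norm_ell2_sq
        by (rule suminf_le_const[OF summable_ell2]) (simp only: minus_ell2.rep_eq L N[OF that])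
      then have "norm (X p - L) \<le> e/2" by (rule power2_le_imp_le) (use e in simp)
      then show ?thesis using e by (simp add: dist_norm)
    qed
    then show "\<exists>N. \<forall>p\<ge>N. dist (X p) L < e" by blast
  qed
  then show ?thesis by (auto simp: convergent_def)
qed

instantiation ell2 :: (chilbert_space) chilbert_space
begin

lift_definition scaleC_ell2 :: "complex \<Rightarrow> 'a ell2 \<Rightarrow> 'a ell2" is "\<lambda>c f m. c *\<^sub>C f m"
  by (rule summable_sq_scaleC)

definition cinner_ell2 :: "'a ell2 \<Rightarrow> 'a ell2 \<Rightarrow> complex" where
  "cinner_ell2 f g = (\<Sum>m. cinner (ell2_nth f m) (ell2_nth g m))"

instance
proof
  fix f g h :: "'a ell2" and c d :: complex and r :: real
  show "r *\<^sub>R f = complex_of_real r *\<^sub>C f" by transfer (simp add: scaleR_scaleC)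
  show "c *\<^sub>C (f + g) = c *\<^sub>C f + c *\<^sub>C g" by transfer (simp add: scaleC_add_right)
  show "(c + d) *\<^sub>C f = c *\<^sub>C f + d *\<^sub>C f" by transfer (simp add: scaleC_add_left)
  show "c *\<^sub>C d *\<^sub>C f = (c * d) *\<^sub>C f" by transfer (simp add: scaleC_scaleC)
  show "inner f g = Re (cinner f g)"
    by (simp add: inner_ell2_def cinner_ell2_def inner_cinner Re_suminf summable_ell2_cinner)
  show "cinner f g = cnj (cinner g f)"
    unfolding cinner_ell2_def
    by (subst cinner_commute)
      (rule sums_unique[symmetric], simp only: sums_cnj, rule summable_sums, rule summable_ell2_cinner)
  show "cinner f (g + h) = cinner f g + cinner f h"
    by (simp add: cinner_ell2_def plus_ell2.rep_eq cinner_add_right suminf_add summable_ell2_cinner)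
  show "cinner f (c *\<^sub>C g) = c * cinner f g"
    by (simp add: cinner_ell2_def scaleC_ell2.rep_eq cinner_scaleC_right suminf_mult summable_ell2_cinner)
qed (rule ell2_complete)

end


section \<open>Unital C*-algebras\<close>

definition complex_ring :: "complex ring" where
  "complex_ring = \<lparr>carrier = UNIV, monoid.mult = (*), one = 1, ring.zero = 0, add = (+)\<rparr>"

record 'a cstar_struct = "(complex, 'a) module" +
  cstar :: "'a \<Rightarrow> 'a"
  cnorm :: "'a \<Rightarrow> real"

locale unital_cstar_algebra = ring A for A :: "'a cstar_struct" (structure) +
  assumes complex_module: "Module.module complex_ring A"
    and smult_mult_left:
      "\<lbrakk>x \<in> carrier A; y \<in> carrier A\<rbrakk> \<Longrightarrow> (c \<odot> x) \<otimes> y = c \<odot> (x \<otimes> y)"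
    and smult_mult_right:
      "\<lbrakk>x \<in> carrier A; y \<in> carrier A\<rbrakk> \<Longrightarrow> x \<otimes> (c \<odot> y) = c \<odot> (x \<otimes> y)"
    and star_closed: "x \<in> carrier A \<Longrightarrow> cstar A x \<in> carrier A"
    and star_star: "x \<in> carrier A \<Longrightarrow> cstar A (cstar A x) = x"
    and star_add: "\<lbrakk>x \<in> carrier A; y \<in> carrier A\<rbrakk> \<Longrightarrow> cstar A (x \<oplus> y) = cstar A x \<oplus> cstar A y"
    and star_smult: "x \<in> carrier A \<Longrightarrow> cstar A (c \<odot> x) = cnj c \<odot> cstar A x"
    and star_mult: "\<lbrakk>x \<in> carrier A; y \<in> carrier A\<rbrakk> \<Longrightarrow> cstar A (x \<otimes> y) = cstar A y \<otimes> cstar A x"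
    and norm_nonneg: "x \<in> carrier A \<Longrightarrow> cnorm A x \<ge> 0"
    and norm_eq_zero: "x \<in> carrier A \<Longrightarrow> cnorm A x = 0 \<longleftrightarrow> x = \<zero>"
    and norm_triangle: "\<lbrakk>x \<in> carrier A; y \<in> carrier A\<rbrakk> \<Longrightarrow> cnorm A (x \<oplus> y) \<le> cnorm A x + cnorm A y"
    and norm_smult: "x \<in> carrier A \<Longrightarrow> cnorm A (c \<odot> x) = cmod c * cnorm A x"
    and norm_mult: "\<lbrakk>x \<in> carrier A; y \<in> carrier A\<rbrakk> \<Longrightarrow> cnorm A (x \<otimes> y) \<le> cnorm A x * cnorm A y"
    and cstar_identity: "x \<in> carrier A \<Longrightarrow> cnorm A (cstar A x \<otimes> x) = (cnorm A x)\<^sup>2"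
    and complete:
      "\<lbrakk>range X \<subseteq> carrier A; \<forall>e>0. \<exists>N. \<forall>p\<ge>N. \<forall>q\<ge>N. cnorm A (X p \<ominus> X q) < e\<rbrakk>
        \<Longrightarrow> \<exists>x\<in>carrier A. (\<lambda>p. cnorm A (X p \<ominus> x)) \<longlonglongrightarrow> 0"

text \<open>Preservation of the unit is part of \<^const>\<open>ring_hom\<close>.\<close>

definition unital_star_hom :: "'a cstar_struct \<Rightarrow> 'b cstar_struct \<Rightarrow> ('a \<Rightarrow> 'b) \<Rightarrow> bool" where
  "unital_star_hom A B \<phi> \<longleftrightarrow> \<phi> \<in> ring_hom A B
    \<and> (\<forall>c. \<forall>x\<in>carrier A. \<phi> (c \<odot>\<^bsub>A\<^esub> x) = c \<odot>\<^bsub>B\<^esub> \<phi> x)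
    \<and> (\<forall>x\<in>carrier A. \<phi> (cstar A x) = cstar B (\<phi> x))"

definition unital_cstar_subalgebra :: "'a cstar_struct \<Rightarrow> 'a set \<Rightarrow> bool" where
  "unital_cstar_subalgebra A S \<longleftrightarrow> S \<subseteq> carrier A \<and> \<one>\<^bsub>A\<^esub> \<in> S
    \<and> (\<forall>x\<in>S. \<forall>y\<in>S. x \<oplus>\<^bsub>A\<^esub> y \<in> S \<and> x \<otimes>\<^bsub>A\<^esub> y \<in> S)
    \<and> (\<forall>c. \<forall>x\<in>S. c \<odot>\<^bsub>A\<^esub> x \<in> S)
    \<and> (\<forall>x\<in>S. cstar A x \<in> S)
    \<and> (\<forall>X x. range X \<subseteq> S \<and> x \<in> carrier A \<and> (\<lambda>p. cnorm A (X p \<ominus>\<^bsub>A\<^esub> x)) \<longlonglongrightarrow> 0 \<longrightarrow> x \<in> S)"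


section \<open>The C*-algebra of bounded operators\<close>

text \<open>An operator on \<open>H\<close> is a function on the ambient type whose values outside \<open>H\<close> are
  \<^const>\<open>undefined\<close>, so that operators which agree on \<open>H\<close> are equal.\<close>

definition bounded_ops :: "'h::chilbert_space set \<Rightarrow> ('h \<Rightarrow> 'h) set" where
  "bounded_ops H = {T \<in> H \<rightarrow>\<^sub>E H.
     (\<forall>x\<in>H. \<forall>y\<in>H. T (x + y) = T x + T y) \<and> (\<forall>c. \<forall>x\<in>H. T (c *\<^sub>C x) = c *\<^sub>C T x)
     \<and> (\<exists>K. \<forall>x\<in>H. norm (T x) \<le> K * norm x)}"

definition adjoint_op :: "'h::chilbert_space set \<Rightarrow> ('h \<Rightarrow> 'h) \<Rightarrow> ('h \<Rightarrow> 'h)" where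
  "adjoint_op H T = (THE R. R \<in> bounded_ops H \<and> (\<forall>x\<in>H. \<forall>y\<in>H. cinner (T x) y = cinner x (R y)))"

definition B_op :: "'h::chilbert_space set \<Rightarrow> ('h \<Rightarrow> 'h) cstar_struct" where
  "B_op H = \<lparr>carrier = bounded_ops H, monoid.mult = compose H, one = (\<lambda>x\<in>H. x),
     ring.zero = (\<lambda>x\<in>H. 0), add = (\<lambda>T R. \<lambda>x\<in>H. T x + R x), smult = (\<lambda>c T. \<lambda>x\<in>H. c *\<^sub>C T x),
     cstar = adjoint_op H, cnorm = (\<lambda>T. Sup ((\<lambda>x. norm (T x)) ` {x \<in> H. norm x \<le> 1}))\<rparr>"

definition representation ::
    "'a cstar_struct \<Rightarrow> 'h::chilbert_space set \<Rightarrow> ('a \<Rightarrow> 'h \<Rightarrow> 'h) \<Rightarrow> bool" where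
  "representation A H \<pi> \<longleftrightarrow> hilbert_subspace H \<and> unital_star_hom A (B_op H) \<pi>"

definition irreducible_representation ::
    "'a cstar_struct \<Rightarrow> 'h::chilbert_space set \<Rightarrow> ('a \<Rightarrow> 'h \<Rightarrow> 'h) \<Rightarrow> bool" where
  "irreducible_representation A H \<pi> \<longleftrightarrow> representation A H \<pi> \<and> H \<noteq> {0}
    \<and> (\<forall>M. hilbert_subspace M \<and> M \<subseteq> H \<and> (\<forall>a\<in>carrier A. \<pi> a ` M \<subseteq> M) \<longrightarrow> M = {0} \<or> M = H)"

definition unitarily_equivalent ::
    "'a cstar_struct \<Rightarrow> 'h::chilbert_space set \<Rightarrow> ('a \<Rightarrow> 'h \<Rightarrow> 'h)
      \<Rightarrow> 'k::chilbert_space set \<Rightarrow> ('a \<Rightarrow> 'k \<Rightarrow> 'k) \<Rightarrow> bool" where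
  "unitarily_equivalent A H \<pi> K \<rho> \<longleftrightarrow> (\<exists>U. bij_betw U H K
    \<and> (\<forall>x\<in>H. \<forall>y\<in>H. U (x + y) = U x + U y) \<and> (\<forall>c. \<forall>x\<in>H. U (c *\<^sub>C x) = c *\<^sub>C U x)
    \<and> (\<forall>x\<in>H. \<forall>y\<in>H. cinner (U x) (U y) = cinner x y)
    \<and> (\<forall>a\<in>carrier A. \<forall>x\<in>H. U (\<pi> a x) = \<rho> a (U x)))"


section \<open>The C*-algebra of $SU_0(n+1)$\<close>

text \<open>The ordered product of \<open>f a, f (a + 1), \<dots>, f (b - 1)\<close>; it is the unit if \<open>a \<ge> b\<close>.\<close>

definition ordprod :: "'a cstar_struct \<Rightarrow> (nat \<Rightarrow> 'a) \<Rightarrow> nat \<Rightarrow> nat \<Rightarrow> 'a" where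
  "ordprod A f a b = foldr (\<lambda>t x. f t \<otimes>\<^bsub>A\<^esub> x) [a..<b] \<one>\<^bsub>A\<^esub>"

text \<open>All indices range over \<open>{1..n+1}\<close>; the values of \<open>z\<close> elsewhere are irrelevant.\<close>

definition SU0_relations :: "nat \<Rightarrow> 'a cstar_struct \<Rightarrow> (nat \<Rightarrow> nat \<Rightarrow> 'a) \<Rightarrow> bool" where
  "SU0_relations n A z \<longleftrightarrow>
    (let I = {1..n+1};
         mul = (\<lambda>x y. x \<otimes>\<^bsub>A\<^esub> y);
         commutator = (\<lambda>x y. (x \<otimes>\<^bsub>A\<^esub> y) \<ominus>\<^bsub>A\<^esub> (y \<otimes>\<^bsub>A\<^esub> x));
         diag = ordprod A (\<lambda>t. z t t);
         upper = ordprod A (\<lambda>t. z t (t+1));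
         lower = ordprod A (\<lambda>t. z (t+1) t)
     in (\<forall>i\<in>I. \<forall>j\<in>I. z i j \<in> carrier A)
      \<and> (\<forall>i\<in>I. \<forall>j\<in>I. \<forall>l\<in>I. j < l \<longrightarrow> mul (z i j) (z i l) = \<zero>\<^bsub>A\<^esub>)
      \<and> (\<forall>i\<in>I. \<forall>k\<in>I. \<forall>j\<in>I. i < k \<longrightarrow> mul (z i j) (z k j) = \<zero>\<^bsub>A\<^esub>)
      \<and> (\<forall>i\<in>I. \<forall>k\<in>I. \<forall>j\<in>I. \<forall>l\<in>I. i < k \<and> j < l \<longrightarrow>
            mul (z i l) (z k j) = mul (z k j) (z i l)
          \<and> (max i j \<ge> min k l \<longrightarrow> mul (z i l) (z k j) = \<zero>\<^bsub>A\<^esub>)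
          \<and> (max i j + 1 = min k l \<longrightarrow> commutator (z i j) (z k l) = mul (z i l) (z k j))
          \<and> (max i j + 1 < min k l \<longrightarrow> mul (z i j) (z k l) = mul (z k l) (z i j)))
      \<and> diag 1 (n+2) = \<one>\<^bsub>A\<^esub>
      \<and> (\<forall>i\<in>I. \<forall>j\<in>I. \<forall>r\<in>I. \<forall>s\<in>I. i \<noteq> r \<and> j \<noteq> s \<longrightarrow>
            mul (z i j) (cstar A (z r s)) = mul (cstar A (z r s)) (z i j))
      \<and> (\<forall>r\<in>I. \<forall>s\<in>I.
            (r > s \<longrightarrow> cstar A (z r s) = mul (mul (diag 1 s) (upper s r)) (diag (r+1) (n+2)))
          \<and> (r < s \<longrightarrow> cstar A (z r s) = mul (mul (diag 1 r) (lower r s)) (diag (s+1) (n+2)))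
          \<and> (r = s \<longrightarrow> cstar A (z r s) = mul (diag 1 r) (diag (r+1) (n+2)))))"

text \<open>\<open>A\<close> is (a copy of) the universal unital C*-algebra on generators \<open>z i j\<close> with the above
  relations.  As HOL cannot quantify over all types, the C*-algebras \<open>B\<close> in the universal
  property are those whose elements have type \<open>'b\<close>.  If \<open>'b\<close> has at least the cardinality of the
  continuum this is no restriction: the C*-subalgebra of \<open>B\<close> generated by the finitely many
  elements \<open>w i j\<close> has at most that cardinality, and so it has a copy in type \<open>'b\<close>.  The type
  \<open>'h \<Rightarrow> 'h\<close> of the operators on a nonzero Hilbert space is always large enough.\<close>

definition is_C_SU0 ::
    "'b itself \<Rightarrow> nat \<Rightarrow> 'a cstar_struct \<Rightarrow> (nat \<Rightarrow> nat \<Rightarrow> 'a) \<Rightarrow> bool" where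
  "is_C_SU0 TYPE('b) n A z \<longleftrightarrow> unital_cstar_algebra A \<and> SU0_relations n A z
    \<and> (\<forall>S. unital_cstar_subalgebra A S \<and> (\<forall>i\<in>{1..n+1}. \<forall>j\<in>{1..n+1}. z i j \<in> S) \<longrightarrow> S = carrier A)
    \<and> (\<forall>(B :: 'b cstar_struct) w. unital_cstar_algebra B \<and> SU0_relations n B w \<longrightarrow>
        (\<exists>\<phi>. unital_star_hom A B \<phi> \<and> (\<forall>i\<in>{1..n+1}. \<forall>j\<in>{1..n+1}. \<phi> (z i j) = w i j)))"

definition rep_index ::
    "nat \<Rightarrow> (nat \<Rightarrow> nat \<Rightarrow> 'a) \<Rightarrow> 'h::chilbert_space set \<Rightarrow> ('a \<Rightarrow> 'h \<Rightarrow> 'h) \<Rightarrow> nat" where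
  "rep_index n z H \<pi> = Min {i \<in> {1..n+1}. \<pi> (z (n+1) i) \<noteq> \<zero>\<^bsub>B_op H\<^esub>}"


section \<open>The representations $\psi_{s_r}$ and the tensor product with $\ell^2(\mathbf{N})$\<close>

text \<open>\<open>complex ell2\<close> is \<open>\<ell>\<^sup>2(\<nat>)\<close>.\<close>

lift_definition shift_op :: "complex ell2 \<Rightarrow> complex ell2" is "\<lambda>f m. f (Suc m)"
  by (subst summable_Suc_iff)

lift_definition basis_ell2 :: "nat \<Rightarrow> complex ell2" is "\<lambda>k m. if m = k then 1 else 0"
  by (rule summable_finite[where N = "{k}" for k]) auto

lemma shift_op_basis:
  "shift_op (basis_ell2 m) = (if m \<ge> 1 then basis_ell2 (m - 1) else 0)"
  by (rule ell2_eqI) (auto simp: shift_op.rep_eq basis_ell2.rep_eq zero_ell2.rep_eq)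

definition psi_gen :: "nat \<Rightarrow> nat \<Rightarrow> nat \<Rightarrow> complex ell2 \<Rightarrow> complex ell2" where
  "psi_gen r i j = (let B = B_op (UNIV :: complex ell2 set);
       S' = cstar B shift_op;
       P0 = \<one>\<^bsub>B\<^esub> \<ominus>\<^bsub>B\<^esub> (S' \<otimes>\<^bsub>B\<^esub> shift_op)
     in if i = r \<and> j = r then shift_op
        else if i = r + 1 \<and> j = r + 1 then S'
        else if i = r \<and> j = r + 1 \<or> i = r + 1 \<and> j = r then P0
        else if i = j then \<one>\<^bsub>B\<^esub> else \<zero>\<^bsub>B\<^esub>)"

text \<open>The representation \<open>\<psi>\<close> of the universal C*-algebra is determined by its values on the
  generators, so \<open>is_psi\<close> describes it uniquely on \<open>carrier A\<close>; the same applies to \<open>is_conv\<close>.\<close>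

definition is_psi ::
    "nat \<Rightarrow> 'a cstar_struct \<Rightarrow> (nat \<Rightarrow> nat \<Rightarrow> 'a) \<Rightarrow> nat \<Rightarrow> ('a \<Rightarrow> complex ell2 \<Rightarrow> complex ell2) \<Rightarrow> bool" where
  "is_psi n A z r \<psi> \<longleftrightarrow> representation A UNIV \<psi>
    \<and> (\<forall>i\<in>{1..n+1}. \<forall>j\<in>{1..n+1}. \<psi> (z i j) = psi_gen r i j)"

text \<open>The tensor product of \<open>H\<close> and \<open>\<ell>\<^sup>2(\<nat>)\<close> is realised inside the space of square-summable
  sequences in \<open>H\<close>: by \<open>cinner_elem_tensor\<close> below the algebraic tensor product embeds there
  isometrically, and the Hilbert space tensor product is its completion.\<close>

lift_definition elem_tensor :: "'h::chilbert_space \<Rightarrow> complex ell2 \<Rightarrow> 'h ell2" is "\<lambda>x f m. f m *\<^sub>C x"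
  by (simp add: norm_scaleC power_mult_distrib summable_mult2)

lemma cinner_elem_tensor: "cinner (elem_tensor x f) (elem_tensor y g) = cinner x y * cinner f g"
proof -
  have "cinner (ell2_nth f m *\<^sub>C x) (ell2_nth g m *\<^sub>C y)
      = cinner x y * cinner (ell2_nth f m) (ell2_nth g m)" for m
    by (simp add: cinner_scaleC_left cinner_scaleC_right cinner_complex_def)
  then show ?thesis
    by (simp add: cinner_ell2_def elem_tensor.rep_eq suminf_mult summable_ell2_cinner)
qed

definition tensor_ell2 :: "'h::chilbert_space set \<Rightarrow> 'h ell2 set" where
  "tensor_ell2 H = closure (cspan {elem_tensor x f | x f. x \<in> H})"

definition op_tensor ::
    "'h::chilbert_space set \<Rightarrow> ('h \<Rightarrow> 'h) \<Rightarrow> (complex ell2 \<Rightarrow> complex ell2) \<Rightarrow> 'h ell2 \<Rightarrow> 'h ell2" where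
  "op_tensor H T V = (THE R. R \<in> bounded_ops (tensor_ell2 H)
     \<and> (\<forall>x\<in>H. \<forall>f. R (elem_tensor x f) = elem_tensor (T x) (V f)))"

definition is_conv ::
    "nat \<Rightarrow> 'a cstar_struct \<Rightarrow> (nat \<Rightarrow> nat \<Rightarrow> 'a) \<Rightarrow> 'h::chilbert_space set \<Rightarrow> ('a \<Rightarrow> 'h \<Rightarrow> 'h)
      \<Rightarrow> ('a \<Rightarrow> complex ell2 \<Rightarrow> complex ell2) \<Rightarrow> ('a \<Rightarrow> 'h ell2 \<Rightarrow> 'h ell2) \<Rightarrow> bool" where
  "is_conv n A z H \<pi> \<psi> \<rho> \<longleftrightarrow> representation A (tensor_ell2 H) \<rho>
    \<and> (\<forall>i\<in>{1..n+1}. \<forall>j\<in>{1..n+1}. \<rho> (z i j) =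
        (\<lambda>\<xi>\<in>tensor_ell2 H. \<Sum>k=min i j..max i j. op_tensor H (\<pi> (z i k)) (\<psi> (z k j)) \<xi>))"

end

theory Submission
  imports Defs
begin

text \<open>The last row of the generators satisfies the relations of a quantum sphere at \<open>q = 0\<close>, with
  \<open>z\<^bsub>n+1,r\<^esub>\<close> normal.  Its range \<open>H0\<close> is killed by the adjoints of all later entries of the row.
  The monomials in these later entries, applied to \<open>H0\<close>, have the Gram matrix of an orthonormal
  family tensored with \<open>H0\<close> and span an invariant subspace, which by irreducibility is everything.
  Splitting off the exponent of \<open>z\<^bsub>n+1,r+1\<^esub>\<close> identifies the space with
  \<open>H1 \<otimes> \<ell>\<^sup>2\<close>.  In this picture every generator is a sum of terms \<open>W \<otimes> (generator under \<psi>)\<close>.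
  Because the relations are homogeneous for a suitable degree, they pass to the coefficients \<open>W\<close>,
  which thus define \<open>\<pi>\<^sub>1\<close> by the universal property; an invariant subspace for \<open>W\<close> gives one for \<open>\<pi>\<close>.\<close>

section \<open>Bounded operators between Hilbert spaces\<close>

text \<open>The relations give full exchange rules with the last row only on and above the diagonal:
  for \<open>j < l \<le> i \<le> n\<close> they say nothing directly about
  \<open>Z i j (c l x)\<close>. Entries below the diagonal are therefore rewritten, by taking
  adjoints in the star relation, as products of adjoints of diagonal and superdiagonal entries. That
  \<open>r\<close> is the first nonzero column makes \<open>c r\<close> normal: the sphere relation
  writes \<open>cs r (c r x)\<close> as the sum of \<open>c m (cs m x)\<close> over
  \<open>m \<le> r\<close>, and one term is left. The degree comes from \<psi>: only
  \<open>z r r\<close> and \<open>z (r+1) (r+1)\<close> go to shifts, so column \<open>r\<close> has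
  degree -1 and column \<open>r+1\<close> has degree 1, while the terms with P_0 live on the bottom
  level. Comparing both sides of a relation on high levels thus isolates the coefficients. The
  computations concern generators but irreducibility concerns the whole algebra; continuity of
  representations bridges the gap. \<open>H1\<close> is taken inside \<open>H\<close>, so that its
  operators have the type at which universality is assumed.\<close>

lemma cinner_zero_left [simp]: "cinner 0 (x::'a::chilbert_space) = 0"
  using cinner_scaleC_left[of 0 0 x] by simp

lemma cinner_zero_right [simp]: "cinner (x::'a::chilbert_space) 0 = 0"
  using cinner_scaleC_right[of x 0 0] by simp

lemma scaleC_minus1: "(-1) *\<^sub>C x = - (x::'a::chilbert_space)"
  using scaleR_scaleC[of "-1" x] by simp

lemma cinner_minus_right: "cinner (x::'a::chilbert_space) (- y) = - cinner x y"
  using cinner_scaleC_right[of x "-1" y] by (simp add: scaleC_minus1)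

lemma cinner_minus_left: "cinner (- x) (y::'a::chilbert_space) = - cinner x y"
  using cinner_scaleC_left[of "-1" x y] by (simp add: scaleC_minus1)

lemma cinner_diff_right: "cinner (x::'a::chilbert_space) (y - z) = cinner x y - cinner x z"
  using cinner_add_right[of x y "- z"] by (simp add: cinner_minus_right)

lemma cinner_diff_left: "cinner (x - y) (z::'a::chilbert_space) = cinner x z - cinner y z"
  using cinner_add_left[of x "- y" z] by (simp add: cinner_minus_left)

lemma cinner_sum_right: "cinner (x::'a::chilbert_space) (sum f S) = (\<Sum>i\<in>S. cinner x (f i))"
  by (induction S rule: infinite_finite_induct) (simp_all add: cinner_add_right)

lemma cinner_sum_left: "cinner (sum f S) (x::'a::chilbert_space) = (\<Sum>i\<in>S. cinner (f i) x)"
  by (induction S rule: infinite_finite_induct) (simp_all add: cinner_add_left)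

lemma cinner_self_eq_0: "cinner x x = 0 \<longleftrightarrow> x = (0::'a::chilbert_space)"
  by (simp add: cinner_self)

lemma bounded_bilinear_cinner: "bounded_bilinear (cinner :: 'a::chilbert_space \<Rightarrow> _)"
proof
  fix a b x y :: 'a and r :: real
  show "cinner (a + b) x = cinner a x + cinner b x" by (rule cinner_add_left)
  show "cinner a (x + y) = cinner a x + cinner a y" by (rule cinner_add_right)
  show "cinner (r *\<^sub>R a) x = r *\<^sub>R cinner a x"
    by (simp add: scaleR_scaleC cinner_scaleC_left scaleC_complex_def)
  show "cinner a (r *\<^sub>R x) = r *\<^sub>R cinner a x"
    by (simp add: scaleR_scaleC cinner_scaleC_right scaleC_complex_def)
  show "\<exists>K. \<forall>a x :: 'a. norm (cinner a x) \<le> norm a * norm x * K"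
    by (rule exI[of _ 1]) (simp add: cinner_Cauchy_Schwarz)
qed

lemmas tendsto_cinner = bounded_bilinear.tendsto[OF bounded_bilinear_cinner]

lemma bounded_linear_scaleC: "bounded_linear ((*\<^sub>C) c :: 'a::chilbert_space \<Rightarrow> 'a)"
proof
  show "c *\<^sub>C (x + y) = c *\<^sub>C x + c *\<^sub>C y" for x y :: 'a by (rule scaleC_add_right)
  show "c *\<^sub>C (r *\<^sub>R x) = r *\<^sub>R (c *\<^sub>C x)" for r and x :: 'a
    by (simp add: scaleR_scaleC scaleC_scaleC mult.commute)
  show "\<exists>K. \<forall>x::'a. norm (c *\<^sub>C x) \<le> norm x * K"
    by (rule exI[of _ "cmod c"]) (simp add: norm_scaleC mult.commute)
qed

lemma norm_eq_of_cinner_eq: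
  fixes x :: "'a::chilbert_space" and y :: "'b::chilbert_space"
  assumes "cinner x x = cinner y y"
  shows "norm x = norm y"
  using assms by (simp add: cinner_self flip: of_real_power)

lemma hilbert_subspaceD:
  assumes "hilbert_subspace H"
  shows "closed H" "csubspace H" "0 \<in> H"
    "\<And>x y. x \<in> H \<Longrightarrow> y \<in> H \<Longrightarrow> x + y \<in> H" "\<And>x y. x \<in> H \<Longrightarrow> y \<in> H \<Longrightarrow> x - y \<in> H"
    "\<And>x. x \<in> H \<Longrightarrow> - x \<in> H" "\<And>c x. x \<in> H \<Longrightarrow> c *\<^sub>C x \<in> H"
    "\<And>S f. (\<And>i. i \<in> S \<Longrightarrow> f i \<in> H) \<Longrightarrow> sum f S \<in> H"
  using assms unfolding hilbert_subspace_def
  by (auto intro: cvec.subspace_0 cvec.subspace_add cvec.subspace_diff cvec.subspace_neg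
      cvec.subspace_scale cvec.subspace_sum)

lemma hilbert_subspace_UNIV: "hilbert_subspace UNIV"
  by (auto simp: hilbert_subspace_def cvec.subspace_def)

lemma hilbert_subspace_tendsto:
  assumes "hilbert_subspace H" "X \<longlonglongrightarrow> x" "\<And>n. X n \<in> H"
  shows "x \<in> H"
  using closed_sequentially[OF hilbert_subspaceD(1)[OF assms(1)]] assms(2,3) by blast

lemma hilbert_subspace_closure:
  assumes "csubspace S"
  shows "hilbert_subspace (closure S)"
  unfolding hilbert_subspace_def
proof
  show "csubspace (closure S)"
    unfolding cvec.subspace_def
  proof (intro conjI ballI allI)
    show "0 \<in> closure S" using cvec.subspace_0[OF assms] closure_subset by blast
  next
    fix x y assume "x \<in> closure S" "y \<in> closure S"
    then obtain f g where "\<forall>n. f n \<in> S" "f \<longlonglongrightarrow> x" "\<forall>n. g n \<in> S" "g \<longlonglongrightarrow> y"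
      by (auto simp: closure_sequential)
    then show "x + y \<in> closure S"
      unfolding closure_sequential
      by (intro exI[of _ "\<lambda>n. f n + g n"]) (auto intro: tendsto_add cvec.subspace_add[OF assms])
  next
    fix c x assume "x \<in> closure S"
    then obtain f where "\<forall>n. f n \<in> S" "f \<longlonglongrightarrow> x" by (auto simp: closure_sequential)
    then show "c *\<^sub>C x \<in> closure S"
      unfolding closure_sequential
      by (intro exI[of _ "\<lambda>n. c *\<^sub>C f n"])
        (auto intro: bounded_linear.tendsto[OF bounded_linear_scaleC] cvec.subspace_scale[OF assms])
  qed
qed simp

section \<open>Closed spans and bounded linear maps between closed subspaces\<close>

definition clspan :: "'a::chilbert_space set \<Rightarrow> 'a set" where
  "clspan S = closure (cspan S)"

lemma hilbert_subspace_clspan: "hilbert_subspace (clspan S)"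
  unfolding clspan_def by (intro hilbert_subspace_closure cvec.subspace_span)

lemma clspan_superset: "S \<subseteq> clspan S"
  unfolding clspan_def using cvec.span_superset closure_subset by blast

lemma clspan_minimal: "S \<subseteq> H \<Longrightarrow> hilbert_subspace H \<Longrightarrow> clspan S \<subseteq> H"
  unfolding clspan_def hilbert_subspace_def
  by (intro closure_minimal cvec.span_minimal) auto

text \<open>Linearity and boundedness are required on \<open>H\<close> only, because Hilbert spaces
  are closed subspaces of a type and values elsewhere carry no meaning. Membership in
  \<open>bounded_ops H\<close> is this together with extensionality.\<close>

definition blin :: "'h::chilbert_space set \<Rightarrow> 'k::chilbert_space set \<Rightarrow> ('h \<Rightarrow> 'k) \<Rightarrow> bool" where
  "blin H K T \<longleftrightarrow> (\<forall>x\<in>H. T x \<in> K) \<and> (\<forall>x\<in>H. \<forall>y\<in>H. T (x + y) = T x + T y)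
     \<and> (\<forall>c. \<forall>x\<in>H. T (c *\<^sub>C x) = c *\<^sub>C T x) \<and> (\<exists>B. \<forall>x\<in>H. norm (T x) \<le> B * norm x)"

lemma bounded_ops_iff: "T \<in> bounded_ops H \<longleftrightarrow> blin H H T \<and> T \<in> extensional H"
  by (auto simp: bounded_ops_def blin_def PiE_iff)

lemma blinI:
  assumes "\<And>x. x \<in> H \<Longrightarrow> T x \<in> K" "\<And>x y. x \<in> H \<Longrightarrow> y \<in> H \<Longrightarrow> T (x + y) = T x + T y"
    "\<And>c x. x \<in> H \<Longrightarrow> T (c *\<^sub>C x) = c *\<^sub>C T x" "\<And>x. x \<in> H \<Longrightarrow> norm (T x) \<le> B * norm x"
  shows "blin H K T"
  unfolding blin_def using assms by blast

lemma blin_cong: "(\<And>x. x \<in> H \<Longrightarrow> T x = R x) \<Longrightarrow> csubspace H \<Longrightarrow> blin H K T \<longleftrightarrow> blin H K R"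
  unfolding blin_def by (intro arg_cong2[of _ _ _ _ "(\<and>)"] all_cong1 ball_cong ex_cong1)
    (simp_all add: cvec.subspace_add cvec.subspace_scale)

lemma blinD:
  assumes "blin H K T"
  shows "\<And>x. x \<in> H \<Longrightarrow> T x \<in> K" "\<And>x y. x \<in> H \<Longrightarrow> y \<in> H \<Longrightarrow> T (x + y) = T x + T y"
    "\<And>c x. x \<in> H \<Longrightarrow> T (c *\<^sub>C x) = c *\<^sub>C T x"
  using assms by (auto simp: blin_def)

lemma blin_bound:
  assumes "blin H K T"
  obtains B where "B > 0" "\<And>x. x \<in> H \<Longrightarrow> norm (T x) \<le> B * norm x"
proof -
  obtain B where B: "\<forall>x\<in>H. norm (T x) \<le> B * norm x" using assms by (auto simp: blin_def)
  have "norm (T x) \<le> (\<bar>B\<bar> + 1) * norm x" if "x \<in> H" for x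
  proof -
    have "B * norm x \<le> (\<bar>B\<bar> + 1) * norm x" by (intro mult_right_mono) auto
    then show ?thesis using B that by fastforce
  qed
  then show ?thesis using that[of "\<bar>B\<bar> + 1"] by auto
qed

lemma blin_zero:
  assumes "blin H K T" "csubspace H"
  shows "T 0 = 0"
  using blinD(3)[OF assms(1) cvec.subspace_0[OF assms(2)], of 0] by simp

lemma blin_minus:
  assumes "blin H K T" "x \<in> H"
  shows "T (- x) = - T x"
  using blinD(3)[OF assms, of "-1"] by (simp add: scaleC_minus1)

lemma blin_diff:
  assumes "blin H K T" "csubspace H" "x \<in> H" "y \<in> H"
  shows "T (x - y) = T x - T y"
  using blinD(2)[OF assms(1) assms(3), of "- y"] blin_minus[OF assms(1,4)] cvec.subspace_neg[OF assms(2,4)]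
  by simp

lemma blin_sum:
  assumes "blin H K T" "csubspace H" "\<And>i. i \<in> S \<Longrightarrow> f i \<in> H"
  shows "T (sum f S) = (\<Sum>i\<in>S. T (f i))"
  using assms(3)
  by (induction S rule: infinite_finite_induct)
    (simp_all add: blin_zero[OF assms(1,2)] blinD(2)[OF assms(1)] cvec.subspace_sum[OF assms(2)])

lemma blin_comp:
  assumes "blin H K T" "blin K L R"
  shows "blin H L (\<lambda>x. R (T x))"
proof -
  obtain B where B: "B > 0" "\<And>x. x \<in> H \<Longrightarrow> norm (T x) \<le> B * norm x" using blin_bound[OF assms(1)] by blast
  obtain C where C: "C > 0" "\<And>x. x \<in> K \<Longrightarrow> norm (R x) \<le> C * norm x" using blin_bound[OF assms(2)] by blast
  show ?thesis
  proof (rule blinI)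
    show "norm (R (T x)) \<le> (C * B) * norm x" if "x \<in> H" for x
    proof -
      have "norm (R (T x)) \<le> C * norm (T x)" by (intro C(2) blinD(1)[OF assms(1)] that)
      also have "\<dots> \<le> C * (B * norm x)" using B(2)[OF that] C(1) by simp
      finally show ?thesis by simp
    qed
  qed (auto simp: blinD[OF assms(1)] blinD[OF assms(2)])
qed

lemma blin_add:
  assumes "blin H K T" "blin H K R" "csubspace K"
  shows "blin H K (\<lambda>x. T x + R x)"
proof -
  obtain B where B: "B > 0" "\<And>x. x \<in> H \<Longrightarrow> norm (T x) \<le> B * norm x" using blin_bound[OF assms(1)] by blast
  obtain C where C: "C > 0" "\<And>x. x \<in> H \<Longrightarrow> norm (R x) \<le> C * norm x" using blin_bound[OF assms(2)] by blast
  show ?thesis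
  proof (rule blinI)
    show "norm (T x + R x) \<le> (B + C) * norm x" if "x \<in> H" for x
      using norm_triangle_ineq[of "T x" "R x"] B(2)[OF that] C(2)[OF that]
      by (simp add: distrib_right)
  qed (auto simp: blinD[OF assms(1)] blinD[OF assms(2)] cvec.subspace_add[OF assms(3)] scaleC_add_right)
qed

lemma blin_scaleC:
  assumes "blin H K T" "csubspace K"
  shows "blin H K (\<lambda>x. c *\<^sub>C T x)"
proof -
  obtain B where B: "B > 0" "\<And>x. x \<in> H \<Longrightarrow> norm (T x) \<le> B * norm x" using blin_bound[OF assms(1)] by blast
  show ?thesis
  proof (rule blinI)
    show "norm (c *\<^sub>C T x) \<le> (cmod c * B) * norm x" if "x \<in> H" for x
      using mult_left_mono[OF B(2)[OF that], of "cmod c"] by (simp add: norm_scaleC mult.assoc)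
  qed (auto simp: blinD[OF assms(1)] cvec.subspace_scale[OF assms(2)] scaleC_add_right scaleC_scaleC
      mult.commute)
qed

lemma blin_id: "blin H H (\<lambda>x. x)"
  by (rule blinI[where B = 1]) auto

lemma blin_const_0: "csubspace K \<Longrightarrow> blin H K (\<lambda>x. 0)"
  by (rule blinI[where B = 0]) (auto simp: cvec.subspace_0)

lemma blin_finite_sum:
  assumes "\<And>i. i \<in> S \<Longrightarrow> blin H K (T i)" "csubspace K"
  shows "blin H K (\<lambda>x. \<Sum>i\<in>S. T i x)"
  using assms(1)
  by (induction S rule: infinite_finite_induct) (auto intro: blin_const_0 blin_add assms(2))

lemma blin_tendsto:
  assumes T: "blin H K T" and H: "hilbert_subspace H" and X: "X \<longlonglongrightarrow> x" "\<And>n. X n \<in> H"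
  shows "(\<lambda>n. T (X n)) \<longlonglongrightarrow> T x"
proof -
  have x: "x \<in> H" by (rule hilbert_subspace_tendsto[OF H X])
  obtain B where B: "B > 0" "\<And>x. x \<in> H \<Longrightarrow> norm (T x) \<le> B * norm x" using blin_bound[OF T] by blast
  have "(\<lambda>n. T (X n) - T x) \<longlonglongrightarrow> 0"
  proof (rule Lim_null_comparison)
    have "norm (T (X n) - T x) \<le> B * norm (X n - x)" for n
      using B(2)[of "X n - x"] x X(2)[of n] blin_diff[OF T hilbert_subspaceD(2)[OF H] X(2) x]
        hilbert_subspaceD(5)[OF H] by simp
    then show "\<forall>\<^sub>F n in sequentially. norm (T (X n) - T x) \<le> B * norm (X n - x)" by simp
    have "(\<lambda>n. norm (X n - x)) \<longlonglongrightarrow> 0" using X(1) by (simp add: LIM_zero_iff tendsto_norm_zero_iff)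
    then show "(\<lambda>n. B * norm (X n - x)) \<longlonglongrightarrow> 0" by (rule tendsto_mult_right_zero)
  qed
  then show ?thesis by (simp add: LIM_zero_iff)
qed

text \<open>The equaliser of two bounded maps is a closed subspace. This is how operator identities
  are reduced to generating vectors throughout.\<close>

lemma clspan_blin_eqI:
  assumes T: "blin (clspan S) K T" and R: "blin (clspan S) L R"
    and eq: "\<And>x. x \<in> S \<Longrightarrow> T x = R x" and x: "x \<in> clspan S"
  shows "T x = R x"
proof -
  let ?M = "{x \<in> clspan S. T x = R x}"
  note H = hilbert_subspace_clspan[of S]
  have "hilbert_subspace ?M"
    unfolding hilbert_subspace_def
  proof
    show "closed ?M"
      unfolding closed_sequential_limits
    proof (intro allI impI)
      fix X l assume X: "(\<forall>n. X n \<in> ?M) \<and> X \<longlonglongrightarrow> l"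
      then have l: "l \<in> clspan S" using hilbert_subspace_tendsto[OF H] by blast
      have "(\<lambda>n. T (X n)) \<longlonglongrightarrow> T l" using X by (intro blin_tendsto[OF T H]) auto
      moreover have "(\<lambda>n. R (X n)) \<longlonglongrightarrow> R l" using X by (intro blin_tendsto[OF R H]) auto
      moreover have "(\<lambda>n. T (X n)) = (\<lambda>n. R (X n))" using X by auto
      ultimately have "T l = R l" using LIMSEQ_unique by metis
      then show "l \<in> ?M" using l by simp
    qed
    show "csubspace ?M"
      unfolding cvec.subspace_def
      by (simp add: hilbert_subspaceD(2-4,7)[OF H] blinD(2,3)[OF T] blinD(2,3)[OF R]
          blin_zero[OF T] blin_zero[OF R])
  qed
  then have "clspan S \<subseteq> ?M"
    using eq clspan_superset[of S] by (intro clspan_minimal) auto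
  then show ?thesis using x by auto
qed

lemma blin_preimage_hilbert:
  assumes T: "blin H K T" and H: "hilbert_subspace H" and M: "hilbert_subspace M"
  shows "hilbert_subspace {x \<in> H. T x \<in> M}"
  unfolding hilbert_subspace_def
proof
  show "closed {x \<in> H. T x \<in> M}"
    unfolding closed_sequential_limits
  proof (intro allI impI)
    fix X l assume X: "(\<forall>n. X n \<in> {x \<in> H. T x \<in> M}) \<and> X \<longlonglongrightarrow> l"
    have "l \<in> H" by (rule hilbert_subspace_tendsto[OF H, of X]) (use X in auto)
    moreover have "T l \<in> M"
      by (rule hilbert_subspace_tendsto[OF M blin_tendsto[OF T H, of X]]) (use X in auto)
    ultimately show "l \<in> {x \<in> H. T x \<in> M}" by simp
  qed
  show "csubspace {x \<in> H. T x \<in> M}"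
    unfolding cvec.subspace_def
    by (simp add: hilbert_subspaceD(2-4,7)[OF H] hilbert_subspaceD(3,4,7)[OF M] blinD(2,3)[OF T]
        blin_zero[OF T])
qed

lemma clspan_image_subset:
  assumes T: "blin (clspan S) K T" and M: "hilbert_subspace M" and "\<And>x. x \<in> S \<Longrightarrow> T x \<in> M"
    and "x \<in> clspan S"
  shows "T x \<in> M"
proof -
  have "clspan S \<subseteq> {x \<in> clspan S. T x \<in> M}"
    by (rule clspan_minimal[OF _ blin_preimage_hilbert[OF T hilbert_subspace_clspan M]])
      (use assms(3) clspan_superset[of S] in auto)
  then show ?thesis using assms(4) by auto
qed

subsection \<open>Riesz representation and adjoints\<close>

text \<open>The representing vector is the minimiser of \<open>(norm x)^2 - 2 * Re (f x)\<close>; if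
  \<open>f\<close> is \<open>cinner z\<close>, this functional is
  \<open>norm (x - z)^2 - norm z^2\<close>. Existence of the minimiser comes from completeness, and
  its first variation yields the formula for \<open>f\<close>.\<close>

lemma riesz_representation:
  fixes f :: "'h::chilbert_space \<Rightarrow> complex"
  assumes H: "hilbert_subspace H" and f: "blin H UNIV f"
  shows "\<exists>z\<in>H. \<forall>y\<in>H. f y = cinner z y"
proof -
  note Hs = hilbert_subspaceD[OF H]
  have Hr: "r *\<^sub>R x \<in> H" if "x \<in> H" for r x using Hs(7)[OF that] by (simp add: scaleR_scaleC)
  obtain B where B: "B > 0" "\<And>x. x \<in> H \<Longrightarrow> norm (f x) \<le> B * norm x" using blin_bound[OF f] by blast
  have fr: "f (r *\<^sub>R x) = r *\<^sub>R f x" if "x \<in> H" for r x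
    using blinD(3)[OF f that] by (simp add: scaleR_scaleC)
  define \<Phi> where "\<Phi> x = (norm x)\<^sup>2 - 2 * Re (f x)" for x
  have low: "- (B\<^sup>2) \<le> \<Phi> x" if "x \<in> H" for x
  proof -
    have "Re (f x) \<le> B * norm x" using complex_Re_le_cmod[of "f x"] B(2)[OF that] by linarith
    moreover have "0 \<le> (norm x - B)\<^sup>2" by simp
    ultimately show ?thesis unfolding \<Phi>_def power2_diff by (simp add: mult.commute)
  qed
  have bdd: "bdd_below (\<Phi> ` H)" using low by (auto intro!: bdd_belowI2)
  define m where "m = Inf (\<Phi> ` H)"
  have mlow: "m \<le> \<Phi> x" if "x \<in> H" for x unfolding m_def by (rule cINF_lower[OF bdd that])
  have "\<exists>x\<in>H. \<Phi> x < m + 1 / (real n + 1)" for n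
  proof (rule ccontr)
    assume "\<not> ?thesis"
    then have "m + 1 / (real n + 1) \<le> Inf (\<Phi> ` H)"
      using Hs(3) by (intro cINF_greatest) (auto simp: not_less)
    then show False unfolding m_def by (simp add: field_simps)
  qed
  then obtain X where X: "\<And>n. X n \<in> H" "\<And>n. \<Phi> (X n) < m + 1 / (real n + 1)" by metis
  \<comment> \<open>The linear part of \<Phi> is affine along the segment, so comparing with the
    midpoint leaves just the parallelogram identity: almost minimisers are close to each
    other.\<close>
  have par: "(norm (x - y))\<^sup>2 \<le> 2 * (\<Phi> x - m) + 2 * (\<Phi> y - m)" if "x \<in> H" "y \<in> H" for x y
  proof -
    let ?h = "(1/2) *\<^sub>R (x + y)"
    have "m \<le> \<Phi> ?h" using that by (intro mlow Hr Hs(4))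
    moreover have "f ?h = (1/2) *\<^sub>R (f x + f y)"
      using that fr[of "x + y" "1/2"] blinD(2)[OF f] Hs(4) by simp
    moreover have "(norm ?h)\<^sup>2 = (norm (x + y))\<^sup>2 / 4" by (simp add: power_divide)
    moreover have "(norm (x + y))\<^sup>2 + (norm (x - y))\<^sup>2 = 2 * (norm x)\<^sup>2 + 2 * (norm y)\<^sup>2"
      by (simp add: power2_norm_eq_inner inner_add_left inner_add_right inner_diff_left inner_diff_right)
    ultimately show ?thesis unfolding \<Phi>_def by (simp add: field_simps)
  qed
  have "Cauchy X"
  proof (rule CauchyI)
    fix e :: real assume e: "e > 0"
    obtain N where N: "real N > 4 / e\<^sup>2" using reals_Archimedean2 by blast
    have Nb: "4 / (real N + 1) < e\<^sup>2"
    proof -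
      have "4 / e\<^sup>2 < real N + 1" using N by simp
      then have "4 < (real N + 1) * e\<^sup>2" using e by (subst (asm) pos_divide_less_eq) auto
      then show ?thesis by (subst pos_divide_less_eq) (auto simp: mult.commute)
    qed
    have "norm (X p - X q) < e" if "p \<ge> N" "q \<ge> N" for p q
    proof -
      have "1 / (real k + 1) \<le> 1 / (real N + 1)" if "k \<ge> N" for k using that by (simp add: frac_le)
      then have "\<Phi> (X p) - m < 1 / (real N + 1)" "\<Phi> (X q) - m < 1 / (real N + 1)"
        using X(2)[of p] X(2)[of q] that by (smt (verit))+
      then have "(norm (X p - X q))\<^sup>2 < e\<^sup>2"
        using par[OF X(1)[of p] X(1)[of q]] Nb by simp
      then show ?thesis using e by (simp add: power_less_imp_less_base)
    qed
    then show "\<exists>M. \<forall>p\<ge>M. \<forall>q\<ge>M. norm (X p - X q) < e" by blast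
  qed
  then obtain z where z: "X \<longlonglongrightarrow> z" using Cauchy_convergent convergent_def by blast
  have zH: "z \<in> H" by (rule hilbert_subspace_tendsto[OF H z X(1)])
  have "(\<lambda>n. f (X n)) \<longlonglongrightarrow> f z" by (rule blin_tendsto[OF f H z X(1)])
  then have \<Phi>lim: "(\<lambda>n. \<Phi> (X n)) \<longlonglongrightarrow> \<Phi> z"
    unfolding \<Phi>_def by (intro tendsto_intros z)
  have "(\<lambda>n. m + 1 / (real n + 1)) \<longlonglongrightarrow> m + 0"
    using LIMSEQ_inverse_real_of_nat by (intro tendsto_intros) (simp add: inverse_eq_divide add.commute)
  then have "\<Phi> z \<le> m + 0"
    using X(2) by (intro LIMSEQ_le[OF \<Phi>lim]) (auto intro: less_imp_le)
  then have min: "\<Phi> z \<le> \<Phi> x" if "x \<in> H" for x using mlow[OF that] by simp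
  have re: "Re (f y) = Re (cinner z y)" if y: "y \<in> H" for y
  proof (rule ccontr)
    assume ne: "Re (f y) \<noteq> Re (cinner z y)"
    define d where "d = Re (f y) - Re (cinner z y)"
    \<comment> \<open>Moving the minimiser by \<open>t *\<^sub>R y\<close> cannot lower \<Phi>; a
      bound that is linear in \<open>t\<close> on the left and quadratic on the right forces
      \<open>d = 0\<close>.\<close>
    have q: "2 * t * d \<le> t\<^sup>2 * (norm y)\<^sup>2" for t
    proof -
      have "\<Phi> z \<le> \<Phi> (z + t *\<^sub>R y)" by (intro min Hs(4) zH Hr y)
      moreover have "f (z + t *\<^sub>R y) = f z + t *\<^sub>R f y" using blinD(2)[OF f zH Hr[OF y]] fr[OF y] by simp
      moreover have "(norm (z + t *\<^sub>R y))\<^sup>2 = (norm z)\<^sup>2 + 2 * t * Re (cinner z y) + t\<^sup>2 * (norm y)\<^sup>2"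
        by (simp only: power2_norm_eq_inner inner_add_left inner_add_right inner_scaleR_left
            inner_scaleR_right inner_commute[of y z] flip: inner_cinner)
          (simp add: power2_eq_square algebra_simps)
      ultimately show ?thesis unfolding \<Phi>_def d_def by (simp add: algebra_simps)
    qed
    have d: "d \<noteq> 0" using ne by (simp add: d_def)
    \<comment> \<open>The test value is \<open>t = d / c\<close>. The summand 1 keeps the quotient
      defined when \<open>y = 0\<close>.\<close>
    define c where "c = (norm y)\<^sup>2 + 1"
    have c: "c > 0" unfolding c_def by (simp add: add_nonneg_pos)
    have "2 * (d / c) * d \<le> (d / c)\<^sup>2 * (norm y)\<^sup>2" by (rule q)
    also have "\<dots> \<le> (d / c)\<^sup>2 * c" by (intro mult_left_mono) (auto simp: c_def)
    also have "\<dots> = (d / c) * d" using c by (simp add: power2_eq_square)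
    finally have "(d / c) * d \<le> 0" by simp
    moreover have "(d / c) * d = d\<^sup>2 / c" by (simp add: power2_eq_square)
    moreover have "d\<^sup>2 / c > 0" using d c by simp
    ultimately show False by linarith
  qed
  have "f y = cinner z y" if y: "y \<in> H" for y
  proof (rule complex_eqI)
    show "Re (f y) = Re (cinner z y)" by (rule re[OF y])
    \<comment> \<open>The real part at \<open>\<i> *\<^sub>C y\<close> is minus the imaginary part
      at \<open>y\<close>.\<close>
    show "Im (f y) = Im (cinner z y)"
      using re[OF Hs(7)[OF y, of "\<i>"]] blinD(3)[OF f y, of "\<i>"]
      by (simp add: cinner_scaleC_right scaleC_complex_def)
  qed
  then show ?thesis using zH by blast
qed

lemma cinner_eqI:
  assumes "hilbert_subspace H" "x \<in> H" "y \<in> H" "\<And>z. z \<in> H \<Longrightarrow> cinner z x = cinner z y"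
  shows "x = y"
proof -
  have "cinner (x - y) (x - y) = 0"
    using assms(4)[OF hilbert_subspaceD(5)[OF assms(1-3)]] by (simp add: cinner_diff_right)
  then show ?thesis by (simp add: cinner_self_eq_0)
qed

text \<open>Riesz representation of the functionals \<open>\<lambda>x. cinner y (T x)\<close>, which
  are linear because the inner product is linear in its second argument. Linearity of the resulting
  map follows by testing against all vectors.\<close>

lemma adjoint_exists:
  assumes H: "hilbert_subspace H" and T: "blin H H T"
  shows "\<exists>R. R \<in> bounded_ops H \<and> (\<forall>x\<in>H. \<forall>y\<in>H. cinner (T x) y = cinner x (R y))"
proof -
  note Hs = hilbert_subspaceD[OF H]
  obtain B where B: "B > 0" "\<And>x. x \<in> H \<Longrightarrow> norm (T x) \<le> B * norm x" using blin_bound[OF T] by blast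
  have "\<exists>z\<in>H. \<forall>x\<in>H. cinner y (T x) = cinner z x" if "y \<in> H" for y
  proof (rule riesz_representation[OF H blinI])
    show "cmod (cinner y (T x)) \<le> (norm y * B) * norm x" if "x \<in> H" for x
    proof -
      have "norm y * norm (T x) \<le> norm y * (B * norm x)"
        by (intro mult_left_mono B that) simp
      then show ?thesis using cinner_Cauchy_Schwarz[of y "T x"] by (simp add: mult.assoc)
    qed
  qed (simp_all add: blinD[OF T] cinner_add_right cinner_scaleC_right scaleC_complex_def)
  then obtain R0 where R0: "\<And>y. y \<in> H \<Longrightarrow> R0 y \<in> H"
    "\<And>x y. y \<in> H \<Longrightarrow> x \<in> H \<Longrightarrow> cinner y (T x) = cinner (R0 y) x" by metis
  have R0': "cinner (T x) y = cinner x (R0 y)" if "x \<in> H" "y \<in> H" for x y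
    using R0(2)[OF that(2,1)] cinner_commute[of "T x" y] cinner_commute[of x "R0 y"] by simp
  define R where "R = restrict R0 H"
  have "blin H H R0"
  proof (rule blinI)
    show "R0 y \<in> H" if "y \<in> H" for y using that by (rule R0(1))
    show "R0 (x + y) = R0 x + R0 y" if "x \<in> H" "y \<in> H" for x y
      by (rule cinner_eqI[OF H]) (use that in \<open>auto simp: R0(1) Hs cinner_add_right R0'[symmetric]\<close>)
    show "R0 (c *\<^sub>C x) = c *\<^sub>C R0 x" if "x \<in> H" for c x
      by (rule cinner_eqI[OF H]) (use that in \<open>auto simp: R0(1) Hs cinner_scaleC_right R0'[symmetric]\<close>)
    show "norm (R0 y) \<le> B * norm y" if y: "y \<in> H" for y
    proof (cases "R0 y = 0")
      case False
      have "(norm (R0 y))\<^sup>2 = cmod (cinner (R0 y) (R0 y))" by (simp add: cinner_self norm_power)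
      also have "\<dots> = cmod (cinner (T (R0 y)) y)" using R0'[OF R0(1)[OF y] y] by simp
      also have "\<dots> \<le> norm (T (R0 y)) * norm y" by (rule cinner_Cauchy_Schwarz)
      also have "\<dots> \<le> (B * norm (R0 y)) * norm y" by (intro mult_right_mono B R0(1) y) simp
      finally have "norm (R0 y) * norm (R0 y) \<le> norm (R0 y) * (B * norm y)"
        by (simp add: power2_eq_square mult_ac)
      then show ?thesis using False by simp
    qed (use B(1) in simp)
  qed
  then have "R \<in> bounded_ops H"
    unfolding R_def bounded_ops_iff using blin_cong[of H "restrict R0 H" R0 H] Hs(2) by simp
  moreover have "cinner (T x) y = cinner x (R y)" if "x \<in> H" "y \<in> H" for x y
    using R0'[OF that] that by (simp add: R_def)
  ultimately show ?thesis by blast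
qed

lemma bounded_ops_eqI:
  assumes "T \<in> bounded_ops H" "R \<in> bounded_ops H" "\<And>x. x \<in> H \<Longrightarrow> T x = R x"
  shows "T = R"
  using assms by (auto simp: bounded_ops_iff intro: extensionalityI)

lemma restrict_bounded_ops: "blin H H T \<Longrightarrow> csubspace H \<Longrightarrow> restrict T H \<in> bounded_ops H"
  using blin_cong[of H "restrict T H" T H] by (simp add: bounded_ops_iff)

text \<open>Evaluates the definite description: two candidates have the same inner product with
  every vector of \<open>H\<close> and are extensional, hence equal.\<close>

lemma adjoint_op_eqI:
  assumes H: "hilbert_subspace H" and R: "R \<in> bounded_ops H"
    and adj: "\<And>x y. x \<in> H \<Longrightarrow> y \<in> H \<Longrightarrow> cinner (T x) y = cinner x (R y)"
  shows "adjoint_op H T = R"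
  unfolding adjoint_op_def
proof (rule the_equality)
  fix R' assume R': "R' \<in> bounded_ops H \<and> (\<forall>x\<in>H. \<forall>y\<in>H. cinner (T x) y = cinner x (R' y))"
  show "R' = R"
  proof (rule bounded_ops_eqI[of _ H])
    fix x assume x: "x \<in> H"
    show "R' x = R x"
    proof (rule cinner_eqI[OF H])
      show "R' x \<in> H" "R x \<in> H" using R R' x by (auto simp: bounded_ops_iff blin_def)
      show "cinner z (R' x) = cinner z (R x)" if "z \<in> H" for z
        using R' adj[OF that x] that x by simp
    qed
  qed (use R R' in auto)
qed (use R adj in auto)

lemma adjoint_op_props:
  assumes "hilbert_subspace H" "blin H H T"
  shows "adjoint_op H T \<in> bounded_ops H"
    "\<And>x y. x \<in> H \<Longrightarrow> y \<in> H \<Longrightarrow> cinner (T x) y = cinner x (adjoint_op H T y)"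
    "\<And>x y. x \<in> H \<Longrightarrow> y \<in> H \<Longrightarrow> cinner x (T y) = cinner (adjoint_op H T x) y"
proof -
  obtain R where R: "R \<in> bounded_ops H" "\<forall>x\<in>H. \<forall>y\<in>H. cinner (T x) y = cinner x (R y)"
    using adjoint_exists[OF assms] by blast
  then have eq: "adjoint_op H T = R" by (intro adjoint_op_eqI[OF assms(1)]) auto
  show "adjoint_op H T \<in> bounded_ops H" using eq R by simp
  show *: "cinner (T x) y = cinner x (adjoint_op H T y)" if "x \<in> H" "y \<in> H" for x y
    using eq R that by simp
  show "cinner x (T y) = cinner (adjoint_op H T x) y" if "x \<in> H" "y \<in> H" for x y
    using *[OF that(2,1)] cinner_commute[of x "T y"] cinner_commute[of "adjoint_op H T x" y] by simp
qed

section \<open>The C*-algebra of bounded operators\<close>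

lemma B_op_simps [simp]:
  "carrier (B_op H) = bounded_ops H" "\<one>\<^bsub>B_op H\<^esub> = (\<lambda>x\<in>H. x)" "\<zero>\<^bsub>B_op H\<^esub> = (\<lambda>x\<in>H. 0)"
  "T \<otimes>\<^bsub>B_op H\<^esub> R = compose H T R" "T \<oplus>\<^bsub>B_op H\<^esub> R = (\<lambda>x\<in>H. T x + R x)"
  "c \<odot>\<^bsub>B_op H\<^esub> T = (\<lambda>x\<in>H. c *\<^sub>C T x)" "cstar (B_op H) = adjoint_op H"
  by (simp_all add: B_op_def)

lemma bounded_ops_blin: "T \<in> bounded_ops H \<Longrightarrow> blin H H T"
  by (simp add: bounded_ops_iff)

lemma bounded_ops_mem: "T \<in> bounded_ops H \<Longrightarrow> x \<in> H \<Longrightarrow> T x \<in> H"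
  using bounded_ops_blin blinD(1) by blast

lemma compose_apply: "x \<in> H \<Longrightarrow> compose H T R x = T (R x)"
  by (simp add: compose_def)

context
  fixes H :: "'h::chilbert_space set"
  assumes H: "hilbert_subspace H"
begin

lemma bounded_ops_intros:
  "(\<lambda>x\<in>H. x) \<in> bounded_ops H" "(\<lambda>x\<in>H. 0) \<in> bounded_ops H"
  "T \<in> bounded_ops H \<Longrightarrow> R \<in> bounded_ops H \<Longrightarrow> compose H T R \<in> bounded_ops H"
  "T \<in> bounded_ops H \<Longrightarrow> R \<in> bounded_ops H \<Longrightarrow> (\<lambda>x\<in>H. T x + R x) \<in> bounded_ops H"
  "T \<in> bounded_ops H \<Longrightarrow> (\<lambda>x\<in>H. c *\<^sub>C T x) \<in> bounded_ops H"
  "T \<in> bounded_ops H \<Longrightarrow> (\<lambda>x\<in>H. - T x) \<in> bounded_ops H"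
  "T \<in> bounded_ops H \<Longrightarrow> R \<in> bounded_ops H \<Longrightarrow> (\<lambda>x\<in>H. T x - R x) \<in> bounded_ops H"
proof -
  note S = hilbert_subspaceD(2)[OF H]
  note r = restrict_bounded_ops[OF _ S]
  show "(\<lambda>x\<in>H. x) \<in> bounded_ops H" by (intro r blin_id)
  show "(\<lambda>x\<in>H. 0) \<in> bounded_ops H" by (intro r blin_const_0 S)
  show "compose H T R \<in> bounded_ops H" if "T \<in> bounded_ops H" "R \<in> bounded_ops H"
    unfolding compose_def by (intro r blin_comp[OF bounded_ops_blin bounded_ops_blin] that)
  show "(\<lambda>x\<in>H. T x + R x) \<in> bounded_ops H" if "T \<in> bounded_ops H" "R \<in> bounded_ops H"
    by (intro r blin_add bounded_ops_blin that S)
  show sc: "(\<lambda>x\<in>H. c *\<^sub>C T x) \<in> bounded_ops H" if "T \<in> bounded_ops H" for c T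
    by (intro r blin_scaleC bounded_ops_blin that S)
  show "(\<lambda>x\<in>H. - T x) \<in> bounded_ops H" if "T \<in> bounded_ops H"
    using sc[OF that, of "-1"] by (simp add: scaleC_minus1)
  show "(\<lambda>x\<in>H. T x - R x) \<in> bounded_ops H" if "T \<in> bounded_ops H" "R \<in> bounded_ops H"
    using r[OF blin_add[OF bounded_ops_blin[OF that(1)] blin_scaleC[OF bounded_ops_blin[OF that(2)] S, of "-1"] S]]
    by (simp add: scaleC_minus1)
qed

lemma bounded_ops_ext_iff:
  "T \<in> bounded_ops H \<Longrightarrow> R \<in> bounded_ops H \<Longrightarrow> T = R \<longleftrightarrow> (\<forall>x\<in>H. T x = R x)"
  using bounded_ops_eqI by blast

lemmas bounded_ops_linear =
  blinD(2)[OF bounded_ops_blin] blinD(3)[OF bounded_ops_blin]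
  blin_minus[OF bounded_ops_blin]

lemma ring_B_op: "ring (B_op H)"
proof (rule ringI)
  note bi = bounded_ops_intros
  show "abelian_group (B_op H)"
  proof (rule abelian_groupI)
    fix T assume T: "T \<in> carrier (B_op H)"
    show "\<exists>R\<in>carrier (B_op H). R \<oplus>\<^bsub>B_op H\<^esub> T = \<zero>\<^bsub>B_op H\<^esub>"
      by (rule bexI[of _ "\<lambda>x\<in>H. - T x"]) (use T in \<open>auto simp: bi intro!: restrict_ext\<close>)
    show "\<zero>\<^bsub>B_op H\<^esub> \<oplus>\<^bsub>B_op H\<^esub> T = T"
    proof (rule bounded_ops_eqI[of _ H])
      show "\<zero>\<^bsub>B_op H\<^esub> \<oplus>\<^bsub>B_op H\<^esub> T \<in> bounded_ops H"
        unfolding B_op_simps using T by (intro bi) simp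
    qed (use T in auto)
  qed (auto simp: bi add_ac intro!: restrict_ext)
  show "monoid (B_op H)"
  proof (rule monoidI)
    fix T assume T: "T \<in> carrier (B_op H)"
    show "\<one>\<^bsub>B_op H\<^esub> \<otimes>\<^bsub>B_op H\<^esub> T = T" "T \<otimes>\<^bsub>B_op H\<^esub> \<one>\<^bsub>B_op H\<^esub> = T"
      by (rule bounded_ops_eqI[of _ H]; use T in \<open>auto simp: bi compose_apply bounded_ops_mem\<close>)+
  next
    fix T R Q assume "T \<in> carrier (B_op H)" "R \<in> carrier (B_op H)" "Q \<in> carrier (B_op H)"
    then show "T \<otimes>\<^bsub>B_op H\<^esub> R \<otimes>\<^bsub>B_op H\<^esub> Q = T \<otimes>\<^bsub>B_op H\<^esub> (R \<otimes>\<^bsub>B_op H\<^esub> Q)"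
      by (auto simp: compose_def bounded_ops_mem intro!: restrict_ext)
  qed (auto simp: bi)
  fix T R Q assume a: "T \<in> carrier (B_op H)" "R \<in> carrier (B_op H)" "Q \<in> carrier (B_op H)"
  then show "(T \<oplus>\<^bsub>B_op H\<^esub> R) \<otimes>\<^bsub>B_op H\<^esub> Q = T \<otimes>\<^bsub>B_op H\<^esub> Q \<oplus>\<^bsub>B_op H\<^esub> R \<otimes>\<^bsub>B_op H\<^esub> Q"
    by (auto simp: compose_def bounded_ops_mem intro!: restrict_ext)
  show "Q \<otimes>\<^bsub>B_op H\<^esub> (T \<oplus>\<^bsub>B_op H\<^esub> R) = Q \<otimes>\<^bsub>B_op H\<^esub> T \<oplus>\<^bsub>B_op H\<^esub> Q \<otimes>\<^bsub>B_op H\<^esub> R"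
    using a by (auto simp: compose_def bounded_ops_mem bounded_ops_linear intro!: restrict_ext)
qed

lemma B_op_minus:
  assumes "T \<in> bounded_ops H" "R \<in> bounded_ops H"
  shows "T \<ominus>\<^bsub>B_op H\<^esub> R = (\<lambda>x\<in>H. T x - R x)"
proof -
  interpret B: ring "B_op H" by (rule ring_B_op)
  have "\<ominus>\<^bsub>B_op H\<^esub> R = (\<lambda>x\<in>H. - R x)"
    by (rule B.minus_equality) (use assms bounded_ops_intros in \<open>auto intro!: restrict_ext\<close>)
  then show ?thesis by (auto simp: a_minus_def intro!: restrict_ext)
qed

lemma adjoint_props:
  assumes "T \<in> bounded_ops H"
  shows "adjoint_op H T \<in> bounded_ops H"
    "\<And>x y. x \<in> H \<Longrightarrow> y \<in> H \<Longrightarrow> cinner (T x) y = cinner x (adjoint_op H T y)"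
    "\<And>x y. x \<in> H \<Longrightarrow> y \<in> H \<Longrightarrow> cinner x (T y) = cinner (adjoint_op H T x) y"
  using adjoint_op_props[OF H bounded_ops_blin[OF assms]] by auto

section \<open>The operator norm, the C*-identity and completeness\<close>

definition opnorm :: "('h \<Rightarrow> 'h) \<Rightarrow> real" where
  "opnorm T = Sup ((\<lambda>x. norm (T x)) ` {x \<in> H. norm x \<le> 1})"

lemma cnorm_B_op: "cnorm (B_op H) T = opnorm T"
  by (simp add: B_op_def opnorm_def)

lemma opnorm_bound:
  assumes T: "T \<in> bounded_ops H" and x: "x \<in> H"
  shows "norm (T x) \<le> opnorm T * norm x"
proof (cases "x = 0")
  case True
  then show ?thesis using blin_zero[OF bounded_ops_blin[OF T] hilbert_subspaceD(2)[OF H]] by simp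
next
  case False
  obtain B where B: "B > 0" "\<And>x. x \<in> H \<Longrightarrow> norm (T x) \<le> B * norm x"
    using blin_bound[OF bounded_ops_blin[OF T]] by blast
  let ?u = "complex_of_real (1 / norm x) *\<^sub>C x"
  have u: "?u \<in> H" "norm ?u = 1"
    using False hilbert_subspaceD(7)[OF H x] by (auto simp: norm_scaleC norm_divide)
  have "norm (T ?u) \<le> opnorm T"
    unfolding opnorm_def
  proof (rule cSUP_upper[of ?u _ "\<lambda>x. norm (T x)"])
    show "bdd_above ((\<lambda>x. norm (T x)) ` {x \<in> H. norm x \<le> 1})"
    proof (rule bdd_aboveI2)
      show "norm (T x) \<le> B" if "x \<in> {x \<in> H. norm x \<le> 1}" for x
        using order_trans[OF B(2)[of x] mult_left_le[of "norm x" B]] B(1) that by simp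
    qed
  qed (use u in simp)
  moreover have "norm (T ?u) = norm (T x) / norm x"
    using bounded_ops_linear(2)[OF T x] by (simp add: norm_scaleC norm_divide)
  ultimately show ?thesis using False by (simp add: divide_le_eq)
qed

lemma opnorm_le:
  assumes "\<And>x. x \<in> H \<Longrightarrow> norm (T x) \<le> B * norm x" "B \<ge> 0"
  shows "opnorm T \<le> B"
  unfolding opnorm_def
proof (rule cSUP_least)
  have "0 \<in> {x \<in> H. norm x \<le> 1}" using hilbert_subspaceD(3)[OF H] by simp
  then show "{x \<in> H. norm x \<le> 1} \<noteq> {}" by blast
  show "norm (T x) \<le> B" if "x \<in> {x \<in> H. norm x \<le> 1}" for x
    using order_trans[OF assms(1)[of x] mult_left_le[of "norm x" B]] assms(2) that by simp
qed

lemma opnorm_nonneg: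
  assumes "T \<in> bounded_ops H"
  shows "opnorm T \<ge> 0"
proof -
  obtain B where B: "B > 0" "\<And>x. x \<in> H \<Longrightarrow> norm (T x) \<le> B * norm x"
    using blin_bound[OF bounded_ops_blin[OF assms]] by blast
  have "norm (T 0) \<le> opnorm T"
    unfolding opnorm_def
  proof (rule cSUP_upper[of 0 _ "\<lambda>x. norm (T x)"])
    show "bdd_above ((\<lambda>x. norm (T x)) ` {x \<in> H. norm x \<le> 1})"
    proof (rule bdd_aboveI2)
      show "norm (T x) \<le> B" if "x \<in> {x \<in> H. norm x \<le> 1}" for x
        using order_trans[OF B(2)[of x] mult_left_le[of "norm x" B]] B(1) that by simp
    qed
  qed (use hilbert_subspaceD(3)[OF H] in simp)
  then show ?thesis using norm_ge_zero[of "T 0"] by linarith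
qed

lemma opnorm_adjoint_le:
  assumes T: "T \<in> bounded_ops H"
  shows "opnorm (adjoint_op H T) \<le> opnorm T"
proof (rule opnorm_le[OF _ opnorm_nonneg[OF T]])
  fix y assume y: "y \<in> H"
  let ?w = "adjoint_op H T y"
  have w: "?w \<in> H" using adjoint_props(1)[OF T] y by (simp add: bounded_ops_mem)
  show "norm ?w \<le> opnorm T * norm y"
  proof (cases "?w = 0")
    case False
    have "(norm ?w)\<^sup>2 = cmod (cinner ?w ?w)" by (simp add: cinner_self norm_power)
    also have "cinner ?w ?w = cinner (T ?w) y" using adjoint_props(2)[OF T w y] by simp
    also have "cmod (cinner (T ?w) y) \<le> norm (T ?w) * norm y" by (rule cinner_Cauchy_Schwarz)
    also have "\<dots> \<le> (opnorm T * norm ?w) * norm y" by (intro mult_right_mono opnorm_bound T w) simp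
    finally have "norm ?w * norm ?w \<le> norm ?w * (opnorm T * norm y)"
      by (simp add: power2_eq_square mult_ac)
    then show ?thesis using False by simp
  qed (simp add: opnorm_nonneg[OF T])
qed

text \<open>One inequality is submultiplicativity with the norm bound for the adjoint. The other
  takes the square root of \<open>norm (T x)^2 = cmod (cinner x (?Q x))\<close>, where
  Cauchy-Schwarz bounds the right side by the norm of \<open>?Q\<close>.\<close>

lemma opnorm_cstar:
  assumes T: "T \<in> bounded_ops H"
  shows "opnorm (compose H (adjoint_op H T) T) = (opnorm T)\<^sup>2"
proof (rule antisym)
  let ?S = "adjoint_op H T" and ?Q = "compose H (adjoint_op H T) T"
  note S = adjoint_props(1)[OF T]
  have Q: "?Q \<in> bounded_ops H" by (intro bounded_ops_intros S T)
  show "opnorm ?Q \<le> (opnorm T)\<^sup>2"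
  proof (rule opnorm_le)
    fix x assume x: "x \<in> H"
    have "norm (?Q x) \<le> opnorm ?S * norm (T x)"
      using x by (simp add: compose_apply opnorm_bound S T bounded_ops_mem)
    also have "\<dots> \<le> opnorm T * norm (T x)" by (intro mult_right_mono opnorm_adjoint_le T) simp
    also have "\<dots> \<le> opnorm T * (opnorm T * norm x)"
      by (intro mult_left_mono opnorm_bound T x opnorm_nonneg)
    finally show "norm (?Q x) \<le> (opnorm T)\<^sup>2 * norm x" by (simp add: power2_eq_square)
  qed simp
  have "opnorm T \<le> sqrt (opnorm ?Q)"
  proof (rule opnorm_le)
    fix x assume x: "x \<in> H"
    have "(norm (T x))\<^sup>2 = cmod (cinner (T x) (T x))" by (simp add: cinner_self norm_power)
    also have "\<dots> = cmod (cinner x (?Q x))"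
      using adjoint_props(2)[OF T x bounded_ops_mem[OF T x]] x by (simp add: compose_apply)
    also have "\<dots> \<le> norm x * norm (?Q x)" by (rule cinner_Cauchy_Schwarz)
    also have "\<dots> \<le> norm x * (opnorm ?Q * norm x)" by (intro mult_left_mono opnorm_bound Q x) simp
    also have "\<dots> = (sqrt (opnorm ?Q) * norm x)\<^sup>2"
      by (simp add: power_mult_distrib opnorm_nonneg[OF Q] power2_eq_square[of "norm x"])
    finally show "norm (T x) \<le> sqrt (opnorm ?Q) * norm x"
      by (rule power2_le_imp_le) (simp add: opnorm_nonneg[OF Q])
  qed (use opnorm_nonneg[OF Q] in simp)
  then have "(opnorm T)\<^sup>2 \<le> (sqrt (opnorm ?Q))\<^sup>2" by (intro power_mono opnorm_nonneg T)
  then show "(opnorm T)\<^sup>2 \<le> opnorm ?Q" using opnorm_nonneg[OF Q] by simp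
qed

lemma opnorm_eq_0:
  assumes T: "T \<in> bounded_ops H"
  shows "opnorm T = 0 \<longleftrightarrow> T = (\<lambda>x\<in>H. 0)"
proof
  assume "opnorm T = 0"
  then show "T = (\<lambda>x\<in>H. 0)"
    using opnorm_bound[OF T] by (intro bounded_ops_eqI[OF T bounded_ops_intros(2)]) auto
next
  assume "T = (\<lambda>x\<in>H. 0)"
  then have "opnorm T \<le> 0" by (intro opnorm_le) auto
  then show "opnorm T = 0" using opnorm_nonneg[OF T] by simp
qed

text \<open>The limit is taken pointwise; the Cauchy estimate is uniform relative to
  \<open>norm x\<close>, so it survives letting the second index tend to infinity and gives
  convergence in norm.\<close>

lemma opnorm_complete:
  assumes X: "range X \<subseteq> bounded_ops H"
    and C: "\<forall>e>0. \<exists>N. \<forall>p\<ge>N. \<forall>q\<ge>N. opnorm (\<lambda>x\<in>H. X p x - X q x) < e"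
  shows "\<exists>T\<in>bounded_ops H. (\<lambda>p. opnorm (\<lambda>x\<in>H. X p x - T x)) \<longlonglongrightarrow> 0"
proof -
  note Hs = hilbert_subspaceD[OF H]
  have Xb: "X p \<in> bounded_ops H" for p using X by auto
  have d: "norm (X p x - X q x) \<le> opnorm (\<lambda>x\<in>H. X p x - X q x) * norm x" if "x \<in> H" for p q x
    using opnorm_bound[OF bounded_ops_intros(7)[OF Xb Xb] that, of p q] that by simp
  have tail: "\<exists>N. \<forall>p\<ge>N. \<forall>q\<ge>N. \<forall>x\<in>H. norm (X p x - X q x) \<le> e * norm x" if e: "e > 0" for e :: real
  proof -
    obtain N where N: "\<forall>p\<ge>N. \<forall>q\<ge>N. opnorm (\<lambda>x\<in>H. X p x - X q x) < e" using C e by blast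
    have "norm (X p x - X q x) \<le> e * norm x" if "p \<ge> N" "q \<ge> N" "x \<in> H" for p q x
    proof -
      have "opnorm (\<lambda>x\<in>H. X p x - X q x) * norm x \<le> e * norm x"
        using N that by (intro mult_right_mono) (auto intro: less_imp_le)
      then show ?thesis using d[OF that(3), of p q] by linarith
    qed
    then show ?thesis by blast
  qed
  have "convergent (\<lambda>p. X p x)" if x: "x \<in> H" for x
  proof (rule Cauchy_convergent, rule CauchyI)
    fix e :: real assume e: "e > 0"
    \<comment> \<open>The estimate in \<open>tail\<close> is relative to \<open>norm x\<close>; the
      summand 1 covers \<open>x = 0\<close> and gives a strict inequality.\<close>
    define e' where "e' = e / (norm x + 1)"
    have nx: "norm x + 1 > 0" by (simp add: add_nonneg_pos)
    have e': "e' > 0" using e nx by (simp add: e'_def)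
    have "e' * norm x < e' * (norm x + 1)" using e' by simp
    also have "\<dots> = e" using nx by (simp add: e'_def)
    finally have e'2: "e' * norm x < e" .
    obtain N where "\<forall>p\<ge>N. \<forall>q\<ge>N. \<forall>x\<in>H. norm (X p x - X q x) \<le> e' * norm x"
      using tail[OF e'] by blast
    then show "\<exists>M. \<forall>p\<ge>M. \<forall>q\<ge>M. norm (X p x - X q x) < e" using x e'2 by (meson le_less_trans)
  qed
  then have "\<forall>x\<in>H. \<exists>l. (\<lambda>p. X p x) \<longlonglongrightarrow> l" by (simp add: convergent_def)
  then obtain L where L: "\<And>x. x \<in> H \<Longrightarrow> (\<lambda>p. X p x) \<longlonglongrightarrow> L x" by metis
  have LH: "L x \<in> H" if "x \<in> H" for x
    using hilbert_subspace_tendsto[OF H L[OF that] bounded_ops_mem[OF Xb that]] .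
  have est: "\<exists>N. \<forall>p\<ge>N. \<forall>x\<in>H. norm (X p x - L x) \<le> e * norm x" if e: "e > 0" for e :: real
  proof -
    obtain N where N: "\<forall>p\<ge>N. \<forall>q\<ge>N. \<forall>x\<in>H. norm (X p x - X q x) \<le> e * norm x"
      using tail[OF e] by blast
    have "norm (X p x - L x) \<le> e * norm x" if "p \<ge> N" "x \<in> H" for p x
    proof (rule Lim_bounded)
      show "(\<lambda>q. norm (X p x - X q x)) \<longlonglongrightarrow> norm (X p x - L x)" by (intro tendsto_intros L that)
      show "\<forall>q\<ge>N. norm (X p x - X q x) \<le> e * norm x" using N that by blast
    qed
    then show ?thesis by blast
  qed
  have "blin H H L"
  proof -
    obtain N where N: "\<forall>x\<in>H. norm (X N x - L x) \<le> 1 * norm x" using est[of 1] by auto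
    show ?thesis
    proof (rule blinI[OF LH])
      fix x y c assume x: "x \<in> H" and y: "y \<in> H"
      have "(\<lambda>p. X p (x + y)) \<longlonglongrightarrow> L x + L y"
        using tendsto_add[OF L[OF x] L[OF y]] by (simp add: bounded_ops_linear(1)[OF Xb x y])
      then show "L (x + y) = L x + L y" using L[OF Hs(4)[OF x y]] LIMSEQ_unique by blast
    next
      fix x and c :: complex assume x: "x \<in> H"
      have "(\<lambda>p. X p (c *\<^sub>C x)) \<longlonglongrightarrow> c *\<^sub>C L x"
        using bounded_linear.tendsto[OF bounded_linear_scaleC L[OF x], of c]
        by (simp add: bounded_ops_linear(2)[OF Xb x])
      then show "L (c *\<^sub>C x) = c *\<^sub>C L x" using L[OF Hs(7)[OF x]] LIMSEQ_unique by blast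
    next
      fix x assume x: "x \<in> H"
      have "norm (L x) \<le> norm (X N x) + norm (X N x - L x)"
        using norm_triangle_ineq4[of "X N x" "X N x - L x"] by simp
      also have "\<dots> \<le> opnorm (X N) * norm x + norm x"
        using opnorm_bound[OF Xb x, of N] N x by (intro add_mono) auto
      finally show "norm (L x) \<le> (opnorm (X N) + 1) * norm x" by (simp add: distrib_right)
    qed
  qed
  then have T: "restrict L H \<in> bounded_ops H" by (rule restrict_bounded_ops[OF _ Hs(2)])
  have "(\<lambda>p. opnorm (\<lambda>x\<in>H. X p x - restrict L H x)) \<longlonglongrightarrow> 0"
  proof (rule LIMSEQ_I)
    fix e :: real assume e: "e > 0"
    obtain N where N: "\<forall>p\<ge>N. \<forall>x\<in>H. norm (X p x - L x) \<le> e/2 * norm x"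
      using est[of "e/2"] e by auto
    have "norm (opnorm (\<lambda>x\<in>H. X p x - restrict L H x) - 0) < e" if "p \<ge> N" for p
    proof -
      have "opnorm (\<lambda>x\<in>H. X p x - restrict L H x) \<le> e/2"
        by (rule opnorm_le) (use N that e in auto)
      then show ?thesis using opnorm_nonneg[OF bounded_ops_intros(7)[OF Xb T], of p] e by simp
    qed
    then show "\<exists>N. \<forall>p\<ge>N. norm (opnorm (\<lambda>x\<in>H. X p x - restrict L H x) - 0) < e" by blast
  qed
  then show ?thesis using T by blast
qed

lemma cring_complex_ring: "cring complex_ring"
proof (rule cringI)
  show "abelian_group complex_ring"
  proof (rule abelian_groupI)
    show "\<exists>y\<in>carrier complex_ring. y \<oplus>\<^bsub>complex_ring\<^esub> x = \<zero>\<^bsub>complex_ring\<^esub>" for x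
      by (rule bexI[of _ "- x"]) (simp_all add: complex_ring_def)
  qed (simp_all add: complex_ring_def)
  show "comm_monoid complex_ring"
    by (rule comm_monoidI) (simp_all add: complex_ring_def)
qed (simp add: complex_ring_def distrib_right)

text \<open>Needed at two places: for \<open>H\<close>, to push the relations forward along \<pi>,
  and for \<open>H1\<close>, whose operator algebra is the target of the universal property.\<close>

lemma unital_cstar_algebra_B_op: "unital_cstar_algebra (B_op H)"
proof -
  interpret B: ring "B_op H" by (rule ring_B_op)
  note bi = bounded_ops_intros
  show ?thesis
  proof (intro unital_cstar_algebra.intro unital_cstar_algebra_axioms.intro)
    show "ring (B_op H)" by (rule ring_B_op)
    show "Module.module complex_ring (B_op H)"
    proof (rule moduleI[OF cring_complex_ring B.abelian_group_axioms])
      show "\<one>\<^bsub>complex_ring\<^esub> \<odot>\<^bsub>B_op H\<^esub> T = T" if "T \<in> carrier (B_op H)" for T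
      proof (rule bounded_ops_eqI[of _ H])
        show "\<one>\<^bsub>complex_ring\<^esub> \<odot>\<^bsub>B_op H\<^esub> T \<in> bounded_ops H"
          unfolding B_op_simps using that by (intro bi) simp
      qed (use that in \<open>auto simp: complex_ring_def scaleC_one\<close>)
    qed (auto simp: bi complex_ring_def scaleC_add_left scaleC_add_right scaleC_scaleC
          intro!: restrict_ext)
    fix T R :: "'h \<Rightarrow> 'h" and c :: complex
    assume T: "T \<in> carrier (B_op H)"
    then have T': "T \<in> bounded_ops H" by simp
    note aT = adjoint_props[OF T']
    show "cstar (B_op H) T \<in> carrier (B_op H)" using aT(1) by simp
    show "cstar (B_op H) (cstar (B_op H) T) = T"
      unfolding B_op_simps by (rule adjoint_op_eqI[OF H T']) (rule aT(3)[symmetric])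
    show "cstar (B_op H) (c \<odot>\<^bsub>B_op H\<^esub> T) = cnj c \<odot>\<^bsub>B_op H\<^esub> cstar (B_op H) T"
      unfolding B_op_simps
      by (rule adjoint_op_eqI[OF H])
        (use aT in \<open>auto simp: bi cinner_scaleC_left cinner_scaleC_right\<close>)
    show "cnorm (B_op H) T \<ge> 0" using T' by (simp add: cnorm_B_op opnorm_nonneg)
    show "cnorm (B_op H) T = 0 \<longleftrightarrow> T = \<zero>\<^bsub>B_op H\<^esub>" using T' by (simp add: cnorm_B_op opnorm_eq_0)
    show "cnorm (B_op H) (c \<odot>\<^bsub>B_op H\<^esub> T) = cmod c * cnorm (B_op H) T"
    proof -
      \<comment> \<open>One inequality for all scalars is enough: applied to the operator scaled by
        \<open>c\<close> and to the scalar \<open>1/c\<close> it gives the reverse one.\<close>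
      have le: "opnorm (\<lambda>x\<in>H. c *\<^sub>C Q x) \<le> cmod c * opnorm Q" if Q: "Q \<in> bounded_ops H" for c Q
        by (rule opnorm_le)
          (use opnorm_bound[OF Q] opnorm_nonneg[OF Q] in \<open>auto simp: norm_scaleC mult.assoc intro!: mult_left_mono\<close>)
      show ?thesis
      proof (cases "c = 0")
        case True
        then have "opnorm (\<lambda>x\<in>H. c *\<^sub>C T x) \<le> 0" using le[OF T', of c] by simp
        then show ?thesis
          using True opnorm_nonneg[OF bi(5)[OF T', of c]] by (simp add: cnorm_B_op)
      next
        case False
        have "T = (\<lambda>x\<in>H. (1/c) *\<^sub>C (\<lambda>x\<in>H. c *\<^sub>C T x) x)"
        proof (rule bounded_ops_eqI[OF T'])
          show "(\<lambda>x\<in>H. (1/c) *\<^sub>C (\<lambda>x\<in>H. c *\<^sub>C T x) x) \<in> bounded_ops H" by (intro bi T')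
        qed (use False in \<open>auto simp: scaleC_scaleC scaleC_one\<close>)
        then have "opnorm T \<le> cmod (1/c) * opnorm (\<lambda>x\<in>H. c *\<^sub>C T x)"
          using le[OF bi(5)[OF T', of c], of "1/c"] by simp
        then have "cmod c * opnorm T \<le> opnorm (\<lambda>x\<in>H. c *\<^sub>C T x)"
          using False by (simp add: norm_divide field_simps)
        then show ?thesis using le[OF T', of c] by (simp add: cnorm_B_op)
      qed
    qed
    show "cnorm (B_op H) (cstar (B_op H) T \<otimes>\<^bsub>B_op H\<^esub> T) = (cnorm (B_op H) T)\<^sup>2"
      using T' by (simp add: cnorm_B_op opnorm_cstar)
    assume R: "R \<in> carrier (B_op H)"
    then have R': "R \<in> bounded_ops H" by simp
    note aR = adjoint_props[OF R']
    show "(c \<odot>\<^bsub>B_op H\<^esub> T) \<otimes>\<^bsub>B_op H\<^esub> R = c \<odot>\<^bsub>B_op H\<^esub> (T \<otimes>\<^bsub>B_op H\<^esub> R)"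
      using R' by (auto simp: compose_def bounded_ops_mem intro!: restrict_ext)
    show "T \<otimes>\<^bsub>B_op H\<^esub> (c \<odot>\<^bsub>B_op H\<^esub> R) = c \<odot>\<^bsub>B_op H\<^esub> (T \<otimes>\<^bsub>B_op H\<^esub> R)"
      using R' T' by (auto simp: compose_def bounded_ops_mem bounded_ops_linear intro!: restrict_ext)
    show "cstar (B_op H) (T \<oplus>\<^bsub>B_op H\<^esub> R) = cstar (B_op H) T \<oplus>\<^bsub>B_op H\<^esub> cstar (B_op H) R"
      unfolding B_op_simps
      by (rule adjoint_op_eqI[OF H]) (use aT aR in \<open>auto simp: bi cinner_add_left cinner_add_right\<close>)
    show "cstar (B_op H) (T \<otimes>\<^bsub>B_op H\<^esub> R) = cstar (B_op H) R \<otimes>\<^bsub>B_op H\<^esub> cstar (B_op H) T"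
      unfolding B_op_simps
      by (rule adjoint_op_eqI[OF H])
        (use aT aR T' R' in \<open>auto simp: bi compose_apply bounded_ops_mem\<close>)
    show "cnorm (B_op H) (T \<oplus>\<^bsub>B_op H\<^esub> R) \<le> cnorm (B_op H) T + cnorm (B_op H) R"
      unfolding cnorm_B_op
    proof (rule opnorm_le)
      show "norm ((T \<oplus>\<^bsub>B_op H\<^esub> R) x) \<le> (opnorm T + opnorm R) * norm x" if "x \<in> H" for x
        using norm_triangle_ineq[of "T x" "R x"] opnorm_bound[OF T' that] opnorm_bound[OF R' that] that
        by (simp add: distrib_right)
    qed (use T' R' opnorm_nonneg in auto)
    show "cnorm (B_op H) (T \<otimes>\<^bsub>B_op H\<^esub> R) \<le> cnorm (B_op H) T * cnorm (B_op H) R"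
      unfolding cnorm_B_op
    proof (rule opnorm_le)
      fix x assume x: "x \<in> H"
      have "norm (T (R x)) \<le> opnorm T * norm (R x)" by (intro opnorm_bound T' bounded_ops_mem[OF R' x])
      also have "\<dots> \<le> opnorm T * (opnorm R * norm x)"
        by (intro mult_left_mono opnorm_bound R' x opnorm_nonneg T')
      finally show "norm ((T \<otimes>\<^bsub>B_op H\<^esub> R) x) \<le> (opnorm T * opnorm R) * norm x"
        using x by (simp add: compose_apply mult.assoc)
    qed (use T' R' opnorm_nonneg in auto)
  next
    fix X :: "nat \<Rightarrow> 'h \<Rightarrow> 'h" assume X: "range X \<subseteq> carrier (B_op H)"
      and C: "\<forall>e>0. \<exists>N. \<forall>p\<ge>N. \<forall>q\<ge>N. cnorm (B_op H) (X p \<ominus>\<^bsub>B_op H\<^esub> X q) < e"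
    have Xb: "X p \<in> bounded_ops H" for p using X by auto
    have "\<exists>T\<in>bounded_ops H. (\<lambda>p. opnorm (\<lambda>x\<in>H. X p x - T x)) \<longlonglongrightarrow> 0"
      using X C by (intro opnorm_complete) (simp_all add: B_op_minus Xb cnorm_B_op)
    then show "\<exists>T\<in>carrier (B_op H). (\<lambda>p. cnorm (B_op H) (X p \<ominus>\<^bsub>B_op H\<^esub> T)) \<longlonglongrightarrow> 0"
      by (auto simp: B_op_minus Xb cnorm_B_op cong: bex_cong)
  qed
qed

end

section \<open>Representations of C*-algebras are continuous\<close>

context unital_cstar_algebra
begin

interpretation M: module complex_ring A by (rule complex_module)

lemma smult_simps:
  "x \<in> carrier A \<Longrightarrow> c \<odot> x \<in> carrier A"
  "\<lbrakk>x \<in> carrier A; y \<in> carrier A\<rbrakk> \<Longrightarrow> c \<odot> (x \<oplus> y) = c \<odot> x \<oplus> c \<odot> y"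
  "x \<in> carrier A \<Longrightarrow> (c + d) \<odot> x = c \<odot> x \<oplus> d \<odot> x"
  "x \<in> carrier A \<Longrightarrow> c \<odot> (d \<odot> x) = (c * d) \<odot> x"
  "x \<in> carrier A \<Longrightarrow> 1 \<odot> x = x"
  using M.smult_closed[of c x] M.smult_r_distr[of c x y] M.smult_l_distr[of c d x]
    M.smult_assoc1[of c d x] M.smult_one[of x]
  by (simp_all add: complex_ring_def)

lemma a_inv_smult: "x \<in> carrier A \<Longrightarrow> \<ominus> x = (-1) \<odot> x"
proof (rule minus_equality)
  assume x: "x \<in> carrier A"
  have "0 \<odot> x \<oplus> 0 \<odot> x = 0 \<odot> x" using smult_simps(3)[OF x, of 0 0] by simp
  then have "0 \<odot> x = \<zero>" using x by (simp add: smult_simps(1) add.r_cancel_one')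
  then show "(-1) \<odot> x \<oplus> x = \<zero>"
    using smult_simps(3)[OF x, of "-1" 1] x by (simp add: smult_simps(5))
qed (auto simp: smult_simps(1))

lemma norm_a_inv: "x \<in> carrier A \<Longrightarrow> cnorm A (\<ominus> x) = cnorm A x"
  by (simp add: a_inv_smult norm_smult)

lemma norm_zero: "cnorm A \<zero> = 0"
  by (simp add: norm_eq_zero)

lemma minus_triangle:
  assumes "x \<in> carrier A" "y \<in> carrier A" "w \<in> carrier A"
  shows "cnorm A (x \<ominus> w) \<le> cnorm A (x \<ominus> y) + cnorm A (y \<ominus> w)"
proof -
  have "x \<ominus> w = (x \<ominus> y) \<oplus> (y \<ominus> w)" using assms by (simp add: minus_eq a_assoc r_neg1)
  then show ?thesis using norm_triangle[of "x \<ominus> y" "y \<ominus> w"] assms by simp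
qed

lemma norm_minus_sym:
  assumes "x \<in> carrier A" "y \<in> carrier A"
  shows "cnorm A (x \<ominus> y) = cnorm A (y \<ominus> x)"
proof -
  have "x \<ominus> y = \<ominus> (y \<ominus> x)" using assms by (simp add: minus_eq minus_add a_comm)
  then show ?thesis using assms by (simp add: norm_a_inv)
qed

lemma norm_star: "x \<in> carrier A \<Longrightarrow> cnorm A (cstar A x) = cnorm A x"
proof -
  have le: "cnorm A x \<le> cnorm A (cstar A x)" if x: "x \<in> carrier A" for x
  proof (cases "cnorm A x = 0")
    case False
    have "cnorm A x * cnorm A x \<le> cnorm A (cstar A x) * cnorm A x"
      using norm_mult[OF star_closed[OF x] x] cstar_identity[OF x] by (simp add: power2_eq_square)
    then show ?thesis using False norm_nonneg[OF x] by simp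
  qed (simp add: norm_nonneg star_closed x)
  assume x: "x \<in> carrier A"
  show ?thesis using le[OF x] le[OF star_closed[OF x]] star_star[OF x] by simp
qed

lemma star_minus:
  assumes "x \<in> carrier A" "y \<in> carrier A"
  shows "cstar A (x \<ominus> y) = cstar A x \<ominus> cstar A y"
  using assms by (simp add: minus_eq a_inv_smult star_add star_smult smult_simps star_closed)

lemma smult_minus:
  assumes "x \<in> carrier A" "y \<in> carrier A"
  shows "c \<odot> (x \<ominus> y) = c \<odot> x \<ominus> c \<odot> y"
  using assms by (simp add: minus_eq a_inv_smult smult_simps)

text \<open>A self-adjoint \<open>h\<close> with \<open>\<parallel>h\<parallel> \<le> 1/4\<close> satisfies \<open>1 - h = (1 - y)\<^sup>2\<close> with \<open>y\<close> self-adjoint: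
  \<open>y\<close> is the fixed point of the contraction \<open>v \<mapsto> (h + v\<^sup>2) / 2\<close> of the ball of radius \<open>1/2\<close>.\<close>

lemma selfadjoint_sqrt:
  assumes h: "h \<in> carrier A" and hs: "cstar A h = h" and hn: "cnorm A h \<le> 1/4"
  shows "\<exists>y\<in>carrier A. cstar A y = y \<and> y \<oplus> y = h \<oplus> y \<otimes> y"
proof -
  define f where "f v = (1/2) \<odot> (h \<oplus> v \<otimes> v)" for v
  have fc: "f v \<in> carrier A" if "v \<in> carrier A" for v
    unfolding f_def using that h by (intro smult_simps) simp
  \<comment> \<open>The difference of squares is split as \<open>u(u-v) + (u-v)v\<close>, which
    holds without commutativity.\<close>
  have fdiff: "cnorm A (f u \<ominus> f v) \<le> 1/2 * (cnorm A u + cnorm A v) * cnorm A (u \<ominus> v)"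
    if uv: "u \<in> carrier A" "v \<in> carrier A" for u v
  proof -
    have "(h \<oplus> u \<otimes> u) \<ominus> (h \<oplus> v \<otimes> v) = u \<otimes> u \<ominus> v \<otimes> v"
      using uv h by (simp add: minus_eq minus_add a_ac r_neg1 r_neg2)
    also have "\<dots> = u \<otimes> (u \<ominus> v) \<oplus> (u \<ominus> v) \<otimes> v"
      using uv by (simp add: minus_eq l_distr r_distr a_ac r_minus l_minus r_neg1 r_neg2)
    finally have "f u \<ominus> f v = (1/2) \<odot> (u \<otimes> (u \<ominus> v) \<oplus> (u \<ominus> v) \<otimes> v)"
      unfolding f_def using uv h by (simp flip: smult_minus)
    then have "cnorm A (f u \<ominus> f v) = 1/2 * cnorm A (u \<otimes> (u \<ominus> v) \<oplus> (u \<ominus> v) \<otimes> v)"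
      using uv by (simp add: norm_smult norm_divide)
    also have "cnorm A (u \<otimes> (u \<ominus> v) \<oplus> (u \<ominus> v) \<otimes> v)
        \<le> cnorm A (u \<otimes> (u \<ominus> v)) + cnorm A ((u \<ominus> v) \<otimes> v)"
      using uv by (intro norm_triangle) auto
    also have "\<dots> \<le> cnorm A u * cnorm A (u \<ominus> v) + cnorm A (u \<ominus> v) * cnorm A v"
      using uv by (intro add_mono norm_mult) auto
    finally show ?thesis by (simp add: algebra_simps)
  qed
  define Y where "Y k = (f ^^ k) \<zero>" for k
  have Yc: "Y k \<in> carrier A" for k by (induction k) (auto simp: Y_def fc)
  have Yn: "cnorm A (Y k) \<le> 1/2" for k
  proof (induction k)
    case (Suc k)
    have "cnorm A (Y (Suc k)) = 1/2 * cnorm A (h \<oplus> Y k \<otimes> Y k)"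
      using h Yc by (simp add: Y_def f_def norm_smult norm_divide)
    also have "cnorm A (h \<oplus> Y k \<otimes> Y k) \<le> cnorm A h + cnorm A (Y k) * cnorm A (Y k)"
      using norm_triangle[of h "Y k \<otimes> Y k"] norm_mult[of "Y k" "Y k"] h Yc by simp
    also have "\<dots> \<le> 1/4 + (1/2) * (1/2)"
      using Suc norm_nonneg[OF Yc] by (intro add_mono hn mult_mono) auto
    finally show ?case by simp
  qed (simp add: Y_def norm_zero)
  have Ys: "cstar A (Y k) = Y k" for k
  proof (induction k)
    case 0
    have "cstar A \<zero> = \<zero>"
      using norm_star[of \<zero>] norm_zero norm_eq_zero[OF star_closed[of \<zero>]] by simp
    then show ?case by (simp add: Y_def)
  next
    case (Suc k)
    have "Y (Suc k) = f (Y k)" by (simp add: Y_def)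
    then show ?case using Suc hs h Yc by (simp add: f_def star_smult star_add star_mult)
  qed
  \<comment> \<open>On the ball of radius 1/2 the bound \<open>fdiff\<close> has the constant
    (1/2)(1/2 + 1/2) = 1/2.\<close>
  have contr: "cnorm A (Y (p + k) \<ominus> Y p) \<le> (1/2)^p" for p k
  proof (induction p)
    case 0
    have "Y k \<ominus> Y 0 = Y k" using Yc by (simp add: Y_def minus_eq)
    then show ?case using Yn[of k] by simp
  next
    case (Suc p)
    have "cnorm A (Y (Suc p + k) \<ominus> Y (Suc p)) = cnorm A (f (Y (p + k)) \<ominus> f (Y p))"
      by (simp add: Y_def)
    also have "\<dots> \<le> 1/2 * (cnorm A (Y (p + k)) + cnorm A (Y p)) * cnorm A (Y (p + k) \<ominus> Y p)"
      by (rule fdiff[OF Yc Yc])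
    also have "\<dots> \<le> 1/2 * 1 * cnorm A (Y (p + k) \<ominus> Y p)"
      using Yn[of "p + k"] Yn[of p] Yc by (intro mult_right_mono mult_left_mono norm_nonneg) auto
    also have "\<dots> \<le> (1/2) ^ Suc p" using Suc by simp
    finally show ?case .
  qed
  have "\<exists>y\<in>carrier A. (\<lambda>p. cnorm A (Y p \<ominus> y)) \<longlonglongrightarrow> 0"
  proof (rule complete)
    show "\<forall>e>0. \<exists>N. \<forall>p\<ge>N. \<forall>q\<ge>N. cnorm A (Y p \<ominus> Y q) < e"
    proof (intro allI impI)
      fix e :: real assume e: "e > 0"
      obtain N where N: "(1/2::real) ^ N < e" using real_arch_pow_inv[OF e, of "1/2"] by auto
      have le: "cnorm A (Y q \<ominus> Y p) < e" if "N \<le> p" "p \<le> q" for p q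
      proof -
        have "cnorm A (Y q \<ominus> Y p) \<le> (1/2) ^ p" using contr[of p "q - p"] that by simp
        also have "\<dots> \<le> (1/2) ^ N" using that by (intro power_decreasing) auto
        finally show ?thesis using N by simp
      qed
      have "cnorm A (Y p \<ominus> Y q) < e" if "N \<le> p" "N \<le> q" for p q
        using le[of p q] le[of q p] that norm_minus_sym[OF Yc Yc, of p q] by (cases "p \<le> q") auto
      then show "\<exists>N. \<forall>p\<ge>N. \<forall>q\<ge>N. cnorm A (Y p \<ominus> Y q) < e" by blast
    qed
  qed (use Yc in auto)
  then obtain y where y: "y \<in> carrier A" "(\<lambda>p. cnorm A (Y p \<ominus> y)) \<longlonglongrightarrow> 0" by blast
  have zero: "a = b" if ab: "a \<in> carrier A" "b \<in> carrier A"
    and le: "\<And>p. cnorm A (a \<ominus> b) \<le> g p" and g: "g \<longlonglongrightarrow> 0" for a b and g :: "nat \<Rightarrow> real"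
  proof -
    have "cnorm A (a \<ominus> b) \<le> 0" by (rule LIMSEQ_le_const[OF g]) (use le in auto)
    then have "a \<ominus> b = \<zero>" using norm_nonneg[of "a \<ominus> b"] norm_eq_zero[of "a \<ominus> b"] ab by simp
    moreover have "a = (a \<ominus> b) \<oplus> b" using ab by (simp add: minus_eq a_assoc l_neg)
    ultimately show ?thesis using ab by simp
  qed
  have "cstar A y = y"
  proof (rule zero)
    show "cnorm A (cstar A y \<ominus> y) \<le> cnorm A (Y p \<ominus> y) + cnorm A (Y p \<ominus> y)" for p
    proof -
      have "cnorm A (cstar A y \<ominus> Y p) = cnorm A (y \<ominus> Y p)"
        using norm_star[of "y \<ominus> Y p"] star_minus[of y "Y p"] y Yc Ys by simp
      then show ?thesis
        using minus_triangle[OF star_closed[OF y(1)] Yc y(1), of p] norm_minus_sym[OF y(1) Yc, of p] by simp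
    qed
    show "(\<lambda>p. cnorm A (Y p \<ominus> y) + cnorm A (Y p \<ominus> y)) \<longlonglongrightarrow> 0"
      using tendsto_add[OF y(2) y(2)] by simp
  qed (use y star_closed in auto)
  moreover have "y = f y"
  proof (rule zero)
    show "cnorm A (y \<ominus> f y) \<le> cnorm A (Y (Suc p) \<ominus> y) + 1/2 * (1/2 + cnorm A y) * cnorm A (Y p \<ominus> y)" for p
    proof -
      have "cnorm A (f (Y p) \<ominus> f y) \<le> 1/2 * (cnorm A (Y p) + cnorm A y) * cnorm A (Y p \<ominus> y)"
        by (rule fdiff[OF Yc y(1)])
      also have "\<dots> \<le> 1/2 * (1/2 + cnorm A y) * cnorm A (Y p \<ominus> y)"
        using Yn[of p] Yc y by (intro mult_right_mono mult_left_mono norm_nonneg add_right_mono) auto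
      finally have "cnorm A (Y (Suc p) \<ominus> f y) \<le> 1/2 * (1/2 + cnorm A y) * cnorm A (Y p \<ominus> y)"
        by (simp add: Y_def)
      then show ?thesis
        using minus_triangle[OF y(1) Yc fc[OF y(1)], of "Suc p"] norm_minus_sym[OF y(1) Yc, of "Suc p"]
        by simp
    qed
    have "(\<lambda>p. cnorm A (Y (Suc p) \<ominus> y) + 1/2 * (1/2 + cnorm A y) * cnorm A (Y p \<ominus> y))
        \<longlonglongrightarrow> 0 + 1/2 * (1/2 + cnorm A y) * 0"
      by (intro tendsto_add tendsto_mult tendsto_const y(2) LIMSEQ_Suc)
    then show "(\<lambda>p. cnorm A (Y (Suc p) \<ominus> y) + 1/2 * (1/2 + cnorm A y) * cnorm A (Y p \<ominus> y)) \<longlonglongrightarrow> 0"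
      by simp
  qed (use y fc in auto)
  then have "y \<oplus> y = h \<oplus> y \<otimes> y"
    using smult_simps(3)[of "h \<oplus> y \<otimes> y" "1/2" "1/2"] smult_simps(5)[of "h \<oplus> y \<otimes> y"] y h
    by (simp add: f_def)
  ultimately show ?thesis using y by blast
qed

end

section \<open>Continuity of representations and the passage from generators to the algebra\<close>

lemma representationD:
  assumes "representation A H \<pi>"
  shows "hilbert_subspace H"
    "\<And>a. a \<in> carrier A \<Longrightarrow> \<pi> a \<in> bounded_ops H"
    "\<And>a b x. a \<in> carrier A \<Longrightarrow> b \<in> carrier A \<Longrightarrow> x \<in> H \<Longrightarrow> \<pi> (a \<otimes>\<^bsub>A\<^esub> b) x = \<pi> a (\<pi> b x)"
    "\<And>a b x. a \<in> carrier A \<Longrightarrow> b \<in> carrier A \<Longrightarrow> x \<in> H \<Longrightarrow> \<pi> (a \<oplus>\<^bsub>A\<^esub> b) x = \<pi> a x + \<pi> b x"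
    "\<And>x. x \<in> H \<Longrightarrow> \<pi> \<one>\<^bsub>A\<^esub> x = x"
    "\<And>a c x. a \<in> carrier A \<Longrightarrow> x \<in> H \<Longrightarrow> \<pi> (c \<odot>\<^bsub>A\<^esub> a) x = c *\<^sub>C \<pi> a x"
    "\<And>a. a \<in> carrier A \<Longrightarrow> \<pi> (cstar A a) = adjoint_op H (\<pi> a)"
    "\<And>a x. a \<in> carrier A \<Longrightarrow> x \<in> H \<Longrightarrow> \<pi> a x \<in> H"
proof -
  have h: "\<pi> \<in> ring_hom A (B_op H)" and s: "unital_star_hom A (B_op H) \<pi>" and H: "hilbert_subspace H"
    using assms by (auto simp: representation_def unital_star_hom_def)
  note hs = ring_hom_closed[OF h] ring_hom_mult[OF h] ring_hom_add[OF h] ring_hom_one[OF h]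
  show "hilbert_subspace H" by (rule H)
  show b: "\<pi> a \<in> bounded_ops H" if "a \<in> carrier A" for a using hs(1)[OF that] by simp
  show "\<pi> (a \<otimes>\<^bsub>A\<^esub> b) x = \<pi> a (\<pi> b x)" if "a \<in> carrier A" "b \<in> carrier A" "x \<in> H" for a b x
    using hs(2)[OF that(1,2)] that by (simp add: compose_apply)
  show "\<pi> (a \<oplus>\<^bsub>A\<^esub> b) x = \<pi> a x + \<pi> b x" if "a \<in> carrier A" "b \<in> carrier A" "x \<in> H" for a b x
    using hs(3)[OF that(1,2)] that by simp
  show "\<pi> \<one>\<^bsub>A\<^esub> x = x" if "x \<in> H" for x using hs(4) that by simp
  show "\<pi> (c \<odot>\<^bsub>A\<^esub> a) x = c *\<^sub>C \<pi> a x" if "a \<in> carrier A" "x \<in> H" for a c x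
    using s that by (simp add: unital_star_hom_def)
  show "\<pi> (cstar A a) = adjoint_op H (\<pi> a)" if "a \<in> carrier A" for a
    using s that by (simp add: unital_star_hom_def)
  show "\<pi> a x \<in> H" if "a \<in> carrier A" "x \<in> H" for a x
    using bounded_ops_mem[OF b] that by blast
qed

text \<open>With \<open>1 - h = (1 - y)^2\<close> for \<open>h\<close> the product of the adjoint of
  \<open>b\<close> and \<open>b\<close>, and \<open>T\<close> the image of \<open>y\<close>, one has
  \<open>norm x^2 - norm (\<pi> b x)^2 = norm (x - T x)^2\<close>, so \<pi> does not enlarge vectors
  by elements of norm at most 1/2. The factor 2 comes from this 1/2, that is, from the bound 1/4
  under which the square root was constructed.\<close>

lemma representation_continuous:
  assumes A: "unital_cstar_algebra A" and \<pi>: "representation A H \<pi>"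
    and a: "a \<in> carrier A" and x: "x \<in> H"
  shows "norm (\<pi> a x) \<le> 2 * cnorm A a * norm x"
proof -
  interpret unital_cstar_algebra A by (rule A)
  note p = representationD[OF \<pi>]
  have small: "norm (\<pi> b x) \<le> norm x" if b: "b \<in> carrier A" and bn: "cnorm A b \<le> 1/2" for b
  proof -
    let ?h = "cstar A b \<otimes>\<^bsub>A\<^esub> b"
    have h: "?h \<in> carrier A" "cstar A ?h = ?h" using b by (simp_all add: star_closed star_mult star_star)
    have "cnorm A ?h \<le> (1/2)\<^sup>2"
      unfolding cstar_identity[OF b] using bn norm_nonneg[OF b] by (intro power_mono) auto
    then obtain y where y: "y \<in> carrier A" "cstar A y = y" "y \<oplus>\<^bsub>A\<^esub> y = ?h \<oplus>\<^bsub>A\<^esub> y \<otimes>\<^bsub>A\<^esub> y"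
      using selfadjoint_sqrt[OF h] by (auto simp: power2_eq_square)
    let ?T = "\<pi> y"
    note aT = adjoint_props(2)[OF p(1) p(2)[OF y(1)]] and ab = adjoint_props(2)[OF p(1) p(2)[OF b]]
    have "?T x + ?T x = \<pi> (cstar A b) (\<pi> b x) + ?T (?T x)"
      using arg_cong[OF y(3), of "\<lambda>a. \<pi> a x"] y(1) h(1) b x by (simp add: p star_closed)
    then have "cinner x (?T x + ?T x) = cinner x (\<pi> (cstar A b) (\<pi> b x) + ?T (?T x))" by simp
    moreover have "cinner x (?T (?T x)) = cinner (?T x) (?T x)"
      using aT[OF x p(8)[OF y(1) x]] p(7)[OF y(1)] y(2) by simp
    moreover have "cinner x (\<pi> (cstar A b) (\<pi> b x)) = cinner (\<pi> b x) (\<pi> b x)"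
      using ab[OF x p(8)[OF b x]] p(7)[OF b] by simp
    ultimately have "cinner x (?T x) + cinner x (?T x) = cinner (\<pi> b x) (\<pi> b x) + cinner (?T x) (?T x)"
      by (simp add: cinner_add_right)
    from arg_cong[OF this, of Re]
    have "Re (cinner x (?T x)) + Re (cinner x (?T x)) = (norm (\<pi> b x))\<^sup>2 + (norm (?T x))\<^sup>2"
      by (simp add: power2_norm_eq_inner inner_cinner)
    moreover have "Re (cinner x (?T x)) \<le> norm x * norm (?T x)"
      using complex_Re_le_cmod[of "cinner x (?T x)"] cinner_Cauchy_Schwarz[of x "?T x"] by linarith
    moreover have "2 * (norm x * norm (?T x)) \<le> (norm x)\<^sup>2 + (norm (?T x))\<^sup>2"
      using sum_squares_bound[of "norm x" "norm (?T x)"] by simp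
    ultimately have "(norm (\<pi> b x))\<^sup>2 \<le> (norm x)\<^sup>2" by linarith
    then show ?thesis by (rule power2_le_imp_le) simp
  qed
  show ?thesis
  proof (cases "cnorm A a = 0")
    case True
    have "c \<odot>\<^bsub>A\<^esub> a \<in> carrier A" for c using a by (rule smult_simps(1))
    have "\<pi> a x = 0"
    proof (rule ccontr)
      assume ne: "\<pi> a x \<noteq> 0"
      \<comment> \<open>Scaling \<open>a\<close> leaves its norm at 0 but would stretch the image of
        \<open>x\<close> to the norm \<open>norm x + 1\<close>, against
        \<open>small\<close>.\<close>
      let ?c = "complex_of_real ((norm x + 1) / norm (\<pi> a x))"
      have "norm (\<pi> (?c \<odot>\<^bsub>A\<^esub> a) x) \<le> norm x"
        by (rule small) (use a True in \<open>auto simp: smult_simps(1) norm_smult\<close>)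
      moreover have "norm (\<pi> (?c \<odot>\<^bsub>A\<^esub> a) x) = norm x + 1"
        using ne by (simp add: p(6)[OF a x] norm_scaleC norm_divide del: of_real_add of_real_divide)
      ultimately show False by simp
    qed
    then show ?thesis using True by simp
  next
    case False
    let ?r = "1 / (2 * cnorm A a)" 
    let ?c = "complex_of_real ?r"
    have pos: "?r > 0" using False norm_nonneg[OF a] by simp
    have cm: "cmod ?c = ?r" using pos by (simp del: of_real_divide of_real_mult)
    have "norm (\<pi> (?c \<odot>\<^bsub>A\<^esub> a) x) \<le> norm x"
      by (rule small) (use a False in \<open>simp_all only: smult_simps(1) norm_smult cm, simp\<close>)
    then have "?r * norm (\<pi> a x) \<le> norm x"
      by (simp only: p(6)[OF a x] norm_scaleC cm)
    then show ?thesis using False norm_nonneg[OF a] by (simp add: field_simps)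
  qed
qed

text \<open>The elements that preserve \<open>K\<close> together with their adjoints form a
  C*-subalgebra. Closedness under norm limits is the point where continuity enters, and carrying the
  adjoint along in \<open>?S\<close> is what makes the set stable under the involution.\<close>

lemma representation_invariant:
  assumes A: "unital_cstar_algebra A" and \<pi>: "representation A H \<pi>"
    and gen: "\<And>S. unital_cstar_subalgebra A S \<Longrightarrow> G \<subseteq> S \<Longrightarrow> S = carrier A"
    and G: "G \<subseteq> carrier A" and K: "hilbert_subspace K" "K \<subseteq> H"
    and inv: "\<And>g x. g \<in> G \<Longrightarrow> x \<in> K \<Longrightarrow> \<pi> g x \<in> K"
    and inv_star: "\<And>g x. g \<in> G \<Longrightarrow> x \<in> K \<Longrightarrow> \<pi> (cstar A g) x \<in> K"
    and a: "a \<in> carrier A" and x: "x \<in> K"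
  shows "\<pi> a x \<in> K"
proof -
  interpret unital_cstar_algebra A by (rule A)
  note p = representationD[OF \<pi>]
  let ?S = "{a \<in> carrier A. \<forall>x\<in>K. \<pi> a x \<in> K \<and> \<pi> (cstar A a) x \<in> K}"
  have lim: "\<pi> b x \<in> K" if X: "\<And>k. X k \<in> carrier A" "\<And>k. \<pi> (X k) x \<in> K" "b \<in> carrier A"
    "(\<lambda>k. cnorm A (X k \<ominus>\<^bsub>A\<^esub> b)) \<longlonglongrightarrow> 0" and x: "x \<in> K" for X b x
  proof (rule hilbert_subspace_tendsto[OF K(1) _ X(2)])
    have xH: "x \<in> H" using x K by auto
    have "(\<lambda>k. \<pi> (X k) x - \<pi> b x) \<longlonglongrightarrow> 0"
    proof (rule Lim_null_comparison)
      have "\<pi> (X k \<ominus>\<^bsub>A\<^esub> b) x = \<pi> (X k) x - \<pi> b x" for k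
        using X(1,3) xH by (simp add: minus_eq a_inv_smult p smult_simps scaleC_minus1)
      then have "norm (\<pi> (X k) x - \<pi> b x) \<le> 2 * cnorm A (X k \<ominus>\<^bsub>A\<^esub> b) * norm x" for k
        using representation_continuous[OF A \<pi> _ xH, of "X k \<ominus>\<^bsub>A\<^esub> b"] X(1,3) by simp
      then show "\<forall>\<^sub>F k in sequentially. norm (\<pi> (X k) x - \<pi> b x) \<le> 2 * cnorm A (X k \<ominus>\<^bsub>A\<^esub> b) * norm x"
        by simp
      show "(\<lambda>k. 2 * cnorm A (X k \<ominus>\<^bsub>A\<^esub> b) * norm x) \<longlonglongrightarrow> 0"
        using tendsto_mult[OF tendsto_mult[OF tendsto_const[of 2] X(4)] tendsto_const[of "norm x"]] by simp
    qed
    then show "(\<lambda>k. \<pi> (X k) x) \<longlonglongrightarrow> \<pi> b x" by (simp add: LIM_zero_iff)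
  qed
  note Ks = hilbert_subspaceD[OF K(1)]
  have KH: "x \<in> H" if "x \<in> K" for x using that K by auto
  have star1: "cstar A \<one>\<^bsub>A\<^esub> = \<one>\<^bsub>A\<^esub>"
  proof -
    have "cstar A (cstar A \<one>\<^bsub>A\<^esub> \<otimes>\<^bsub>A\<^esub> \<one>\<^bsub>A\<^esub>) = cstar A \<one>\<^bsub>A\<^esub> \<otimes>\<^bsub>A\<^esub> cstar A (cstar A \<one>\<^bsub>A\<^esub>)"
      by (rule star_mult) (simp_all add: star_closed)
    then show ?thesis by (simp add: star_closed star_star)
  qed
  have "unital_cstar_subalgebra A ?S"
    unfolding unital_cstar_subalgebra_def
  proof (intro conjI)
    show "\<one>\<^bsub>A\<^esub> \<in> ?S" using KH by (simp add: star1 p)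
    show "\<forall>a\<in>?S. \<forall>b\<in>?S. a \<oplus>\<^bsub>A\<^esub> b \<in> ?S \<and> a \<otimes>\<^bsub>A\<^esub> b \<in> ?S"
      using KH by (auto simp: star_add star_mult star_closed p(3,4) Ks(4))
    show "\<forall>c. \<forall>a\<in>?S. c \<odot>\<^bsub>A\<^esub> a \<in> ?S"
      using KH by (auto simp: star_smult star_closed p(6) Ks(7) smult_simps(1))
    show "\<forall>a\<in>?S. cstar A a \<in> ?S" by (auto simp: star_closed star_star)
    show "\<forall>X b. range X \<subseteq> ?S \<and> b \<in> carrier A \<and> (\<lambda>p. cnorm A (X p \<ominus>\<^bsub>A\<^esub> b)) \<longlonglongrightarrow> 0 \<longrightarrow> b \<in> ?S"
    proof (intro allI impI, elim conjE)
      fix X b assume X: "range X \<subseteq> ?S" and b: "b \<in> carrier A" and l: "(\<lambda>p. cnorm A (X p \<ominus>\<^bsub>A\<^esub> b)) \<longlonglongrightarrow> 0"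
      have Xs: "X k \<in> carrier A" "\<And>x. x \<in> K \<Longrightarrow> \<pi> (X k) x \<in> K" "\<And>x. x \<in> K \<Longrightarrow> \<pi> (cstar A (X k)) x \<in> K" for k
        using X by auto
      have "cnorm A (cstar A (X k) \<ominus>\<^bsub>A\<^esub> cstar A b) = cnorm A (X k \<ominus>\<^bsub>A\<^esub> b)" for k
        using norm_star[of "X k \<ominus>\<^bsub>A\<^esub> b"] star_minus[of "X k" b] Xs(1) b by simp
      then have l': "(\<lambda>p. cnorm A (cstar A (X p) \<ominus>\<^bsub>A\<^esub> cstar A b)) \<longlonglongrightarrow> 0" using l by simp
      show "b \<in> ?S"
        using lim[OF Xs(1) Xs(2) b l] lim[of "\<lambda>k. cstar A (X k)", OF star_closed[OF Xs(1)] Xs(3) star_closed[OF b] l'] b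
        by simp
    qed
  qed auto
  moreover have "G \<subseteq> ?S" using G inv inv_star by auto
  ultimately have "?S = carrier A" by (rule gen)
  then show ?thesis using a x by blast
qed

section \<open>Isometries from equal Gram matrices\<close>

text \<open>A relation rather than a map, since a vector may be a combination of the
  \<open>x i\<close> in many ways. That the relation is single-valued is a consequence of the Gram
  condition, obtained in \<open>gram_rel_unique\<close> after closing up.\<close>

definition gram_rel0 :: "'i set \<Rightarrow> ('i \<Rightarrow> 'h::chilbert_space) \<Rightarrow> ('i \<Rightarrow> 'k::chilbert_space) \<Rightarrow> 'h \<Rightarrow> 'k \<Rightarrow> bool" where
  "gram_rel0 I x y u w \<longleftrightarrow>
    (\<exists>t r. finite t \<and> t \<subseteq> I \<and> u = (\<Sum>i\<in>t. r i *\<^sub>C x i) \<and> w = (\<Sum>i\<in>t. r i *\<^sub>C y i))"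

definition gram_rel :: "'i set \<Rightarrow> ('i \<Rightarrow> 'h::chilbert_space) \<Rightarrow> ('i \<Rightarrow> 'k::chilbert_space) \<Rightarrow> 'h \<Rightarrow> 'k \<Rightarrow> bool" where
  "gram_rel I x y u w \<longleftrightarrow> (\<exists>X W. (\<forall>n. gram_rel0 I x y (X n) (W n)) \<and> X \<longlonglongrightarrow> u \<and> W \<longlonglongrightarrow> w)"

lemma gram_rel0_sym: "gram_rel0 I x y u w \<longleftrightarrow> gram_rel0 I y x w u"
  unfolding gram_rel0_def by blast

lemma gram_rel_sym: "gram_rel I x y u w \<longleftrightarrow> gram_rel I y x w u"
  unfolding gram_rel_def using gram_rel0_sym by blast

lemma gram_rel0_span: "gram_rel0 I x y u w \<Longrightarrow> u \<in> cspan (x ` I)"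
  unfolding gram_rel0_def
  by (auto intro!: cvec.span_sum cvec.span_scale intro: cvec.span_base)

lemma gram_rel_clspan:
  assumes "gram_rel I x y u w"
  shows "u \<in> clspan (x ` I)"
proof -
  obtain X W where X: "\<And>n. gram_rel0 I x y (X n) (W n)" "X \<longlonglongrightarrow> u"
    using assms unfolding gram_rel_def by blast
  have "X n \<in> clspan (x ` I)" for n
    using gram_rel0_span[OF X(1)] closure_subset unfolding clspan_def by blast
  then show ?thesis using hilbert_subspace_tendsto[OF hilbert_subspace_clspan X(2)] by blast
qed

lemma gram_rel0_total:
  assumes "u \<in> cspan (x ` I)"
  shows "\<exists>w. gram_rel0 I x y u w"
proof -
  obtain t r where t: "finite t" "t \<subseteq> x ` I" "u = (\<Sum>a\<in>t. r a *\<^sub>C a)"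
    using assms unfolding cvec.span_explicit by blast
  \<comment> \<open>The family may repeat vectors, so one index is chosen for each vector that
    occurs.\<close>
  let ?s = "inv_into I x"
  have inj: "inj_on ?s t" using inj_on_inv_into[OF t(2)] .
  have xs: "x (?s a) = a" if "a \<in> t" for a
    by (rule f_inv_into_f) (use t(2) that in blast)
  have "u = (\<Sum>a\<in>t. r (x (?s a)) *\<^sub>C x (?s a))"
    unfolding t(3) by (rule sum.cong) (simp_all add: xs)
  also have "\<dots> = (\<Sum>i\<in>?s ` t. r (x i) *\<^sub>C x i)" using inj by (simp add: sum.reindex)
  finally have "u = (\<Sum>i\<in>?s ` t. r (x i) *\<^sub>C x i)" .
  moreover have "?s ` t \<subseteq> I" using inv_into_into[of _ x I] t(2) by blast
  ultimately show ?thesis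
    unfolding gram_rel0_def
    by (intro exI[of _ "\<Sum>i\<in>?s ` t. r (x i) *\<^sub>C y i"] exI[of _ "?s ` t"] exI[of _ "\<lambda>i. r (x i)"])
      (simp add: t(1))
qed

context
  fixes I :: "'i set" and x :: "'i \<Rightarrow> 'h::chilbert_space" and y :: "'i \<Rightarrow> 'k::chilbert_space"
  assumes gram: "\<And>i j. i \<in> I \<Longrightarrow> j \<in> I \<Longrightarrow> cinner (x i) (x j) = cinner (y i) (y j)"
begin

lemma gram_rel0_cinner:
  assumes "gram_rel0 I x y u w" "gram_rel0 I x y u' w'"
  shows "cinner u u' = cinner w w'"
proof -
  obtain t r where t: "t \<subseteq> I" "u = (\<Sum>i\<in>t. r i *\<^sub>C x i)" "w = (\<Sum>i\<in>t. r i *\<^sub>C y i)"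
    using assms(1) unfolding gram_rel0_def by blast
  obtain t' r' where t': "t' \<subseteq> I" "u' = (\<Sum>i\<in>t'. r' i *\<^sub>C x i)" "w' = (\<Sum>i\<in>t'. r' i *\<^sub>C y i)"
    using assms(2) unfolding gram_rel0_def by blast
  show ?thesis
    unfolding t t' cinner_sum_left cinner_sum_right cinner_scaleC_left cinner_scaleC_right
    using t(1) t'(1) by (intro sum.cong refl) (auto simp: gram subset_eq)
qed

lemma gram_rel_cinner:
  assumes "gram_rel I x y u w" "gram_rel I x y u' w'"
  shows "cinner u u' = cinner w w'"
proof -
  obtain X W where X: "\<And>n. gram_rel0 I x y (X n) (W n)" "X \<longlonglongrightarrow> u" "W \<longlonglongrightarrow> w"
    using assms(1) unfolding gram_rel_def by blast
  obtain X' W' where X': "\<And>n. gram_rel0 I x y (X' n) (W' n)" "X' \<longlonglongrightarrow> u'" "W' \<longlonglongrightarrow> w'"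
    using assms(2) unfolding gram_rel_def by blast
  have "(\<lambda>n. cinner (X n) (X' n)) \<longlonglongrightarrow> cinner u u'" by (rule tendsto_cinner[OF X(2) X'(2)])
  moreover have "(\<lambda>n. cinner (X n) (X' n)) \<longlonglongrightarrow> cinner w w'"
    using tendsto_cinner[OF X(3) X'(3)] by (simp add: gram_rel0_cinner[OF X(1) X'(1)])
  ultimately show ?thesis by (rule LIMSEQ_unique)
qed

lemma gram_rel_total:
  assumes "u \<in> clspan (x ` I)"
  shows "\<exists>w. gram_rel I x y u w"
proof -
  obtain X where X: "\<And>n. X n \<in> cspan (x ` I)" "X \<longlonglongrightarrow> u"
    using assms unfolding clspan_def closure_sequential by blast
  have "\<forall>n. \<exists>w. gram_rel0 I x y (X n) w" using gram_rel0_total[OF X(1)] by blast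
  then obtain W where W: "\<And>n. gram_rel0 I x y (X n) (W n)" by metis
  have dist: "norm (W p - W q) = norm (X p - X q)" for p q
    by (rule norm_eq_of_cinner_eq)
      (simp add: cinner_diff_left cinner_diff_right gram_rel0_cinner[OF W W])
  have "Cauchy X" using X(2) by (simp add: LIMSEQ_imp_Cauchy)
  then have "Cauchy W" unfolding Cauchy_def dist_norm dist .
  then obtain w where "W \<longlonglongrightarrow> w" using Cauchy_convergent convergent_def by blast
  then show ?thesis unfolding gram_rel_def using X(2) W by blast
qed

lemma gram_rel_unique:
  assumes "gram_rel I x y u w" "gram_rel I x y u w'"
  shows "w = w'"
proof -
  have "cinner (w - w') (w - w') = 0"
    unfolding cinner_diff_left cinner_diff_right
    using gram_rel_cinner[OF assms(1) assms(1)] gram_rel_cinner[OF assms(1) assms(2)]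
      gram_rel_cinner[OF assms(2) assms(1)] gram_rel_cinner[OF assms(2) assms(2)] by simp
  then show ?thesis by (simp add: cinner_self_eq_0)
qed

text \<open>Equal Gram matrices make the correspondence of finite combinations isometric, so it
  extends to the closures. This produces both the embeddings \<open>J k\<close> and the final
  unitary.\<close>

lemma gram_isometry:
  obtains U where "blin (clspan (x ` I)) (clspan (y ` I)) U"
    "\<And>i. i \<in> I \<Longrightarrow> U (x i) = y i"
    "\<And>u v. u \<in> clspan (x ` I) \<Longrightarrow> v \<in> clspan (x ` I) \<Longrightarrow> cinner (U u) (U v) = cinner u v"
    "U ` clspan (x ` I) = clspan (y ` I)"
proof -
  define U where "U u = (SOME w. gram_rel I x y u w)" for u
  note Hs = hilbert_subspaceD[OF hilbert_subspace_clspan[of "x ` I"]]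
  have U: "gram_rel I x y u (U u)" if "u \<in> clspan (x ` I)" for u
    unfolding U_def using gram_rel_total[OF that] by (rule someI_ex)
  have inner: "cinner (U u) (U v) = cinner u v" if "u \<in> clspan (x ` I)" "v \<in> clspan (x ` I)" for u v
    using gram_rel_cinner[OF U[OF that(1)] U[OF that(2)]] by simp
  have mem: "U u \<in> clspan (y ` I)" if "u \<in> clspan (x ` I)" for u
    using gram_rel_clspan[of I y x "U u" u] U[OF that] gram_rel_sym[of I x y] by blast
  have b: "blin (clspan (x ` I)) (clspan (y ` I)) U"
  proof (rule blinI[OF mem])
    fix u v assume uv: "u \<in> clspan (x ` I)" "v \<in> clspan (x ` I)"
    note s = Hs(4)[OF uv]
    \<comment> \<open>Additivity needs no return to combinations: the squared norm of the defect
      expands into inner products that \<open>U\<close> preserves, and there the defect is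
      \<open>u + v - u - v\<close>.\<close>
    have "cinner (U (u + v) - U u - U v) (U (u + v) - U u - U v) = 0"
      unfolding cinner_diff_left cinner_diff_right inner[OF uv] inner[OF uv(2,1)] inner[OF uv(1,1)]
        inner[OF uv(2,2)] inner[OF s s] inner[OF s uv(1)] inner[OF s uv(2)] inner[OF uv(1) s] inner[OF uv(2) s]
      by (simp add: cinner_add_left cinner_add_right)
    then have "U (u + v) - U u - U v = 0" by (simp only: cinner_self_eq_0)
    then show "U (u + v) = U u + U v" by (simp add: algebra_simps)
  next
    fix c u assume u: "u \<in> clspan (x ` I)"
    note s = Hs(7)[OF u, of c]
    have "cinner (U (c *\<^sub>C u) - c *\<^sub>C U u) (U (c *\<^sub>C u) - c *\<^sub>C U u) = 0"
      unfolding cinner_diff_left cinner_diff_right cinner_scaleC_left cinner_scaleC_right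
        inner[OF s s] inner[OF s u] inner[OF u s] inner[OF u u] by simp
    then show "U (c *\<^sub>C u) = c *\<^sub>C U u" by (simp add: cinner_self_eq_0)
  next
    show "norm (U u) \<le> 1 * norm u" if "u \<in> clspan (x ` I)" for u
      using norm_eq_of_cinner_eq[OF inner[OF that that]] by simp
  qed
  have gen: "U (x i) = y i" if "i \<in> I" for i
  proof (rule gram_rel_unique[OF U])
    show "x i \<in> clspan (x ` I)" using clspan_superset[of "x ` I"] that by blast
    have "gram_rel0 I x y (x i) (y i)"
      unfolding gram_rel0_def using that
      by (intro exI[of _ "{i}"] exI[of _ "\<lambda>_. 1"]) (simp add: scaleC_one)
    then show "gram_rel I x y (x i) (y i)"
      unfolding gram_rel_def by (intro exI[of _ "\<lambda>_. x i"] exI[of _ "\<lambda>_. y i"]) simp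
  qed
  show ?thesis
  proof (rule that[OF b gen inner])
    have "w \<in> U ` clspan (x ` I)" if w: "w \<in> clspan (y ` I)" for w
    proof -
      \<comment> \<open>Surjectivity is totality of the reversed relation; Cauchy sequences transfer
        back because the relation is isometric in both directions.\<close>
      have "\<exists>u. gram_rel I y x w u"
      proof -
        obtain X where X: "\<And>n. X n \<in> cspan (y ` I)" "X \<longlonglongrightarrow> w"
          using w unfolding clspan_def closure_sequential by blast
        have "\<forall>n. \<exists>u. gram_rel0 I y x (X n) u" using gram_rel0_total[OF X(1)] by blast
        then obtain W where W: "\<And>n. gram_rel0 I y x (X n) (W n)" by metis
        have W': "gram_rel0 I x y (W n) (X n)" for n using W gram_rel0_sym by blast
        have dist: "norm (W p - W q) = norm (X p - X q)" for p q
          by (rule norm_eq_of_cinner_eq)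
            (simp add: cinner_diff_left cinner_diff_right gram_rel0_cinner[OF W' W'])
        have "Cauchy X" using X(2) by (simp add: LIMSEQ_imp_Cauchy)
        then have "Cauchy W" unfolding Cauchy_def dist_norm dist .
        then obtain u where "W \<longlonglongrightarrow> u" using Cauchy_convergent convergent_def by blast
        then show ?thesis unfolding gram_rel_def using X(2) W by blast
      qed
      then obtain u where u: "gram_rel I x y u w" using gram_rel_sym by blast
      note uc = gram_rel_clspan[OF u]
      have "U u = w" by (rule gram_rel_unique[OF U[OF uc] u])
      then show ?thesis using uc by blast
    qed
    then show "U ` clspan (x ` I) = clspan (y ` I)" using mem by auto
  qed auto
qed

end

section \<open>The tensor product with \<open>\<ell>\<^sup>2(\<nat>)\<close>\<close>

definition ell2_at :: "nat \<Rightarrow> 'h::chilbert_space \<Rightarrow> 'h ell2" where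
  "ell2_at k x = elem_tensor x (basis_ell2 k)"

lemma ell2_nth_at: "ell2_nth (ell2_at k x) m = (if m = k then x else 0)"
  by (simp add: ell2_at_def elem_tensor.rep_eq basis_ell2.rep_eq scaleC_one)

lemmas ell2_nth_simps = zero_ell2.rep_eq plus_ell2.rep_eq uminus_ell2.rep_eq minus_ell2.rep_eq
  scaleC_ell2.rep_eq elem_tensor.rep_eq

lemma cinner_ell2_at: "cinner (ell2_at k x) (ell2_at l y) = (if k = l then cinner x y else 0)"
proof -
  have "cinner (basis_ell2 k) (basis_ell2 l) = (if k = l then 1 else 0)"
  proof -
    have "(\<lambda>m. cinner (ell2_nth (basis_ell2 k) m) (ell2_nth (basis_ell2 l) m)) sums
        (\<Sum>m\<in>{k}. cinner (ell2_nth (basis_ell2 k) m) (ell2_nth (basis_ell2 l) m))"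
      by (rule sums_finite) (auto simp: basis_ell2.rep_eq)
    then show ?thesis
      unfolding cinner_ell2_def by (simp add: sums_iff basis_ell2.rep_eq cinner_complex_def)
  qed
  then show ?thesis by (simp add: ell2_at_def cinner_elem_tensor)
qed

lemma ell2_nth_sum: "ell2_nth (sum f S) m = (\<Sum>i\<in>S. ell2_nth (f i) m)"
  by (induction S rule: infinite_finite_induct) (simp_all add: ell2_nth_simps)

text \<open>The squared distance is a tail of the convergent series for
  \<open>norm \<xi>^2\<close>.\<close>

lemma ell2_partial_sums: "(\<lambda>p. \<Sum>k<p. ell2_at k (ell2_nth \<xi> k)) \<longlonglongrightarrow> \<xi>"
proof -
  let ?s = "\<lambda>p. \<Sum>k<p. ell2_at k (ell2_nth \<xi> k)"
  let ?f = "\<lambda>m. (norm (ell2_nth \<xi> m))\<^sup>2"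
  have nth: "ell2_nth (\<xi> - ?s p) m = (if m < p then 0 else ell2_nth \<xi> m)" for p m
    by (simp add: ell2_nth_simps ell2_nth_sum ell2_nth_at if_distrib[of "\<lambda>u. _ - u"])
  have sq: "(norm (\<xi> - ?s p))\<^sup>2 = (\<Sum>m. ?f (m + p))" for p
  proof -
    have "(norm (\<xi> - ?s p))\<^sup>2 = (\<Sum>m. (norm (ell2_nth (\<xi> - ?s p) m))\<^sup>2)" by (rule norm_ell2_sq)
    also have "\<dots> = (\<Sum>m. (norm (ell2_nth (\<xi> - ?s p) (m + p)))\<^sup>2)
        + (\<Sum>m<p. (norm (ell2_nth (\<xi> - ?s p) m))\<^sup>2)"
      by (rule suminf_split_initial_segment[OF summable_ell2])
    also have "(\<Sum>m<p. (norm (ell2_nth (\<xi> - ?s p) m))\<^sup>2) = 0"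
      by (intro sum.neutral) (simp add: nth)
    finally show ?thesis by (simp add: nth)
  qed
  have "(\<lambda>p. \<Sum>m. ?f (m + p)) \<longlonglongrightarrow> 0"
  proof -
    have "(\<lambda>p. suminf ?f - sum ?f {..<p}) \<longlonglongrightarrow> suminf ?f - suminf ?f"
      by (intro tendsto_diff tendsto_const summable_LIMSEQ summable_ell2)
    moreover have "suminf ?f - sum ?f {..<p} = (\<Sum>m. ?f (m + p))" for p
      using suminf_minus_initial_segment[OF summable_ell2[of \<xi>], of p] by simp
    ultimately show ?thesis by simp
  qed
  then have "(\<lambda>p. sqrt ((norm (\<xi> - ?s p))\<^sup>2)) \<longlonglongrightarrow> sqrt 0"
    unfolding sq by (rule tendsto_real_sqrt)
  then have "(\<lambda>p. norm (?s p - \<xi>)) \<longlonglongrightarrow> 0" by (simp add: norm_minus_commute)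
  then show ?thesis by (simp add: tendsto_norm_zero_iff LIM_zero_iff)
qed

lemma hilbert_subspace_coordinates:
  assumes "hilbert_subspace H"
  shows "hilbert_subspace {\<xi>. \<forall>m. ell2_nth \<xi> m \<in> H}"
proof -
  note Hs = hilbert_subspaceD[OF assms]
  have b: "blin (UNIV :: 'a ell2 set) UNIV (\<lambda>\<xi>. ell2_nth \<xi> m)" for m
    by (rule blinI[where B = 1]) (simp_all add: ell2_nth_simps norm_ell2_nth_le)
  have "closed {\<xi>. ell2_nth \<xi> m \<in> H}" for m
    using hilbert_subspaceD(1)[OF blin_preimage_hilbert[OF b hilbert_subspace_UNIV assms]] by simp
  then have "closed {\<xi>. \<forall>m. ell2_nth \<xi> m \<in> H}" by (rule closed_Collect_all)
  moreover have "csubspace {\<xi>. \<forall>m. ell2_nth \<xi> m \<in> H}"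
    unfolding cvec.subspace_def by (simp add: ell2_nth_simps Hs(3,4,7))
  ultimately show ?thesis by (simp add: hilbert_subspace_def)
qed

lemma tensor_ell2_conv_clspan: "tensor_ell2 H = clspan {elem_tensor x f | x f. x \<in> H}"
  by (simp add: tensor_ell2_def clspan_def)

lemma hilbert_subspace_tensor_ell2: "hilbert_subspace (tensor_ell2 H)"
  by (simp add: tensor_ell2_conv_clspan hilbert_subspace_clspan)

context
  fixes H :: "'h::chilbert_space set"
  assumes H: "hilbert_subspace H"
begin

text \<open>The closure of the elementary tensors, the closed span of the
  \<open>x \<otimes> e_k\<close> and the space of sequences with all entries in \<open>H\<close>
  coincide by a cycle of inclusions. The second description serves to build unitaries, the third to
  define operators by coordinates.\<close>

lemma tensor_ell2_at: "tensor_ell2 H = clspan ((\<lambda>(k, x). ell2_at k x) ` (UNIV \<times> H))"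
  and tensor_ell2_nth: "tensor_ell2 H = {\<xi>. \<forall>m. ell2_nth \<xi> m \<in> H}"
proof -
  let ?C = "clspan ((\<lambda>(k, x). ell2_at k x) ` (UNIV \<times> H))" and ?N = "{\<xi>. \<forall>m. ell2_nth \<xi> m \<in> H}"
  have 1: "tensor_ell2 H \<subseteq> ?N"
    unfolding tensor_ell2_conv_clspan
    by (rule clspan_minimal[OF _ hilbert_subspace_coordinates[OF H]])
      (auto simp: ell2_nth_simps hilbert_subspaceD(7)[OF H])
  have 2: "?N \<subseteq> ?C"
  proof
    fix \<xi> assume \<xi>: "\<xi> \<in> ?N"
    have "ell2_at k (ell2_nth \<xi> k) \<in> (\<lambda>(k, x). ell2_at k x) ` (UNIV \<times> H)" for k
      using \<xi> by (intro image_eqI[of _ _ "(k, ell2_nth \<xi> k)"]) auto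
    then have "ell2_at k (ell2_nth \<xi> k) \<in> ?C" for k using clspan_superset by blast
    then have "(\<Sum>k<p. ell2_at k (ell2_nth \<xi> k)) \<in> ?C" for p
      by (intro hilbert_subspaceD(8)[OF hilbert_subspace_clspan])
    then show "\<xi> \<in> ?C"
      using hilbert_subspace_tendsto[OF hilbert_subspace_clspan ell2_partial_sums] by blast
  qed
  have "(\<lambda>(k, x). ell2_at k x) ` (UNIV \<times> H) \<subseteq> {elem_tensor x f | x f. x \<in> H}"
    by (auto simp: ell2_at_def)
  then have "(\<lambda>(k, x). ell2_at k x) ` (UNIV \<times> H) \<subseteq> tensor_ell2 H"
    using clspan_superset[of "{elem_tensor x f | x f. x \<in> H}"] unfolding tensor_ell2_conv_clspan
    by (rule subset_trans)
  then have 3: "?C \<subseteq> tensor_ell2 H"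
    by (rule clspan_minimal[OF _ hilbert_subspace_tensor_ell2])
  show "tensor_ell2 H = ?C" "tensor_ell2 H = ?N" using 1 2 3 by auto
qed

lemma ell2_at_tensor: "x \<in> H \<Longrightarrow> ell2_at k x \<in> tensor_ell2 H"
  by (simp add: tensor_ell2_nth ell2_nth_at hilbert_subspaceD(3)[OF H])

lemma tensor_ell2_eqI:
  assumes "blin (tensor_ell2 H) K T" "blin (tensor_ell2 H) L R"
    "\<And>k x. x \<in> H \<Longrightarrow> T (ell2_at k x) = R (ell2_at k x)" "\<xi> \<in> tensor_ell2 H"
  shows "T \<xi> = R \<xi>"
proof (rule clspan_blin_eqI[of "(\<lambda>(k, x). ell2_at k x) ` (UNIV \<times> H)" K T L R])
  show "T \<xi> = R \<xi>" if "\<xi> \<in> (\<lambda>(k, x). ell2_at k x) ` (UNIV \<times> H)" for \<xi>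
    using that assms(3) by auto
qed (use assms(1,2,4) in \<open>simp_all only: tensor_ell2_at\<close>)

lemma op_tensor_eqI:
  assumes R: "R \<in> bounded_ops (tensor_ell2 H)"
    and eq: "\<And>x f. x \<in> H \<Longrightarrow> R (elem_tensor x f) = elem_tensor (T x) (V f)"
  shows "op_tensor H T V = R"
  unfolding op_tensor_def
proof (rule the_equality)
  fix R' assume R': "R' \<in> bounded_ops (tensor_ell2 H)
      \<and> (\<forall>x\<in>H. \<forall>f. R' (elem_tensor x f) = elem_tensor (T x) (V f))"
  show "R' = R"
  proof (rule bounded_ops_eqI)
    fix \<xi> assume "\<xi> \<in> tensor_ell2 H"
    moreover have "R' \<eta> = R \<eta>" if "\<eta> \<in> {elem_tensor x f | x f. x \<in> H}" for \<eta>
      using that R' eq by auto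
    moreover have "blin (tensor_ell2 H) (tensor_ell2 H) R'" "blin (tensor_ell2 H) (tensor_ell2 H) R"
      using R R' bounded_ops_blin by auto
    ultimately show "R' \<xi> = R \<xi>"
      unfolding tensor_ell2_conv_clspan
      using clspan_blin_eqI[of "{elem_tensor x f | x f. x \<in> H}" _ R' _ R \<xi>] by blast
  qed (use R R' in auto)
qed (use R eq in auto)

end

text \<open>Every \<open>\<psi>(z\<^sub>i\<^sub>j)\<close> permutes the basis vectors partially, so \<open>T \<otimes> \<psi>(z\<^sub>i\<^sub>j)\<close> acts by applying \<open>T\<close> to each
  coordinate and moving the coordinates along a partial injection.\<close>

definition reindex :: "(nat \<Rightarrow> nat option) \<Rightarrow> (nat \<Rightarrow> 'h) \<Rightarrow> nat \<Rightarrow> 'h::zero" where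
  "reindex \<sigma> f m = (case \<sigma> m of None \<Rightarrow> 0 | Some k \<Rightarrow> f k)"

text \<open>Injectivity on the domain turns a partial sum of the moved series into a sum over
  distinct terms of the original one, and the terms are nonnegative.\<close>

lemma reindex_summable:
  assumes inj: "inj_on \<sigma> (dom \<sigma>)" and f: "summable f" "\<And>m. (f m :: real) \<ge> 0"
  shows "summable (reindex \<sigma> f)" "suminf (reindex \<sigma> f) \<le> suminf f"
proof -
  have le: "sum (reindex \<sigma> f) {..<M} \<le> suminf f" for M
  proof -
    let ?D = "{..<M} \<inter> dom \<sigma>"
    have "sum (reindex \<sigma> f) {..<M} = sum (reindex \<sigma> f) ?D"
      by (rule sum.mono_neutral_right) (auto simp: reindex_def split: option.splits)
    also have "\<dots> = (\<Sum>m\<in>?D. f (the (\<sigma> m)))"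
      by (rule sum.cong) (auto simp: reindex_def)
    also have "\<dots> = sum f ((\<lambda>m. the (\<sigma> m)) ` ?D)"
    proof (rule sum.reindex[symmetric, unfolded comp_def])
      show "inj_on (\<lambda>m. the (\<sigma> m)) ?D"
      proof (rule inj_onI)
        fix a b assume ab: "a \<in> ?D" "b \<in> ?D" "the (\<sigma> a) = the (\<sigma> b)"
        then have "\<sigma> a = \<sigma> b" by (auto simp: dom_def)
        then show "a = b" using inj ab by (auto dest: inj_onD)
      qed
    qed
    also have "\<dots> \<le> suminf f" by (rule sum_le_suminf) (use f in auto)
    finally show ?thesis .
  qed
  have nn: "reindex \<sigma> f m \<ge> 0" for m using f(2) by (simp add: reindex_def split: option.split)
  show s: "summable (reindex \<sigma> f)"
  proof (rule bounded_imp_summable)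
    show "(\<Sum>k\<le>M. reindex \<sigma> f k) \<le> suminf f" for M using le[of "Suc M"] by (simp only: lessThan_Suc_atMost)
  qed (rule nn)
  show "suminf (reindex \<sigma> f) \<le> suminf f" by (rule suminf_le_const[OF s le])
qed

text \<open>\<open>Abs_ell2\<close> is meaningful for square-summable sequences only; boundedness of
  \<open>T\<close> and injectivity of \<sigma> guarantee this on
  \<open>tensor_ell2 H\<close>.\<close>

definition reindex_op :: "(nat \<Rightarrow> nat option) \<Rightarrow> ('h \<Rightarrow> 'h) \<Rightarrow> 'h ell2 \<Rightarrow> 'h::chilbert_space ell2" where
  "reindex_op \<sigma> T \<xi> = Abs_ell2 (reindex \<sigma> (\<lambda>m. T (ell2_nth \<xi> m)))"

context
  fixes H :: "'h::chilbert_space set" and T :: "'h \<Rightarrow> 'h" and \<sigma> :: "nat \<Rightarrow> nat option"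
  assumes H: "hilbert_subspace H" and T: "blin H H T" and \<sigma>: "inj_on \<sigma> (dom \<sigma>)"
begin

lemma reindex_op_summable:
  assumes B: "B > 0" "\<And>x. x \<in> H \<Longrightarrow> norm (T x) \<le> B * norm x" and \<xi>: "\<xi> \<in> tensor_ell2 H"
  shows "summable (\<lambda>m. (norm (reindex \<sigma> (\<lambda>m. T (ell2_nth \<xi> m)) m))\<^sup>2)"
    "(\<Sum>m. (norm (reindex \<sigma> (\<lambda>m. T (ell2_nth \<xi> m)) m))\<^sup>2) \<le> (B * norm \<xi>)\<^sup>2"
proof -
  let ?g = "\<lambda>m. (norm (T (ell2_nth \<xi> m)))\<^sup>2"
  have le: "?g m \<le> B\<^sup>2 * (norm (ell2_nth \<xi> m))\<^sup>2" for m
  proof -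
    have "?g m \<le> (B * norm (ell2_nth \<xi> m))\<^sup>2"
      using B \<xi> by (intro power_mono) (auto simp: tensor_ell2_nth[OF H])
    then show ?thesis by (simp add: power_mult_distrib)
  qed
  have s: "summable (\<lambda>m. B\<^sup>2 * (norm (ell2_nth \<xi> m))\<^sup>2)" by (intro summable_mult summable_ell2)
  have sg: "summable ?g" by (rule summable_comparison_test'[OF s]) (use le in auto)
  have eq: "(\<lambda>m. (norm (reindex \<sigma> (\<lambda>m. T (ell2_nth \<xi> m)) m))\<^sup>2) = reindex \<sigma> ?g"
    by (rule ext) (simp add: reindex_def split: option.split)
  show "summable (\<lambda>m. (norm (reindex \<sigma> (\<lambda>m. T (ell2_nth \<xi> m)) m))\<^sup>2)"
    unfolding eq by (rule reindex_summable[OF \<sigma> sg]) simp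
  have "suminf (reindex \<sigma> ?g) \<le> suminf ?g" by (rule reindex_summable[OF \<sigma> sg]) simp
  also have "\<dots> \<le> (\<Sum>m. B\<^sup>2 * (norm (ell2_nth \<xi> m))\<^sup>2)" by (rule suminf_le[OF le sg s])
  also have "\<dots> = (B * norm \<xi>)\<^sup>2"
    by (simp add: suminf_mult[OF summable_ell2] power_mult_distrib norm_ell2_sq)
  finally show "(\<Sum>m. (norm (reindex \<sigma> (\<lambda>m. T (ell2_nth \<xi> m)) m))\<^sup>2) \<le> (B * norm \<xi>)\<^sup>2"
    unfolding eq .
qed

lemma ell2_nth_reindex_op:
  assumes "\<xi> \<in> tensor_ell2 H"
  shows "ell2_nth (reindex_op \<sigma> T \<xi>) = reindex \<sigma> (\<lambda>m. T (ell2_nth \<xi> m))"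
proof -
  obtain B where B: "B > 0" "\<And>x. x \<in> H \<Longrightarrow> norm (T x) \<le> B * norm x" using blin_bound[OF T] by blast
  show ?thesis
    unfolding reindex_op_def
    by (rule Abs_ell2_inverse) (use reindex_op_summable(1)[OF B assms] in simp)
qed

lemma blin_reindex_op: "blin (tensor_ell2 H) (tensor_ell2 H) (reindex_op \<sigma> T)"
proof -
  obtain B where B: "B > 0" "\<And>x. x \<in> H \<Longrightarrow> norm (T x) \<le> B * norm x" using blin_bound[OF T] by blast
  note Ls = hilbert_subspaceD[OF hilbert_subspace_tensor_ell2[of H]]
  have nthH: "ell2_nth \<xi> m \<in> H" if "\<xi> \<in> tensor_ell2 H" for \<xi> m
    using that by (simp add: tensor_ell2_nth[OF H])
  show ?thesis
  proof (rule blinI)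
    show "reindex_op \<sigma> T \<xi> \<in> tensor_ell2 H" if "\<xi> \<in> tensor_ell2 H" for \<xi>
      using nthH[OF that] blinD(1)[OF T] hilbert_subspaceD(3)[OF H]
      by (simp add: tensor_ell2_nth[OF H] ell2_nth_reindex_op[OF that] reindex_def split: option.split)
    show "reindex_op \<sigma> T (\<xi> + \<eta>) = reindex_op \<sigma> T \<xi> + reindex_op \<sigma> T \<eta>"
      if "\<xi> \<in> tensor_ell2 H" "\<eta> \<in> tensor_ell2 H" for \<xi> \<eta>
      using that nthH blinD(2)[OF T]
      by (intro ell2_eqI) (simp add: ell2_nth_reindex_op Ls(4) ell2_nth_simps reindex_def split: option.split)
    show "reindex_op \<sigma> T (c *\<^sub>C \<xi>) = c *\<^sub>C reindex_op \<sigma> T \<xi>" if "\<xi> \<in> tensor_ell2 H" for c \<xi>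
      using that nthH blinD(3)[OF T]
      by (intro ell2_eqI) (simp add: ell2_nth_reindex_op Ls(7) ell2_nth_simps reindex_def split: option.split)
    show "norm (reindex_op \<sigma> T \<xi>) \<le> B * norm \<xi>" if "\<xi> \<in> tensor_ell2 H" for \<xi>
    proof (rule power2_le_imp_le)
      show "(norm (reindex_op \<sigma> T \<xi>))\<^sup>2 \<le> (B * norm \<xi>)\<^sup>2"
        unfolding norm_ell2_sq[of "reindex_op \<sigma> T \<xi>"] ell2_nth_reindex_op[OF that]
        by (rule reindex_op_summable(2)[OF B that])
    qed (use B in simp)
  qed
qed

end

lemma tensor_ell2_UNIV: "tensor_ell2 UNIV = UNIV"
  by (simp add: tensor_ell2_nth[OF hilbert_subspace_UNIV])

lemma reindex_op_elem_tensor: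
  assumes H: "hilbert_subspace H" and T: "blin H H T" and \<sigma>: "inj_on \<sigma> (dom \<sigma>)" and x: "x \<in> H"
  shows "reindex_op \<sigma> T (elem_tensor x f) = elem_tensor (T x) (reindex_op \<sigma> (\<lambda>u. u) f)"
proof (rule ell2_eqI)
  have t: "elem_tensor x f \<in> tensor_ell2 H"
    using x hilbert_subspaceD(7)[OF H] by (simp add: tensor_ell2_nth[OF H] ell2_nth_simps)
  show "ell2_nth (reindex_op \<sigma> T (elem_tensor x f)) m
      = ell2_nth (elem_tensor (T x) (reindex_op \<sigma> (\<lambda>u. u) f)) m" for m
    by (simp add: ell2_nth_simps ell2_nth_reindex_op[OF H T \<sigma> t]
        ell2_nth_reindex_op[OF hilbert_subspace_UNIV blin_id \<sigma>] tensor_ell2_UNIV reindex_def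
        blinD(3)[OF T x] split: option.split)
qed

lemma op_tensor_reindex:
  assumes H: "hilbert_subspace H" and T: "T \<in> bounded_ops H" and \<sigma>: "inj_on \<sigma> (dom \<sigma>)"
  shows "op_tensor H T (reindex_op \<sigma> (\<lambda>u. u)) = restrict (reindex_op \<sigma> T) (tensor_ell2 H)"
proof (rule op_tensor_eqI[OF H])
  note T' = bounded_ops_blin[OF T]
  show "restrict (reindex_op \<sigma> T) (tensor_ell2 H) \<in> bounded_ops (tensor_ell2 H)"
    by (intro restrict_bounded_ops blin_reindex_op[OF H T' \<sigma>] hilbert_subspaceD(2) hilbert_subspace_tensor_ell2)
  show "restrict (reindex_op \<sigma> T) (tensor_ell2 H) (elem_tensor x f) = elem_tensor (T x) (reindex_op \<sigma> (\<lambda>u. u) f)"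
    if "x \<in> H" for x f
    using that hilbert_subspaceD(7)[OF H that] reindex_op_elem_tensor[OF H T' \<sigma> that]
    by (simp add: tensor_ell2_nth[OF H] ell2_nth_simps)
qed

text \<open>\<sigma> is read backwards: it tells from which coordinate position \<open>m\<close> is
  filled. Hence a vector at \<open>k\<close> moves to the position that \<sigma> sends to
  \<open>Some k\<close>, which injectivity makes unique, or it disappears.\<close>

lemma reindex_op_at:
  assumes H: "hilbert_subspace H" and T: "blin H H T" and \<sigma>: "inj_on \<sigma> (dom \<sigma>)" and x: "x \<in> H"
  shows "\<sigma> m = Some k \<Longrightarrow> reindex_op \<sigma> T (ell2_at k x) = ell2_at m (T x)"
    "(\<And>m. \<sigma> m \<noteq> Some k) \<Longrightarrow> reindex_op \<sigma> T (ell2_at k x) = 0"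
proof -
  note nth = ell2_nth_reindex_op[OF H T \<sigma> ell2_at_tensor[OF H x]]
  note T0 = blin_zero[OF T hilbert_subspaceD(2)[OF H]]
  show "reindex_op \<sigma> T (ell2_at k x) = ell2_at m (T x)" if m: "\<sigma> m = Some k"
  proof (rule ell2_eqI)
    fix p
    have "\<sigma> p = Some k \<longleftrightarrow> p = m" using inj_onD[OF \<sigma>, of p m] m by (auto simp: dom_def)
    then show "ell2_nth (reindex_op \<sigma> T (ell2_at k x)) p = ell2_nth (ell2_at m (T x)) p"
      by (auto simp: nth reindex_def ell2_nth_at T0 m split: option.split)
  qed
  show "reindex_op \<sigma> T (ell2_at k x) = 0" if m: "\<And>m. \<sigma> m \<noteq> Some k"
    using m by (intro ell2_eqI) (auto simp: nth reindex_def ell2_nth_at ell2_nth_simps T0 split: option.split)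
qed

subsection \<open>The generators of \<open>\<psi>\<close>\<close>

text \<open>Because the index function names the source of a coordinate, the left shift, which
  lowers basis vectors, appears as the successor, and its adjoint as the predecessor with nothing
  flowing into position 0.\<close>

definition psi_index :: "nat \<Rightarrow> nat \<Rightarrow> nat \<Rightarrow> nat \<Rightarrow> nat option" where
  "psi_index r i j = (if i = r \<and> j = r then \<lambda>m. Some (Suc m)
     else if i = r + 1 \<and> j = r + 1 then (\<lambda>m. if m = 0 then None else Some (m - 1))
     else if i = r \<and> j = r + 1 \<or> i = r + 1 \<and> j = r then (\<lambda>m. if m = 0 then Some 0 else None)
     else if i = j then Some else (\<lambda>m. None))"

lemma inj_psi_index: "inj_on (psi_index r i j) (dom (psi_index r i j))"
  by (auto simp: psi_index_def inj_on_def dom_def split: if_splits)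

lemma ell2_nth_reindex_id:
  "inj_on \<sigma> (dom \<sigma>) \<Longrightarrow> ell2_nth (reindex_op \<sigma> (\<lambda>u. u) f) m = reindex \<sigma> (ell2_nth f) m"
  using ell2_nth_reindex_op[OF hilbert_subspace_UNIV blin_id, of \<sigma> f] by (simp add: tensor_ell2_UNIV)

lemma psi_gen_reindex: "psi_gen r i j = reindex_op (psi_index r i j) (\<lambda>u. u)"
proof -
  let ?U = "UNIV :: complex ell2 set"
  let ?R = "reindex_op (\<lambda>m. if m = 0 then None else Some (m - 1)) (\<lambda>u. u) :: complex ell2 \<Rightarrow> complex ell2"
  have "inj_on (\<lambda>m::nat. if m = 0 then None else Some (m - 1)) (dom (\<lambda>m. if m = 0 then None else Some (m - 1)))"
    by (auto simp: inj_on_def split: if_splits)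
  note injR = this
  have "inj_on (\<lambda>m::nat. Some (Suc m)) (dom (\<lambda>m. Some (Suc m)))" by (auto simp: inj_on_def)
  note injS = this
  have S: "shift_op = reindex_op (\<lambda>m. Some (Suc m)) (\<lambda>u. u)"
    by (rule ext, rule ell2_eqI) (simp add: shift_op.rep_eq ell2_nth_reindex_id[OF injS] reindex_def)
  have bo: "reindex_op \<sigma> (\<lambda>u. u) \<in> bounded_ops ?U" if "inj_on \<sigma> (dom \<sigma>)" for \<sigma>
    using blin_reindex_op[OF hilbert_subspace_UNIV blin_id that] by (simp add: bounded_ops_iff tensor_ell2_UNIV)
  have Sb: "shift_op \<in> bounded_ops ?U" unfolding S by (rule bo[OF injS])
  have Rb: "?R \<in> bounded_ops ?U" by (rule bo[OF injR])
  have adj: "adjoint_op ?U shift_op = ?R"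
  proof (rule adjoint_op_eqI[OF hilbert_subspace_UNIV Rb])
    fix f g :: "complex ell2"
    have nthR: "ell2_nth (?R g) m = (if m = 0 then 0 else ell2_nth g (m - 1))" for m
      by (simp add: ell2_nth_reindex_id[OF injR] reindex_def)
    \<comment> \<open>The split-off term vanishes, since the right shift puts 0 into position
      0.\<close>
    have "cinner f (?R g) = (\<Sum>m. cinner (ell2_nth f (Suc m)) (ell2_nth (?R g) (Suc m)))
        + cinner (ell2_nth f 0) (ell2_nth (?R g) 0)"
      using suminf_split_head[OF summable_ell2_cinner[of f "?R g"]] by (simp add: cinner_ell2_def)
    also have "\<dots> = cinner (shift_op f) g" by (simp add: nthR cinner_ell2_def shift_op.rep_eq)
    finally show "cinner (shift_op f) g = cinner f (?R g)" by simp
  qed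
  have inj0: "inj_on (\<lambda>m::nat. if m = 0 then Some (0::nat) else None) (dom (\<lambda>m. if m = 0 then Some 0 else None))"
    by (auto simp: inj_on_def split: if_splits)
  have P0: "\<one>\<^bsub>B_op ?U\<^esub> \<ominus>\<^bsub>B_op ?U\<^esub> (?R \<otimes>\<^bsub>B_op ?U\<^esub> shift_op)
      = reindex_op (\<lambda>m. if m = 0 then Some 0 else None) (\<lambda>u. u)"
  proof -
    have "\<one>\<^bsub>B_op ?U\<^esub> \<ominus>\<^bsub>B_op ?U\<^esub> (?R \<otimes>\<^bsub>B_op ?U\<^esub> shift_op) = (\<lambda>f. f - ?R (shift_op f))"
      using B_op_minus[OF hilbert_subspace_UNIV bounded_ops_intros(1)[OF hilbert_subspace_UNIV]
          bounded_ops_intros(3)[OF hilbert_subspace_UNIV Rb Sb]]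
      by (simp add: compose_def restrict_UNIV)
    also have "\<dots> = reindex_op (\<lambda>m. if m = 0 then Some 0 else None) (\<lambda>u. u)"
      by (rule ext, rule ell2_eqI)
        (simp add: ell2_nth_simps ell2_nth_reindex_id[OF injR] ell2_nth_reindex_id[OF inj0] reindex_def
          shift_op.rep_eq)
    finally show ?thesis .
  qed
  have id: "(\<lambda>f::complex ell2. f) = reindex_op Some (\<lambda>u. u)"
    by (rule ext, rule ell2_eqI) (simp add: ell2_nth_reindex_id reindex_def)
  have zero: "(\<lambda>f::complex ell2. 0) = reindex_op (\<lambda>m. None) (\<lambda>u. u)"
    by (rule ext, rule ell2_eqI) (simp add: ell2_nth_reindex_id reindex_def ell2_nth_simps)
  show ?thesis
    unfolding psi_gen_def Let_def B_op_simps(7) adj P0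
    unfolding B_op_simps(2,3) restrict_UNIV psi_index_def
    unfolding S[symmetric] if_distrib[of "\<lambda>\<sigma>. reindex_op \<sigma> (\<lambda>u. u)"] id[symmetric] zero[symmetric]
    by (rule refl)
qed

section \<open>The defining relations as identities between operators\<close>

text \<open>The ordered product evaluated at a vector. The factors are plain functions without
  restriction to \<open>H\<close>, so that relations can be applied inside as equations between
  vectors.\<close>

definition opprod :: "(nat \<Rightarrow> 'h \<Rightarrow> 'h) \<Rightarrow> nat \<Rightarrow> nat \<Rightarrow> 'h \<Rightarrow> 'h" where
  "opprod f a b x = foldr f [a..<b] x"

lemma opprod_empty: "b \<le> a \<Longrightarrow> opprod f a b x = x"
  by (simp add: opprod_def)

lemma opprod_first: "a < b \<Longrightarrow> opprod f a b x = f a (opprod f (Suc a) b x)"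
  by (simp add: opprod_def upt_conv_Cons)

lemma opprod_last: "a \<le> b \<Longrightarrow> opprod f a (Suc b) x = opprod f a b (f b x)"
  by (simp add: opprod_def)

lemma opprod_split: "a \<le> b \<Longrightarrow> b \<le> c \<Longrightarrow> opprod f a c x = opprod f a b (opprod f b c x)"
  using upt_add_eq_append[of a b "c - b"] by (simp add: opprod_def)

lemma opprod_cong:
  assumes "\<And>t x. a \<le> t \<Longrightarrow> t < b \<Longrightarrow> x \<in> H \<Longrightarrow> f t x = g t x"
    "\<And>t x. a \<le> t \<Longrightarrow> t < b \<Longrightarrow> x \<in> H \<Longrightarrow> g t x \<in> H" "x \<in> H"
  shows "opprod f a b x = opprod g a b x \<and> opprod g a b x \<in> H"
  using assms
proof (induction b arbitrary: x)
  case (Suc b)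
  show ?case
  proof (cases "a \<le> b")
    case True
    have "opprod f a b (g b x) = opprod g a b (g b x) \<and> opprod g a b (g b x) \<in> H"
      using Suc.prems True by (intro Suc.IH) auto
    then show ?thesis using Suc.prems True by (simp add: opprod_last)
  qed (use Suc.prems in \<open>simp add: opprod_empty\<close>)
qed (simp add: opprod_empty)

lemma ordprod_B_op:
  assumes H: "hilbert_subspace H" and f: "\<And>t. a \<le> t \<Longrightarrow> t < b \<Longrightarrow> f t \<in> bounded_ops H"
  shows "ordprod (B_op H) f a b \<in> bounded_ops H \<and> (\<forall>x\<in>H. ordprod (B_op H) f a b x = opprod f a b x)"
proof -
  have "set l \<subseteq> {a..<b} \<Longrightarrow> foldr (\<lambda>t x. f t \<otimes>\<^bsub>B_op H\<^esub> x) l \<one>\<^bsub>B_op H\<^esub> \<in> bounded_ops H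
      \<and> (\<forall>x\<in>H. foldr (\<lambda>t x. f t \<otimes>\<^bsub>B_op H\<^esub> x) l \<one>\<^bsub>B_op H\<^esub> x = foldr f l x)" for l
  proof (induction l)
    case Nil
    have "foldr (\<lambda>t x. f t \<otimes>\<^bsub>B_op H\<^esub> x) [] \<one>\<^bsub>B_op H\<^esub> \<in> bounded_ops H"
      unfolding foldr.simps id_apply B_op_simps by (rule bounded_ops_intros(1)[OF H])
    moreover have "\<forall>x\<in>H. foldr (\<lambda>t x. f t \<otimes>\<^bsub>B_op H\<^esub> x) [] \<one>\<^bsub>B_op H\<^esub> x = foldr f [] x" by simp
    ultimately show ?case by blast
  next
    case (Cons t l)
    then show ?case using bounded_ops_intros(3)[OF H f[of t]] by (simp add: compose_apply)
  qed
  from this[of "[a..<b]"] show ?thesis by (simp add: ordprod_def opprod_def)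
qed

text \<open>The defining relations evaluated at vectors: products become nested applications, and
  the commutator relation is solved for one of its products, which avoids subtraction in the
  operator algebra.\<close>

locale SU0_ops =
  fixes n :: nat and H :: "'h::chilbert_space set" and Z :: "nat \<Rightarrow> nat \<Rightarrow> 'h \<Rightarrow> 'h"
  assumes H: "hilbert_subspace H"
    and Zb: "\<lbrakk>i \<in> {1..n+1}; j \<in> {1..n+1}\<rbrakk> \<Longrightarrow> Z i j \<in> bounded_ops H"
    and row: "\<lbrakk>i \<in> {1..n+1}; j \<in> {1..n+1}; l \<in> {1..n+1}; j < l; x \<in> H\<rbrakk> \<Longrightarrow> Z i j (Z i l x) = 0"
    and col: "\<lbrakk>i \<in> {1..n+1}; k \<in> {1..n+1}; j \<in> {1..n+1}; i < k; x \<in> H\<rbrakk> \<Longrightarrow> Z i j (Z k j x) = 0"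
    and anti_comm: "\<lbrakk>i \<in> {1..n+1}; k \<in> {1..n+1}; j \<in> {1..n+1}; l \<in> {1..n+1}; i < k; j < l; x \<in> H\<rbrakk>
      \<Longrightarrow> Z i l (Z k j x) = Z k j (Z i l x)"
    and anti_zero: "\<lbrakk>i \<in> {1..n+1}; k \<in> {1..n+1}; j \<in> {1..n+1}; l \<in> {1..n+1}; i < k; j < l;
        min k l \<le> max i j; x \<in> H\<rbrakk> \<Longrightarrow> Z i l (Z k j x) = 0"
    and diag_next: "\<lbrakk>i \<in> {1..n+1}; k \<in> {1..n+1}; j \<in> {1..n+1}; l \<in> {1..n+1}; i < k; j < l;
        max i j + 1 = min k l; x \<in> H\<rbrakk> \<Longrightarrow> Z i j (Z k l x) = Z k l (Z i j x) + Z i l (Z k j x)"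
    and diag_comm: "\<lbrakk>i \<in> {1..n+1}; k \<in> {1..n+1}; j \<in> {1..n+1}; l \<in> {1..n+1}; i < k; j < l;
        max i j + 1 < min k l; x \<in> H\<rbrakk> \<Longrightarrow> Z i j (Z k l x) = Z k l (Z i j x)"
    and det: "x \<in> H \<Longrightarrow> opprod (\<lambda>t. Z t t) 1 (n+2) x = x"
    and star_comm: "\<lbrakk>i \<in> {1..n+1}; j \<in> {1..n+1}; r \<in> {1..n+1}; s \<in> {1..n+1}; i \<noteq> r; j \<noteq> s; x \<in> H\<rbrakk>
      \<Longrightarrow> Z i j (adjoint_op H (Z r s) x) = adjoint_op H (Z r s) (Z i j x)"
    and star_lower: "\<lbrakk>r \<in> {1..n+1}; s \<in> {1..n+1}; s < r; x \<in> H\<rbrakk> \<Longrightarrow> adjoint_op H (Z r s) x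
      = opprod (\<lambda>t. Z t t) 1 s (opprod (\<lambda>t. Z t (t+1)) s r (opprod (\<lambda>t. Z t t) (r+1) (n+2) x))"
    and star_upper: "\<lbrakk>r \<in> {1..n+1}; s \<in> {1..n+1}; r < s; x \<in> H\<rbrakk> \<Longrightarrow> adjoint_op H (Z r s) x
      = opprod (\<lambda>t. Z t t) 1 r (opprod (\<lambda>t. Z (t+1) t) r s (opprod (\<lambda>t. Z t t) (s+1) (n+2) x))"
    and star_diag: "\<lbrakk>r \<in> {1..n+1}; x \<in> H\<rbrakk> \<Longrightarrow> adjoint_op H (Z r r) x
      = opprod (\<lambda>t. Z t t) 1 r (opprod (\<lambda>t. Z t t) (r+1) (n+2) x)"

context
  fixes n :: nat and A :: "'a cstar_struct" and z :: "nat \<Rightarrow> nat \<Rightarrow> 'a"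
begin

lemma SU0_relationsD:
  assumes "SU0_relations n A z"
  shows "\<And>i j. i \<in> {1..n+1} \<Longrightarrow> j \<in> {1..n+1} \<Longrightarrow> z i j \<in> carrier A"
    "\<And>i j l. i \<in> {1..n+1} \<Longrightarrow> j \<in> {1..n+1} \<Longrightarrow> l \<in> {1..n+1} \<Longrightarrow> j < l \<Longrightarrow> z i j \<otimes>\<^bsub>A\<^esub> z i l = \<zero>\<^bsub>A\<^esub>"
    "\<And>i k j. i \<in> {1..n+1} \<Longrightarrow> k \<in> {1..n+1} \<Longrightarrow> j \<in> {1..n+1} \<Longrightarrow> i < k \<Longrightarrow> z i j \<otimes>\<^bsub>A\<^esub> z k j = \<zero>\<^bsub>A\<^esub>"
    "\<And>i k j l. i \<in> {1..n+1} \<Longrightarrow> k \<in> {1..n+1} \<Longrightarrow> j \<in> {1..n+1} \<Longrightarrow> l \<in> {1..n+1} \<Longrightarrow> i < k \<Longrightarrow> j < l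
      \<Longrightarrow> z i l \<otimes>\<^bsub>A\<^esub> z k j = z k j \<otimes>\<^bsub>A\<^esub> z i l"
    "\<And>i k j l. i \<in> {1..n+1} \<Longrightarrow> k \<in> {1..n+1} \<Longrightarrow> j \<in> {1..n+1} \<Longrightarrow> l \<in> {1..n+1} \<Longrightarrow> i < k \<Longrightarrow> j < l
      \<Longrightarrow> min k l \<le> max i j \<Longrightarrow> z i l \<otimes>\<^bsub>A\<^esub> z k j = \<zero>\<^bsub>A\<^esub>"
    "\<And>i k j l. i \<in> {1..n+1} \<Longrightarrow> k \<in> {1..n+1} \<Longrightarrow> j \<in> {1..n+1} \<Longrightarrow> l \<in> {1..n+1} \<Longrightarrow> i < k \<Longrightarrow> j < l
      \<Longrightarrow> max i j + 1 = min k l \<Longrightarrow> z i j \<otimes>\<^bsub>A\<^esub> z k l \<ominus>\<^bsub>A\<^esub> z k l \<otimes>\<^bsub>A\<^esub> z i j = z i l \<otimes>\<^bsub>A\<^esub> z k j"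
    "\<And>i k j l. i \<in> {1..n+1} \<Longrightarrow> k \<in> {1..n+1} \<Longrightarrow> j \<in> {1..n+1} \<Longrightarrow> l \<in> {1..n+1} \<Longrightarrow> i < k \<Longrightarrow> j < l
      \<Longrightarrow> max i j + 1 < min k l \<Longrightarrow> z i j \<otimes>\<^bsub>A\<^esub> z k l = z k l \<otimes>\<^bsub>A\<^esub> z i j"
    "ordprod A (\<lambda>t. z t t) 1 (n+2) = \<one>\<^bsub>A\<^esub>"
    "\<And>i j r s. i \<in> {1..n+1} \<Longrightarrow> j \<in> {1..n+1} \<Longrightarrow> r \<in> {1..n+1} \<Longrightarrow> s \<in> {1..n+1} \<Longrightarrow> i \<noteq> r \<Longrightarrow> j \<noteq> s
      \<Longrightarrow> z i j \<otimes>\<^bsub>A\<^esub> cstar A (z r s) = cstar A (z r s) \<otimes>\<^bsub>A\<^esub> z i j"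
    "\<And>r s. r \<in> {1..n+1} \<Longrightarrow> s \<in> {1..n+1} \<Longrightarrow> s < r \<Longrightarrow> cstar A (z r s) = ordprod A (\<lambda>t. z t t) 1 s
      \<otimes>\<^bsub>A\<^esub> ordprod A (\<lambda>t. z t (t+1)) s r \<otimes>\<^bsub>A\<^esub> ordprod A (\<lambda>t. z t t) (r+1) (n+2)"
    "\<And>r s. r \<in> {1..n+1} \<Longrightarrow> s \<in> {1..n+1} \<Longrightarrow> r < s \<Longrightarrow> cstar A (z r s) = ordprod A (\<lambda>t. z t t) 1 r
      \<otimes>\<^bsub>A\<^esub> ordprod A (\<lambda>t. z (t+1) t) r s \<otimes>\<^bsub>A\<^esub> ordprod A (\<lambda>t. z t t) (s+1) (n+2)"
    "\<And>r. r \<in> {1..n+1} \<Longrightarrow> cstar A (z r r) = ordprod A (\<lambda>t. z t t) 1 r \<otimes>\<^bsub>A\<^esub> ordprod A (\<lambda>t. z t t) (r+1) (n+2)"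
proof -
  note c = assms[unfolded SU0_relations_def Let_def]
  note c1 = c[THEN conjunct1] and d1 = c[THEN conjunct2]
  note c2 = d1[THEN conjunct1] and d2 = d1[THEN conjunct2]
  note c3 = d2[THEN conjunct1] and d3 = d2[THEN conjunct2]
  note c4 = d3[THEN conjunct1]
  show "z i j \<in> carrier A" if "i \<in> {1..n+1}" "j \<in> {1..n+1}" for i j
    using c1 that by blast
  show "z i j \<otimes>\<^bsub>A\<^esub> z i l = \<zero>\<^bsub>A\<^esub>"
    if "i \<in> {1..n+1}" "j \<in> {1..n+1}" "l \<in> {1..n+1}" "j < l" for i j l
    using c2 that by blast
  show "z i j \<otimes>\<^bsub>A\<^esub> z k j = \<zero>\<^bsub>A\<^esub>"
    if "i \<in> {1..n+1}" "k \<in> {1..n+1}" "j \<in> {1..n+1}" "i < k" for i k j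
    using c3 that by blast
  fix i k j l assume i: "i \<in> {1..n+1}" and k: "k \<in> {1..n+1}" and j: "j \<in> {1..n+1}" and l: "l \<in> {1..n+1}"
  {
    assume lt: "i < k" "j < l"
    note e = c4[THEN bspec, OF i, THEN bspec, OF k, THEN bspec, OF j, THEN bspec, OF l, THEN mp, OF conjI[OF lt]]
    show "z i l \<otimes>\<^bsub>A\<^esub> z k j = z k j \<otimes>\<^bsub>A\<^esub> z i l" using e by blast
    show "z i l \<otimes>\<^bsub>A\<^esub> z k j = \<zero>\<^bsub>A\<^esub>" if "min k l \<le> max i j" using e that by blast
    show "z i j \<otimes>\<^bsub>A\<^esub> z k l \<ominus>\<^bsub>A\<^esub> z k l \<otimes>\<^bsub>A\<^esub> z i j = z i l \<otimes>\<^bsub>A\<^esub> z k j"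
      if "max i j + 1 = min k l" using e that by blast
    show "z i j \<otimes>\<^bsub>A\<^esub> z k l = z k l \<otimes>\<^bsub>A\<^esub> z i j" if "max i j + 1 < min k l"
      using e that by blast
  }
next
  note c = assms[unfolded SU0_relations_def Let_def]
  note d4 = c[THEN conjunct2, THEN conjunct2, THEN conjunct2, THEN conjunct2]
  note d5 = d4[THEN conjunct2]
  show "ordprod A (\<lambda>t. z t t) 1 (n+2) = \<one>\<^bsub>A\<^esub>" by (rule d4[THEN conjunct1])
  show "z i j \<otimes>\<^bsub>A\<^esub> cstar A (z r s) = cstar A (z r s) \<otimes>\<^bsub>A\<^esub> z i j"
    if "i \<in> {1..n+1}" "j \<in> {1..n+1}" "r \<in> {1..n+1}" "s \<in> {1..n+1}" "i \<noteq> r" "j \<noteq> s" for i j r s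
    using d5[THEN conjunct1] that by blast
  note c7 = d5[THEN conjunct2]
  fix r s assume r: "r \<in> {1..n+1}" and s: "s \<in> {1..n+1}"
  note e = c7[THEN bspec, OF r, THEN bspec, OF s]
  show "cstar A (z r s) = ordprod A (\<lambda>t. z t t) 1 s
      \<otimes>\<^bsub>A\<^esub> ordprod A (\<lambda>t. z t (t+1)) s r \<otimes>\<^bsub>A\<^esub> ordprod A (\<lambda>t. z t t) (r+1) (n+2)" if "s < r"
    using e that by blast
  show "cstar A (z r s) = ordprod A (\<lambda>t. z t t) 1 r
      \<otimes>\<^bsub>A\<^esub> ordprod A (\<lambda>t. z (t+1) t) r s \<otimes>\<^bsub>A\<^esub> ordprod A (\<lambda>t. z t t) (s+1) (n+2)" if "r < s"
    using e that by blast
next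
  note c = assms[unfolded SU0_relations_def Let_def]
  note c7 = c[THEN conjunct2, THEN conjunct2, THEN conjunct2, THEN conjunct2, THEN conjunct2, THEN conjunct2]
  fix r assume r: "r \<in> {1..n+1}"
  show "cstar A (z r r) = ordprod A (\<lambda>t. z t t) 1 r \<otimes>\<^bsub>A\<^esub> ordprod A (\<lambda>t. z t t) (r+1) (n+2)"
    using c7[THEN bspec, OF r, THEN bspec, OF r] by blast
qed

lemma SU0_relationsI:
  assumes "\<And>i j. i \<in> {1..n+1} \<Longrightarrow> j \<in> {1..n+1} \<Longrightarrow> z i j \<in> carrier A"
    "\<And>i j l. i \<in> {1..n+1} \<Longrightarrow> j \<in> {1..n+1} \<Longrightarrow> l \<in> {1..n+1} \<Longrightarrow> j < l \<Longrightarrow> z i j \<otimes>\<^bsub>A\<^esub> z i l = \<zero>\<^bsub>A\<^esub>"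
    "\<And>i k j. i \<in> {1..n+1} \<Longrightarrow> k \<in> {1..n+1} \<Longrightarrow> j \<in> {1..n+1} \<Longrightarrow> i < k \<Longrightarrow> z i j \<otimes>\<^bsub>A\<^esub> z k j = \<zero>\<^bsub>A\<^esub>"
    "\<And>i k j l. i \<in> {1..n+1} \<Longrightarrow> k \<in> {1..n+1} \<Longrightarrow> j \<in> {1..n+1} \<Longrightarrow> l \<in> {1..n+1} \<Longrightarrow> i < k \<Longrightarrow> j < l
      \<Longrightarrow> z i l \<otimes>\<^bsub>A\<^esub> z k j = z k j \<otimes>\<^bsub>A\<^esub> z i l"
    "\<And>i k j l. i \<in> {1..n+1} \<Longrightarrow> k \<in> {1..n+1} \<Longrightarrow> j \<in> {1..n+1} \<Longrightarrow> l \<in> {1..n+1} \<Longrightarrow> i < k \<Longrightarrow> j < l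
      \<Longrightarrow> min k l \<le> max i j \<Longrightarrow> z i l \<otimes>\<^bsub>A\<^esub> z k j = \<zero>\<^bsub>A\<^esub>"
    "\<And>i k j l. i \<in> {1..n+1} \<Longrightarrow> k \<in> {1..n+1} \<Longrightarrow> j \<in> {1..n+1} \<Longrightarrow> l \<in> {1..n+1} \<Longrightarrow> i < k \<Longrightarrow> j < l
      \<Longrightarrow> max i j + 1 = min k l \<Longrightarrow> z i j \<otimes>\<^bsub>A\<^esub> z k l \<ominus>\<^bsub>A\<^esub> z k l \<otimes>\<^bsub>A\<^esub> z i j = z i l \<otimes>\<^bsub>A\<^esub> z k j"
    "\<And>i k j l. i \<in> {1..n+1} \<Longrightarrow> k \<in> {1..n+1} \<Longrightarrow> j \<in> {1..n+1} \<Longrightarrow> l \<in> {1..n+1} \<Longrightarrow> i < k \<Longrightarrow> j < l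
      \<Longrightarrow> max i j + 1 < min k l \<Longrightarrow> z i j \<otimes>\<^bsub>A\<^esub> z k l = z k l \<otimes>\<^bsub>A\<^esub> z i j"
    "ordprod A (\<lambda>t. z t t) 1 (n+2) = \<one>\<^bsub>A\<^esub>"
    "\<And>i j r s. i \<in> {1..n+1} \<Longrightarrow> j \<in> {1..n+1} \<Longrightarrow> r \<in> {1..n+1} \<Longrightarrow> s \<in> {1..n+1} \<Longrightarrow> i \<noteq> r \<Longrightarrow> j \<noteq> s
      \<Longrightarrow> z i j \<otimes>\<^bsub>A\<^esub> cstar A (z r s) = cstar A (z r s) \<otimes>\<^bsub>A\<^esub> z i j"
    "\<And>r s. r \<in> {1..n+1} \<Longrightarrow> s \<in> {1..n+1} \<Longrightarrow> s < r \<Longrightarrow> cstar A (z r s) = ordprod A (\<lambda>t. z t t) 1 s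
      \<otimes>\<^bsub>A\<^esub> ordprod A (\<lambda>t. z t (t+1)) s r \<otimes>\<^bsub>A\<^esub> ordprod A (\<lambda>t. z t t) (r+1) (n+2)"
    "\<And>r s. r \<in> {1..n+1} \<Longrightarrow> s \<in> {1..n+1} \<Longrightarrow> r < s \<Longrightarrow> cstar A (z r s) = ordprod A (\<lambda>t. z t t) 1 r
      \<otimes>\<^bsub>A\<^esub> ordprod A (\<lambda>t. z (t+1) t) r s \<otimes>\<^bsub>A\<^esub> ordprod A (\<lambda>t. z t t) (s+1) (n+2)"
    "\<And>r. r \<in> {1..n+1} \<Longrightarrow> cstar A (z r r) = ordprod A (\<lambda>t. z t t) 1 r \<otimes>\<^bsub>A\<^esub> ordprod A (\<lambda>t. z t t) (r+1) (n+2)"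
  shows "SU0_relations n A z"
  unfolding SU0_relations_def Let_def
  by (intro conjI ballI impI; (elim conjE)?; (hypsubst)?; rule assms; assumption)

end

text \<open>Members of \<open>bounded_ops H\<close> are extensional, so an operator identity is the
  same as its values on \<open>H\<close>. If some \<open>Z i j\<close> is not such an operator, both
  sides fail.\<close>

lemma SU0_relations_B_op:
  assumes H: "hilbert_subspace H"
  shows "SU0_relations n (B_op H) Z \<longleftrightarrow> SU0_ops n H Z"
proof (cases "\<forall>i\<in>{1..n+1}. \<forall>j\<in>{1..n+1}. Z i j \<in> bounded_ops H")
  case False
  then have "\<not> SU0_relations n (B_op H) Z" unfolding SU0_relations_def Let_def B_op_simps(1) by blast
  moreover have "\<not> SU0_ops n H Z" using False SU0_ops.Zb by blast
  ultimately show ?thesis by blast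
next
  case True
  let ?I = "{1..n+1}"
  have Zb: "Z i j \<in> bounded_ops H" if "i \<in> ?I" "j \<in> ?I" for i j using True that by blast
  have ab: "adjoint_op H (Z i j) \<in> bounded_ops H" if "i \<in> ?I" "j \<in> ?I" for i j
    by (rule adjoint_props(1)[OF H Zb[OF that]])
  note bi = bounded_ops_intros[OF H] and ext = bounded_ops_ext_iff[OF H]
  have zero: "compose H T R = (\<lambda>x\<in>H. 0) \<longleftrightarrow> (\<forall>x\<in>H. T (R x) = 0)"
    if "T \<in> bounded_ops H" "R \<in> bounded_ops H" for T R
    unfolding ext[OF bi(3)[OF that] bi(2)] by (simp add: compose_apply)
  have comm: "compose H T R = compose H T' R' \<longleftrightarrow> (\<forall>x\<in>H. T (R x) = T' (R' x))"
    if "T \<in> bounded_ops H" "R \<in> bounded_ops H" "T' \<in> bounded_ops H" "R' \<in> bounded_ops H" for T R T' R'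
    unfolding ext[OF bi(3)[OF that(1,2)] bi(3)[OF that(3,4)]] by (simp add: compose_apply)
  have cmt: "compose H T R \<ominus>\<^bsub>B_op H\<^esub> compose H R T = compose H T' R'
      \<longleftrightarrow> (\<forall>x\<in>H. T (R x) = R (T x) + T' (R' x))"
    if "T \<in> bounded_ops H" "R \<in> bounded_ops H" "T' \<in> bounded_ops H" "R' \<in> bounded_ops H" for T R T' R'
    unfolding B_op_minus[OF H bi(3)[OF that(1,2)] bi(3)[OF that(2,1)]]
      ext[OF bi(7)[OF bi(3)[OF that(1,2)] bi(3)[OF that(2,1)]] bi(3)[OF that(3,4)]]
    by (auto simp: compose_apply algebra_simps)
  let ?d = "\<lambda>t. Z t t" and ?u = "\<lambda>t. Z t (t+1)" and ?l = "\<lambda>t. Z (t+1) t"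
  have od: "ordprod (B_op H) ?d a b \<in> bounded_ops H"
    "\<And>x. x \<in> H \<Longrightarrow> ordprod (B_op H) ?d a b x = opprod ?d a b x" if "1 \<le> a" "b \<le> n+2" for a b
    using ordprod_B_op[OF H, of a b ?d] Zb that by auto
  have ou: "ordprod (B_op H) ?u a b \<in> bounded_ops H"
    "\<And>x. x \<in> H \<Longrightarrow> ordprod (B_op H) ?u a b x = opprod ?u a b x" if "1 \<le> a" "b \<le> n+1" for a b
    using ordprod_B_op[OF H, of a b ?u] Zb that by auto
  have ol: "ordprod (B_op H) ?l a b \<in> bounded_ops H"
    "\<And>x. x \<in> H \<Longrightarrow> ordprod (B_op H) ?l a b x = opprod ?l a b x" if "1 \<le> a" "b \<le> n+1" for a b
    using ordprod_B_op[OF H, of a b ?l] Zb that by auto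
  have r7: "ordprod (B_op H) ?d 1 (n+2) = \<one>\<^bsub>B_op H\<^esub> \<longleftrightarrow> (\<forall>x\<in>H. opprod ?d 1 (n+2) x = x)"
    unfolding B_op_simps using ext[OF od(1)[of 1 "n+2"] bi(1)] od(2)[of 1 "n+2"] by simp
  have p3: "T = compose H (compose H P Q) R \<longleftrightarrow> (\<forall>x\<in>H. T x = P (Q (R x)))"
    if "T \<in> bounded_ops H" "P \<in> bounded_ops H" "Q \<in> bounded_ops H" "R \<in> bounded_ops H" for T P Q R
    unfolding ext[OF that(1) bi(3)[OF bi(3)[OF that(2,3)] that(4)]]
    using that by (simp add: compose_apply bounded_ops_mem)
  have p2: "T = compose H P Q \<longleftrightarrow> (\<forall>x\<in>H. T x = P (Q x))"
    if "T \<in> bounded_ops H" "P \<in> bounded_ops H" "Q \<in> bounded_ops H" for T P Q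
    unfolding ext[OF that(1) bi(3)[OF that(2,3)]] using that by (simp add: compose_apply)
  have low: "adjoint_op H (Z r s) = compose H (compose H (ordprod (B_op H) ?d 1 s) (ordprod (B_op H) ?u s r))
        (ordprod (B_op H) ?d (r+1) (n+2))
      \<longleftrightarrow> (\<forall>x\<in>H. adjoint_op H (Z r s) x = opprod ?d 1 s (opprod ?u s r (opprod ?d (r+1) (n+2) x)))"
    if "r \<in> ?I" "s \<in> ?I" "s < r" for r s
  proof -
    note o = od[of 1 s] ou[of s r] od[of "r+1" "n+2"]
    have "opprod ?d (r+1) (n+2) x \<in> H" "opprod ?u s r y \<in> H" if "x \<in> H" "y \<in> H" for x y
      using bounded_ops_mem[OF od(1)[of "r+1" "n+2"] that(1)] od(2)[of "r+1" "n+2" x]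
        bounded_ops_mem[OF ou(1)[of s r] that(2)] ou(2)[of s r y] \<open>r \<in> ?I\<close> \<open>s \<in> ?I\<close> that by auto
    then show ?thesis using p3[OF ab[OF that(1,2)], of "ordprod (B_op H) ?d 1 s" "ordprod (B_op H) ?u s r"
          "ordprod (B_op H) ?d (r+1) (n+2)"] that o by simp
  qed
  have upp: "adjoint_op H (Z r s) = compose H (compose H (ordprod (B_op H) ?d 1 r) (ordprod (B_op H) ?l r s))
        (ordprod (B_op H) ?d (s+1) (n+2))
      \<longleftrightarrow> (\<forall>x\<in>H. adjoint_op H (Z r s) x = opprod ?d 1 r (opprod ?l r s (opprod ?d (s+1) (n+2) x)))"
    if "r \<in> ?I" "s \<in> ?I" "r < s" for r s
  proof -
    note o = od[of 1 r] ol[of r s] od[of "s+1" "n+2"]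
    have "opprod ?d (s+1) (n+2) x \<in> H" "opprod ?l r s y \<in> H" if "x \<in> H" "y \<in> H" for x y
      using bounded_ops_mem[OF od(1)[of "s+1" "n+2"] that(1)] od(2)[of "s+1" "n+2" x]
        bounded_ops_mem[OF ol(1)[of r s] that(2)] ol(2)[of r s y] \<open>r \<in> ?I\<close> \<open>s \<in> ?I\<close> that by auto
    then show ?thesis using p3[OF ab[OF that(1,2)], of "ordprod (B_op H) ?d 1 r" "ordprod (B_op H) ?l r s"
          "ordprod (B_op H) ?d (s+1) (n+2)"] that o by simp
  qed
  have dia: "adjoint_op H (Z r r) = compose H (ordprod (B_op H) ?d 1 r) (ordprod (B_op H) ?d (r+1) (n+2))
      \<longleftrightarrow> (\<forall>x\<in>H. adjoint_op H (Z r r) x = opprod ?d 1 r (opprod ?d (r+1) (n+2) x))"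
    if "r \<in> ?I" for r
  proof -
    note o = od[of 1 r] od[of "r+1" "n+2"]
    have "opprod ?d (r+1) (n+2) x \<in> H" if "x \<in> H" for x
      using bounded_ops_mem[OF od(1)[of "r+1" "n+2"] that] od(2)[of "r+1" "n+2" x] \<open>r \<in> ?I\<close> that by auto
    then show ?thesis using p2[OF ab[OF that that], of "ordprod (B_op H) ?d 1 r"
          "ordprod (B_op H) ?d (r+1) (n+2)"] that o by simp
  qed
  show ?thesis
  proof
    assume L: "SU0_relations n (B_op H) Z"
    note R = SU0_relationsD[OF L, unfolded B_op_simps(3,4,7)]
    show "SU0_ops n H Z"
    proof
      show "hilbert_subspace H" by (rule H)
      show "opprod (\<lambda>t. Z t t) 1 (n+2) x = x" if "x \<in> H" for x using R(8) r7 that by blast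
    next
      fix i j assume i: "i \<in> ?I" and j: "j \<in> ?I"
      show "Z i j \<in> bounded_ops H" by (rule Zb[OF i j])
      fix l assume l: "l \<in> ?I"
      show "Z i j (Z i l x) = 0" if "j < l" "x \<in> H" for x
        using R(2)[OF i j l that(1)] zero[OF Zb[OF i j] Zb[OF i l]] that by blast
    next
      fix i k j assume i: "i \<in> ?I" and k: "k \<in> ?I" and j: "j \<in> ?I"
      show "Z i j (Z k j x) = 0" if "i < k" "x \<in> H" for x
        using R(3)[OF i k j that(1)] zero[OF Zb[OF i j] Zb[OF k j]] that by blast
      fix l assume l: "l \<in> ?I" assume lt: "i < k" "j < l"
      show "Z i l (Z k j x) = Z k j (Z i l x)" if "x \<in> H" for x
        using R(4)[OF i k j l lt] comm[OF Zb[OF i l] Zb[OF k j] Zb[OF k j] Zb[OF i l]] that by blast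
      show "Z i l (Z k j x) = 0" if "min k l \<le> max i j" "x \<in> H" for x
        using R(5)[OF i k j l lt that(1)] zero[OF Zb[OF i l] Zb[OF k j]] that by blast
      show "Z i j (Z k l x) = Z k l (Z i j x) + Z i l (Z k j x)" if "max i j + 1 = min k l" "x \<in> H" for x
        using R(6)[OF i k j l lt that(1)] cmt[OF Zb[OF i j] Zb[OF k l] Zb[OF i l] Zb[OF k j]] that by blast
      show "Z i j (Z k l x) = Z k l (Z i j x)" if "max i j + 1 < min k l" "x \<in> H" for x
        using R(7)[OF i k j l lt that(1)] comm[OF Zb[OF i j] Zb[OF k l] Zb[OF k l] Zb[OF i j]] that by blast
    next
      fix i j r s x assume i: "i \<in> ?I" and j: "j \<in> ?I" and r: "r \<in> ?I" and s: "s \<in> ?I"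
        and ne: "i \<noteq> r" "j \<noteq> s" and x: "x \<in> H"
      show "Z i j (adjoint_op H (Z r s) x) = adjoint_op H (Z r s) (Z i j x)"
        using R(9)[OF i j r s ne] comm[OF Zb[OF i j] ab[OF r s] ab[OF r s] Zb[OF i j]] x by blast
    next
      fix r s x assume r: "r \<in> ?I" and s: "s \<in> ?I" and x: "x \<in> H"
      show "adjoint_op H (Z r s) x = opprod ?d 1 s (opprod ?u s r (opprod ?d (r+1) (n+2) x))" if "s < r"
        using R(10)[OF r s that] low[OF r s that] x by blast
      show "adjoint_op H (Z r s) x = opprod ?d 1 r (opprod ?l r s (opprod ?d (s+1) (n+2) x))" if "r < s"
        using R(11)[OF r s that] upp[OF r s that] x by blast
      show "adjoint_op H (Z r r) x = opprod ?d 1 r (opprod ?d (r+1) (n+2) x)"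
        using R(12)[OF r] dia[OF r] x by blast
    qed
  next
    assume "SU0_ops n H Z"
    then interpret SU0_ops n H Z .
    show "SU0_relations n (B_op H) Z"
    proof (rule SU0_relationsI; (unfold B_op_simps(1,3,4,7))?)
      show "ordprod (B_op H) ?d 1 (n+2) = \<one>\<^bsub>B_op H\<^esub>" using r7 det by blast
    next
      fix i j assume i: "i \<in> ?I" and j: "j \<in> ?I"
      show "Z i j \<in> bounded_ops H" by (rule Zb[OF i j])
      fix l assume l: "l \<in> ?I"
      show "compose H (Z i j) (Z i l) = (\<lambda>x\<in>H. 0)" if "j < l"
        using row[OF i j l that] zero[OF Zb[OF i j] Zb[OF i l]] by blast
    next
      fix i k j assume i: "i \<in> ?I" and k: "k \<in> ?I" and j: "j \<in> ?I"
      show "compose H (Z i j) (Z k j) = (\<lambda>x\<in>H. 0)" if "i < k"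
        using col[OF i k j that(1)] zero[OF Zb[OF i j] Zb[OF k j]] by blast
      fix l assume l: "l \<in> ?I" assume lt: "i < k" "j < l"
      show "compose H (Z i l) (Z k j) = compose H (Z k j) (Z i l)"
        using anti_comm[OF i k j l lt] comm[OF Zb[OF i l] Zb[OF k j] Zb[OF k j] Zb[OF i l]] by blast
      show "compose H (Z i l) (Z k j) = (\<lambda>x\<in>H. 0)" if "min k l \<le> max i j"
        using anti_zero[OF i k j l lt that(1)] zero[OF Zb[OF i l] Zb[OF k j]] by blast
      show "compose H (Z i j) (Z k l) \<ominus>\<^bsub>B_op H\<^esub> compose H (Z k l) (Z i j) = compose H (Z i l) (Z k j)"
        if "max i j + 1 = min k l"
        using diag_next[OF i k j l lt that(1)] cmt[OF Zb[OF i j] Zb[OF k l] Zb[OF i l] Zb[OF k j]] by blast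
      show "compose H (Z i j) (Z k l) = compose H (Z k l) (Z i j)" if "max i j + 1 < min k l"
        using diag_comm[OF i k j l lt that(1)] comm[OF Zb[OF i j] Zb[OF k l] Zb[OF k l] Zb[OF i j]] by blast
    next
      fix i j r s assume i: "i \<in> ?I" and j: "j \<in> ?I" and r: "r \<in> ?I" and s: "s \<in> ?I"
        and ne: "i \<noteq> r" "j \<noteq> s"
      show "compose H (Z i j) (adjoint_op H (Z r s)) = compose H (adjoint_op H (Z r s)) (Z i j)"
        using star_comm[OF i j r s ne] comm[OF Zb[OF i j] ab[OF r s] ab[OF r s] Zb[OF i j]] by blast
    next
      fix r s assume r: "r \<in> ?I" and s: "s \<in> ?I"
      show "adjoint_op H (Z r s) = compose H (compose H (ordprod (B_op H) ?d 1 s) (ordprod (B_op H) ?u s r))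
        (ordprod (B_op H) ?d (r+1) (n+2))" if "s < r"
        using star_lower[OF r s that] low[OF r s that] by blast
      show "adjoint_op H (Z r s) = compose H (compose H (ordprod (B_op H) ?d 1 r) (ordprod (B_op H) ?l r s))
        (ordprod (B_op H) ?d (s+1) (n+2))" if "r < s"
        using star_upper[OF r s that] upp[OF r s that] by blast
    next
      fix r assume r: "r \<in> ?I"
      show "adjoint_op H (Z r r) = compose H (ordprod (B_op H) ?d 1 r) (ordprod (B_op H) ?d (r+1) (n+2))"
        using star_diag[OF r] dia[OF r] by blast
    qed
  qed
qed

lemma SU0_relations_hom:
  assumes A: "unital_cstar_algebra A" and B: "unital_cstar_algebra B" and \<phi>: "unital_star_hom A B \<phi>"
    and rel: "SU0_relations n A z"
  shows "SU0_relations n B (\<lambda>i j. \<phi> (z i j))"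
proof -
  interpret A: unital_cstar_algebra A by (rule A)
  interpret B: unital_cstar_algebra B by (rule B)
  have h: "\<phi> \<in> ring_hom A B" and st: "\<And>x. x \<in> carrier A \<Longrightarrow> \<phi> (cstar A x) = cstar B (\<phi> x)"
    using \<phi> by (auto simp: unital_star_hom_def)
  have sm: "\<phi> (c \<odot>\<^bsub>A\<^esub> x) = c \<odot>\<^bsub>B\<^esub> \<phi> x" if "x \<in> carrier A" for c x
    using \<phi> that by (simp add: unital_star_hom_def)
  note hs [simp] = ring_hom_closed[OF h] ring_hom_mult[OF h] ring_hom_add[OF h] ring_hom_one[OF h]
  have inv [simp]: "\<phi> (\<ominus>\<^bsub>A\<^esub> x) = \<ominus>\<^bsub>B\<^esub> \<phi> x" if "x \<in> carrier A" for x
    using that by (simp add: A.a_inv_smult B.a_inv_smult sm)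
  \<comment> \<open>Homomorphisms are specified by sums, products and the unit; zero is reached as
    the sum of the unit and its negative.\<close>
  have [simp]: "\<phi> \<zero>\<^bsub>A\<^esub> = \<zero>\<^bsub>B\<^esub>"
    using inv[of "\<one>\<^bsub>A\<^esub>"] hs(3)[of "\<one>\<^bsub>A\<^esub>" "\<ominus>\<^bsub>A\<^esub> \<one>\<^bsub>A\<^esub>"] by (simp add: A.r_neg B.r_neg)
  let ?I = "{1..n+1}"
  have zc: "z i j \<in> carrier A" if "i \<in> ?I" "j \<in> ?I" for i j
    by (rule SU0_relationsD(1)[OF rel that])
  have minus: "\<phi> (x \<ominus>\<^bsub>A\<^esub> y) = \<phi> x \<ominus>\<^bsub>B\<^esub> \<phi> y" if "x \<in> carrier A" "y \<in> carrier A" for x y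
    using that by (simp add: A.minus_eq B.minus_eq)
  have ordp: "ordprod A f a b \<in> carrier A \<and> \<phi> (ordprod A f a b) = ordprod B (\<lambda>t. \<phi> (f t)) a b"
    if f: "\<And>t. a \<le> t \<Longrightarrow> t < b \<Longrightarrow> f t \<in> carrier A" for f a b
  proof -
    have "set l \<subseteq> {a..<b} \<Longrightarrow> foldr (\<lambda>t x. f t \<otimes>\<^bsub>A\<^esub> x) l \<one>\<^bsub>A\<^esub> \<in> carrier A
      \<and> \<phi> (foldr (\<lambda>t x. f t \<otimes>\<^bsub>A\<^esub> x) l \<one>\<^bsub>A\<^esub>) = foldr (\<lambda>t x. \<phi> (f t) \<otimes>\<^bsub>B\<^esub> x) l \<one>\<^bsub>B\<^esub>" for l
      by (induction l) (auto simp: f)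
    from this[of "[a..<b]"] show ?thesis by (simp add: ordprod_def)
  qed
  let ?d = "\<lambda>t. z t t" and ?u = "\<lambda>t. z t (t+1)" and ?l = "\<lambda>t. z (t+1) t"
  have od: "ordprod A ?d a b \<in> carrier A" "\<phi> (ordprod A ?d a b) = ordprod B (\<lambda>t. \<phi> (z t t)) a b"
    if "1 \<le> a" "b \<le> n+2" for a b using ordp[of a b ?d] zc that by auto
  have ou: "ordprod A ?u a b \<in> carrier A" "\<phi> (ordprod A ?u a b) = ordprod B (\<lambda>t. \<phi> (z t (t+1))) a b"
    if "1 \<le> a" "b \<le> n+1" for a b using ordp[of a b ?u] zc that by auto
  have ol: "ordprod A ?l a b \<in> carrier A" "\<phi> (ordprod A ?l a b) = ordprod B (\<lambda>t. \<phi> (z (t+1) t)) a b"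
    if "1 \<le> a" "b \<le> n+1" for a b using ordp[of a b ?l] zc that by auto
  have m: "\<phi> x \<otimes>\<^bsub>B\<^esub> \<phi> y = \<phi> (x \<otimes>\<^bsub>A\<^esub> y)" if "x \<in> carrier A" "y \<in> carrier A" for x y
    using that by simp
  note R = SU0_relationsD[OF rel]
  show ?thesis
  proof (rule SU0_relationsI)
    fix i j assume i: "i \<in> ?I" and j: "j \<in> ?I"
    show "\<phi> (z i j) \<in> carrier B" using zc[OF i j] by simp
    fix l assume l: "l \<in> ?I"
    show "\<phi> (z i j) \<otimes>\<^bsub>B\<^esub> \<phi> (z i l) = \<zero>\<^bsub>B\<^esub>" if "j < l"
      using R(2)[OF i j l that] zc i j l by (simp add: m del: hs)
  next
    fix i k j assume i: "i \<in> ?I" and k: "k \<in> ?I" and j: "j \<in> ?I"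
    show "\<phi> (z i j) \<otimes>\<^bsub>B\<^esub> \<phi> (z k j) = \<zero>\<^bsub>B\<^esub>" if "i < k"
      using R(3)[OF i k j that] zc i k j by (simp add: m del: hs)
    fix l assume l: "l \<in> ?I"
    assume lt: "i < k" "j < l"
    show "\<phi> (z i l) \<otimes>\<^bsub>B\<^esub> \<phi> (z k j) = \<phi> (z k j) \<otimes>\<^bsub>B\<^esub> \<phi> (z i l)"
      using R(4)[OF i k j l lt] zc i j k l by (simp add: m del: hs)
    show "\<phi> (z i l) \<otimes>\<^bsub>B\<^esub> \<phi> (z k j) = \<zero>\<^bsub>B\<^esub>" if "min k l \<le> max i j"
      using R(5)[OF i k j l lt that] zc i j k l by (simp add: m del: hs)
    show "\<phi> (z i j) \<otimes>\<^bsub>B\<^esub> \<phi> (z k l) \<ominus>\<^bsub>B\<^esub> \<phi> (z k l) \<otimes>\<^bsub>B\<^esub> \<phi> (z i j) = \<phi> (z i l) \<otimes>\<^bsub>B\<^esub> \<phi> (z k j)"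
      if mm: "max i j + 1 = min k l"
    proof -
      have "z i j \<otimes>\<^bsub>A\<^esub> z k l \<ominus>\<^bsub>A\<^esub> z k l \<otimes>\<^bsub>A\<^esub> z i j = z i l \<otimes>\<^bsub>A\<^esub> z k j" by (rule R(6)[OF i k j l lt mm])
      from arg_cong[OF this, of \<phi>] show ?thesis using zc i j k l by (simp add: minus)
    qed
    show "\<phi> (z i j) \<otimes>\<^bsub>B\<^esub> \<phi> (z k l) = \<phi> (z k l) \<otimes>\<^bsub>B\<^esub> \<phi> (z i j)" if "max i j + 1 < min k l"
      using R(7)[OF i k j l lt that] zc i j k l by (simp add: m del: hs)
  next
    have "\<phi> (ordprod A ?d 1 (n+2)) = \<phi> \<one>\<^bsub>A\<^esub>" by (simp only: R(8))
    then show "ordprod B (\<lambda>t. \<phi> (z t t)) 1 (n+2) = \<one>\<^bsub>B\<^esub>" using od(2)[of 1 "n+2"] by simp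
  next
    fix i j r s assume i: "i \<in> ?I" and j: "j \<in> ?I" and r: "r \<in> ?I" and s: "s \<in> ?I" and ne: "i \<noteq> r" "j \<noteq> s"
    have "z i j \<otimes>\<^bsub>A\<^esub> cstar A (z r s) = cstar A (z r s) \<otimes>\<^bsub>A\<^esub> z i j" by (rule R(9)[OF i j r s ne])
    from arg_cong[OF this, of \<phi>]
    show "\<phi> (z i j) \<otimes>\<^bsub>B\<^esub> cstar B (\<phi> (z r s)) = cstar B (\<phi> (z r s)) \<otimes>\<^bsub>B\<^esub> \<phi> (z i j)"
      using zc i j r s by (simp add: A.star_closed flip: st)
  next
    fix r s assume r: "r \<in> ?I" and s: "s \<in> ?I"
    show "cstar B (\<phi> (z r s)) = ordprod B (\<lambda>t. \<phi> (z t t)) 1 s \<otimes>\<^bsub>B\<^esub> ordprod B (\<lambda>t. \<phi> (z t (t + 1))) s r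
        \<otimes>\<^bsub>B\<^esub> ordprod B (\<lambda>t. \<phi> (z t t)) (r + 1) (n + 2)" if lt: "s < r"
    proof -
      have "cstar A (z r s) = ordprod A ?d 1 s \<otimes>\<^bsub>A\<^esub> ordprod A ?u s r \<otimes>\<^bsub>A\<^esub> ordprod A ?d (r+1) (n+2)"
        by (rule R(10)[OF r s lt])
      from arg_cong[OF this, of \<phi>] show ?thesis
        using zc[OF r s] r s od[of 1 s] ou[of s r] od[of "r+1" "n+2"] by (simp flip: st)
    qed
    show "cstar B (\<phi> (z r s)) = ordprod B (\<lambda>t. \<phi> (z t t)) 1 r \<otimes>\<^bsub>B\<^esub> ordprod B (\<lambda>t. \<phi> (z (t + 1) t)) r s
        \<otimes>\<^bsub>B\<^esub> ordprod B (\<lambda>t. \<phi> (z t t)) (s + 1) (n + 2)" if lt: "r < s"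
    proof -
      have "cstar A (z r s) = ordprod A ?d 1 r \<otimes>\<^bsub>A\<^esub> ordprod A ?l r s \<otimes>\<^bsub>A\<^esub> ordprod A ?d (s+1) (n+2)"
        by (rule R(11)[OF r s lt])
      from arg_cong[OF this, of \<phi>] show ?thesis
        using zc[OF r s] r s od[of 1 r] ol[of r s] od[of "s+1" "n+2"] by (simp flip: st)
    qed
  next
    fix r assume r: "r \<in> ?I"
    show "cstar B (\<phi> (z r r)) = ordprod B (\<lambda>t. \<phi> (z t t)) 1 r \<otimes>\<^bsub>B\<^esub> ordprod B (\<lambda>t. \<phi> (z t t)) (r + 1) (n + 2)"
      using arg_cong[OF R(12)[OF r], of \<phi>] zc[OF r r] r od[of 1 r] od[of "r+1" "n+2"] by (simp flip: st)
  qed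
qed

section \<open>Ordered products and adjoints of commuting operators\<close>

lemma opprod_mem:
  assumes "\<And>t x. a \<le> t \<Longrightarrow> t < b \<Longrightarrow> x \<in> H \<Longrightarrow> f t x \<in> H" "x \<in> H"
  shows "opprod f a b x \<in> H"
  by (rule opprod_cong[where H = H and f = f and g = f, THEN conjunct2]) (use assms in auto)

lemma opprod_commute:
  assumes "\<And>t x. a \<le> t \<Longrightarrow> t < b \<Longrightarrow> x \<in> H \<Longrightarrow> f t (g x) = g (f t x)"
    "\<And>t x. a \<le> t \<Longrightarrow> t < b \<Longrightarrow> x \<in> H \<Longrightarrow> f t x \<in> H" "x \<in> H"
  shows "opprod f a b (g x) = g (opprod f a b x)"
  using assms
proof (induction b arbitrary: x)
  case (Suc b)
  show ?case
  proof (cases "a \<le> b")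
    case True
    have "opprod f a b (g (f b x)) = g (opprod f a b (f b x))"
      using Suc.prems True by (intro Suc.IH) auto
    then show ?thesis using Suc.prems True by (simp add: opprod_last)
  qed (simp add: opprod_empty)
qed (simp add: opprod_empty)

lemma blin_opprod:
  assumes "\<And>t. a \<le> t \<Longrightarrow> t < b \<Longrightarrow> blin H H (f t)"
  shows "blin H H (opprod f a b)"
  using assms
proof (induction b)
  case (Suc b)
  show ?case
  proof (cases "a \<le> b")
    case True
    have "blin H H (\<lambda>x. opprod f a b (f b x))"
      using Suc True by (intro blin_comp[of H H "f b" H "opprod f a b"]) auto
    moreover have "opprod f a (Suc b) = (\<lambda>x. opprod f a b (f b x))"
      using True by (intro ext) (simp add: opprod_last)
    ultimately show ?thesis by simp
  next
    case False
    then have "opprod f a (Suc b) = (\<lambda>x. x)" by (intro ext) (simp add: opprod_empty)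
    then show ?thesis by (simp add: blin_id)
  qed
next
  case 0
  have "opprod f a 0 = (\<lambda>x. x)" by (intro ext) (simp add: opprod_empty)
  then show ?case by (simp add: blin_id)
qed

lemma adjoint_commute:
  assumes H: "hilbert_subspace H" and T: "T \<in> bounded_ops H" and R: "R \<in> bounded_ops H"
    and comm: "\<And>x. x \<in> H \<Longrightarrow> T (R x) = R (T x)" and x: "x \<in> H"
  shows "adjoint_op H T (adjoint_op H R x) = adjoint_op H R (adjoint_op H T x)"
proof (rule cinner_eqI[OF H])
  note aT = adjoint_props[OF H T] and aR = adjoint_props[OF H R]
  note m = bounded_ops_mem[OF aT(1)] bounded_ops_mem[OF aR(1)] bounded_ops_mem[OF T] bounded_ops_mem[OF R]
  show "adjoint_op H T (adjoint_op H R x) \<in> H" "adjoint_op H R (adjoint_op H T x) \<in> H"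
    using x by (simp_all add: m)
  fix w assume w: "w \<in> H"
  have "cinner w (adjoint_op H T (adjoint_op H R x)) = cinner (R (T w)) x"
    using w x by (simp add: m flip: aT(2) aR(2))
  moreover have "cinner w (adjoint_op H R (adjoint_op H T x)) = cinner (T (R w)) x"
    using w x by (simp add: m flip: aT(2) aR(2))
  ultimately show "cinner w (adjoint_op H T (adjoint_op H R x)) = cinner w (adjoint_op H R (adjoint_op H T x))"
    using comm[OF w] by simp
qed

lemma adjoint_adjoint:
  assumes H: "hilbert_subspace H" and T: "T \<in> bounded_ops H"
  shows "adjoint_op H (adjoint_op H T) = T"
  by (rule adjoint_op_eqI[OF H T]) (rule adjoint_props(3)[OF H T, symmetric])

section \<open>The last row of the generators\<close>

lemma sum_single_term:
  fixes f :: "'i \<Rightarrow> 'b::comm_monoid_add"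
  assumes "j \<in> S" "finite S" "\<And>m. m \<in> S \<Longrightarrow> m \<noteq> j \<Longrightarrow> f m = 0"
  shows "sum f S = f j"
proof -
  have "sum f S = sum f {j}" by (rule sum.mono_neutral_right) (use assms in auto)
  then show ?thesis by simp
qed

context SU0_ops
begin

definition Zs :: "nat \<Rightarrow> nat \<Rightarrow> 'h \<Rightarrow> 'h" where "Zs i j = adjoint_op H (Z i j)"

definition c :: "nat \<Rightarrow> 'h \<Rightarrow> 'h" where "c l = Z (n+1) l"

definition cs :: "nat \<Rightarrow> 'h \<Rightarrow> 'h" where "cs l = Zs (n+1) l"

lemma Z_bounded: "\<lbrakk>1 \<le> i; i \<le> n+1; 1 \<le> j; j \<le> n+1\<rbrakk> \<Longrightarrow> Z i j \<in> bounded_ops H"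
  by (rule Zb) auto

lemma Zs_bounded: "\<lbrakk>1 \<le> i; i \<le> n+1; 1 \<le> j; j \<le> n+1\<rbrakk> \<Longrightarrow> Zs i j \<in> bounded_ops H"
  unfolding Zs_def by (rule adjoint_props(1)[OF H Z_bounded])

lemma c_bounded: "\<lbrakk>1 \<le> l; l \<le> n+1\<rbrakk> \<Longrightarrow> c l \<in> bounded_ops H"
  unfolding c_def by (rule Z_bounded) auto

lemma cs_bounded: "\<lbrakk>1 \<le> l; l \<le> n+1\<rbrakk> \<Longrightarrow> cs l \<in> bounded_ops H"
  unfolding cs_def by (rule Zs_bounded) auto

lemmas Z_blin = bounded_ops_blin[OF Z_bounded]
  and Zs_blin = bounded_ops_blin[OF Zs_bounded]
  and c_blin = bounded_ops_blin[OF c_bounded]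
  and cs_blin = bounded_ops_blin[OF cs_bounded]

lemmas Z_mem = bounded_ops_mem[OF Z_bounded]
  and Zs_mem = bounded_ops_mem[OF Zs_bounded]
  and c_mem = bounded_ops_mem[OF c_bounded]
  and cs_mem = bounded_ops_mem[OF cs_bounded]

lemmas mem = Z_mem Zs_mem c_mem cs_mem

lemmas Hs = hilbert_subspaceD[OF H]

lemmas lin_zero = blin_zero[OF Z_blin Hs(2)] blin_zero[OF Zs_blin Hs(2)] blin_zero[OF c_blin Hs(2)]
  blin_zero[OF cs_blin Hs(2)]

lemmas lin_add = blinD(2)[OF Z_blin] blinD(2)[OF Zs_blin] blinD(2)[OF c_blin] blinD(2)[OF cs_blin]

lemma Zs_adj: "\<lbrakk>1 \<le> i; i \<le> n+1; 1 \<le> j; j \<le> n+1; x \<in> H; y \<in> H\<rbrakk> \<Longrightarrow> cinner (Z i j x) y = cinner x (Zs i j y)"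
  unfolding Zs_def by (rule adjoint_props(2)[OF H Z_bounded])

lemma cs_adj: "\<lbrakk>1 \<le> l; l \<le> n+1; x \<in> H; y \<in> H\<rbrakk> \<Longrightarrow> cinner (c l x) y = cinner x (cs l y)"
  unfolding c_def cs_def by (rule Zs_adj) auto

lemma cs_adj': "\<lbrakk>1 \<le> l; l \<le> n+1; x \<in> H; y \<in> H\<rbrakk> \<Longrightarrow> cinner x (c l y) = cinner (cs l x) y"
  unfolding c_def cs_def Zs_def by (rule adjoint_props(3)[OF H Z_bounded]) auto

section \<open>Exchange relations between the generators and the last row\<close>

lemma c_row: "\<lbrakk>1 \<le> j; j < l; l \<le> n+1; x \<in> H\<rbrakk> \<Longrightarrow> c j (c l x) = 0"
  unfolding c_def by (rule row) auto

lemma Z_c_col: "\<lbrakk>1 \<le> i; i \<le> n; 1 \<le> j; j \<le> n+1; x \<in> H\<rbrakk> \<Longrightarrow> Z i j (c j x) = 0"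
  unfolding c_def by (rule col) auto

lemma Z_c_less: "\<lbrakk>1 \<le> i; i \<le> n; 1 \<le> l; l < j; j \<le> n+1; x \<in> H\<rbrakk> \<Longrightarrow> Z i j (c l x) = c l (Z i j x)"
  unfolding c_def by (rule anti_comm) auto

text \<open>For rows \<open>i\<close> and \<open>n+1\<close> the index condition involves
  \<open>max i j\<close>, which is \<open>j\<close> exactly when \<open>i \<le> j\<close>. This is
  the source of the restriction to entries on or above the diagonal in the exchange rules.\<close>

lemma Z_c_next:
  "\<lbrakk>1 \<le> i; i \<le> j; j \<le> n; x \<in> H\<rbrakk> \<Longrightarrow> Z i j (c (j+1) x) = c (j+1) (Z i j x) + Z i (j+1) (c j x)"
  unfolding c_def by (rule diag_next) auto

lemma Z_c_greater: "\<lbrakk>1 \<le> i; i \<le> j; j + 1 < l; l \<le> n+1; x \<in> H\<rbrakk> \<Longrightarrow> Z i j (c l x) = c l (Z i j x)"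
  unfolding c_def by (rule diag_comm) auto

lemma Z_cs: "\<lbrakk>1 \<le> i; i \<le> n; 1 \<le> j; j \<le> n+1; 1 \<le> l; l \<le> n+1; l \<noteq> j; x \<in> H\<rbrakk> \<Longrightarrow> Z i j (cs l x) = cs l (Z i j x)"
  unfolding cs_def Zs_def by (rule star_comm) auto

lemma Zs_c:
  assumes "1 \<le> i" "i \<le> n" "1 \<le> j" "j \<le> n+1" "1 \<le> l" "l \<le> n+1" "l \<noteq> j" "x \<in> H"
  shows "Zs i j (c l x) = c l (Zs i j x)"
proof -
  have "adjoint_op H (Z i j) (adjoint_op H (cs l) x) = adjoint_op H (cs l) (adjoint_op H (Z i j) x)"
  proof (rule adjoint_commute[OF H])
    show "Z i j (cs l y) = cs l (Z i j y)" if "y \<in> H" for y by (rule Z_cs) (use assms that in auto)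
  qed (use assms in \<open>auto intro: Z_bounded cs_bounded\<close>)
  moreover have "adjoint_op H (cs l) = c l"
    unfolding cs_def Zs_def c_def by (rule adjoint_adjoint[OF H Z_bounded]) (use assms in auto)
  ultimately show ?thesis by (simp only: Zs_def)
qed

text \<open>In row \<open>n+1\<close> the trailing diagonal block of the star relation is empty, and
  the diagonal case is the one with empty superdiagonal block, so one formula covers all
  columns.\<close>

lemma cs_formula:
  assumes l: "1 \<le> l" "l \<le> n+1" and x: "x \<in> H"
  shows "cs l x = opprod (\<lambda>t. Z t t) 1 l (opprod (\<lambda>t. Z t (t+1)) l (n+1) x)"
proof (cases "l = n+1")
  case True
  then show ?thesis using star_diag[of l x] x by (simp add: cs_def Zs_def opprod_empty)
next
  case False
  then show ?thesis using star_lower[of "n+1" l x] l x by (simp add: cs_def Zs_def opprod_empty)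
qed

section \<open>The sphere relations of the last row\<close>

lemma Zdiag_mem: "\<lbrakk>1 \<le> a; b \<le> n+2; x \<in> H\<rbrakk> \<Longrightarrow> opprod (\<lambda>t. Z t t) a b x \<in> H"
  by (rule opprod_mem) (auto intro: Z_mem)

lemma Zup_mem: "\<lbrakk>1 \<le> a; b \<le> n+1; x \<in> H\<rbrakk> \<Longrightarrow> opprod (\<lambda>t. Z t (t+1)) a b x \<in> H"
  by (rule opprod_mem) (auto intro: Z_mem)

lemma Zup_c:
  assumes "1 \<le> l" "l \<le> a" "b \<le> n+1" "x \<in> H"
  shows "opprod (\<lambda>t. Z t (t+1)) a b (c l x) = c l (opprod (\<lambda>t. Z t (t+1)) a b x)"
  by (rule opprod_commute[where H = H]) (use assms in \<open>auto intro!: Z_mem Z_c_less\<close>)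

text \<open>The product for \<open>cs l\<close> contains \<open>Z (j-1) j\<close>. The factors to
  its right let \<open>c j\<close> pass, and then \<open>Z (j-1) j\<close> annihilates it by the
  column relation.\<close>

lemma cs_c_orth_less:
  assumes "1 \<le> l" "l < j" "j \<le> n+1" "x \<in> H"
  shows "cs l (c j x) = 0"
proof -
  let ?u = "\<lambda>t. Z t (t+1)"
  have "opprod ?u l (n+1) (c j x) = opprod ?u l (j-1) (opprod ?u (j-1) (n+1) (c j x))"
    using assms by (intro opprod_split) auto
  also have "opprod ?u (j-1) (n+1) (c j x) = ?u (j-1) (opprod ?u j (n+1) (c j x))"
    using assms opprod_first[of "j-1" "n+1" ?u "c j x"] by simp
  also have "opprod ?u j (n+1) (c j x) = c j (opprod ?u j (n+1) x)"
    using assms by (intro Zup_c) auto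
  also have "?u (j-1) (c j (opprod ?u j (n+1) x)) = 0"
    using assms Z_c_col[of "j-1" j "opprod ?u j (n+1) x"] Zup_mem[of j "n+1" x] by simp
  also have "opprod ?u l (j-1) 0 = 0"
    by (rule blin_zero[OF blin_opprod Hs(2)]) (use assms in \<open>auto intro: Z_blin\<close>)
  finally show ?thesis
    using assms cs_formula[of l "c j x"] blin_zero[OF blin_opprod[of 1 l H "\<lambda>t. Z t t"] Hs(2)]
    by (simp add: c_mem Z_blin)
qed

lemma cs_c_orth:
  assumes "1 \<le> l" "l \<le> n+1" "1 \<le> j" "j \<le> n+1" "l \<noteq> j" "x \<in> H"
  shows "cs l (c j x) = 0"
proof (cases "l < j")
  case True
  then show ?thesis using assms cs_c_orth_less by blast
next
  case False
  then have lt: "j < l" using assms by simp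
  show ?thesis
  proof (rule cinner_eqI[OF H])
    fix w assume w: "w \<in> H"
    have "cinner w (cs l (c j x)) = cinner (c l w) (c j x)" using assms w by (simp add: cs_adj c_mem)
    also have "\<dots> = cinner (cs j (c l w)) x" using assms w by (simp add: cs_adj' c_mem)
    also have "cs j (c l w) = 0" by (rule cs_c_orth_less) (use assms lt w in auto)
    finally show "cinner w (cs l (c j x)) = cinner w 0" by simp
  qed (use assms mem Hs(3) in auto)
qed

text \<open>While \<open>c (l+1)\<close> moves to the left through the product for
  \<open>cs (l+1)\<close>, only the factor \<open>Z l l\<close> leaves a correction. It contributes
  \<open>Z l (l+1)\<close> and \<open>c l\<close>, which completes the superdiagonal block to that
  of \<open>cs l\<close>.\<close>

lemma cs_c_step:
  assumes l: "1 \<le> l" "l \<le> n" and x: "x \<in> H"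
  shows "cs (l+1) (c (l+1) x) = c (l+1) (cs (l+1) x) + cs l (c l x)"
proof -
  let ?u = "\<lambda>t. Z t (t+1)" and ?d = "\<lambda>t. Z t t"
  let ?y = "opprod ?u (l+1) (n+1) x"
  have y: "?y \<in> H" using l x by (intro Zup_mem) auto
  have b: "blin H H (opprod ?d 1 l)" by (rule blin_opprod) (use l in \<open>auto intro: Z_blin\<close>)
  have "cs (l+1) (c (l+1) x) = opprod ?d 1 (l+1) (opprod ?u (l+1) (n+1) (c (l+1) x))"
    using l x by (intro cs_formula) (auto simp: c_mem)
  also have "opprod ?u (l+1) (n+1) (c (l+1) x) = c (l+1) ?y" using l x by (intro Zup_c) auto
  also have "opprod ?d 1 (l+1) (c (l+1) ?y) = opprod ?d 1 l (Z l l (c (l+1) ?y))"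
    using l opprod_last[of 1 l ?d "c (l+1) ?y"] by simp
  also have "Z l l (c (l+1) ?y) = c (l+1) (Z l l ?y) + Z l (l+1) (c l ?y)"
    using l y by (intro Z_c_next) auto
  also have "opprod ?d 1 l (c (l+1) (Z l l ?y) + Z l (l+1) (c l ?y))
      = opprod ?d 1 l (c (l+1) (Z l l ?y)) + opprod ?d 1 l (Z l (l+1) (c l ?y))"
    by (rule blinD(2)[OF b]) (use l y in \<open>auto simp: mem\<close>)
  also have "opprod ?d 1 l (c (l+1) (Z l l ?y)) = c (l+1) (opprod ?d 1 l (Z l l ?y))"
    by (rule opprod_commute[where H = H]) (use l y in \<open>auto intro!: Z_mem Z_c_greater\<close>)
  also have "opprod ?d 1 l (Z l l ?y) = opprod ?d 1 (l+1) ?y" using l opprod_last[of 1 l ?d ?y] by simp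
  also have "\<dots> = cs (l+1) x" using cs_formula[of "l+1" x] l x by simp
  also have "c l ?y = opprod ?u (l+1) (n+1) (c l x)" using l x by (intro Zup_c[symmetric]) auto
  also have "Z l (l+1) (opprod ?u (l+1) (n+1) (c l x)) = opprod ?u l (n+1) (c l x)"
    using l opprod_first[of l "n+1" ?u "c l x"] by simp
  also have "opprod ?d 1 l (opprod ?u l (n+1) (c l x)) = cs l (c l x)"
    using cs_formula[of l "c l x"] l x by (simp add: c_mem)
  finally show ?thesis .
qed

lemma cs_c_sum:
  assumes "1 \<le> l" "l \<le> n+1" "x \<in> H"
  shows "cs l (c l x) = (\<Sum>m=1..l. c m (cs m x))"
  using assms(1,2)
proof (induction l rule: nat_induct_at_least)
  case base
  \<comment> \<open>For \<open>l = 1\<close> the diagonal block is empty and \<open>c 1\<close>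
    passes the whole superdiagonal block.\<close>
  have "cs 1 (c 1 x) = c 1 (cs 1 x)"
    using cs_formula[of 1 "c 1 x"] cs_formula[of 1 x] Zup_c[of 1 1 "n+1" x] assms(3)
    by (simp add: opprod_empty c_mem[simplified])
  then show ?case by simp
next
  case (Suc l)
  have "cs (Suc l) (c (Suc l) x) = c (Suc l) (cs (Suc l) x) + cs l (c l x)"
    using cs_c_step[of l x] Suc assms(3) by simp
  then show ?case using Suc by (simp add: add.commute)
qed

text \<open>Here the superdiagonal block is empty and \<open>c (n+1)\<close> is itself the last
  diagonal entry, so the product is the determinant relation. Consequently \<open>c (n+1)\<close> is
  an isometry.\<close>

lemma cs_c_last: "x \<in> H \<Longrightarrow> cs (n+1) (c (n+1) x) = x"
proof -
  assume x: "x \<in> H"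
  have "opprod (\<lambda>t. Z t t) 1 (n+2) x = opprod (\<lambda>t. Z t t) 1 (n+1) (c (n+1) x)"
    using opprod_last[of 1 "n+1" "\<lambda>t. Z t t" x] by (simp add: c_def)
  then show ?thesis
    using det[OF x] cs_formula[of "n+1" "c (n+1) x"] x by (simp add: opprod_empty c_mem[simplified])
qed

text \<open>The two values of \<open>cs (n+1) (c (n+1) x)\<close> agree: the unit is the sum of the
  \<open>c m (cs m x)\<close>. Inserting this sum is the standard device whenever no relation covers
  a product directly.\<close>

lemma resolution: "x \<in> H \<Longrightarrow> (\<Sum>m=1..n+1. c m (cs m x)) = x"
  using cs_c_sum[of "n+1" x] cs_c_last[of x] by simp

text \<open>By orthogonality only the \<open>j\<close>-th term of the resolution survives on the
  range of \<open>c j\<close>. So every entry of the row is a partial isometry.\<close>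

lemma c_cs_c: "\<lbrakk>1 \<le> j; j \<le> n+1; x \<in> H\<rbrakk> \<Longrightarrow> c j (cs j (c j x)) = c j x"
proof -
  assume a: "1 \<le> j" "j \<le> n+1" "x \<in> H"
  have "(\<Sum>m=1..n+1. c m (cs m (c j x))) = c j (cs j (c j x))"
    by (rule sum_single_term) (use a in \<open>auto simp: cs_c_orth lin_zero\<close>)
  then show ?thesis using resolution[of "c j x"] a by (simp add: c_mem)
qed

text \<open>If the later adjoints kill \<open>x\<close>, its resolution stops at \<open>l\<close>,
  and the truncated sum is \<open>cs l (c l x)\<close>.\<close>

lemma cs_c_id_of_kernel:
  assumes "1 \<le> l" "l \<le> n+1" "x \<in> H" "\<And>m. l < m \<Longrightarrow> m \<le> n+1 \<Longrightarrow> cs m x = 0"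
  shows "cs l (c l x) = x"
proof -
  have "(\<Sum>m=1..n+1. c m (cs m x)) = (\<Sum>m=1..l. c m (cs m x))"
    by (rule sum.mono_neutral_right) (use assms in \<open>auto simp: lin_zero\<close>)
  then show ?thesis using cs_c_sum[of l x] resolution[of x] assms by simp
qed

text \<open>\<open>star_comm\<close> excludes equal columns, and this fills the gap. After inserting
  the resolution of \<open>x\<close>, all terms with \<open>l \<noteq> j+1\<close> vanish by the
  column relation or by orthogonality, and of the term \<open>j+1\<close> only the correction in
  \<open>Z_c_next\<close> is left.\<close>

lemma cs_Z:
  assumes "1 \<le> i" "i \<le> j" "j \<le> n" "x \<in> H"
  shows "cs j (Z i j x) = Z i (j+1) (cs j (c j (cs (j+1) x)))"
proof -
  have "cs j (Z i j x) = cs j (Z i j (\<Sum>l=1..n+1. c l (cs l x)))" using resolution[of x] assms by simp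
  also have "\<dots> = (\<Sum>l=1..n+1. cs j (Z i j (c l (cs l x))))"
    using blin_sum[OF blin_comp[OF Z_blin[of i j] cs_blin[of j]] Hs(2), of "{1..n+1}" "\<lambda>l. c l (cs l x)"] assms
    by (simp add: mem)
  also have "\<dots> = cs j (Z i j (c (j+1) (cs (j+1) x)))"
  proof (rule sum_single_term)
    fix l assume l: "l \<in> {1..n+1}" and ne: "l \<noteq> j+1"
    let ?w = "cs l x"
    have w: "?w \<in> H" using l assms by (simp add: cs_mem)
    consider "l < j" | "l = j" | "l > j + 1" using ne by linarith
    then show "cs j (Z i j (c l ?w)) = 0"
    proof cases
      case 1
      then have "Z i j (c l ?w) = c l (Z i j ?w)" using l w assms by (intro Z_c_less) auto
      then show ?thesis using 1 l w assms by (simp add: cs_c_orth mem)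
    next
      case 2
      then show ?thesis using l w assms by (simp add: Z_c_col lin_zero)
    next
      case 3
      then have "Z i j (c l ?w) = c l (Z i j ?w)" using l w assms by (intro Z_c_greater) auto
      then show ?thesis using 3 l w assms by (simp add: cs_c_orth mem)
    qed
  qed (use assms in auto)
  also have "Z i j (c (j+1) (cs (j+1) x)) = c (j+1) (Z i j (cs (j+1) x)) + Z i (j+1) (c j (cs (j+1) x))"
    using assms by (intro Z_c_next) (auto simp: mem)
  also have "cs j \<dots> = cs j (c (j+1) (Z i j (cs (j+1) x))) + cs j (Z i (j+1) (c j (cs (j+1) x)))"
    using assms by (intro lin_add) (auto simp: mem)
  also have "cs j (c (j+1) (Z i j (cs (j+1) x))) = 0"
    using assms by (intro cs_c_orth) (auto simp: mem)
  also have "cs j (Z i (j+1) (c j (cs (j+1) x))) = Z i (j+1) (cs j (c j (cs (j+1) x)))"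
    using assms by (intro Z_cs[symmetric]) (auto simp: mem)
  finally show ?thesis by simp
qed

lemma cs_Z_last:
  assumes "1 \<le> i" "i \<le> n" "x \<in> H"
  shows "cs (n+1) (Z i (n+1) x) = 0"
proof -
  let ?N = "n+1"
  have "cs ?N (Z i ?N x) = cs ?N (Z i ?N (\<Sum>l=1..n+1. c l (cs l x)))" using resolution[of x] assms by simp
  also have "\<dots> = (\<Sum>l=1..n+1. cs ?N (Z i ?N (c l (cs l x))))"
    using blin_sum[OF blin_comp[OF Z_blin[of i ?N] cs_blin[of ?N]] Hs(2), of "{1..n+1}" "\<lambda>l. c l (cs l x)"] assms
    by (simp add: mem)
  also have "\<dots> = 0"
  proof (rule sum.neutral, rule ballI)
    fix l assume l: "l \<in> {1..n+1}"
    let ?w = "cs l x"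
    have w: "?w \<in> H" using l assms by (simp add: cs_mem)
    show "cs ?N (Z i ?N (c l ?w)) = 0"
    proof (cases "l = ?N")
      case True
      then show ?thesis using w assms Z_c_col[of i ?N ?w] lin_zero(4)[of ?N] by simp
    next
      case False
      then have "Z i ?N (c l ?w) = c l (Z i ?N ?w)" using l w assms by (intro Z_c_less) auto
      then show ?thesis using False l w assms cs_c_orth[of ?N l "Z i ?N ?w"] Z_mem[of i ?N ?w] by simp
    qed
  qed
  finally show ?thesis .
qed

text \<open>The adjoint of \<open>cs_Z\<close>: the only exchange of \<open>Zs i j\<close> with the
  row that is not plain commutation.\<close>

lemma Zs_c_same:
  assumes "1 \<le> i" "i \<le> j" "j \<le> n" "x \<in> H"
  shows "Zs i j (c j x) = c (j+1) (cs j (c j (Zs i (j+1) x)))"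
proof (rule cinner_eqI[OF H])
  fix w assume w: "w \<in> H"
  have "cinner w (Zs i j (c j x)) = cinner (cs j (Z i j w)) x"
    using assms w by (simp add: mem cs_adj' flip: Zs_adj)
  also have "cs j (Z i j w) = Z i (j+1) (cs j (c j (cs (j+1) w)))" using assms w by (intro cs_Z)
  also have "cinner \<dots> x = cinner (cs j (c j (cs (j+1) w))) (Zs i (j+1) x)"
    using assms w by (intro Zs_adj) (auto simp: mem)
  also have "\<dots> = cinner (c j (cs (j+1) w)) (c j (Zs i (j+1) x))"
    using assms w by (intro cs_adj'[symmetric]) (auto simp: mem)
  also have "\<dots> = cinner (cs (j+1) w) (cs j (c j (Zs i (j+1) x)))"
    using assms w by (intro cs_adj) (auto simp: mem)
  also have "\<dots> = cinner w (c (j+1) (cs j (c j (Zs i (j+1) x))))"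
    using assms w by (intro cs_adj'[symmetric]) (auto simp: mem)
  finally show "cinner w (Zs i j (c j x)) = cinner w (c (j+1) (cs j (c j (Zs i (j+1) x))))" .
qed (use assms in \<open>auto simp: mem\<close>)

lemma Zs_c_last:
  assumes "1 \<le> i" "i \<le> n" "x \<in> H"
  shows "Zs i (n+1) (c (n+1) x) = 0"
proof (rule cinner_eqI[OF H])
  fix w assume w: "w \<in> H"
  have "cinner w (Zs i (n+1) (c (n+1) x)) = cinner (cs (n+1) (Z i (n+1) w)) x"
    using assms w Zs_adj[of i "n+1" w "c (n+1) x"] cs_adj'[of "n+1" "Z i (n+1) w" x]
      c_mem[of "n+1" x] Z_mem[of i "n+1" w] by simp
  then show "cinner w (Zs i (n+1) (c (n+1) x)) = cinner w 0" using cs_Z_last[of i w] assms w by simp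
qed (use assms Zs_mem[of i "n+1"] c_mem[of "n+1"] Hs(3) in auto)

section \<open>Entries on and below the diagonal through adjoint products\<close>

lemma opprod_adjoint:
  assumes "\<And>t. a \<le> t \<Longrightarrow> t < b \<Longrightarrow> f t \<in> bounded_ops H" "x \<in> H" "y \<in> H"
  shows "cinner (opprod f a b x) y = cinner x (foldr (\<lambda>t. adjoint_op H (f t)) (rev [a..<b]) y)
    \<and> foldr (\<lambda>t. adjoint_op H (f t)) (rev [a..<b]) y \<in> H"
  using assms
proof (induction b arbitrary: x)
  case (Suc b)
  show ?case
  proof (cases "a \<le> b")
    case True
    note fb = Suc.prems(1)[OF True lessI]
    have "cinner (opprod f a b (f b x)) y = cinner (f b x) (foldr (\<lambda>t. adjoint_op H (f t)) (rev [a..<b]) y)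
      \<and> foldr (\<lambda>t. adjoint_op H (f t)) (rev [a..<b]) y \<in> H"
      using Suc.prems bounded_ops_mem[OF fb] by (intro Suc.IH) auto
    then show ?thesis
      using True Suc.prems(2) adjoint_props(2)[OF H fb] bounded_ops_mem[OF adjoint_props(1)[OF H fb]]
      by (simp add: opprod_last)
  qed (use Suc.prems in \<open>simp add: opprod_empty\<close>)
qed (simp add: opprod_empty)

definition diag_adj :: "nat \<Rightarrow> nat \<Rightarrow> 'h \<Rightarrow> 'h" where
  "diag_adj a b = foldr (\<lambda>t. Zs t t) (rev [a..<b])"

definition up_adj :: "nat \<Rightarrow> nat \<Rightarrow> 'h \<Rightarrow> 'h" where
  "up_adj a b = foldr (\<lambda>t. Zs t (t+1)) (rev [a..<b])"

lemma diag_adj_props: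
  assumes "1 \<le> a" "b \<le> n+2" "y \<in> H"
  shows "diag_adj a b y \<in> H" "x \<in> H \<Longrightarrow> cinner (opprod (\<lambda>t. Z t t) a b x) y = cinner x (diag_adj a b y)"
  using opprod_adjoint[of a b "\<lambda>t. Z t t" y y] opprod_adjoint[of a b "\<lambda>t. Z t t" x y] assms
  by (auto simp: diag_adj_def Zs_def Z_bounded)

lemma up_adj_props:
  assumes "1 \<le> a" "b \<le> n+1" "y \<in> H"
  shows "up_adj a b y \<in> H" "x \<in> H \<Longrightarrow> cinner (opprod (\<lambda>t. Z t (t+1)) a b x) y = cinner x (up_adj a b y)"
  using opprod_adjoint[of a b "\<lambda>t. Z t (t+1)" y y] opprod_adjoint[of a b "\<lambda>t. Z t (t+1)" x y] assms
  by (auto simp: up_adj_def Zs_def Z_bounded)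

text \<open>Double adjoint of the star relation. The right side involves adjoints of diagonal and
  superdiagonal entries only, whose behaviour towards the row is known.\<close>

lemma Z_lower_formula:
  assumes "1 \<le> j" "j < i" "i \<le> n+1" "x \<in> H"
  shows "Z i j x = diag_adj (i+1) (n+2) (up_adj j i (diag_adj 1 j x))"
proof (rule cinner_eqI[OF H])
  fix w assume w: "w \<in> H"
  have "cinner w (Z i j x) = cinner (Zs i j w) x"
    unfolding Zs_def using assms w by (intro adjoint_props(3)[OF H Z_bounded]) auto
  also have "Zs i j w = opprod (\<lambda>t. Z t t) 1 j (opprod (\<lambda>t. Z t (t+1)) j i (opprod (\<lambda>t. Z t t) (i+1) (n+2) w))"
    unfolding Zs_def using assms w by (intro star_lower) auto
  also have "cinner \<dots> x = cinner w (diag_adj (i+1) (n+2) (up_adj j i (diag_adj 1 j x)))"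
    using assms w diag_adj_props[of 1 j x] up_adj_props[of j i "diag_adj 1 j x"]
      diag_adj_props[of "i+1" "n+2" "up_adj j i (diag_adj 1 j x)"] Zdiag_mem[of "i+1" "n+2" w]
      Zup_mem[of j i "opprod (\<lambda>t. Z t t) (i+1) (n+2) w"] by (simp del: One_nat_def)
  finally show "cinner w (Z i j x) = cinner w (diag_adj (i+1) (n+2) (up_adj j i (diag_adj 1 j x)))" .
qed (use assms in \<open>auto simp: Z_mem diag_adj_props up_adj_props\<close>)

lemma Z_diag_formula:
  assumes "1 \<le> i" "i \<le> n+1" "x \<in> H"
  shows "Z i i x = diag_adj (i+1) (n+2) (diag_adj 1 i x)"
proof (rule cinner_eqI[OF H])
  fix w assume w: "w \<in> H"
  have "cinner w (Z i i x) = cinner (Zs i i w) x"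
    unfolding Zs_def using assms w by (intro adjoint_props(3)[OF H Z_bounded]) auto
  also have "Zs i i w = opprod (\<lambda>t. Z t t) 1 i (opprod (\<lambda>t. Z t t) (i+1) (n+2) w)"
    unfolding Zs_def using assms w by (intro star_diag) auto
  also have "cinner \<dots> x = cinner w (diag_adj (i+1) (n+2) (diag_adj 1 i x))"
    using assms w by (simp add: diag_adj_props Zdiag_mem[simplified])
  finally show "cinner w (Z i i x) = cinner w (diag_adj (i+1) (n+2) (diag_adj 1 i x))" .
qed (use assms in \<open>auto simp: Z_mem diag_adj_props\<close>)

end

section \<open>Monomials in the last row\<close>

text \<open>The factors are ordered with the highest index to the left and applied last;
  \<open>u\<close> is exclusive. In this order products of the row entries can be nonzero, since
  \<open>c j (c l x) = 0\<close> for \<open>j < l\<close>.\<close>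

primrec mon :: "(nat \<Rightarrow> 'h \<Rightarrow> 'h) \<Rightarrow> (nat \<Rightarrow> nat) \<Rightarrow> nat \<Rightarrow> nat \<Rightarrow> 'h \<Rightarrow> 'h" where
  "mon f a l 0 x = x"
| "mon f a l (Suc u) x = (if l \<le> u then (f u ^^ a u) (mon f a l u x) else x)"

lemma mon_empty: "u \<le> l \<Longrightarrow> mon f a l u x = x"
  by (cases u) auto

lemma mon_split: "l \<le> m \<Longrightarrow> m \<le> u \<Longrightarrow> mon f a l u x = mon f a m u (mon f a l m x)"
proof (induction u)
  case (Suc u)
  show ?case
  proof (cases "m = Suc u")
    case True
    then show ?thesis by (simp add: mon_empty)
  qed (use Suc in auto)
qed (simp add: mon_empty)

lemma mon_cong: "(\<And>t. l \<le> t \<Longrightarrow> t < u \<Longrightarrow> a t = b t) \<Longrightarrow> mon f a l u x = mon f b l u x"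
  by (induction u) auto

lemma funpow_mem: "(\<And>x. x \<in> H \<Longrightarrow> f x \<in> H) \<Longrightarrow> x \<in> H \<Longrightarrow> (f ^^ k) x \<in> H"
  by (induction k) auto

lemma mon_mem:
  "(\<And>t x. l \<le> t \<Longrightarrow> t < u \<Longrightarrow> x \<in> H \<Longrightarrow> f t x \<in> H) \<Longrightarrow> x \<in> H \<Longrightarrow> mon f a l u x \<in> H"
  by (induction u) (auto intro: funpow_mem)

lemma funpow_commute:
  assumes "\<And>x. x \<in> H \<Longrightarrow> T (f x) = f (T x)" "\<And>x. x \<in> H \<Longrightarrow> f x \<in> H" "x \<in> H"
  shows "T ((f ^^ k) x) = (f ^^ k) (T x)"
  using assms funpow_mem[of H f x] by (induction k) auto

lemma mon_commute:
  assumes "\<And>t x. l \<le> t \<Longrightarrow> t < u \<Longrightarrow> x \<in> H \<Longrightarrow> T (f t x) = f t (T x)"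
    "\<And>t x. l \<le> t \<Longrightarrow> t < u \<Longrightarrow> x \<in> H \<Longrightarrow> f t x \<in> H" "x \<in> H"
  shows "T (mon f a l u x) = mon f a l u (T x)"
  using assms(1,2)
proof (induction u)
  case (Suc u)
  show ?case
  proof (cases "l \<le> u")
    case True
    have m: "mon f a l u x \<in> H" using Suc.prems assms(3) by (intro mon_mem) auto
    have "T ((f u ^^ a u) (mon f a l u x)) = (f u ^^ a u) (T (mon f a l u x))"
      by (rule funpow_commute[where H = H]) (use Suc.prems True m in auto)
    then show ?thesis using Suc True by auto
  qed simp
qed simp

lemma blin_funpow: "blin H H f \<Longrightarrow> blin H H (f ^^ k)"
proof (induction k)
  case 0
  show ?case using blin_id by (simp add: id_def)
next
  case (Suc k)
  then show ?case using blin_comp[of H H "f ^^ k" H f] by (simp add: comp_def)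
qed

lemma blin_mon:
  assumes "\<And>t. l \<le> t \<Longrightarrow> t < u \<Longrightarrow> blin H H (f t)"
  shows "blin H H (mon f a l u)"
  using assms
proof (induction u)
  case 0
  have "mon f a l 0 = (\<lambda>x. x)" by auto
  then show ?case by (simp add: blin_id)
next
  case (Suc u)
  show ?case
  proof (cases "l \<le> u")
    case True
    then have "mon f a l (Suc u) = (\<lambda>x. (f u ^^ a u) (mon f a l u x))" by auto
    then show ?thesis
      using blin_comp[of H H "mon f a l u" H "f u ^^ a u"] Suc True blin_funpow[of H "f u"] by auto
  next
    case False
    then have "mon f a l (Suc u) = (\<lambda>x. x)" by auto
    then show ?thesis by (simp add: blin_id)
  qed
qed

lemma mon_Suc_first:
  assumes "l < u"
  shows "mon f a l u x = mon f a (Suc l) u ((f l ^^ a l) x)"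
  using mon_split[of l "Suc l" u f a x] assms by (simp add: mon_empty)

lemma mon_last: "l \<le> u \<Longrightarrow> mon f a l (Suc u) x = (f u ^^ a u) (mon f a l u x)"
  by simp

lemma mon_exp_zero: "(\<And>t. l \<le> t \<Longrightarrow> t < u \<Longrightarrow> a t = 0) \<Longrightarrow> mon f a l u x = x"
  by (induction u) auto

declare mon.simps(2) [simp del]

context SU0_ops
begin

text \<open>Two facts drive the Gram computation: powers of \<open>c u\<close> send
  \<open>ker_from u\<close> into \<open>ker_from (Suc u)\<close>, and on the latter space
  \<open>cs u\<close> inverts \<open>c u\<close> from the left.\<close>

definition ker_from :: "nat \<Rightarrow> 'h set" where
  "ker_from l = {x \<in> H. \<forall>m. l \<le> m \<and> m \<le> n+1 \<longrightarrow> cs m x = 0}"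

lemma c_pow_ker:
  assumes "1 \<le> u" "u \<le> n+1" "v \<in> ker_from u"
  shows "(c u ^^ k) v \<in> ker_from (Suc u)"
proof (induction k)
  case (Suc k)
  then show ?case using assms(1,2) by (auto simp: ker_from_def c_mem cs_c_orth)
qed (use assms in \<open>auto simp: ker_from_def\<close>)

lemma cs_c_ker:
  assumes "1 \<le> u" "u \<le> n+1" "v \<in> ker_from (Suc u)"
  shows "cs u (c u v) = v"
  using assms by (intro cs_c_id_of_kernel) (auto simp: ker_from_def)

text \<open>A wandering subspace: \<open>cs u\<close> kills \<open>ker_from u\<close>, and
  \<open>c u\<close> is isometric on everything generated from it, so cancelling common powers
  leaves either equal exponents or a vanishing inner product.\<close>

lemma c_pow_gram:
  assumes u: "1 \<le> u" "u \<le> n+1" and v: "v \<in> ker_from u" "v' \<in> ker_from u"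
  shows "cinner ((c u ^^ k) v) ((c u ^^ k') v') = (if k = k' then cinner v v' else 0)"
proof (induction k arbitrary: k')
  note p = c_pow_ker[OF u v(1)] c_pow_ker[OF u v(2)]
  note pH = p[unfolded ker_from_def, THEN CollectD, THEN conjunct1]
  have vH: "v \<in> H" "v' \<in> H" "cs u v = 0" "cs u v' = 0" using v u by (auto simp: ker_from_def)
  {
    case 0
    show ?case
    proof (cases k')
      case (Suc q)
      then show ?thesis using cs_adj'[OF u vH(1) pH(2), of q] vH by simp
    qed simp
  next
    case (Suc k)
    show ?case
    proof (cases k')
      case 0
      then show ?thesis using cs_adj[OF u pH(1) vH(2), of k] vH by simp
    next
      case (Suc q)
      have "cinner (c u ((c u ^^ k) v)) (c u ((c u ^^ q) v')) = cinner (cs u (c u ((c u ^^ k) v))) ((c u ^^ q) v')"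
        by (rule cs_adj'[OF u c_mem[OF u pH(1)] pH(2)])
      then show ?thesis using Suc Suc.IH[of q] cs_c_ker[OF u p(1), of k] by simp
    qed
  }
qed

text \<open>The first conjunct is the induction invariant that allows \<open>c_pow_gram\<close> to
  be applied to the next factor.\<close>

lemma mon_gram:
  assumes "1 \<le> l" "l \<le> u" "u \<le> n+2" "y \<in> ker_from l" "y' \<in> ker_from l"
  shows "mon c a l u y \<in> ker_from u \<and> cinner (mon c a l u y) (mon c b l u y')
    = (if \<forall>t. l \<le> t \<and> t < u \<longrightarrow> a t = b t then cinner y y' else 0)"
  using assms(2,3) assms(4,5)
proof (induction u arbitrary: y y' a b rule: dec_induct)
  case base
  then show ?case by (simp add: mon_empty)
next
  case (step u)
  have u: "1 \<le> u" "u \<le> n+1" using step assms(1) by auto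
  note IH = step.IH[OF _ step.prems(2,3), of a b] step.IH[OF _ step.prems(3,3), of b b]
  have k: "mon c a l u y \<in> ker_from u" "mon c b l u y' \<in> ker_from u" using IH u by auto
  show ?case
    using c_pow_ker[OF u k(1)] c_pow_gram[OF u k, of "a u" "b u"] IH u step.hyps
    by (auto simp: less_Suc_eq mon_last)
qed

text \<open>If some exponent is positive, the leftmost factor that occurs has an index above
  \<open>j\<close>, and the row relation annihilates the product.\<close>

lemma c_mon_row:
  assumes "1 \<le> j" "j < l" "u \<le> n+2" "w \<in> H"
  shows "c j (mon c a l u w) = (if \<forall>t. l \<le> t \<and> t < u \<longrightarrow> a t = 0 then c j w else 0)"
  using assms(3)
proof (induction u)
  case 0
  then show ?case by simp
next
  case (Suc u)
  show ?case
  proof (cases "l \<le> u")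
    case False
    then show ?thesis by (simp add: mon_empty)
  next
    case True
    have m: "mon c a l u w \<in> H" using Suc assms True by (intro mon_mem) (auto intro!: c_mem)
    show ?thesis
    proof (cases "a u")
      case 0
      then show ?thesis using Suc True by (auto simp: less_Suc_eq mon_last)
    next
      case (Suc k)
      have p: "(c u ^^ k) (mon c a l u w) \<in> H"
        by (rule funpow_mem[OF c_mem m]) (use Suc.prems True assms in auto)
      have "c j (c u ((c u ^^ k) (mon c a l u w))) = 0"
        by (rule c_row) (use p Suc.prems True assms in auto)
      then show ?thesis using Suc True by (auto simp: mon_last)
    qed
  qed
qed

text \<open>Each exchange leaves a correction containing \<open>c j\<close>, which vanishes as soon
  as another \<open>c (j+1)\<close> stands to its right. Only the innermost factor contributes, and
  \<open>b-1\<close> factors remain on the left.\<close>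

lemma Z_c_next_pow:
  assumes "1 \<le> i" "i \<le> j" "j \<le> n" "w \<in> H"
  shows "Z i j ((c (j+1) ^^ b) w) = (c (j+1) ^^ b) (Z i j w)
    + (if b = 0 then 0 else (c (j+1) ^^ (b-1)) (Z i (j+1) (c j w)))"
proof (induction b)
  case (Suc b)
  let ?p = "(c (j+1) ^^ b) w"
  have p: "?p \<in> H" by (rule funpow_mem[OF c_mem]) (use assms in auto)
  have q: "(c (j+1) ^^ k) y \<in> H" if "y \<in> H" for k y by (rule funpow_mem[OF c_mem]) (use assms that in auto)
  have *: "Z i j (c (j+1) ?p) = c (j+1) (Z i j ?p) + Z i (j+1) (c j ?p)"
    by (rule Z_c_next) (use assms p in auto)
  show ?case
  proof (cases b)
    case 0
    then show ?thesis using * by simp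
  next
    case (Suc d)
    have d: "(c (j+1) ^^ d) w \<in> H" by (rule q[OF assms(4)])
    have "c j ?p = 0" using Suc c_row[of j "j+1" "(c (j+1) ^^ d) w"] assms d by simp
    then have "Z i j (c (j+1) ?p) = c (j+1) (Z i j ?p)" using * assms lin_zero(1)[of i "j+1"] by simp
    also have "Z i j ?p = (c (j+1) ^^ b) (Z i j w) + (c (j+1) ^^ d) (Z i (j+1) (c j w))"
      using Suc.IH Suc by simp
    also have "c (j+1) \<dots> = c (j+1) ((c (j+1) ^^ b) (Z i j w)) + c (j+1) ((c (j+1) ^^ d) (Z i (j+1) (c j w)))"
      by (rule lin_add(3)) (use assms in \<open>auto intro!: q[simplified] mem\<close>)
    finally show ?thesis using Suc by simp
  qed
qed simp

lemma Z_c_pow_same: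
  assumes "1 \<le> i" "i \<le> n" "1 \<le> j" "j \<le> n+1" "w \<in> H"
  shows "Z i j ((c j ^^ b) w) = (if b = 0 then Z i j w else 0)"
proof (cases b)
  case (Suc k)
  have "(c j ^^ k) w \<in> H" by (rule funpow_mem[OF c_mem]) (use assms in auto)
  then show ?thesis using Suc Z_c_col[of i j "(c j ^^ k) w"] assms by simp
qed simp

text \<open>\<open>Z i j\<close> passes every factor except those of columns \<open>j\<close> and
  \<open>j+1\<close>. Reaching a factor \<open>c j\<close> unchanged gives 0; the correction at
  \<open>c (j+1)\<close> moves one unit of exponent from \<open>j+1\<close> to \<open>j\<close> and
  turns \<open>Z i j\<close> into \<open>Z i (j+1)\<close>, which then commutes down to
  \<open>y\<close>.\<close>

lemma Z_mon_upper:
  assumes "1 \<le> i" "i \<le> j" "j \<le> n" "1 \<le> l" "l \<le> j" "y \<in> H"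
  shows "Z i j (mon c a l (n+2) y) = (if a j = 0 then mon c a l (n+2) (Z i j y) else 0)
    + (if a (j+1) = 0 then 0 else mon c (a(j := Suc (a j), j+1 := a (j+1) - 1)) l (n+2) (Z i (j+1) y))"
proof -
  have cH: "\<And>t x. 1 \<le> t \<Longrightarrow> t < n+2 \<Longrightarrow> x \<in> H \<Longrightarrow> c t x \<in> H" by (rule c_mem) auto
  let ?m = "mon c a l j y" and ?M = "mon c a (j+2) (n+2)"
  have bM: "blin H H ?M" by (rule blin_mon) (use assms in \<open>auto intro!: c_blin\<close>)
  have m: "?m \<in> H" by (rule mon_mem) (use assms in \<open>auto intro!: cH\<close>)
  let ?w = "(c j ^^ a j) ?m"
  have w: "?w \<in> H" by (rule funpow_mem[OF c_mem]) (use assms m in auto)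
  have p: "(c (j+1) ^^ k) x \<in> H" if "x \<in> H" for k x by (rule funpow_mem[OF c_mem]) (use assms that in auto)
  have dec: "mon c b l (n+2) x = mon c b (j+2) (n+2) ((c (j+1) ^^ b (j+1)) ((c j ^^ b j) (mon c b l j x)))" for b x
    using mon_split[of l j "n+2" c b x] mon_Suc_first[of j "n+2" c b "mon c b l j x"]
      mon_Suc_first[of "j+1" "n+2" c b] assms by simp
  have "Z i j (mon c a l (n+2) y) = ?M (Z i j ((c (j+1) ^^ a (j+1)) ?w))"
    unfolding dec[of a y]
    by (rule mon_commute[where H = H]) (use assms p[OF w] in \<open>auto intro!: Z_c_greater cH\<close>)
  also have "Z i j ((c (j+1) ^^ a (j+1)) ?w) = (c (j+1) ^^ a (j+1)) (Z i j ?w)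
      + (if a (j+1) = 0 then 0 else (c (j+1) ^^ (a (j+1) - 1)) (Z i (j+1) (c j ?w)))"
    by (rule Z_c_next_pow) (use assms w in auto)
  also have "?M \<dots> = ?M ((c (j+1) ^^ a (j+1)) (Z i j ?w))
      + ?M (if a (j+1) = 0 then 0 else (c (j+1) ^^ (a (j+1) - 1)) (Z i (j+1) (c j ?w)))"
    by (rule blinD(2)[OF bM]) (use assms w Hs(3) in \<open>auto intro!: p[simplified] mem\<close>)
  also have "?M ((c (j+1) ^^ a (j+1)) (Z i j ?w)) = (if a j = 0 then mon c a l (n+2) (Z i j y) else 0)"
  proof -
    have "Z i j ?w = (if a j = 0 then Z i j ?m else 0)" by (rule Z_c_pow_same) (use assms m in auto)
    moreover have "Z i j ?m = mon c a l j (Z i j y)"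
      by (rule mon_commute[where H = H]) (use assms in \<open>auto intro!: Z_c_less cH\<close>)
    moreover have "(c (j+1) ^^ k) 0 = 0" for k
      by (rule blin_zero[OF blin_funpow[OF c_blin] Hs(2)]) (use assms in auto)
    ultimately show ?thesis using blin_zero[OF bM Hs(2)] dec[of a "Z i j y"] by simp
  qed
  also have "?M (if a (j+1) = 0 then 0 else (c (j+1) ^^ (a (j+1) - 1)) (Z i (j+1) (c j ?w)))
    = (if a (j+1) = 0 then 0 else mon c (a(j := Suc (a j), j+1 := a (j+1) - 1)) l (n+2) (Z i (j+1) y))"
  proof (cases "a (j+1) = 0")
    case True
    then show ?thesis using blin_zero[OF bM Hs(2)] by simp
  next
    case False
    let ?b = "a(j := Suc (a j), j+1 := a (j+1) - 1)"
    have "Z i (j+1) ((c j ^^ Suc (a j)) ?m) = (c j ^^ Suc (a j)) (Z i (j+1) ?m)"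
      by (rule funpow_commute[where H = H]) (use assms m in \<open>auto intro!: Z_c_less c_mem\<close>)
    moreover have "Z i (j+1) ?m = mon c a l j (Z i (j+1) y)"
      by (rule mon_commute[where H = H]) (use assms in \<open>auto intro!: Z_c_less cH\<close>)
    moreover have "mon c a l j x = mon c ?b l j x" for x by (rule mon_cong) auto
    moreover have "?M x = mon c ?b (j+2) (n+2) x" for x by (rule mon_cong) auto
    ultimately show ?thesis using False dec[of ?b "Z i (j+1) y"] by simp
  qed
  finally show ?thesis .
qed

lemma Z_mon_last:
  assumes "1 \<le> i" "i \<le> n" "1 \<le> l" "l \<le> n+1" "y \<in> H"
  shows "Z i (n+1) (mon c a l (n+2) y) = (if a (n+1) = 0 then mon c a l (n+2) (Z i (n+1) y) else 0)"
proof -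
  let ?m = "mon c a l (n+1) y"
  have m: "?m \<in> H" by (rule mon_mem) (use assms in \<open>auto intro!: c_mem\<close>)
  have "Z i (n+1) ((c (n+1) ^^ a (n+1)) ?m) = (if a (n+1) = 0 then Z i (n+1) ?m else 0)"
    by (rule Z_c_pow_same) (use assms m in auto)
  moreover have "Z i (n+1) ?m = mon c a l (n+1) (Z i (n+1) y)"
    by (rule mon_commute[where H = H]) (use assms in \<open>auto intro!: Z_c_less[of i _ "n+1",simplified] c_mem\<close>)
  moreover have "mon c a l (n+2) x = (c (n+1) ^^ a (n+1)) (mon c a l (n+1) x)" for x
    using mon_last[of l "n+1" c a x] assms by simp
  moreover have "(c (n+1) ^^ k) 0 = 0" for k
    by (rule blin_zero[OF blin_funpow[OF c_blin] Hs(2)]) auto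
  ultimately show ?thesis by auto
qed

end

section \<open>Representations with a fixed first nonzero entry in the last row\<close>

text \<open>The locale asks only that the row vanish before column \<open>r\<close>. That
  \<open>c r\<close> itself is nonzero is brought in later, by a vector with nonzero image.\<close>

locale SU0_row = SU0_ops n H Z for n :: nat and H :: "'h::chilbert_space set" and Z +
  fixes r :: nat
  assumes r1: "1 \<le> r" and rn: "r \<le> n"
    and c_below: "\<lbrakk>1 \<le> j; j < r; x \<in> H\<rbrakk> \<Longrightarrow> c j x = 0"
begin

lemma cs_below: "\<lbrakk>1 \<le> j; j < r; x \<in> H\<rbrakk> \<Longrightarrow> cs j x = 0"
proof (rule cinner_eqI[OF H])
  fix w assume a: "1 \<le> j" "j < r" "x \<in> H" and w: "w \<in> H"
  show "cinner w (cs j x) = cinner w 0" using cs_adj[of j w x] c_below[of j w] a w rn by simp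
qed (use rn Hs(3) in \<open>auto intro!: cs_mem\<close>)

text \<open>All earlier terms of \<open>cs_c_sum\<close> vanish. Being a normal partial isometry,
  \<open>c r\<close> is unitary on its range.\<close>

lemma c_r_normal: "x \<in> H \<Longrightarrow> cs r (c r x) = c r (cs r x)"
proof -
  assume x: "x \<in> H"
  have "(\<Sum>m=1..r. c m (cs m x)) = c r (cs r x)"
    by (rule sum_single_term) (use x r1 rn in \<open>auto simp: cs_below lin_zero\<close>)
  then show ?thesis using cs_c_sum[of r x] x r1 rn by simp
qed

text \<open>For entries below the diagonal the relations do not give this, and the sphere structure
  replaces them. Downward induction on \<open>l\<close>: \<open>cs l (c l x)\<close> is
  \<open>x\<close> minus the later terms of the resolution, so \<open>Z i j\<close> commutes with
  it. As \<open>Z i j\<close> commutes with the \<open>cs m\<close>, where column \<open>j\<close>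
  causes no trouble because it is zero, it maps the range of \<open>c l\<close> into itself;
  combining both with \<open>c_cs_c\<close> gives the claim.\<close>

lemma Z_c_below:
  assumes "1 \<le> i" "i \<le> n" "1 \<le> j" "j < r" "1 \<le> l" "l \<le> n+1" "x \<in> H"
  shows "Z i j (c l x) = c l (Z i j x)"
  using assms(5-7)
proof (induction "n+1-l" arbitrary: l x rule: less_induct)
  case less
  show ?case
  proof (cases "l = j")
    case True
    then show ?thesis
      using c_below[of j x] c_below[of j "Z i j x"] Z_mem[of i j x] assms less.prems lin_zero(1)[of i j] rn by simp
  next
    case False
    have jN: "j \<le> n+1" using assms rn by simp
    have bl: "blin H H (Z i j)" by (rule Z_blin) (use assms rn in auto)
    have Zx: "Z i j x \<in> H" using assms less.prems rn by (intro Z_mem) auto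
    have q: "cs l (c l y) = y - (\<Sum>m=l+1..n+1. c m (cs m y))" if y: "y \<in> H" for y
    proof -
      have "(\<Sum>m=1..n+1. c m (cs m y)) = (\<Sum>m=1..l. c m (cs m y)) + (\<Sum>m=l+1..n+1. c m (cs m y))"
        using sum.ub_add_nat[of 1 l "\<lambda>m. c m (cs m y)" "n+1-l"] less.prems by simp
      then have "cs l (c l y) + (\<Sum>m=l+1..n+1. c m (cs m y)) = y"
        using cs_c_sum[OF less.prems(1,2) y] resolution[OF y] by (simp only:)
      then show ?thesis by (simp only: eq_diff_eq)
    qed
    have commutes: "Z i j (c m (cs m x)) = c m (cs m (Z i j x))" if m: "1 \<le> m" "l < m" "m \<le> n+1" for m
    proof (cases "m = j")
      case True
      then show ?thesis
        using cs_below[of j x] cs_below[of j "Z i j x"] Zx assms less.prems rn lin_zero(1)[of i j] lin_zero(3)[of j]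
        by simp
    next
      case ne: False
      have "Z i j (c m (cs m x)) = c m (Z i j (cs m x))"
        by (rule less.hyps) (use m less.prems in \<open>auto intro!: cs_mem\<close>)
      also have "Z i j (cs m x) = cs m (Z i j x)" by (rule Z_cs) (use m ne assms jN less.prems in auto)
      finally show ?thesis .
    qed
    have mH: "c m (cs m x) \<in> H" if "1 \<le> m" "m \<le> n+1" for m using that less.prems by (simp add: c_mem cs_mem)
    have "Z i j (cs l (c l x)) = Z i j x - Z i j (\<Sum>m=l+1..n+1. c m (cs m x))"
      unfolding q[OF less.prems(3)]
    proof (rule blin_diff[OF bl Hs(2) less.prems(3)], rule Hs(8))
      show "c m (cs m x) \<in> H" if "m \<in> {l+1..n+1}" for m using that by (intro mH) auto
    qed
    also have "Z i j (\<Sum>m=l+1..n+1. c m (cs m x)) = (\<Sum>m=l+1..n+1. c m (cs m (Z i j x)))"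
      using blin_sum[OF bl Hs(2), of "{l+1..n+1}" "\<lambda>m. c m (cs m x)"] mH commutes less.prems by simp
    also have "Z i j x - \<dots> = cs l (c l (Z i j x))" using q[OF Zx] by simp
    finally have comm: "Z i j (cs l (c l x)) = cs l (c l (Z i j x))" .
    let ?y = "c l x"
    have y: "?y \<in> H" using less.prems by (intro c_mem)
    have Zy: "Z i j ?y \<in> H" using assms y jN by (intro Z_mem) auto
    have "Z i j ?y = (\<Sum>m=1..n+1. c m (cs m (Z i j ?y)))" using resolution[OF Zy] by simp
    also have "\<dots> = c l (cs l (Z i j ?y))"
    proof (rule sum_single_term)
      fix m assume m: "m \<in> {1..n+1}" "m \<noteq> l"
      show "c m (cs m (Z i j ?y)) = 0"
      proof (cases "m = j")
        case True
        then show ?thesis using c_below[of j "cs j (Z i j ?y)"] cs_mem[of j] Zy assms jN by simp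
      next
        case ne: False
        have "cs m (Z i j ?y) = Z i j (cs m ?y)"
          by (rule Z_cs[symmetric]) (use m ne assms jN y in auto)
        also have "cs m ?y = 0" by (rule cs_c_orth) (use m less.prems in auto)
        finally show ?thesis using m assms jN lin_zero(1)[of i j] lin_zero(3)[of m] by simp
      qed
    qed (use less.prems in auto)
    also have "cs l (Z i j ?y) = Z i j (cs l ?y)"
      by (rule Z_cs[symmetric]) (use False assms jN less.prems y in auto)
    also have "\<dots> = cs l (c l (Z i j x))" by (rule comm)
    also have "c l \<dots> = c l (Z i j x)" by (rule c_cs_c) (use less.prems Zx in auto)
    finally show ?thesis .
  qed
qed

text \<open>The initial space of \<open>c r\<close>, which by normality is also its range. On it
  \<open>c r\<close> and \<open>cs r\<close> are mutually inverse isometries.\<close>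

definition H0 :: "'h set" where "H0 = {x \<in> H. cs r (c r x) = x}"

lemma r_bounds: "1 \<le> r" "r \<le> n+1" "r + 1 \<le> n+1"
  using r1 rn by auto

lemma H0_H: "x \<in> H0 \<Longrightarrow> x \<in> H"
  by (simp add: H0_def)

lemma H0_c_cs: "x \<in> H0 \<Longrightarrow> c r (cs r x) = x"
  using c_r_normal[of x] by (simp add: H0_def)

lemma H0_cs_c: "x \<in> H0 \<Longrightarrow> cs r (c r x) = x"
  by (simp add: H0_def)

lemma c_H0: "x \<in> H \<Longrightarrow> c r x \<in> H0"
  using c_r_normal[of "c r x"] c_cs_c[of r x] r_bounds by (simp add: H0_def c_mem)

lemma cs_H0: "x \<in> H0 \<Longrightarrow> cs r x \<in> H0"
  using H0_c_cs[of x] H0_H[of x] r_bounds by (simp add: H0_def cs_mem)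

lemma csp_H0: "x \<in> H0 \<Longrightarrow> (cs r ^^ k) x \<in> H0"
  by (rule funpow_mem[OF cs_H0])

lemma c_csp: "x \<in> H0 \<Longrightarrow> c r ((cs r ^^ Suc k) x) = (cs r ^^ k) x"
  using H0_c_cs[OF csp_H0] by simp

lemma csp_c: "x \<in> H0 \<Longrightarrow> (cs r ^^ Suc k) (c r x) = (cs r ^^ k) x"
  using H0_cs_c by (simp add: funpow_swap1)

lemma cs_cinner_H0: "x \<in> H0 \<Longrightarrow> y \<in> H0 \<Longrightarrow> cinner (cs r x) (cs r y) = cinner x y"
  using cs_adj[of r "cs r x" y] cs_mem[of r x] H0_H[of x] H0_H[of y] H0_c_cs[of x] r_bounds by simp

lemma csp_cinner: "x \<in> H0 \<Longrightarrow> y \<in> H0 \<Longrightarrow> cinner ((cs r ^^ k) x) ((cs r ^^ k) y) = cinner x y"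
  by (induction k) (simp_all add: cs_cinner_H0 csp_H0)

text \<open>\<open>H0\<close> is contained in the range of \<open>c r\<close>, which is orthogonal
  to the ranges of the later entries.\<close>

lemma H0_ker: "x \<in> H0 \<Longrightarrow> x \<in> ker_from (r+1)"
  unfolding ker_from_def
proof (intro CollectI conjI allI impI)
  assume x: "x \<in> H0"
  fix m assume m: "r + 1 \<le> m \<and> m \<le> n+1"
  have "cs m (c r (cs r x)) = 0"
    by (rule cs_c_orth) (use m r_bounds cs_mem[of r x] H0_H[OF x] in auto)
  then show "cs m x = 0" using H0_c_cs[OF x] by simp
qed (rule H0_H)

lemma Z_c_r: "\<lbrakk>1 \<le> i; i \<le> n; 1 \<le> j; j \<le> n+1; j \<noteq> r; x \<in> H\<rbrakk> \<Longrightarrow> Z i j (c r x) = c r (Z i j x)"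
  using Z_c_less[of i r j x] Z_c_below[of i j r x] r1 rn by (cases "r < j") simp_all

lemma Z_cs_r: "\<lbrakk>1 \<le> i; i \<le> n; 1 \<le> j; j \<le> n+1; j \<noteq> r; x \<in> H\<rbrakk> \<Longrightarrow> Z i j (cs r x) = cs r (Z i j x)"
  using r1 rn by (intro Z_cs) auto

lemma Z_H0:
  assumes "1 \<le> i" "i \<le> n" "1 \<le> j" "j \<le> n+1" "j \<noteq> r" "x \<in> H0"
  shows "Z i j x \<in> H0"
proof -
  note x = H0_H[OF assms(6)]
  have "cs r (c r (Z i j x)) = cs r (Z i j (c r x))" using assms x by (simp add: Z_c_r)
  also have "\<dots> = Z i j (cs r (c r x))"
    using assms x r_bounds by (intro Z_cs_r[symmetric]) (auto intro: c_mem)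
  also have "cs r (c r x) = x" by (rule H0_cs_c[OF assms(6)])
  finally show ?thesis using Z_mem[of i j x] assms x by (simp add: H0_def)
qed

lemma Zs_c_r: "\<lbrakk>1 \<le> i; i \<le> n; 1 \<le> j; j \<le> n+1; j \<noteq> r; x \<in> H\<rbrakk> \<Longrightarrow> Zs i j (c r x) = c r (Zs i j x)"
  using r1 rn by (intro Zs_c) auto

lemma Zs_cs_r:
  assumes "1 \<le> i" "i \<le> n" "1 \<le> j" "j \<le> n+1" "j \<noteq> r" "x \<in> H"
  shows "Zs i j (cs r x) = cs r (Zs i j x)"
proof -
  have "adjoint_op H (Z i j) (adjoint_op H (c r) x) = adjoint_op H (c r) (adjoint_op H (Z i j) x)"
  proof (rule adjoint_commute[OF H])
    show "Z i j (c r y) = c r (Z i j y)" if "y \<in> H" for y by (rule Z_c_r) (use assms that in auto)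
  qed (use assms r_bounds in \<open>auto intro!: Z_bounded c_bounded\<close>)
  then show ?thesis by (simp only: Zs_def cs_def c_def)
qed

lemma Zs_H0:
  assumes "1 \<le> i" "i \<le> n" "1 \<le> j" "j \<le> n+1" "j \<noteq> r" "x \<in> H0"
  shows "Zs i j x \<in> H0"
proof -
  note x = H0_H[OF assms(6)]
  have "cs r (c r (Zs i j x)) = cs r (Zs i j (c r x))" using assms x by (simp add: Zs_c_r)
  also have "\<dots> = Zs i j (cs r (c r x))"
    using assms x r_bounds by (intro Zs_cs_r[symmetric]) (auto intro: c_mem)
  also have "cs r (c r x) = x" by (rule H0_cs_c[OF assms(6)])
  finally show ?thesis using Zs_mem[of i j x] assms x by (simp add: H0_def)
qed

lemma Z_csp: "\<lbrakk>1 \<le> i; i \<le> n; 1 \<le> j; j \<le> n+1; j \<noteq> r; x \<in> H\<rbrakk> \<Longrightarrow> Z i j ((cs r ^^ k) x) = (cs r ^^ k) (Z i j x)"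
  by (rule funpow_commute[where H = H]) (use r_bounds in \<open>auto intro!: Z_cs_r cs_mem\<close>)

lemma Z_r_H0:
  assumes "1 \<le> i" "i \<le> n" "x \<in> H0"
  shows "Z i r x = 0"
proof -
  have "Z i r (c r (cs r x)) = 0"
    by (rule Z_c_col) (use assms r_bounds cs_mem[of r x] H0_H[of x] in auto)
  then show ?thesis using H0_c_cs[OF assms(3)] by simp
qed

section \<open>The action of generators and their adjoints on the monomials\<close>

abbreviation pm :: "(nat \<Rightarrow> nat) \<Rightarrow> 'h \<Rightarrow> 'h" where "pm a \<equiv> mon c a (r+1) (n+2)"

lemma pm_blin: "blin H H (pm a)"
  by (rule blin_mon) (use r1 in \<open>auto intro!: c_blin\<close>)

lemmas pm_mem = blinD(1)[OF pm_blin] and pm_zero = blin_zero[OF pm_blin Hs(2)]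

lemma pm_gram:
  assumes "h \<in> H0" "h' \<in> H0"
  shows "cinner (pm a h) (pm b h') = (if \<forall>t. r < t \<and> t \<le> n+1 \<longrightarrow> a t = b t then cinner h h' else 0)"
proof -
  have "(\<forall>t. r+1 \<le> t \<and> t < n+2 \<longrightarrow> a t = b t) = (\<forall>t. r < t \<and> t \<le> n+1 \<longrightarrow> a t = b t)" by auto
  then show ?thesis using mon_gram[of "r+1" "n+2" h h' a b] H0_ker assms rn by simp
qed

lemma Z_pm_upper:
  assumes "1 \<le> i" "i \<le> j" "j \<le> n" "r < j" "y \<in> H"
  shows "Z i j (pm a y) = (if a j = 0 then pm a (Z i j y) else 0)
    + (if a (j+1) = 0 then 0 else pm (a(j := Suc (a j), j+1 := a (j+1) - 1)) (Z i (j+1) y))"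
  by (rule Z_mon_upper) (use assms in auto)

lemma Z_pm_last:
  assumes "1 \<le> i" "i \<le> n" "y \<in> H"
  shows "Z i (n+1) (pm a y) = (if a (n+1) = 0 then pm a (Z i (n+1) y) else 0)"
  by (rule Z_mon_last) (use assms rn in auto)

lemma Z_pm_r:
  assumes "1 \<le> i" "i \<le> r" "y \<in> H0"
  shows "Z i r (pm a y) = (if a (r+1) = 0 then 0 else pm (a(r+1 := a (r+1) - 1)) (c r (Z i (r+1) y)))"
proof -
  \<comment> \<open>\<open>pm\<close> starts at column \<open>r+1\<close> and leaves
    \<open>a r\<close> unread. Prefixing the factor \<open>c r\<close> with exponent 0 makes the
    general formula available for \<open>j = r\<close>.\<close>
  let ?a = "a(r := 0)"
  have yH: "y \<in> H" by (rule H0_H[OF assms(3)])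
  have low: "mon c b r (n+2) x = pm b ((c r ^^ b r) x)" for b x
    using mon_Suc_first[of r "n+2" c b x] rn by simp
  have ac: "mon c ?a (Suc r) (n+2) x = pm a x" for x by (simp, rule mon_cong) auto
  have "Z i r (pm a y) = Z i r (mon c ?a r (n+2) y)" using low[of ?a y] ac by simp
  also have "\<dots> = (if ?a r = 0 then mon c ?a r (n+2) (Z i r y) else 0)
    + (if ?a (r+1) = 0 then 0 else mon c (?a(r := Suc (?a r), r+1 := ?a (r+1) - 1)) r (n+2) (Z i (r+1) y))"
    by (rule Z_mon_upper) (use assms yH r1 rn in auto)
  also have "Z i r y = 0" using assms rn by (intro Z_r_H0) auto
  also have "mon c ?a r (n+2) 0 = 0" using low[of ?a 0] ac pm_zero by simp
  also have "mon c (?a(r := Suc (?a r), r+1 := ?a (r+1) - 1)) r (n+2) (Z i (r+1) y)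
      = pm (a(r+1 := a (r+1) - 1)) (c r (Z i (r+1) y))"
    unfolding low by (simp, rule mon_cong) auto
  finally show ?thesis by simp
qed

lemma Z_pm_below:
  assumes "1 \<le> i" "i \<le> n" "1 \<le> j" "j < r" "y \<in> H"
  shows "Z i j (pm a y) = pm a (Z i j y)"
  by (rule mon_commute[where H = H]) (use assms in \<open>auto intro!: Z_c_below c_mem\<close>)

text \<open>A factor with a larger index to the right of \<open>c j\<close> gives 0 by the row
  relation; otherwise \<open>c j\<close> is the leftmost factor and merges with its own
  power.\<close>

lemma c_pm:
  assumes "r < j" "j \<le> n+1" "y \<in> H"
  shows "c j (pm a y) = (if \<forall>t. j < t \<and> t \<le> n+1 \<longrightarrow> a t = 0 then pm (a(j := Suc (a j))) y else 0)"
proof -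
  let ?m = "mon c a (r+1) j y"
  have m: "?m \<in> H" by (rule mon_mem) (use assms in \<open>auto intro!: c_mem\<close>)
  have p: "(c j ^^ k) ?m \<in> H" for k by (rule funpow_mem[OF c_mem m]) (use assms in auto)
  have dec: "pm b y = mon c b (j+1) (n+2) ((c j ^^ b j) (mon c b (r+1) j y))" for b
    using mon_split[of "r+1" j "n+2" c b y] mon_Suc_first[of j "n+2" c b "mon c b (r+1) j y"] assms by simp
  have eq: "(\<forall>t. j+1 \<le> t \<and> t < n+2 \<longrightarrow> a t = 0) = (\<forall>t. j < t \<and> t \<le> n+1 \<longrightarrow> a t = 0)" by auto
  have "c j (pm a y) = (if \<forall>t. j < t \<and> t \<le> n+1 \<longrightarrow> a t = 0 then c j ((c j ^^ a j) ?m) else 0)"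
    unfolding dec[of a] using c_mon_row[of j "j+1" "n+2" "(c j ^^ a j) ?m" a, unfolded eq] p assms by simp
  also have "\<dots> = (if \<forall>t. j < t \<and> t \<le> n+1 \<longrightarrow> a t = 0 then pm (a(j := Suc (a j))) y else 0)"
  proof (cases "\<forall>t. j < t \<and> t \<le> n+1 \<longrightarrow> a t = 0")
    case True
    let ?b = "a(j := Suc (a j))"
    have "mon c ?b (j+1) (n+2) x = mon c (\<lambda>_. 0) (j+1) (n+2) x" for x
      by (rule mon_cong) (use True in auto)
    moreover have "mon c (\<lambda>_. 0) l u x = x" for l u x by (rule mon_exp_zero) simp
    moreover have "mon c ?b (r+1) j y = ?m" by (rule mon_cong) auto
    ultimately have "pm ?b y = c j ((c j ^^ a j) ?m)" using dec[of ?b] by simp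
    then show ?thesis using True by simp
  next
    case False
    then show ?thesis by (simp only: if_False)
  qed
  finally show ?thesis .
qed

lemma c_r_pm:
  assumes "y \<in> H"
  shows "c r (pm a y) = (if \<forall>t. r < t \<and> t \<le> n+1 \<longrightarrow> a t = 0 then pm a (c r y) else 0)"
proof -
  have eq: "(\<forall>t. r+1 \<le> t \<and> t < n+2 \<longrightarrow> a t = 0) = (\<forall>t. r < t \<and> t \<le> n+1 \<longrightarrow> a t = 0)" by auto
  have "pm a x = x" if "\<forall>t. r < t \<and> t \<le> n+1 \<longrightarrow> a t = 0" for x
    by (rule mon_exp_zero) (use that in auto)
  moreover have "c r (pm a y) = (if \<forall>t. r < t \<and> t \<le> n+1 \<longrightarrow> a t = 0 then c r y else 0)"
    unfolding eq[symmetric] by (rule c_mon_row) (use assms r1 in auto)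
  ultimately show ?thesis by metis
qed

text \<open>The exponent moves in the opposite direction to \<open>Z_pm_upper\<close>.
  \<open>Zs i j\<close> commutes with every \<open>c l\<close> except \<open>c j\<close>; when it
  meets one, \<open>Zs_c_same\<close> replaces that factor by \<open>c (j+1)\<close>, and the
  additional \<open>cs j (c j _)\<close> disappears because its argument lies in
  \<open>ker_from (Suc j)\<close>.\<close>

lemma Zs_pm_upper:
  assumes "1 \<le> i" "i \<le> j" "j \<le> n" "r < j" "h \<in> H0"
  shows "Zs i j (pm a h) = (if a j = 0 then pm a (Zs i j h)
    else pm (a(j := a j - 1, j+1 := Suc (a (j+1)))) (Zs i (j+1) h))"
proof -
  have hH: "h \<in> H" by (rule H0_H[OF assms(5)])
  let ?m = "mon c a (r+1) j h"
  have m: "?m \<in> H" by (rule mon_mem) (use assms hH in \<open>auto intro!: c_mem\<close>)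
  have p: "(c j ^^ k) ?m \<in> H" for k by (rule funpow_mem[OF c_mem m]) (use assms in auto)
  have dec: "pm b x = mon c b (j+1) (n+2) ((c j ^^ b j) (mon c b (r+1) j x))" for b x
    using mon_split[of "r+1" j "n+2" c b x] mon_Suc_first[of j "n+2" c b "mon c b (r+1) j x"] assms by simp
  have *: "Zs i j (pm a h) = mon c a (j+1) (n+2) (Zs i j ((c j ^^ a j) ?m))"
    unfolding dec[of a h]
    by (rule mon_commute[where H = H]) (use assms p in \<open>auto intro!: Zs_c c_mem\<close>)
  show ?thesis
  proof (cases "a j")
    case 0
    have "Zs i j ?m = mon c a (r+1) j (Zs i j h)"
      by (rule mon_commute[where H = H]) (use assms hH in \<open>auto intro!: Zs_c c_mem\<close>)
    then show ?thesis using * 0 dec[of a "Zs i j h"] by simp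
  next
    case (Suc k)
    let ?h = "Zs i (j+1) h"
    have h': "?h \<in> H0" by (rule Zs_H0) (use assms in auto)
    let ?v = "(c j ^^ k) (mon c a (r+1) j ?h)"
    have "mon c a (r+1) j ?h \<in> ker_from j"
      using mon_gram[of "r+1" j ?h ?h a a] H0_ker[OF h'] assms by simp
    then have v: "?v \<in> ker_from (Suc j)" by (rule c_pow_ker[rotated 2]) (use assms in auto)
    have "Zs i j (c j ((c j ^^ k) ?m)) = c (j+1) (cs j (c j (Zs i (j+1) ((c j ^^ k) ?m))))"
      by (rule Zs_c_same) (use assms p in auto)
    also have "Zs i (j+1) ((c j ^^ k) ?m) = (c j ^^ k) (Zs i (j+1) ?m)"
      by (rule funpow_commute[where H = H]) (use assms m in \<open>auto intro!: Zs_c c_mem\<close>)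
    also have "Zs i (j+1) ?m = mon c a (r+1) j ?h"
      by (rule mon_commute[where H = H]) (use assms hH in \<open>auto intro!: Zs_c c_mem\<close>)
    also have "cs j (c j ?v) = ?v" by (rule cs_c_ker) (use assms v in auto)
    finally have e: "Zs i j ((c j ^^ a j) ?m) = c (j+1) ?v" using Suc by simp
    let ?b = "a(j := a j - 1, j+1 := Suc (a (j+1)))"
    have "mon c a (j+1) (n+2) (c (j+1) ?v) = mon c a (j+2) (n+2) ((c (j+1) ^^ a (j+1)) (c (j+1) ?v))"
      using mon_Suc_first[of "j+1" "n+2" c a "c (j+1) ?v"] assms by simp
    also have "(c (j+1) ^^ a (j+1)) (c (j+1) ?v) = (c (j+1) ^^ ?b (j+1)) ?v" by (simp add: funpow_swap1)
    also have "mon c a (j+2) (n+2) \<dots> = mon c ?b (j+2) (n+2) \<dots>" by (rule mon_cong) auto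
    also have "\<dots> = mon c ?b (j+1) (n+2) ?v"
      using mon_Suc_first[of "j+1" "n+2" c ?b ?v] assms by simp
    also have "\<dots> = pm ?b ?h"
      using dec[of ?b ?h] Suc mon_cong[of "r+1" j a ?b c ?h] by simp
    finally show ?thesis using * e Suc by simp
  qed
qed

lemma Zs_pm_last:
  assumes "1 \<le> i" "i \<le> n" "h \<in> H0"
  shows "Zs i (n+1) (pm a h) = (if a (n+1) = 0 then pm a (Zs i (n+1) h) else 0)"
proof -
  have hH: "h \<in> H" by (rule H0_H[OF assms(3)])
  let ?m = "mon c a (r+1) (n+1) h"
  have m: "?m \<in> H" by (rule mon_mem) (use assms hH in \<open>auto intro!: c_mem\<close>)
  have p: "(c (n+1) ^^ k) ?m \<in> H" for k by (rule funpow_mem[OF c_mem m]) auto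
  have dec: "pm a x = (c (n+1) ^^ a (n+1)) (mon c a (r+1) (n+1) x)" for x
    using mon_last[of "r+1" "n+1" c a x] rn by simp
  have "Zs i (n+1) ?m = mon c a (r+1) (n+1) (Zs i (n+1) h)"
    by (rule mon_commute[where H = H]) (use assms hH in \<open>auto intro!: Zs_c[of i "n+1", simplified] c_mem\<close>)
  moreover have "Zs i (n+1) (c (n+1) ((c (n+1) ^^ k) ?m)) = 0" for k
    by (rule Zs_c_last) (use assms p in auto)
  ultimately show ?thesis unfolding dec by (cases "a (n+1)") auto
qed

lemma Zs_pm_r:
  assumes "1 \<le> i" "i \<le> r" "h \<in> H0"
  shows "Zs i r (pm a h) = pm (a(r+1 := Suc (a (r+1)))) (Zs i (r+1) (cs r h))"
proof -
  have hH: "h \<in> H" by (rule H0_H[OF assms(3)])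
  let ?h = "Zs i (r+1) (cs r h)"
  have h': "?h \<in> H0" by (rule Zs_H0) (use assms rn in \<open>auto intro!: cs_H0\<close>)
  have "Zs i r (pm a h) = pm a (Zs i r h)"
    by (rule mon_commute[where H = H]) (use assms rn hH in \<open>auto intro!: Zs_c c_mem\<close>)
  \<comment> \<open>\<open>Zs_c_same\<close> needs a vector in the range of \<open>c r\<close>, and
    \<open>h \<in> H0\<close> is one. This is where the factor \<open>cs r\<close> of the result
    originates.\<close>
  also have "Zs i r h = Zs i r (c r (cs r h))" by (simp add: H0_c_cs[OF assms(3)])
  also have "\<dots> = c (r+1) (cs r (c r ?h))"
    by (rule Zs_c_same) (use assms rn hH r_bounds in \<open>auto intro!: cs_mem\<close>)
  also have "cs r (c r ?h) = ?h" by (rule H0_cs_c[OF h'])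
  also have "pm a (c (r+1) ?h) = mon c a (r+2) (n+2) ((c (r+1) ^^ a (r+1)) (c (r+1) ?h))"
    using mon_Suc_first[of "r+1" "n+2" c a "c (r+1) ?h"] rn by simp
  also have "(c (r+1) ^^ a (r+1)) (c (r+1) ?h) = (c (r+1) ^^ Suc (a (r+1))) ?h" by (simp add: funpow_swap1)
  also have "mon c a (r+2) (n+2) \<dots> = mon c (a(r+1 := Suc (a (r+1)))) (r+2) (n+2) \<dots>"
    by (rule mon_cong) auto
  also have "\<dots> = pm (a(r+1 := Suc (a (r+1)))) ?h"
    using mon_Suc_first[of "r+1" "n+2" c "a(r+1 := Suc (a (r+1)))" ?h] rn by simp
  finally show ?thesis .
qed

lemma Zs_pm_below:
  assumes "1 \<le> i" "i \<le> n" "1 \<le> j" "j < r" "h \<in> H"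
  shows "Zs i j (pm a h) = pm a (Zs i j h)"
  by (rule mon_commute[where H = H]) (use assms rn in \<open>auto intro!: Zs_c c_mem\<close>)

subsection \<open>The monomials span an invariant subspace\<close>

definition pm_span :: "'h set" where "pm_span = clspan {pm a h | a h. h \<in> H0}"

lemma pm_in_span: "h \<in> H0 \<Longrightarrow> pm a h \<in> pm_span"
  unfolding pm_span_def using clspan_superset[of "{pm a h | a h. h \<in> H0}"] by blast

lemma hilbert_pm_span: "hilbert_subspace pm_span"
  unfolding pm_span_def by (rule hilbert_subspace_clspan)

lemma pm_span_H: "pm_span \<subseteq> H"
  unfolding pm_span_def by (rule clspan_minimal[OF _ H]) (use pm_mem H0_H in blast)

lemma pm_span_invariantI:
  assumes "blin H H T" "\<And>a h. h \<in> H0 \<Longrightarrow> T (pm a h) \<in> pm_span" "x \<in> pm_span"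
  shows "T x \<in> pm_span"
proof -
  have "pm_span \<subseteq> {x \<in> H. T x \<in> pm_span}"
    unfolding pm_span_def
    by (rule clspan_minimal[OF _ blin_preimage_hilbert[OF assms(1) H hilbert_subspace_clspan]])
      (use assms(2)[unfolded pm_span_def] pm_mem H0_H in blast)
  then show ?thesis using assms(3) by auto
qed

lemmas pm_span_zero = hilbert_subspaceD(3)[OF hilbert_pm_span]
  and pm_span_add = hilbert_subspaceD(4)[OF hilbert_pm_span]

lemma Z_pm_span_upper:
  assumes "1 \<le> i" "i \<le> j" "i \<le> n" "j \<le> n+1" "x \<in> pm_span"
  shows "Z i j x \<in> pm_span"
proof (rule pm_span_invariantI[OF Z_blin _ assms(5)])
  fix a h assume h: "h \<in> H0"
  note hH = H0_H[OF h]
  consider "j < r" | "j = r" | "r < j" "j \<le> n" | "r < j" "j = n+1" using assms by linarith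
  then show "Z i j (pm a h) \<in> pm_span"
  proof cases
    case 1
    then have "Z i j (pm a h) = pm a (Z i j h)" using assms hH by (intro Z_pm_below) auto
    moreover have "Z i j h \<in> H0" by (rule Z_H0) (use assms 1 h in auto)
    ultimately show ?thesis by (simp only: pm_in_span)
  next
    case 2
    have "c r (Z i (r+1) h) \<in> H0" by (rule c_H0) (use assms rn hH in \<open>auto intro!: Z_mem\<close>)
    then have "pm b (c r (Z i (r+1) h)) \<in> pm_span" for b by (rule pm_in_span)
    then show ?thesis using Z_pm_r[of i h a] assms 2 h pm_span_zero by auto
  next
    case 3
    have "Z i j h \<in> H0" "Z i (j+1) h \<in> H0" using assms 3 h by (auto intro!: Z_H0)
    then have "pm b (Z i j h) \<in> pm_span" "pm b (Z i (j+1) h) \<in> pm_span" for b by (simp_all only: pm_in_span)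
    then show ?thesis using Z_pm_upper[of i j h a] assms 3 hH pm_span_zero pm_span_add by auto
  next
    case 4
    have "Z i j h \<in> H0" using assms 4 h by (intro Z_H0) auto
    then have "pm a (Z i j h) \<in> pm_span" by (rule pm_in_span)
    then show ?thesis using Z_pm_last[of i h a] assms 4 hH pm_span_zero by auto
  qed
qed (use assms in auto)

lemma Zs_pm_span_upper:
  assumes "1 \<le> i" "i \<le> j" "i \<le> n" "j \<le> n+1" "x \<in> pm_span"
  shows "Zs i j x \<in> pm_span"
proof (rule pm_span_invariantI[OF Zs_blin _ assms(5)])
  fix a h assume h: "h \<in> H0"
  note hH = H0_H[OF h]
  consider "j < r" | "j = r" | "r < j" "j \<le> n" | "r < j" "j = n+1" using assms by linarith
  then show "Zs i j (pm a h) \<in> pm_span"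
  proof cases
    case 1
    then have "Zs i j (pm a h) = pm a (Zs i j h)" using assms hH by (intro Zs_pm_below) auto
    moreover have "Zs i j h \<in> H0" by (rule Zs_H0) (use assms 1 h in auto)
    ultimately show ?thesis by (simp only: pm_in_span)
  next
    case 2
    have "Zs i (r+1) (cs r h) \<in> H0" by (rule Zs_H0) (use assms rn h in \<open>auto intro!: cs_H0\<close>)
    then have "pm b (Zs i (r+1) (cs r h)) \<in> pm_span" for b by (rule pm_in_span)
    then show ?thesis using Zs_pm_r[of i h a] assms 2 h by auto
  next
    case 3
    have "Zs i j h \<in> H0" "Zs i (j+1) h \<in> H0" using assms 3 h by (auto intro!: Zs_H0)
    then have "pm b (Zs i j h) \<in> pm_span" "pm b (Zs i (j+1) h) \<in> pm_span" for b by (simp_all only: pm_in_span)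
    then show ?thesis using Zs_pm_upper[of i j h a] assms 3 h by auto
  next
    case 4
    have "Zs i j h \<in> H0" using assms 4 h by (intro Zs_H0) auto
    then have "pm a (Zs i j h) \<in> pm_span" by (rule pm_in_span)
    then show ?thesis using Zs_pm_last[of i h a] assms 4 h pm_span_zero by auto
  qed
qed (use assms in auto)

lemma c_pm_span:
  assumes "1 \<le> j" "j \<le> n+1" "x \<in> pm_span"
  shows "c j x \<in> pm_span"
proof (rule pm_span_invariantI[OF c_blin _ assms(3)])
  fix a h assume h: "h \<in> H0"
  note hH = H0_H[OF h]
  consider "j < r" | "j = r" | "r < j" by linarith
  then show "c j (pm a h) \<in> pm_span"
  proof cases
    case 1
    then show ?thesis using c_below[of j "pm a h"] assms pm_mem[OF hH] pm_span_zero by simp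
  next
    case 2
    then show ?thesis using c_r_pm[OF hH, of a] pm_in_span[OF c_H0[OF hH], of a] pm_span_zero by simp
  next
    case 3
    then show ?thesis using c_pm[of j h a] pm_in_span[OF h] assms hH pm_span_zero by simp
  qed
qed (use assms in auto)

text \<open>Upper entries and the last row act on monomials explicitly. A lower entry is a product
  of adjoints; the adjoint of a diagonal entry is again a product of diagonal entries, which
  includes the corner entry, and the superdiagonal adjoints have been treated.\<close>

lemma Z_pm_span:
  assumes "1 \<le> i" "i \<le> n+1" "1 \<le> j" "j \<le> n+1" "x \<in> pm_span"
  shows "Z i j x \<in> pm_span"
proof -
  have diag: "Z t t x \<in> pm_span" if "1 \<le> t" "t \<le> n+1" "x \<in> pm_span" for t x
    using c_pm_span[of "n+1" x] Z_pm_span_upper[of t t x] that by (cases "t = n+1") (auto simp: c_def)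
  have dp: "opprod (\<lambda>t. Z t t) a b x \<in> pm_span" if "1 \<le> a" "b \<le> n+2" "x \<in> pm_span" for a b x
    by (rule opprod_mem) (use that diag in auto)
  have diag_s: "Zs t t x \<in> pm_span" if t: "1 \<le> t" "t \<le> n+1" and x: "x \<in> pm_span" for t x
  proof -
    have "Zs t t x = opprod (\<lambda>t. Z t t) 1 t (opprod (\<lambda>t. Z t t) (t+1) (n+2) x)"
      unfolding Zs_def by (rule star_diag) (use t x pm_span_H in auto)
    then show ?thesis using dp[of "t+1" "n+2" x] dp[of 1 t] t x by simp
  qed
  have da: "diag_adj a b x \<in> pm_span" if "1 \<le> a" "b \<le> n+2" "x \<in> pm_span" for a b x
  proof -
    have "foldr (\<lambda>t. Zs t t) l x \<in> pm_span" if "set l \<subseteq> {a..<b}" for l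
      using that \<open>1 \<le> a\<close> \<open>b \<le> n+2\<close> \<open>x \<in> pm_span\<close> by (induction l) (auto intro!: diag_s)
    then show ?thesis by (simp add: diag_adj_def)
  qed
  have ua: "up_adj a b x \<in> pm_span" if "1 \<le> a" "b \<le> n+1" "x \<in> pm_span" for a b x
  proof -
    have "foldr (\<lambda>t. Zs t (t+1)) l x \<in> pm_span" if "set l \<subseteq> {a..<b}" for l
      using that \<open>1 \<le> a\<close> \<open>b \<le> n+1\<close> \<open>x \<in> pm_span\<close> by (induction l) (auto intro!: Zs_pm_span_upper)
    then show ?thesis by (simp add: up_adj_def)
  qed
  consider "i = n+1" | "i \<le> n" "i \<le> j" | "i \<le> n" "j < i" using assms by linarith
  then show ?thesis
  proof cases
    case 1
    then show ?thesis using c_pm_span[of j x] assms by (simp add: c_def)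
  next
    case 2
    then show ?thesis using Z_pm_span_upper[of i j x] assms by simp
  next
    case 3
    have "Z i j x = diag_adj (i+1) (n+2) (up_adj j i (diag_adj 1 j x))"
      by (rule Z_lower_formula) (use assms 3 pm_span_H in auto)
    then show ?thesis using da[of 1 j x] ua[of j i] da[of "i+1" "n+2"] assms 3 by simp
  qed
qed

end

lemma blin_cinner: "blin H UNIV (cinner u)"
proof (rule blinI)
  show "norm (cinner u x) \<le> norm u * norm x" for x by (rule cinner_Cauchy_Schwarz)
qed (simp_all add: cinner_add_right cinner_scaleC_right scaleC_complex_def)

section \<open>Splitting off one tensor factor\<close>

text \<open>Irreducibility enters the construction of the tensor splitting through this equation
  alone.\<close>

locale SU0_total = SU0_row n H Z r for n :: nat and H :: "'h::chilbert_space set" and Z r +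
  assumes total: "pm_span = H"
begin

definition gen_index :: "((nat \<Rightarrow> nat) \<times> 'h) set" where
  "gen_index = {(a, h). a (r+1) = 0 \<and> h \<in> H0}"

definition H1 :: "'h set" where "H1 = clspan ((\<lambda>(a, h). pm a h) ` gen_index)"

lemma hilbert_H1: "hilbert_subspace H1"
  unfolding H1_def by (rule hilbert_subspace_clspan)

lemmas H1s = hilbert_subspaceD[OF hilbert_H1]

lemma pm_H1: "a (r+1) = 0 \<Longrightarrow> h \<in> H0 \<Longrightarrow> pm a h \<in> H1"
  unfolding H1_def using clspan_superset by (fastforce simp: gen_index_def)

lemma H1_eqI:
  assumes "blin H1 K T" "blin H1 L R" "\<And>a h. a (r+1) = 0 \<Longrightarrow> h \<in> H0 \<Longrightarrow> T (pm a h) = R (pm a h)" "x \<in> H1"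
  shows "T x = R x"
proof (rule clspan_blin_eqI[of "(\<lambda>(a, h). pm a h) ` gen_index" K T L R])
  show "T x = R x" if "x \<in> (\<lambda>(a, h). pm a h) ` gen_index" for x
    using that assms(3) by (auto simp: gen_index_def)
qed (use assms in \<open>simp_all only: H1_def\<close>)

text \<open>\<open>J k\<close> embeds \<open>H1\<close> as \<open>H1 \<otimes> e\<^sub>k\<close>.  The factor \<open>cs r ^^ k\<close> compensates for the unitary by which
  \<open>c r\<close> acts on \<open>H0\<close>; this makes Schur's lemma unnecessary.\<close>

lemma J_exists:
  "\<exists>U. blin H1 H U \<and> (\<forall>a h. a (r+1) = 0 \<longrightarrow> h \<in> H0 \<longrightarrow> U (pm a h) = pm (a(r+1 := k)) ((cs r ^^ k) h))
    \<and> (\<forall>x\<in>H1. \<forall>y\<in>H1. cinner (U x) (U y) = cinner x y) \<and> hilbert_subspace (U ` H1)"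
proof -
  let ?x = "\<lambda>(a, h). pm a h" and ?y = "\<lambda>(a, h). pm (a(r+1 := k)) ((cs r ^^ k) h)"
  have "cinner (?x i) (?x j) = cinner (?y i) (?y j)" if ij: "i \<in> gen_index" "j \<in> gen_index" for i j
  proof -
    obtain a h b g where e: "i = (a, h)" "j = (b, g)" by (cases i, cases j) auto
    then have m: "a (r+1) = 0" "b (r+1) = 0" "h \<in> H0" "g \<in> H0" using ij by (auto simp: gen_index_def)
    have "a t = b t \<longleftrightarrow> (a(r+1 := k)) t = (b(r+1 := k)) t" for t using m by (cases "t = r+1") auto
    then have "(\<forall>t. r < t \<and> t \<le> n+1 \<longrightarrow> a t = b t) = (\<forall>t. r < t \<and> t \<le> n+1 \<longrightarrow> (a(r+1 := k)) t = (b(r+1 := k)) t)"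
      by blast
    then have "cinner (pm a h) (pm b g) = cinner (pm (a(r+1 := k)) ((cs r ^^ k) h)) (pm (b(r+1 := k)) ((cs r ^^ k) g))"
      unfolding pm_gram[OF m(3,4)] pm_gram[OF csp_H0[OF m(3)] csp_H0[OF m(4)]] csp_cinner[OF m(3,4)] by simp
    then show ?thesis by (simp only: e prod.case)
  qed
  from gram_isometry[of gen_index ?x ?y, OF this]
  obtain U where U: "blin H1 (clspan (?y ` gen_index)) U" "\<And>i. i \<in> gen_index \<Longrightarrow> U (?x i) = ?y i"
    "\<And>u v. u \<in> H1 \<Longrightarrow> v \<in> H1 \<Longrightarrow> cinner (U u) (U v) = cinner u v"
    "U ` H1 = clspan (?y ` gen_index)"
    unfolding H1_def by blast
  have sub: "clspan (?y ` gen_index) \<subseteq> H"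
    by (rule clspan_minimal[OF _ H]) (use pm_mem H0_H csp_H0 in \<open>auto simp: gen_index_def\<close>)
  have "blin H1 H U" using U(1) sub unfolding blin_def by blast
  moreover have "U (pm a h) = pm (a(r+1 := k)) ((cs r ^^ k) h)" if "a (r+1) = 0" "h \<in> H0" for a :: "nat \<Rightarrow> nat" and h
    using U(2)[of "(a, h)"] that by (simp add: gen_index_def)
  ultimately show ?thesis using U(3,4) hilbert_subspace_clspan by metis
qed

definition J :: "nat \<Rightarrow> 'h \<Rightarrow> 'h" where
  "J k = (SOME U. blin H1 H U \<and> (\<forall>a h. a (r+1) = 0 \<longrightarrow> h \<in> H0 \<longrightarrow> U (pm a h) = pm (a(r+1 := k)) ((cs r ^^ k) h))
    \<and> (\<forall>x\<in>H1. \<forall>y\<in>H1. cinner (U x) (U y) = cinner x y) \<and> hilbert_subspace (U ` H1))"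

lemma J_props:
  shows J_blin: "blin H1 H (J k)"
    and J_gen: "a (r+1) = 0 \<Longrightarrow> h \<in> H0 \<Longrightarrow> J k (pm a h) = pm (a(r+1 := k)) ((cs r ^^ k) h)"
    and J_iso: "x \<in> H1 \<Longrightarrow> y \<in> H1 \<Longrightarrow> cinner (J k x) (J k y) = cinner x y"
    and J_image: "hilbert_subspace (J k ` H1)"
  using someI_ex[OF J_exists[of k], folded J_def] by auto

lemmas J_mem = blinD(1)[OF J_blin] and J_add = blinD(2)[OF J_blin] and J_zero = blin_zero[OF J_blin H1s(2)]

lemma J_inj:
  assumes "x \<in> H1" "y \<in> H1" "J k x = J k y"
  shows "x = y"
proof -
  have "J k (x - y) = 0" using blin_diff[OF J_blin H1s(2) assms(1,2), of k] assms(3) by simp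
  then have "cinner (x - y) (x - y) = 0"
    using J_iso[of "x - y" "x - y" k] H1s(5)[OF assms(1,2)] by simp
  then show ?thesis by (simp add: cinner_self_eq_0)
qed

text \<open>For different levels the exponents at \<open>r+1\<close> differ, so generators are
  orthogonal; this extends to \<open>H1\<close> in one argument at a time.\<close>

lemma J_gram:
  assumes x: "x \<in> H1" and y: "y \<in> H1"
  shows "cinner (J k x) (J l y) = (if k = l then cinner x y else 0)"
proof (cases "k = l")
  case True
  then show ?thesis using J_iso[OF x y] by simp
next
  case False
  have gg: "cinner (J k (pm a h)) (J l (pm b g)) = 0"
    if ab: "a (r+1) = 0" "b (r+1) = 0" "h \<in> H0" "g \<in> H0" for a b :: "nat \<Rightarrow> nat" and h g
  proof -
    have "\<not> (\<forall>t. r < t \<and> t \<le> n+1 \<longrightarrow> (a(r+1 := k)) t = (b(r+1 := l)) t)"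
      using False rn by (auto intro!: exI[of _ "r+1"])
    then show ?thesis
      unfolding J_gen[of a h, OF ab(1,3)] J_gen[of b g, OF ab(2,4)] pm_gram[OF csp_H0[OF ab(3)] csp_H0[OF ab(4)]]
      by (simp only: if_False)
  qed
  have bz: "blin H1 UNIV (\<lambda>x. 0 :: complex)" by (rule blin_const_0) (rule hilbert_subspaceD(2)[OF hilbert_subspace_UNIV])
  have gy: "cinner (J k (pm a h)) (J l y) = 0" if ah: "a (r+1) = 0" "h \<in> H0" for a :: "nat \<Rightarrow> nat" and h
    by (rule H1_eqI[OF blin_comp[OF J_blin blin_cinner] bz _ y]) (rule gg[of a _ h], use ah in auto)
  have "cinner (J l y) (J k x) = 0"
  proof (rule H1_eqI[OF blin_comp[OF J_blin blin_cinner] bz _ x])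
    fix a :: "nat \<Rightarrow> nat" and h assume "a (r+1) = 0" "h \<in> H0"
    then show "cinner (J l y) (J k (pm a h)) = 0"
      using gy[of a h] cinner_commute[of "J l y" "J k (pm a h)"] by simp
  qed
  then show ?thesis using False cinner_commute[of "J k x" "J l y"] by simp
qed

lemma J_total: "H = clspan ((\<lambda>(k, x). J k x) ` (UNIV \<times> H1))"
proof
  have cp: "(c r ^^ k) h \<in> H0" if "h \<in> H0" for k h
    by (rule funpow_mem[of H0]) (auto intro: c_H0 H0_H that)
  have cc: "(cs r ^^ k) ((c r ^^ k) h) = h" if "h \<in> H0" for k h
  proof (induction k)
    case (Suc k)
    have "(cs r ^^ Suc k) ((c r ^^ Suc k) h) = (cs r ^^ Suc k) (c r ((c r ^^ k) h))"
      by (simp only: funpow.simps comp_apply)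
    also have "\<dots> = (cs r ^^ k) ((c r ^^ k) h)" by (rule csp_c[OF cp[OF that]])
    finally show ?case using Suc by (simp only:)
  qed simp
  have "pm a h \<in> (\<lambda>(k, x). J k x) ` (UNIV \<times> H1)" if h: "h \<in> H0" for a :: "nat \<Rightarrow> nat" and h
  \<comment> \<open>The exponent at \<open>r+1\<close> becomes the level. Applying the same power of
    \<open>c r\<close> to \<open>h\<close> beforehand cancels the power of \<open>cs r\<close> built
    into \<open>J\<close>.\<close>
  proof (rule image_eqI[of _ _ "(a (r+1), pm (a(r+1 := 0)) ((c r ^^ a (r+1)) h))"])
    show "pm a h = (case (a (r+1), pm (a(r+1 := 0)) ((c r ^^ a (r+1)) h)) of (k, x) \<Rightarrow> J k x)"
      using J_gen[of "a(r+1 := 0)" "(c r ^^ a (r+1)) h" "a (r+1)"] cp[OF h] cc[OF h] by simp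
    show "(a (r+1), pm (a(r+1 := 0)) ((c r ^^ a (r+1)) h)) \<in> UNIV \<times> H1"
      using pm_H1[of "a(r+1 := 0)"] cp[OF h] by simp
  qed
  then have "{pm a h | a h. h \<in> H0} \<subseteq> clspan ((\<lambda>(k, x). J k x) ` (UNIV \<times> H1))"
    using clspan_superset[of "(\<lambda>(k, x). J k x) ` (UNIV \<times> H1)"] by blast
  then have "clspan {pm a h | a h. h \<in> H0} \<subseteq> clspan ((\<lambda>(k, x). J k x) ` (UNIV \<times> H1))"
    by (rule clspan_minimal[OF _ hilbert_subspace_clspan])
  then show "H \<subseteq> clspan ((\<lambda>(k, x). J k x) ` (UNIV \<times> H1))"
    by (rule ord_eq_le_trans[OF sym[OF total[unfolded pm_span_def]]])
  show "clspan ((\<lambda>(k, x). J k x) ` (UNIV \<times> H1)) \<subseteq> H"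
    by (rule clspan_minimal[OF _ H]) (use J_mem in auto)
qed

lemma J_eqI:
  assumes u: "u \<in> H" and v: "v \<in> H" and eq: "\<And>l y. y \<in> H1 \<Longrightarrow> cinner u (J l y) = cinner v (J l y)"
  shows "u = v"
proof (rule cinner_eqI[OF H u v])
  fix x assume x: "x \<in> H"
  have "cinner u x = cinner v x"
  proof (rule clspan_blin_eqI[of "(\<lambda>(k, x). J k x) ` (UNIV \<times> H1)" UNIV "cinner u" UNIV "cinner v"])
    show "cinner u x = cinner v x" if "x \<in> (\<lambda>(k, x). J k x) ` (UNIV \<times> H1)" for x using that eq by auto
  qed (use x J_total blin_cinner in auto)
  then show "cinner x u = cinner x v" using cinner_commute[of x u] cinner_commute[of x v] by simp
qed

subsection \<open>Operators of tensor form\<close>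

text \<open>From level \<open>e\<close> on, \<open>T\<close> is \<open>t\<close> tensored with a
  shift by \<open>e' - e\<close>. The offset leaves room for a different behaviour on the levels
  below.\<close>

definition act :: "('h \<Rightarrow> 'h) \<Rightarrow> nat \<Rightarrow> nat \<Rightarrow> ('h \<Rightarrow> 'h) \<Rightarrow> bool" where
  "act T e e' t \<longleftrightarrow> t \<in> bounded_ops H1 \<and> (\<forall>k. \<forall>x\<in>H1. T (J (k+e) x) = J (k+e') (t x))"

text \<open>With \<open>S\<close> the left shift, \<open>T\<close> is
  \<open>t \<otimes> S* + t' \<otimes> P_0\<close>. This is the shape of column \<open>r+1\<close>
  of the convolution.\<close>

definition up_form :: "('h \<Rightarrow> 'h) \<Rightarrow> ('h \<Rightarrow> 'h) \<Rightarrow> ('h \<Rightarrow> 'h) \<Rightarrow> bool" where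
  "up_form T t t' \<longleftrightarrow> t \<in> bounded_ops H1 \<and> t' \<in> bounded_ops H1
    \<and> (\<forall>k. \<forall>x\<in>H1. T (J k x) = J (Suc k) (t x) + (if k = 0 then J 0 (t' x) else 0))"

text \<open>With \<open>S\<close> the left shift, \<open>T\<close> is
  \<open>t \<otimes> S + t' \<otimes> P_0\<close>. This is the shape of column \<open>r\<close> of
  the convolution.\<close>

definition down_form :: "('h \<Rightarrow> 'h) \<Rightarrow> ('h \<Rightarrow> 'h) \<Rightarrow> ('h \<Rightarrow> 'h) \<Rightarrow> bool" where
  "down_form T t t' \<longleftrightarrow> t \<in> bounded_ops H1 \<and> t' \<in> bounded_ops H1
    \<and> (\<forall>x\<in>H1. T (J 0 x) = J 0 (t' x) \<and> (\<forall>k. T (J (Suc k) x) = J k (t x)))"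

abbreviation zero1 :: "'h \<Rightarrow> 'h" where "zero1 \<equiv> (\<lambda>x\<in>H1. 0)"

lemmas bi1 = bounded_ops_intros[OF hilbert_H1]

text \<open>Boundedness of the coefficient need not be checked by hand: the image of the isometry
  \<open>J e'\<close> is closed, so \<open>T\<close> composed with \<open>J e\<close> maps all of
  \<open>H1\<close> into it and can be pulled back. The identity on the other levels then holds
  because it holds on generators.\<close>

lemma act_exists:
  assumes T: "blin H H T"
    and gen: "\<And>a h. a (r+1) = 0 \<Longrightarrow> h \<in> H0 \<Longrightarrow> v a h \<in> H1 \<and> (\<forall>k. T (J (k+e) (pm a h)) = J (k+e') (v a h))"
  obtains t where "act T e e' t" "\<And>a h. a (r+1) = 0 \<Longrightarrow> h \<in> H0 \<Longrightarrow> t (pm a h) = v a h"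
proof -
  have bT: "blin H1 H (\<lambda>x. T (J k x))" for k by (rule blin_comp[OF J_blin T])
  have im: "T (J e x) \<in> J e' ` H1" if "x \<in> H1" for x
  proof (rule clspan_image_subset[of "(\<lambda>(a, h). pm a h) ` gen_index" H "\<lambda>x. T (J e x)", OF _ J_image])
    show "T (J e x) \<in> J e' ` H1" if x: "x \<in> (\<lambda>(a, h). pm a h) ` gen_index" for x
    proof -
      obtain a h where "x = pm a h" "a (r+1) = 0" "h \<in> H0" using x by (auto simp: gen_index_def)
      then have "v a h \<in> H1" "T (J e x) = J e' (v a h)" using gen[of a h] by (metis, metis add_0)
      then show ?thesis by blast
    qed
  qed (use bT that in \<open>simp_all only: H1_def\<close>)
  define t0 where "t0 x = inv_into H1 (J e') (T (J e x))" for x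
  have t0: "t0 x \<in> H1" "J e' (t0 x) = T (J e x)" if "x \<in> H1" for x
    using im[OF that] unfolding t0_def by (auto intro: inv_into_into f_inv_into_f)
  have b0: "blin H1 H1 t0"
  proof -
    obtain B where B: "B > 0" "\<And>x. x \<in> H1 \<Longrightarrow> norm (T (J e x)) \<le> B * norm x" using blin_bound[OF bT] by blast
    show ?thesis
    proof (rule blinI[OF t0(1)])
      fix x y assume xy: "x \<in> H1" "y \<in> H1"
      show "t0 (x + y) = t0 x + t0 y"
        by (rule J_inj[of _ _ e'])
          (use xy t0 H1s(4) J_add blinD(2)[OF bT] in auto)
    next
      fix x c assume x: "x \<in> H1"
      show "t0 (c *\<^sub>C x) = c *\<^sub>C t0 x"
        by (rule J_inj[of _ _ e'])
          (use x t0 H1s(7) blinD(3)[OF J_blin] blinD(3)[OF bT] in auto)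
    next
      fix x assume x: "x \<in> H1"
      have "norm (t0 x) = norm (J e' (t0 x))"
        by (rule norm_eq_of_cinner_eq) (use J_iso[OF t0(1)[OF x] t0(1)[OF x]] in simp)
      then show "norm (t0 x) \<le> B * norm x" using t0(2)[OF x] B(2)[OF x] by simp
    qed
  qed
  have g0: "t0 (pm a h) = v a h" if "a (r+1) = 0" "h \<in> H0" for a :: "nat \<Rightarrow> nat" and h
  proof (rule J_inj[of _ _ e'])
    have "\<forall>k. T (J (k+e) (pm a h)) = J (k+e') (v a h)" using gen[of a h, OF that] by blast
    then have "T (J (0+e) (pm a h)) = J (0+e') (v a h)" by blast
    then show "J e' (t0 (pm a h)) = J e' (v a h)" using t0(2)[OF pm_H1[of a h, OF that]] by simp
  qed (use gen[of a h, OF that] t0(1)[OF pm_H1[of a h, OF that]] in auto)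
  have eq: "T (J (k+e) x) = J (k+e') (t0 x)" if x: "x \<in> H1" for k x
  proof (rule H1_eqI[OF bT blin_comp[OF b0 J_blin] _ x])
    fix a :: "nat \<Rightarrow> nat" and h assume ah: "a (r+1) = 0" "h \<in> H0"
    show "T (J (k+e) (pm a h)) = J (k+e') (t0 (pm a h))" using gen[of a h, OF ah] g0[of a h, OF ah] by simp
  qed
  show ?thesis
  proof (rule that[of "restrict t0 H1"])
    show "act T e e' (restrict t0 H1)"
      unfolding act_def using eq restrict_bounded_ops[OF b0 H1s(2)] by simp
    show "restrict t0 H1 (pm a h) = v a h" if "a (r+1) = 0" "h \<in> H0" for a :: "nat \<Rightarrow> nat" and h
      using g0[of a h, OF that] pm_H1[of a h, OF that] by simp
  qed
qed

text \<open>The vectors \<open>J l y\<close> are total, so an adjoint can be read off from the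
  tensor form of the operator itself.\<close>

lemma adj_J:
  assumes T: "T \<in> bounded_ops H" and x: "x \<in> H1" and v: "v \<in> H"
    and eq: "\<And>l y. y \<in> H1 \<Longrightarrow> cinner (J k x) (T (J l y)) = cinner v (J l y)"
  shows "adjoint_op H T (J k x) = v"
proof (rule J_eqI[OF _ v])
  show "adjoint_op H T (J k x) \<in> H" using adjoint_props(1)[OF H T] J_mem[OF x] by (rule bounded_ops_mem)
  show "cinner (adjoint_op H T (J k x)) (J l y) = cinner v (J l y)" if "y \<in> H1" for l y
    using eq[OF that] adjoint_props(3)[OF H T J_mem[OF x] J_mem[OF that]] by simp
qed

lemma adjoint_act0:
  assumes T: "T \<in> bounded_ops H" and a: "act T 0 0 t"
  shows "act (adjoint_op H T) 0 0 (adjoint_op H1 t)"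
proof -
  have t: "t \<in> bounded_ops H1" and f: "\<And>k x. x \<in> H1 \<Longrightarrow> T (J k x) = J k (t x)" using a by (auto simp: act_def)
  note at = adjoint_props[OF hilbert_H1 t]
  have "adjoint_op H T (J k x) = J k (adjoint_op H1 t x)" if x: "x \<in> H1" for k x
  proof (rule adj_J[OF T x])
    note m = bounded_ops_mem[OF at(1) x]
    show "J k (adjoint_op H1 t x) \<in> H" by (rule J_mem[OF m])
    show "cinner (J k x) (T (J l y)) = cinner (J k (adjoint_op H1 t x)) (J l y)" if y: "y \<in> H1" for l y
      using x y m bounded_ops_mem[OF t y] at(3)[OF x y] by (simp add: f J_gram)
  qed
  then show ?thesis using at(1) by (simp add: act_def)
qed

lemma adjoint_up_form:
  assumes T: "T \<in> bounded_ops H" and a: "up_form T t t'"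
  shows "down_form (adjoint_op H T) (adjoint_op H1 t) (adjoint_op H1 t')"
proof -
  have t: "t \<in> bounded_ops H1" "t' \<in> bounded_ops H1"
    and f: "\<And>k x. x \<in> H1 \<Longrightarrow> T (J k x) = J (Suc k) (t x) + (if k = 0 then J 0 (t' x) else 0)"
    using a by (auto simp: up_form_def)
  note at = adjoint_props[OF hilbert_H1 t(1)] and at' = adjoint_props[OF hilbert_H1 t(2)]
  note m = bounded_ops_mem[OF at(1)] bounded_ops_mem[OF at'(1)] bounded_ops_mem[OF t(1)] bounded_ops_mem[OF t(2)]
  have "adjoint_op H T (J (Suc k) x) = J k (adjoint_op H1 t x)" if x: "x \<in> H1" for k x
    by (rule adj_J[OF T x J_mem[OF m(1)[OF x]]])
      (use x at(3) in \<open>auto simp: f J_gram m cinner_add_right\<close>)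
  moreover have "adjoint_op H T (J 0 x) = J 0 (adjoint_op H1 t' x)" if x: "x \<in> H1" for x
    by (rule adj_J[OF T x J_mem[OF m(2)[OF x]]])
      (use x at'(3) in \<open>auto simp: f J_gram m cinner_add_right\<close>)
  ultimately show ?thesis using at(1) at'(1) by (simp add: down_form_def)
qed

lemma adjoint_down_form:
  assumes T: "T \<in> bounded_ops H" and a: "down_form T t t'"
  shows "up_form (adjoint_op H T) (adjoint_op H1 t) (adjoint_op H1 t')"
proof -
  have t: "t \<in> bounded_ops H1" "t' \<in> bounded_ops H1"
    and f: "\<And>x. x \<in> H1 \<Longrightarrow> T (J 0 x) = J 0 (t' x)" "\<And>k x. x \<in> H1 \<Longrightarrow> T (J (Suc k) x) = J k (t x)"
    using a by (auto simp: down_form_def)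
  note at = adjoint_props[OF hilbert_H1 t(1)] and at' = adjoint_props[OF hilbert_H1 t(2)]
  note m = bounded_ops_mem[OF at(1)] bounded_ops_mem[OF at'(1)] bounded_ops_mem[OF t(1)] bounded_ops_mem[OF t(2)]
  have "adjoint_op H T (J k x) = J (Suc k) (adjoint_op H1 t x) + (if k = 0 then J 0 (adjoint_op H1 t' x) else 0)"
    if x: "x \<in> H1" for k x
  proof (rule adj_J[OF T x])
    show "J (Suc k) (adjoint_op H1 t x) + (if k = 0 then J 0 (adjoint_op H1 t' x) else 0) \<in> H"
      using x by (auto intro!: Hs(3,4) J_mem m)
    fix l y assume y: "y \<in> H1"
    show "cinner (J k x) (T (J l y))
        = cinner (J (Suc k) (adjoint_op H1 t x) + (if k = 0 then J 0 (adjoint_op H1 t' x) else 0)) (J l y)"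
      using x y at(3)[OF x y] at'(3)[OF x y]
      by (cases l) (auto simp: f J_gram m cinner_add_left)
  qed
  then show ?thesis using at(1) at'(1) by (simp add: up_form_def)
qed

lemma act_comp: "act T e' e'' t \<Longrightarrow> act S e e' s \<Longrightarrow> act (\<lambda>x. T (S x)) e e'' (compose H1 t s)"
  using bi1(3)[of t s] by (auto simp: act_def compose_apply bounded_ops_mem)

lemma act0_comp_up: "act T 0 0 t \<Longrightarrow> up_form S s s' \<Longrightarrow> blin H H T
  \<Longrightarrow> up_form (\<lambda>x. T (S x)) (compose H1 t s) (compose H1 t s')"
  using bi1(3)[of t s] bi1(3)[of t s'] blin_zero[of H H T, OF _ Hs(2)] blinD(2)[of H H T]
  by (auto simp: act_def up_form_def compose_apply bounded_ops_mem J_mem Hs(3))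

lemma act0_comp_down: "act T 0 0 t \<Longrightarrow> down_form S s s'
  \<Longrightarrow> down_form (\<lambda>x. T (S x)) (compose H1 t s) (compose H1 t s')"
  using bi1(3)[of t s] bi1(3)[of t s']
  by (auto simp: act_def down_form_def compose_apply bounded_ops_mem)

lemma up_comp_act0: "up_form T t t' \<Longrightarrow> act S 0 0 s
  \<Longrightarrow> up_form (\<lambda>x. T (S x)) (compose H1 t s) (compose H1 t' s)"
  using bi1(3)[of t s] bi1(3)[of t' s]
  by (auto simp: act_def up_form_def compose_apply bounded_ops_mem)

lemma down_comp_act0: "down_form T t t' \<Longrightarrow> act S 0 0 s
  \<Longrightarrow> down_form (\<lambda>x. T (S x)) (compose H1 t s) (compose H1 t' s)"
  using bi1(3)[of t s] bi1(3)[of t' s]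
  by (auto simp: act_def down_form_def compose_apply bounded_ops_mem)

text \<open>The tensor form of \<open>S S* = 1\<close>. After raising, no vector is on the bottom
  level, so \<open>t'\<close> is never reached.\<close>

lemma down_comp_up: "down_form T t t' \<Longrightarrow> up_form S s zero1
  \<Longrightarrow> act (\<lambda>x. T (S x)) 0 0 (compose H1 t s)"
  using bi1(3)[of t s]
  by (auto simp: act_def up_form_def down_form_def compose_apply bounded_ops_mem J_zero)

lemma compose_zero1: "t \<in> bounded_ops H1 \<Longrightarrow> compose H1 t zero1 = zero1" "compose H1 zero1 t' = zero1" if "t' \<in> bounded_ops H1"
  using blin_zero[OF bounded_ops_blin H1s(2), of t] bounded_ops_mem[OF that]
  by (auto simp: compose_def intro!: restrict_ext)

lemma adjoint_zero1: "adjoint_op H1 zero1 = zero1"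
  by (rule adjoint_op_eqI[OF hilbert_H1 bi1(2)]) simp

subsection \<open>The generators on and above the diagonal and in the last row\<close>

lemma J_pm_Z:
  assumes "1 \<le> i" "i \<le> n" "1 \<le> j" "j \<le> n+1" "j \<noteq> r" "a (r+1) = 0" "h \<in> H0"
  shows "J k (pm a (Z i j h)) = pm (a(r+1 := k)) (Z i j ((cs r ^^ k) h))"
  using J_gen[of a "Z i j h" k] Z_H0[of i j h] Z_csp[of i j h k] H0_H[of h] assms by simp

lemma act0_below:
  assumes "1 \<le> i" "i \<le> n" "1 \<le> j" "j < r"
  shows "\<exists>t. act (Z i j) 0 0 t"
proof -
  have T: "blin H H (Z i j)" by (rule Z_blin) (use assms rn in auto)
  have "pm a (Z i j h) \<in> H1 \<and> (\<forall>k. Z i j (J (k+0) (pm a h)) = J (k+0) (pm a (Z i j h)))"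
    if ah: "a (r+1) = 0" "h \<in> H0" for a :: "nat \<Rightarrow> nat" and h
  proof
    have "Z i j h \<in> H0" by (rule Z_H0) (use assms ah rn in auto)
    then show "pm a (Z i j h) \<in> H1" by (rule pm_H1[of a, OF ah(1)])
    show "\<forall>k. Z i j (J (k+0) (pm a h)) = J (k+0) (pm a (Z i j h))"
      unfolding add_0_right using J_gen[of a h, OF ah] J_pm_Z[of i j a h] Z_pm_below[of i j] H0_H[OF csp_H0[OF ah(2)]] assms ah rn
      by simp
  qed
  note gens = this
  obtain t where "act (Z i j) 0 0 t" by (rule act_exists[OF T gens]) (assumption | erule that | blast)+
  then show ?thesis by blast
qed

text \<open>The exchange formula only touches the exponents at \<open>j\<close> and
  \<open>j+1\<close>, both beyond \<open>r+1\<close>, and the generators involved commute with the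
  twist by \<open>cs r\<close>.\<close>

lemma act0_upper:
  assumes "1 \<le> i" "i \<le> j" "i \<le> n" "r + 2 \<le> j" "j \<le> n+1"
  shows "\<exists>t. act (Z i j) 0 0 t"
proof -
  have T: "blin H H (Z i j)" by (rule Z_blin) (use assms rn in auto)
  \<comment> \<open>The guard \<open>j = n+1\<close> includes the last column, which has no right
    neighbour to take exponents from.\<close>
  define v where "v a h = (if a j = 0 then pm a (Z i j h) else 0)
    + (if j = n+1 \<or> a (j+1) = 0 then 0 else pm (a(j := Suc (a j), j+1 := a (j+1) - 1)) (Z i (j+1) h))" for a :: "nat \<Rightarrow> nat" and h
  have "v a h \<in> H1 \<and> (\<forall>k. Z i j (J (k+0) (pm a h)) = J (k+0) (v a h))"
    if ah: "a (r+1) = 0" "h \<in> H0" for a :: "nat \<Rightarrow> nat" and h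
  proof -
    let ?b = "a(j := Suc (a j), j+1 := a (j+1) - 1)"
    have b: "?b (r+1) = 0" using ah assms by simp
    have Z1: "Z i j h \<in> H0" by (rule Z_H0) (use assms ah rn in auto)
    have Z2: "Z i (j+1) h \<in> H0" if "j \<noteq> n+1" by (rule Z_H0) (use assms ah rn that in auto)
    define p where "p = (if a j = 0 then pm a (Z i j h) else 0)"
    define q where "q = (if j = n+1 \<or> a (j+1) = 0 then 0 else pm ?b (Z i (j+1) h))"
    have pq: "p \<in> H1" "q \<in> H1"
      unfolding p_def q_def using pm_H1[of a, OF ah(1) Z1] pm_H1[of ?b, OF b Z2] H1s(3) by auto
    have v: "v a h = p + q" by (simp only: v_def p_def q_def)
    have "Z i j (J k (pm a h)) = J k (p + q)" for k
    proof -
      let ?y = "(cs r ^^ k) h" and ?a = "a(r+1 := k)"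
      have y: "?y \<in> H" by (rule H0_H[OF csp_H0[OF ah(2)]])
      have av: "?a j = a j" "?a (j+1) = a (j+1)" using assms by auto
      have "J k p = (if a j = 0 then pm ?a (Z i j ?y) else 0)"
        unfolding p_def using J_pm_Z[of i j a h k] assms ah J_zero rn by simp
      moreover have "J k q = (if j = n+1 \<or> a (j+1) = 0 then 0 else pm (?a(j := Suc (a j), j+1 := a (j+1) - 1)) (Z i (j+1) ?y))"
      proof -
        have "?b(r+1 := k) = ?a(j := Suc (a j), j+1 := a (j+1) - 1)" using assms by auto
        then show ?thesis
          unfolding q_def using J_pm_Z[of i "j+1" ?b h k] b assms ah J_zero rn by simp
      qed
      moreover have "Z i j (J k (pm a h)) = Z i j (pm ?a ?y)" using J_gen[of a h k, OF ah] by simp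
      moreover have "Z i j (pm ?a ?y) = (if a j = 0 then pm ?a (Z i j ?y) else 0)
        + (if j = n+1 \<or> a (j+1) = 0 then 0 else pm (?a(j := Suc (a j), j+1 := a (j+1) - 1)) (Z i (j+1) ?y))"
      proof (cases "j = n+1")
        case True
        then show ?thesis using Z_pm_last[of i ?y ?a] y assms av by simp
      next
        case False
        then show ?thesis using Z_pm_upper[of i j ?y ?a, unfolded av] y assms by simp
      qed
      ultimately show ?thesis using J_add[OF pq, of k] by (simp only:)
    qed
    then show ?thesis using v pq H1s(4) by simp
  qed
  note gens = this
  obtain t where "act (Z i j) 0 0 t" by (rule act_exists[OF T gens]) (assumption | erule that | blast)+
  then show ?thesis by blast
qed

lemma act0_row:
  assumes "1 \<le> j" "j \<le> n+1" "j \<noteq> r" "j \<noteq> r+1"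
  shows "\<exists>t. act (c j) 0 0 t"
proof (cases "j < r")
  case True
  then have "act (c j) 0 0 zero1"
    unfolding act_def using bi1(2) c_below[OF assms(1) True J_mem] J_zero by simp
  then show ?thesis by blast
next
  case False
  then have j: "r + 1 < j" using assms by simp
  have T: "blin H H (c j)" by (rule c_blin) (use assms in auto)
  define v where "v a h = (if \<forall>t. j < t \<and> t \<le> n+1 \<longrightarrow> a t = 0 then pm (a(j := Suc (a j))) h else 0)" for a :: "nat \<Rightarrow> nat" and h
  have "v a h \<in> H1 \<and> (\<forall>k. c j (J (k+0) (pm a h)) = J (k+0) (v a h))"
    if ah: "a (r+1) = 0" "h \<in> H0" for a :: "nat \<Rightarrow> nat" and h
  proof -
    let ?b = "a(j := Suc (a j))"
    have b: "?b (r+1) = 0" using ah j by simp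
    have "v a h \<in> H1" unfolding v_def using pm_H1[of ?b, OF b ah(2)] H1s(3) by simp
    moreover have "c j (J k (pm a h)) = J k (v a h)" for k
    proof -
      have e: "(a(r+1 := k))(j := Suc ((a(r+1 := k)) j)) = ?b(r+1 := k)" using j by auto
      have e2: "(\<forall>t. j < t \<and> t \<le> n+1 \<longrightarrow> (a(r+1 := k)) t = 0) = (\<forall>t. j < t \<and> t \<le> n+1 \<longrightarrow> a t = 0)"
        using j by auto
      have "c j (J k (pm a h)) = c j (pm (a(r+1 := k)) ((cs r ^^ k) h))" by (simp only: J_gen[of a h k, OF ah])
      also have "\<dots> = (if \<forall>t. j < t \<and> t \<le> n+1 \<longrightarrow> (a(r+1 := k)) t = 0
          then pm ((a(r+1 := k))(j := Suc ((a(r+1 := k)) j))) ((cs r ^^ k) h) else 0)"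
        by (rule c_pm) (use j assms H0_H[OF csp_H0[OF ah(2)]] in auto)
      also have "\<dots> = J k (v a h)" unfolding e e2 v_def if_distrib[of "J k"] J_gen[of ?b h k, OF b ah(2)] J_zero ..
      finally show ?thesis .
    qed
    ultimately show ?thesis by simp
  qed
  note gens = this
  obtain t where "act (c j) 0 0 t" by (rule act_exists[OF T gens]) (assumption | erule that | blast)+
  then show ?thesis by blast
qed

text \<open>Column \<open>r\<close> lowers the exponent at \<open>r+1\<close>, and the accompanying
  \<open>c r\<close> cancels one factor of the twist. Column \<open>r+1\<close> raises that exponent
  at the expense of \<open>r+2\<close>; in addition, when the exponent at \<open>r+1\<close> is 0,
  it acts by \<open>Z i (r+1)\<close> on \<open>h\<close>, which is precisely the coefficient
  \<open>t\<close> of column \<open>r\<close>. This coincidence is what the P_0 term of \<psi>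
  demands.\<close>

lemma forms_upper:
  assumes i: "1 \<le> i" "i \<le> r"
  shows "\<exists>t t'. down_form (Z i r) t zero1 \<and> up_form (Z i (r+1)) t' t"
proof -
  have Tr: "blin H H (Z i r)" by (rule Z_blin) (use i rn in auto)
  have Tr1: "blin H H (Z i (r+1))" by (rule Z_blin) (use i rn in auto)
  have ZH0: "Z i (r+1) h \<in> H0" if "h \<in> H0" for h by (rule Z_H0) (use i rn that in auto)
  have "pm a (Z i (r+1) h) \<in> H1 \<and> (\<forall>k. Z i r (J (k+1) (pm a h)) = J (k+0) (pm a (Z i (r+1) h)))"
    if ah: "a (r+1) = 0" "h \<in> H0" for a :: "nat \<Rightarrow> nat" and h
  proof (intro conjI allI)
    show "pm a (Z i (r+1) h) \<in> H1" by (rule pm_H1[of a, OF ah(1) ZH0[OF ah(2)]])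
    fix k
    let ?y = "(cs r ^^ (k+1)) h" and ?a = "a(r+1 := k+1)"
    have y: "?y \<in> H0" by (rule csp_H0[OF ah(2)])
    have "Z i r (J (k+1) (pm a h)) = Z i r (pm ?a ?y)" by (simp only: J_gen[of a h, OF ah])
    also have "\<dots> = pm (a(r+1 := k)) (c r (Z i (r+1) ?y))" using Z_pm_r[OF i y, of ?a] by simp
    also have "Z i (r+1) ?y = (cs r ^^ (k+1)) (Z i (r+1) h)"
      by (rule Z_csp) (use i rn H0_H[OF ah(2)] in auto)
    also have "c r \<dots> = (cs r ^^ k) (Z i (r+1) h)" using c_csp[OF ZH0[OF ah(2)], of k] by simp
    also have "pm (a(r+1 := k)) \<dots> = J (k+0) (pm a (Z i (r+1) h))"
      using J_gen[of a "Z i (r+1) h" k, OF ah(1) ZH0[OF ah(2)]] by simp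
    finally show "Z i r (J (k+1) (pm a h)) = J (k+0) (pm a (Z i (r+1) h))" .
  qed
  note gens = this
  obtain t where t: "act (Z i r) 1 0 t"
    "\<And>a h. a (r+1) = 0 \<Longrightarrow> h \<in> H0 \<Longrightarrow> t (pm a h) = pm a (Z i (r+1) h)"
    by (rule act_exists[OF Tr gens]) (assumption | erule that | blast)+
  have tb: "t \<in> bounded_ops H1" using t(1) by (simp add: act_def)
  have "Z i r (J 0 x) = 0" if x: "x \<in> H1" for x
  proof (rule H1_eqI[OF blin_comp[OF J_blin Tr] blin_const_0[OF Hs(2)] _ x])
    fix a :: "nat \<Rightarrow> nat" and h assume ah: "a (r+1) = 0" "h \<in> H0"
    show "Z i r (J 0 (pm a h)) = 0"
      using J_gen[of a h 0, OF ah] Z_pm_r[OF i ah(2), of "a(r+1 := 0)"] by simp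
  qed
  then have down: "down_form (Z i r) t zero1"
    unfolding down_form_def using t(1) tb bi1(2) J_zero by (simp add: act_def)
  \<comment> \<open>The next level of \<open>J\<close> carries one more \<open>cs r\<close>; the
    factor \<open>c r\<close> compensates for it. For \<open>r = n\<close> there is no column
    \<open>r+2\<close>.\<close>
  define v where "v a h = (if r = n \<or> a (r+2) = 0 then 0 else pm (a(r+2 := a (r+2) - 1)) (c r (Z i (r+2) h)))" for a :: "nat \<Rightarrow> nat" and h
  have v: "v a h \<in> H1" and Jv: "J (Suc k) (v a h) = (if r = n \<or> a (r+2) = 0 then 0
      else pm (a(r+1 := Suc k, r+2 := a (r+2) - 1)) (Z i (r+2) ((cs r ^^ k) h)))"
    if ah: "a (r+1) = 0" "h \<in> H0" for a :: "nat \<Rightarrow> nat" and h k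
  proof -
    let ?b = "a(r+2 := a (r+2) - 1)"
    have b: "?b (r+1) = 0" using ah by simp
    have Z2: "Z i (r+2) h \<in> H0" if "r \<noteq> n" by (rule Z_H0) (use i rn ah that in auto)
    have cZ: "c r (Z i (r+2) h) \<in> H0" if "r \<noteq> n" by (rule c_H0[OF H0_H[OF Z2[OF that]]])
    show "v a h \<in> H1" unfolding v_def using pm_H1[of ?b, OF b cZ] H1s(3) by simp
    show "J (Suc k) (v a h) = (if r = n \<or> a (r+2) = 0 then 0
      else pm (a(r+1 := Suc k, r+2 := a (r+2) - 1)) (Z i (r+2) ((cs r ^^ k) h)))"
    proof (cases "r = n \<or> a (r+2) = 0")
      case True
      then show ?thesis by (simp only: v_def if_True J_zero)
    next
      case False
      then have ne: "r \<noteq> n" by simp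
      have "J (Suc k) (pm ?b (c r (Z i (r+2) h))) = pm (?b(r+1 := Suc k)) ((cs r ^^ Suc k) (c r (Z i (r+2) h)))"
        by (rule J_gen[of ?b, OF b cZ[OF ne]])
      also have "(cs r ^^ Suc k) (c r (Z i (r+2) h)) = (cs r ^^ k) (Z i (r+2) h)" by (rule csp_c[OF Z2[OF ne]])
      also have "\<dots> = Z i (r+2) ((cs r ^^ k) h)"
        by (rule Z_csp[symmetric]) (use i rn ne H0_H[OF ah(2)] in auto)
      also have "?b(r+1 := Suc k) = a(r+1 := Suc k, r+2 := a (r+2) - 1)" by auto
      finally show ?thesis using False by (simp only: v_def if_False)
    qed
  qed
  have Zpm: "Z i (r+1) (pm b y) = (if b (r+1) = 0 then pm b (Z i (r+1) y) else 0)
      + (if r = n \<or> b (r+2) = 0 then 0 else pm (b(r+1 := Suc (b (r+1)), r+2 := b (r+2) - 1)) (Z i (r+2) y))"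
    if "y \<in> H" for b y
  proof (cases "r = n")
    case True
    then show ?thesis using Z_pm_last[of i y b] that i by simp
  next
    case False
    then show ?thesis using Z_pm_upper[of i "r+1" y b] that i rn by simp
  qed
  \<comment> \<open>The offset is 1 because on level 0 the second summand of \<open>Zpm\<close> also
    contributes a term that stays on level 0.\<close>
  have "v a h \<in> H1 \<and> (\<forall>k. Z i (r+1) (J (k+1) (pm a h)) = J (k+2) (v a h))"
    if ah: "a (r+1) = 0" "h \<in> H0" for a :: "nat \<Rightarrow> nat" and h
  proof (intro conjI allI)
    show "v a h \<in> H1" by (rule v[of a h, OF ah])
    fix k
    have "Z i (r+1) (J (k+1) (pm a h)) = Z i (r+1) (pm (a(r+1 := k+1)) ((cs r ^^ (k+1)) h))"
      by (simp only: J_gen[of a h, OF ah])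
    also have "\<dots> = J (k+2) (v a h)"
      using Zpm[OF H0_H[OF csp_H0[OF ah(2)]], of "a(r+1 := k+1)" "k+1"] Jv[of a h, OF ah, of "k+1"] by simp
    finally show "Z i (r+1) (J (k+1) (pm a h)) = J (k+2) (v a h)" .
  qed
  note gens = this
  obtain t' where t': "act (Z i (r+1)) 1 2 t'"
    "\<And>a h. a (r+1) = 0 \<Longrightarrow> h \<in> H0 \<Longrightarrow> t' (pm a h) = v a h"
    by (rule act_exists[OF Tr1 gens]) (assumption | erule that | blast)+
  have tb': "t' \<in> bounded_ops H1" using t'(1) by (simp add: act_def)
  have J0: "Z i (r+1) (J 0 x) = J 1 (t' x) + J 0 (t x)" if x: "x \<in> H1" for x
  proof (rule H1_eqI[OF blin_comp[OF J_blin Tr1] blin_add[OF blin_comp[OF bounded_ops_blin[OF tb'] J_blin]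
          blin_comp[OF bounded_ops_blin[OF tb] J_blin] Hs(2)] _ x])
    fix a :: "nat \<Rightarrow> nat" and h assume ah: "a (r+1) = 0" "h \<in> H0"
    have "a(r+1 := 0) = a" using ah by auto
    then have "J 0 (pm a g) = pm a g" if "g \<in> H0" for g using J_gen[of a g 0, OF ah(1) that] by simp
    then have "Z i (r+1) (J 0 (pm a h)) = Z i (r+1) (pm a h)" "J 0 (t (pm a h)) = pm a (Z i (r+1) h)"
      using ah ZH0[OF ah(2)] t(2)[of a h, OF ah] by simp_all
    then show "Z i (r+1) (J 0 (pm a h)) = J 1 (t' (pm a h)) + J 0 (t (pm a h))"
      using Zpm[OF H0_H[OF ah(2)], of a] Jv[of a h, OF ah, of 0] t'(2)[of a h, OF ah] ah(1) by simp
  qed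
  have "up_form (Z i (r+1)) t' t"
    unfolding up_form_def
  proof (intro conjI allI ballI tb tb')
    fix k x assume x: "x \<in> H1"
    show "Z i (r+1) (J k x) = J (Suc k) (t' x) + (if k = 0 then J 0 (t x) else 0)"
    proof (cases k)
      case 0
      then show ?thesis using J0[OF x] by simp
    next
      case (Suc m)
      then show ?thesis using t'(1) x unfolding act_def by (auto dest!: spec[of _ m])
    qed
  qed
  then show ?thesis using down by blast
qed

text \<open>Raising the exponent at \<open>r+1\<close> costs one more \<open>cs r\<close> in the
  twist, hence the coefficient of \<open>c (r+1)\<close> applies \<open>c r\<close> to
  \<open>h\<close>. On level 0 \<open>c r\<close> acts by the same rule and it vanishes above, so
  both columns share the coefficient \<open>t\<close>. Without the twist the first coefficient would
  not involve \<open>c r\<close> and the two would differ.\<close>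

lemma forms_row: "\<exists>t. up_form (c (r+1)) t zero1 \<and> down_form (c r) zero1 t"
proof -
  have T1: "blin H H (c (r+1))" and T: "blin H H (c r)" using r_bounds c_blin by auto
  define v where "v a h = (if \<forall>t. r + 1 < t \<and> t \<le> n+1 \<longrightarrow> a t = 0 then pm a (c r h) else 0)" for a :: "nat \<Rightarrow> nat" and h
  have "v a h \<in> H1 \<and> (\<forall>k. c (r+1) (J (k+0) (pm a h)) = J (k+1) (v a h))"
    if ah: "a (r+1) = 0" "h \<in> H0" for a :: "nat \<Rightarrow> nat" and h
  proof (intro conjI allI)
    have ch: "c r h \<in> H0" by (rule c_H0[OF H0_H[OF ah(2)]])
    show "v a h \<in> H1" unfolding v_def using pm_H1[of a, OF ah(1) ch] H1s(3) by simp
    fix k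
    have e: "(a(r+1 := k))(r+1 := Suc ((a(r+1 := k)) (r+1))) = a(r+1 := Suc k)" by auto
    have e2: "(\<forall>t. r+1 < t \<and> t \<le> n+1 \<longrightarrow> (a(r+1 := k)) t = 0) = (\<forall>t. r+1 < t \<and> t \<le> n+1 \<longrightarrow> a t = 0)" by auto
    have "c (r+1) (J (k+0) (pm a h)) = c (r+1) (pm (a(r+1 := k)) ((cs r ^^ k) h))"
      by (simp only: J_gen[of a h, OF ah] add_0_right)
    also have "\<dots> = (if \<forall>t. r+1 < t \<and> t \<le> n+1 \<longrightarrow> (a(r+1 := k)) t = 0
        then pm ((a(r+1 := k))(r+1 := Suc ((a(r+1 := k)) (r+1)))) ((cs r ^^ k) h) else 0)"
      by (rule c_pm) (use rn H0_H[OF csp_H0[OF ah(2)]] in auto)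
    also have "\<dots> = J (Suc k) (v a h)"
      unfolding e e2 v_def if_distrib[of "J (Suc k)"] J_gen[of a "c r h" "Suc k", OF ah(1) ch] J_zero csp_c[OF ah(2)] ..
    finally show "c (r+1) (J (k+0) (pm a h)) = J (k+1) (v a h)" by simp
  qed
  note gens = this
  obtain t where t: "act (c (r+1)) 0 1 t"
    "\<And>a h. a (r+1) = 0 \<Longrightarrow> h \<in> H0 \<Longrightarrow> t (pm a h) = v a h"
    by (rule act_exists[OF T1 gens]) (assumption | erule that | blast)+
  have tb: "t \<in> bounded_ops H1" using t(1) by (simp add: act_def)
  have "up_form (c (r+1)) t zero1"
    unfolding up_form_def using t(1) bi1(2) by (simp add: act_def J_zero)
  moreover have "c r (J (Suc k) x) = 0" if x: "x \<in> H1" for k x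
  proof (rule H1_eqI[OF blin_comp[OF J_blin T] blin_const_0[OF Hs(2)] _ x])
    fix a :: "nat \<Rightarrow> nat" and h assume ah: "a (r+1) = 0" "h \<in> H0"
    have "\<not> (\<forall>t. r < t \<and> t \<le> n+1 \<longrightarrow> (a(r+1 := Suc k)) t = 0)" using rn by (auto intro!: exI[of _ "r+1"])
    then show "c r (J (Suc k) (pm a h)) = 0"
      unfolding J_gen[of a h, OF ah] c_r_pm[OF H0_H[OF csp_H0[OF ah(2)]]] by (simp only: if_False)
  qed
  moreover have "c r (J 0 x) = J 0 (t x)" if x: "x \<in> H1" for x
  proof (rule H1_eqI[OF blin_comp[OF J_blin T] blin_comp[OF bounded_ops_blin[OF tb] J_blin] _ x])
    fix a :: "nat \<Rightarrow> nat" and h assume ah: "a (r+1) = 0" "h \<in> H0"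
    have ch: "c r h \<in> H0" by (rule c_H0[OF H0_H[OF ah(2)]])
    have a0: "a(r+1 := 0) = a" using ah by auto
    have J0: "J 0 (pm a g) = pm a g" if "g \<in> H0" for g using J_gen[of a g 0, OF ah(1) that] a0 by simp
    have e: "(\<forall>t. r < t \<and> t \<le> n+1 \<longrightarrow> a t = 0) = (\<forall>t. r+1 < t \<and> t \<le> n+1 \<longrightarrow> a t = 0)"
      using ah(1) by (metis Suc_eq_plus1 Suc_lessI Suc_lessD)
    show "c r (J 0 (pm a h)) = J 0 (t (pm a h))"
      unfolding J0[OF ah(2)] t(2)[of a h, OF ah] v_def c_r_pm[OF H0_H[OF ah(2)]] e if_distrib[of "J 0"] J0[OF ch] J_zero ..
  qed
  ultimately have "up_form (c (r+1)) t zero1 \<and> down_form (c r) zero1 t"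
    using tb bi1(2) J_zero by (simp add: down_form_def)
  then show ?thesis by blast
qed

subsection \<open>The generators below the diagonal\<close>

lemma diag_adj_split: "a \<le> m \<Longrightarrow> m \<le> b \<Longrightarrow> diag_adj a b y = diag_adj m b (diag_adj a m y)"
  using upt_add_eq_append[of a m "b - m"] by (simp add: diag_adj_def)

lemma diag_adj_Suc: "a \<le> b \<Longrightarrow> diag_adj a (Suc b) y = Zs b b (diag_adj a b y)"
  by (simp add: diag_adj_def)

lemma diag_adj_empty: "diag_adj a a y = y"
  by (simp add: diag_adj_def)

lemma up_adj_Suc: "a \<le> b \<Longrightarrow> up_adj a (Suc b) y = Zs b (b+1) (up_adj a b y)"
  by (simp add: up_adj_def)

lemma up_adj_empty: "up_adj a a y = y"
  by (simp add: up_adj_def)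

lemma up_adj_first: "a < b \<Longrightarrow> up_adj a b y = up_adj (Suc a) b (Zs a (a+1) y)"
  by (simp add: up_adj_def upt_conv_Cons)

lemma act_cong: "(\<And>x. x \<in> H \<Longrightarrow> T x = S x) \<Longrightarrow> act T e e' t \<longleftrightarrow> act S e e' t"
  by (auto simp: act_def J_mem)

lemma up_form_cong: "(\<And>x. x \<in> H \<Longrightarrow> T x = S x) \<Longrightarrow> up_form T t t' \<longleftrightarrow> up_form S t t'"
  by (simp add: up_form_def J_mem cong: conj_cong)

lemma down_form_cong: "(\<And>x. x \<in> H \<Longrightarrow> T x = S x) \<Longrightarrow> down_form T t t' \<longleftrightarrow> down_form S t t'"
  by (simp add: down_form_def J_mem cong: conj_cong)

lemma act_id: "act (\<lambda>x. x) e e (\<lambda>x\<in>H1. x)"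
  using bi1(1) by (simp add: act_def)

lemma diag_adj_act0:
  assumes "a \<le> b" "\<And>t. a \<le> t \<Longrightarrow> t < b \<Longrightarrow> \<exists>s. act (Zs t t) 0 0 s"
  shows "\<exists>s. act (diag_adj a b) 0 0 s"
  using assms
proof (induction b rule: dec_induct)
  case base
  have "diag_adj a a = (\<lambda>x. x)" by (rule ext) (rule diag_adj_empty)
  then show ?case using act_id by metis
next
  case (step b)
  obtain s where s: "act (diag_adj a b) 0 0 s" using step by auto
  obtain t where t: "act (Zs b b) 0 0 t" using step by auto
  have "diag_adj a (Suc b) = (\<lambda>x. Zs b b (diag_adj a b x))"
    by (rule ext) (rule diag_adj_Suc[OF step.hyps(1)])
  then show ?case using act_comp[OF t s] by metis
qed

lemma up_adj_act0:
  assumes "a \<le> b" "\<And>t. a \<le> t \<Longrightarrow> t < b \<Longrightarrow> \<exists>s. act (Zs t (t+1)) 0 0 s"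
  shows "\<exists>s. act (up_adj a b) 0 0 s"
  using assms
proof (induction b rule: dec_induct)
  case base
  have "up_adj a a = (\<lambda>x. x)" by (rule ext) (rule up_adj_empty)
  then show ?case using act_id by metis
next
  case (step b)
  obtain s where s: "act (up_adj a b) 0 0 s" using step by auto
  obtain t where t: "act (Zs b (b+1)) 0 0 t" using step.prems[of b] step.hyps by auto
  have "up_adj a (Suc b) = (\<lambda>x. Zs b (b+1) (up_adj a b x))"
    by (rule ext) (rule up_adj_Suc[OF step.hyps(1)])
  then show ?case using act_comp[OF t s] by metis
qed

lemma Zs_diag_act0:
  assumes "1 \<le> t" "t \<le> n+1" "t \<noteq> r" "t \<noteq> r+1"
  shows "\<exists>s. act (Zs t t) 0 0 s"
proof -
  consider "t = n+1" | "t \<le> n" "t < r" | "t \<le> n" "r + 2 \<le> t" using assms by linarith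
  then have "\<exists>s. act (Z t t) 0 0 s"
  proof cases
    case 1
    then show ?thesis using act0_row[of t] assms by (simp add: c_def)
  next
    case 2
    then show ?thesis using act0_below[of t t] assms by simp
  next
    case 3
    then show ?thesis using act0_upper[of t t] assms by simp
  qed
  then show ?thesis using adjoint_act0[OF Z_bounded] assms unfolding Zs_def by blast
qed

lemma Zs_up_act0:
  assumes "r < t" "t \<le> n"
  shows "\<exists>s. act (Zs t (t+1)) 0 0 s"
  using act0_upper[of t "t+1"] adjoint_act0[OF Z_bounded, of t "t+1"] assms unfolding Zs_def by fastforce

lemma diag_adj_blin:
  assumes "1 \<le> a" "b \<le> n+2"
  shows "blin H H (diag_adj a b)"
proof -
  have "set l \<subseteq> {a..<b} \<Longrightarrow> blin H H (foldr (\<lambda>t. Zs t t) l)" for l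
  proof (induction l)
    case Nil
    show ?case using blin_id by (simp add: id_def)
  next
    case (Cons t l)
    then show ?case using blin_comp[of H H "foldr (\<lambda>t. Zs t t) l" H "Zs t t"] Zs_blin[of t t] assms
      by (simp add: comp_def)
  qed
  then show ?thesis by (simp add: diag_adj_def)
qed

lemma up_adj_blin:
  assumes "1 \<le> a" "b \<le> n+1"
  shows "blin H H (up_adj a b)"
proof -
  have "set l \<subseteq> {a..<b} \<Longrightarrow> blin H H (foldr (\<lambda>t. Zs t (t+1)) l)" for l
  proof (induction l)
    case Nil
    show ?case using blin_id by (simp add: id_def)
  next
    case (Cons t l)
    then show ?case using blin_comp[of H H "foldr (\<lambda>t. Zs t (t+1)) l" H "Zs t (t+1)"] Zs_blin[of t "t+1"] assms
      by (simp add: comp_def)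
  qed
  then show ?thesis by (simp add: up_adj_def)
qed

text \<open>The products for \<open>Z i r\<close> and \<open>Z i (r+1)\<close> agree except in one
  factor, \<open>Zs r (r+1)\<close> against \<open>Zs r r\<close>; all other factors preserve the
  level. By \<open>forms_upper\<close> these two adjoints share the coefficient \<open>?p\<close>,
  and therefore the two entries share \<open>?w\<close>.\<close>

lemma forms_lower:
  assumes i: "r < i" "i \<le> n"
  shows "\<exists>t t'. down_form (Z i r) t t' \<and> up_form (Z i (r+1)) t' zero1"
proof -
  obtain p p' where p: "down_form (Z r r) p zero1" "up_form (Z r (r+1)) p' p"
    using forms_upper[of r] r1 by auto
  let ?p = "adjoint_op H1 p" and ?p' = "adjoint_op H1 p'"
  have u: "up_form (Zs r r) ?p zero1"
    using adjoint_down_form[OF Z_bounded p(1)] r_bounds unfolding Zs_def adjoint_zero1 by blast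
  have d: "down_form (Zs r (r+1)) ?p' ?p"
    using adjoint_up_form[OF Z_bounded p(2)] r_bounds unfolding Zs_def by auto
  let ?N = "diag_adj 1 r" and ?M = "up_adj (r+1) i" and ?L = "diag_adj (i+1) (n+2)"
  obtain s where s: "act ?N 0 0 s" using diag_adj_act0[of 1 r] Zs_diag_act0 r1 rn by fastforce
  obtain m where m: "act ?M 0 0 m" using up_adj_act0[of "r+1" i] Zs_up_act0 i by fastforce
  obtain l where l: "act ?L 0 0 l" using diag_adj_act0[of "i+1" "n+2"] Zs_diag_act0 i by fastforce
  have bM: "blin H H ?M" by (rule up_adj_blin) (use i in auto)
  have bL: "blin H H ?L" by (rule diag_adj_blin) (use i in auto)
  have b: "s \<in> bounded_ops H1" "m \<in> bounded_ops H1" "l \<in> bounded_ops H1"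
    using s m l by (auto simp: act_def)
  let ?w = "compose H1 l (compose H1 m (compose H1 ?p s))"
  have "up_form (\<lambda>x. ?L (?M (Zs r r (?N x)))) ?w (compose H1 l (compose H1 m (compose H1 zero1 s)))"
    by (intro act0_comp_up[OF l _ bL] act0_comp_up[OF m _ bM] up_comp_act0[OF u s])
  then have up: "up_form (\<lambda>x. ?L (?M (Zs r r (?N x)))) ?w zero1"
    by (simp only: compose_zero1(2)[OF b(1)] compose_zero1(1)[OF b(1,2)] compose_zero1(1)[OF b(1,3)])
  have down: "down_form (\<lambda>x. ?L (?M (Zs r (r+1) (?N x)))) (compose H1 l (compose H1 m (compose H1 ?p' s))) ?w"
    by (intro act0_comp_down[OF l] act0_comp_down[OF m] down_comp_act0[OF d s])
  have eq1: "Z i (r+1) x = ?L (?M (Zs r r (?N x)))" if "x \<in> H" for x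
  proof (cases "i = r+1")
    case True
    then show ?thesis
      using Z_diag_formula[of i x] diag_adj_Suc[of 1 r x] up_adj_empty[of "r+1"] that r1 i by simp
  next
    case False
    then show ?thesis
      using Z_lower_formula[of "r+1" i x] diag_adj_Suc[of 1 r x] that r1 i by simp
  qed
  have eq2: "Z i r x = ?L (?M (Zs r (r+1) (?N x)))" if "x \<in> H" for x
    using Z_lower_formula[of r i x] up_adj_first[of r i "?N x"] that r1 i by simp
  have "up_form (Z i (r+1)) ?w zero1" by (rule iffD2[OF up_form_cong[OF eq1] up])
  moreover have "down_form (Z i r) (compose H1 l (compose H1 m (compose H1 ?p' s))) ?w"
    by (rule iffD2[OF down_form_cong[OF eq2] down])
  ultimately show ?thesis by blast
qed

text \<open>For \<open>j \<ge> r+2\<close> both shifting factors \<open>Zs r r\<close> and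
  \<open>Zs (r+1) (r+1)\<close> occur, the raising one acting first, so together they preserve every
  level.\<close>

lemma act0_lower:
  assumes "r + 2 \<le> j" "j < i" "i \<le> n"
  shows "\<exists>t. act (Z i j) 0 0 t"
proof -
  obtain p where p: "down_form (Z r r) p zero1" using forms_upper[of r] r1 by auto
  obtain q where q: "up_form (Z (r+1) (r+1)) q zero1" using forms_lower[of "r+1"] assms by auto
  have u: "up_form (Zs r r) (adjoint_op H1 p) zero1"
    using adjoint_down_form[OF Z_bounded p] r_bounds unfolding Zs_def adjoint_zero1 by blast
  have d: "down_form (Zs (r+1) (r+1)) (adjoint_op H1 q) zero1"
    using adjoint_up_form[OF Z_bounded q] r_bounds unfolding Zs_def adjoint_zero1 by auto
  obtain s where s: "act (diag_adj 1 r) 0 0 s" using diag_adj_act0[of 1 r] Zs_diag_act0 r1 rn by fastforce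
  obtain s' where s': "act (diag_adj (r+2) j) 0 0 s'" using diag_adj_act0[of "r+2" j] Zs_diag_act0 assms by fastforce
  obtain m where m: "act (up_adj j i) 0 0 m" using up_adj_act0[of j i] Zs_up_act0 assms by fastforce
  obtain l where l: "act (diag_adj (i+1) (n+2)) 0 0 l"
    using diag_adj_act0[of "i+1" "n+2"] Zs_diag_act0 assms by fastforce
  have sb: "s \<in> bounded_ops H1" using s by (simp add: act_def)
  have "up_form (\<lambda>x. Zs r r (diag_adj 1 r x)) (compose H1 (adjoint_op H1 p) s) zero1"
    using up_comp_act0[OF u s] compose_zero1(2)[OF sb] by simp
  from down_comp_up[OF d this]
  have "act (\<lambda>x. Zs (r+1) (r+1) (Zs r r (diag_adj 1 r x))) 0 0
    (compose H1 (adjoint_op H1 q) (compose H1 (adjoint_op H1 p) s))" .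
  from act_comp[OF l act_comp[OF m act_comp[OF s' this]]]
  obtain t where t: "act (\<lambda>x. diag_adj (i+1) (n+2) (up_adj j i (diag_adj (r+2) j
      (Zs (r+1) (r+1) (Zs r r (diag_adj 1 r x)))))) 0 0 t" by blast
  have eq: "Z i j x = diag_adj (i+1) (n+2) (up_adj j i (diag_adj (r+2) j
      (Zs (r+1) (r+1) (Zs r r (diag_adj 1 r x)))))" if "x \<in> H" for x
    using Z_lower_formula[of j i x] diag_adj_split[of 1 "r+2" j x] diag_adj_Suc[of 1 "r+1" x]
      diag_adj_Suc[of 1 r x] that r1 assms by simp
  show ?thesis using iffD2[OF act_cong[OF eq] t] by blast
qed

lemma act0_all:
  assumes "1 \<le> i" "i \<le> n+1" "1 \<le> j" "j \<le> n+1" "j \<noteq> r" "j \<noteq> r+1"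
  shows "\<exists>t. act (Z i j) 0 0 t"
proof -
  consider "i = n+1" | "i \<le> n" "j < r" | "i \<le> n" "r + 2 \<le> j" "i \<le> j" | "i \<le> n" "r + 2 \<le> j" "j < i"
    using assms by linarith
  then show ?thesis
  proof cases
    case 1
    then show ?thesis using act0_row[of j] assms by (simp add: c_def)
  next
    case 2
    then show ?thesis using act0_below[of i j] assms by simp
  next
    case 3
    then show ?thesis using act0_upper[of i j] assms by simp
  next
    case 4
    then show ?thesis using act0_lower[of j i] assms by simp
  qed
qed

text \<open>The case split reflects the summation range of the convolution: \<open>k = r\<close>
  takes part in column \<open>r+1\<close> just for \<open>i \<le> r\<close>, and
  \<open>k = r+1\<close> takes part in column \<open>r\<close> just for
  \<open>i > r\<close>.\<close>

definition forms :: "nat \<Rightarrow> ('h \<Rightarrow> 'h) \<Rightarrow> ('h \<Rightarrow> 'h) \<Rightarrow> bool" where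
  "forms i t t' \<longleftrightarrow> down_form (Z i r) t (if i \<le> r then zero1 else t')
    \<and> up_form (Z i (r+1)) t' (if i \<le> r then t else zero1)"

lemma forms_all:
  assumes "1 \<le> i" "i \<le> n+1"
  shows "\<exists>t t'. forms i t t'"
proof -
  consider "i \<le> r" | "r < i" "i \<le> n" | "i = n+1" using assms by linarith
  then show ?thesis
  proof cases
    case 1
    then show ?thesis using forms_upper[of i] assms by (auto simp: forms_def)
  next
    case 2
    then show ?thesis using forms_lower[of i] by (auto simp: forms_def)
  next
    case 3
    then show ?thesis using forms_row rn by (auto simp: forms_def c_def)
  qed
qed

text \<open>Columns \<open>r\<close> and \<open>r+1\<close> are chosen as a pair, because the
  coefficient of one is the bottom term of the other.\<close>

definition W :: "nat \<Rightarrow> nat \<Rightarrow> 'h \<Rightarrow> 'h" where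
  "W i j = (if j = r then fst (SOME p. forms i (fst p) (snd p))
     else if j = r+1 then snd (SOME p. forms i (fst p) (snd p)) else (SOME t. act (Z i j) 0 0 t))"

lemma W_forms:
  assumes "1 \<le> i" "i \<le> n+1"
  shows "down_form (Z i r) (W i r) (if i \<le> r then zero1 else W i (r+1))"
    "up_form (Z i (r+1)) (W i (r+1)) (if i \<le> r then W i r else zero1)"
proof -
  have "\<exists>p. forms i (fst p) (snd p)" using forms_all[OF assms] by auto
  from someI_ex[OF this] have "forms i (W i r) (W i (r+1))" by (simp add: W_def)
  then show "down_form (Z i r) (W i r) (if i \<le> r then zero1 else W i (r+1))"
    "up_form (Z i (r+1)) (W i (r+1)) (if i \<le> r then W i r else zero1)"
    by (simp_all only: forms_def)
qed

lemma W_act0: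
  assumes "1 \<le> i" "i \<le> n+1" "1 \<le> j" "j \<le> n+1" "j \<noteq> r" "j \<noteq> r+1"
  shows "act (Z i j) 0 0 (W i j)"
  using someI_ex[OF act0_all[OF assms]] assms by (simp add: W_def)

lemma W_bounded:
  assumes "1 \<le> i" "i \<le> n+1" "1 \<le> j" "j \<le> n+1"
  shows "W i j \<in> bounded_ops H1"
  using W_forms[OF assms(1,2)] W_act0[OF assms] by (cases "j = r \<or> j = r+1") (auto simp: act_def down_form_def up_form_def)

subsection \<open>The relations for the first tensor factor\<close>

text \<open>All relations are homogeneous for the degree \<open>deg\<close>, so they pass to the symbols.\<close>

definition shift_symbol :: "('h \<Rightarrow> 'h) \<Rightarrow> int \<Rightarrow> ('h \<Rightarrow> 'h) \<Rightarrow> bool" where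
  "shift_symbol T d t \<longleftrightarrow> (\<exists>e e'. int e' = int e + d \<and> act T e e' t)"

lemma act_raise: "act T e e' t \<Longrightarrow> act T (e + f) (e' + f) t"
  unfolding act_def
proof (intro conjI allI ballI)
  assume a: "t \<in> bounded_ops H1 \<and> (\<forall>k. \<forall>x\<in>H1. T (J (k + e) x) = J (k + e') (t x))"
  fix k x assume x: "x \<in> H1"
  have "T (J ((k + f) + e) x) = J ((k + f) + e') (t x)" using a x by blast
  then show "T (J (k + (e + f)) x) = J (k + (e' + f)) (t x)" by (simp add: add_ac)
qed blast

lemma shift_symbol_bounded: "shift_symbol T d t \<Longrightarrow> t \<in> bounded_ops H1"
  by (auto simp: shift_symbol_def act_def)

lemma shift_symbol_comp:
  assumes "shift_symbol T d t" "shift_symbol S d' s"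
  shows "shift_symbol (\<lambda>x. T (S x)) (d + d') (compose H1 t s)"
proof -
  obtain e e' f f' where e: "int e' = int e + d" "act T e e' t" and f: "int f' = int f + d'" "act S f f' s"
    using assms by (auto simp: shift_symbol_def)
  have "act T (e + f') (e' + f') t" "act S (f + e) (f' + e) s" using e f act_raise by auto
  then have "act (\<lambda>x. T (S x)) (f + e) (e' + f') (compose H1 t s)"
    using act_comp[of T "e + f'" "e' + f'" t S "f + e" s] by (simp add: add.commute)
  moreover have "int (e' + f') = int (f + e) + (d + d')" using e f by simp
  ultimately show ?thesis unfolding shift_symbol_def by blast
qed

lemma shift_symbol_add:
  assumes "shift_symbol T d t" "shift_symbol S d s"
  shows "shift_symbol (\<lambda>x. T x + S x) d (\<lambda>x\<in>H1. t x + s x)"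
proof -
  obtain e e' f f' where e: "int e' = int e + d" "act T e e' t" and f: "int f' = int f + d" "act S f f' s"
    using assms by (auto simp: shift_symbol_def)
  have eq: "e' + f = f' + e" using e f by linarith
  have T: "act T (e + f) (f' + e) t" using act_raise[OF e(2), of f] eq by simp
  have S: "act S (e + f) (f' + e) s" using act_raise[OF f(2), of e] by (simp add: add.commute)
  have "act (\<lambda>x. T x + S x) (e + f) (f' + e) (\<lambda>x\<in>H1. t x + s x)"
    using T S bi1(4)[of t s] by (auto simp: act_def J_add bounded_ops_mem)
  moreover have "int (f' + e) = int (e + f) + d" using f by simp
  ultimately show ?thesis unfolding shift_symbol_def by blast
qed

lemma shift_symbol_id: "shift_symbol (\<lambda>x. x) 0 (\<lambda>x\<in>H1. x)"
  unfolding shift_symbol_def using act_id[of 0] by auto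

lemma shift_symbol_zero: "shift_symbol (\<lambda>x. 0) d zero1"
proof -
  have "act (\<lambda>x. 0) (nat (-d)) (nat d) zero1" using bi1(2) by (simp add: act_def J_zero)
  moreover have "int (nat d) = int (nat (-d)) + d" by simp
  ultimately show ?thesis unfolding shift_symbol_def by blast
qed

text \<open>Both operators are evaluated on a level beyond both offsets; equal degrees put the
  results on the same level, where \<open>J\<close> is injective.\<close>

lemma shift_symbol_unique:
  assumes "shift_symbol T d t" "shift_symbol S d s" "\<And>x. x \<in> H \<Longrightarrow> T x = S x"
  shows "t = s"
proof -
  obtain e e' f f' where e: "int e' = int e + d" "act T e e' t" and f: "int f' = int f + d" "act S f f' s"
    using assms by (auto simp: shift_symbol_def)
  have b: "t \<in> bounded_ops H1" "s \<in> bounded_ops H1" using e f by (auto simp: act_def)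
  show ?thesis
  proof (rule bounded_ops_eqI[OF b])
    fix x assume x: "x \<in> H1"
    have "T (J (f + e) x) = J (f + e') (t x)" "S (J (e + f) x) = J (e + f') (s x)"
      using e f x by (auto simp: act_def)
    moreover have "T (J (f + e) x) = S (J (e + f) x)" using assms(3)[OF J_mem[OF x]] by (simp add: add.commute)
    moreover have "f + e' = e + f'" using e f by linarith
    ultimately have "J (f + e') (t x) = J (f + e') (s x)" by simp
    then show "t x = s x" using J_inj bounded_ops_mem[OF b(1) x] bounded_ops_mem[OF b(2) x] by blast
  qed
qed

lemma shift_symbol_opprod:
  assumes "\<And>t. a \<le> t \<Longrightarrow> t < b \<Longrightarrow> shift_symbol (f t) (dg t) (g t)"
  shows "shift_symbol (opprod f a b) (\<Sum>t=a..<b. dg t) (ordprod (B_op H1) g a b)"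
proof (cases "a \<le> b")
  case False
  have "opprod f a b = (\<lambda>x. x)" using False by (intro ext) (simp add: opprod_empty)
  moreover have "ordprod (B_op H1) g a b = (\<lambda>x\<in>H1. x)" using False by (simp add: ordprod_def)
  ultimately show ?thesis using shift_symbol_id False by simp
next
  case True
  then show ?thesis
    using assms
  proof (induction a rule: inc_induct)
    case base
    have "opprod f b b = (\<lambda>x. x)" by (intro ext) (simp add: opprod_empty)
    moreover have "ordprod (B_op H1) g b b = (\<lambda>x\<in>H1. x)" by (simp add: ordprod_def)
    moreover have "(\<Sum>t=b..<b. dg t) = 0" by simp
    ultimately show ?case using shift_symbol_id by (simp only:)
  next
    case (step a)
    have "opprod f a b = (\<lambda>x. f a (opprod f (Suc a) b x))"
      using step.hyps by (intro ext) (simp add: opprod_first)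
    moreover have "ordprod (B_op H1) g a b = compose H1 (g a) (ordprod (B_op H1) g (Suc a) b)"
      using step.hyps by (simp add: ordprod_def upt_conv_Cons)
    moreover have "(\<Sum>t=a..<b. dg t) = dg a + (\<Sum>t=Suc a..<b. dg t)"
      using step.hyps by (simp add: sum.atLeast_Suc_lessThan)
    ultimately show ?case
      using shift_symbol_comp[of "f a" "dg a" "g a" "opprod f (Suc a) b"] step by simp
  qed
qed

text \<open>The shift of level caused by an entry of column \<open>j\<close>: the left shift in
  column \<open>r\<close>, its adjoint in column \<open>r+1\<close>. It depends on the column
  alone.\<close>

definition deg :: "nat \<Rightarrow> int" where
  "deg j = (if j = r then -1 else 0) + (if j = r+1 then 1 else 0)"

lemma symbol_Z:
  assumes "1 \<le> i" "i \<le> n+1" "1 \<le> j" "j \<le> n+1"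
  shows "shift_symbol (Z i j) (deg j) (W i j)"
proof -
  consider "j = r" | "j = r+1" | "j \<noteq> r" "j \<noteq> r+1" by blast
  then show ?thesis
  proof cases
    case 1
    have "act (Z i r) 1 0 (W i r)" using W_forms(1)[OF assms(1,2)] by (auto simp: down_form_def act_def)
    then show ?thesis unfolding shift_symbol_def using 1
      by (intro exI[of _ 1] exI[of _ 0]) (simp add: deg_def)
  next
    case 2
    have "act (Z i (r+1)) 1 2 (W i (r+1))" using W_forms(2)[OF assms(1,2)] by (auto simp: up_form_def act_def)
    then show ?thesis unfolding shift_symbol_def using 2
      by (intro exI[of _ 1] exI[of _ 2]) (simp add: deg_def)
  next
    case 3
    then have "act (Z i j) 0 0 (W i j)" using W_act0 assms by blast
    then show ?thesis unfolding shift_symbol_def using 3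
      by (intro exI[of _ 0] exI[of _ 0]) (simp add: deg_def)
  qed
qed

lemma symbol_Zs:
  assumes "1 \<le> i" "i \<le> n+1" "1 \<le> j" "j \<le> n+1"
  shows "shift_symbol (Zs i j) (- deg j) (adjoint_op H1 (W i j))"
proof -
  note Zb = Z_bounded[OF assms]
  consider "j = r" | "j = r+1" | "j \<noteq> r" "j \<noteq> r+1" by blast
  then show ?thesis
  proof cases
    case 1
    have "up_form (Zs i r) (adjoint_op H1 (W i r)) (adjoint_op H1 (if i \<le> r then zero1 else W i (r+1)))"
      unfolding Zs_def by (rule adjoint_down_form[OF _ W_forms(1)[OF assms(1,2)]]) (use Zb 1 in simp)
    then have "act (Zs i r) 1 2 (adjoint_op H1 (W i r))" by (auto simp: up_form_def act_def)
    then show ?thesis unfolding shift_symbol_def using 1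
      by (intro exI[of _ 1] exI[of _ 2]) (simp add: deg_def)
  next
    case 2
    have "down_form (Zs i (r+1)) (adjoint_op H1 (W i (r+1))) (adjoint_op H1 (if i \<le> r then W i r else zero1))"
      unfolding Zs_def by (rule adjoint_up_form[OF _ W_forms(2)[OF assms(1,2)]]) (use Zb 2 in simp)
    then have "act (Zs i (r+1)) 1 0 (adjoint_op H1 (W i (r+1)))" by (auto simp: down_form_def act_def)
    then show ?thesis unfolding shift_symbol_def using 2
      by (intro exI[of _ 1] exI[of _ 0]) (simp add: deg_def)
  next
    case 3
    then have "act (Zs i j) 0 0 (adjoint_op H1 (W i j))"
      unfolding Zs_def using W_act0 assms by (intro adjoint_act0[OF Zb]) blast
    then show ?thesis unfolding shift_symbol_def using 3
      by (intro exI[of _ 0] exI[of _ 0]) (simp add: deg_def)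
  qed
qed

lemma deg_sum: "(\<Sum>t=1..<n+2. deg t) = 0"
proof -
  have "(\<Sum>t=1..<n+2. deg t) = (\<Sum>t=1..<n+2. if t = r then -1 else 0) + (\<Sum>t=1..<n+2. if t = r+1 then 1 else 0)"
    unfolding deg_def by (rule sum.distrib)
  also have "\<dots> = 0" using r1 rn by (simp add: sum.delta)
  finally show ?thesis .
qed

text \<open>The factors of the star product occupy each column except \<open>s\<close> exactly once,
  and all degrees add up to 0. So the product has the degree of the adjoint of an entry in column
  \<open>s\<close>.\<close>

lemma deg_sum_omit:
  assumes "1 \<le> s" "s \<le> m" "m \<le> n+1"
  shows "(\<Sum>t=1..<s. deg t) + (\<Sum>t=s..<m. deg (t+1)) + (\<Sum>t=m+1..<n+2. deg t) = - deg s"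
proof -
  have "(\<Sum>t=s..<m. deg (t+1)) = (\<Sum>t=s+1..<m+1. deg t)"
    using sum.shift_bounds_Suc_ivl[of deg s m] by simp
  moreover have "(\<Sum>t=1..<n+2. deg t) = (\<Sum>t=1..<s. deg t) + (\<Sum>t=s..<n+2. deg t)"
    using assms by (intro sum.atLeastLessThan_concat[symmetric]) auto
  moreover have "(\<Sum>t=s..<n+2. deg t) = deg s + (\<Sum>t=s+1..<n+2. deg t)"
    using sum.atLeast_Suc_lessThan[of s "n+2" deg] assms by (simp only: Suc_eq_plus1)
  moreover have "(\<Sum>t=s+1..<n+2. deg t) = (\<Sum>t=s+1..<m+1. deg t) + (\<Sum>t=m+1..<n+2. deg t)"
    using assms by (intro sum.atLeastLessThan_concat[symmetric]) auto
  ultimately show ?thesis using deg_sum by linarith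
qed

lemma deg_sum_omit':
  assumes "1 \<le> m" "m \<le> s" "s \<le> n+1"
  shows "(\<Sum>t=1..<m. deg t) + (\<Sum>t=m..<s. deg t) + (\<Sum>t=s+1..<n+2. deg t) = - deg s"
proof -
  have "(\<Sum>t=1..<m. deg t) + (\<Sum>t=m..<s. deg t) = (\<Sum>t=1..<s. deg t)"
    using assms by (intro sum.atLeastLessThan_concat) auto
  then show ?thesis using deg_sum_omit[of s s] assms by simp
qed

lemma symbol_diag:
  assumes "1 \<le> a" "b \<le> n+2"
  shows "shift_symbol (opprod (\<lambda>t. Z t t) a b) (\<Sum>t=a..<b. deg t) (ordprod (B_op H1) (\<lambda>t. W t t) a b)"
  by (rule shift_symbol_opprod) (use assms in \<open>auto intro!: symbol_Z\<close>)

text \<open>Each relation for \<open>Z\<close> equates operators with symbols of one degree, and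
  symbols are multiplicative, additive and unique. The bottom-level terms do not enter a symbol, so
  the coefficients satisfy the relations without corrections.\<close>

lemma W_relations: "SU0_relations n (B_op H1) W"
proof (rule SU0_relationsI; (unfold B_op_simps(1,3,4,7))?)
  let ?I = "{1..n+1}"
  have sZ: "shift_symbol (Z i j) (deg j) (W i j)" and sS: "shift_symbol (Zs i j) (- deg j) (adjoint_op H1 (W i j))"
    if "i \<in> ?I" "j \<in> ?I" for i j using symbol_Z symbol_Zs that by auto
  note sZZ = shift_symbol_comp[OF sZ sZ]
  {
    fix i j assume i: "i \<in> ?I" and j: "j \<in> ?I"
    show "W i j \<in> bounded_ops H1" using W_bounded i j by simp
    fix l assume l: "l \<in> ?I" "j < l"
    show "compose H1 (W i j) (W i l) = zero1"
      by (rule shift_symbol_unique[OF sZZ[OF i j i l(1)] shift_symbol_zero]) (rule row[OF i j l(1,2)])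
  }
  {
    fix i k j assume i: "i \<in> ?I" and k: "k \<in> ?I" and j: "j \<in> ?I" and lt: "i < k"
    show "compose H1 (W i j) (W k j) = zero1"
      by (rule shift_symbol_unique[OF sZZ[OF i j k j] shift_symbol_zero]) (rule col[OF i k j lt])
  }
  {
    fix i k j l assume i: "i \<in> ?I" and k: "k \<in> ?I" and j: "j \<in> ?I" and l: "l \<in> ?I" and lt: "i < k" "j < l"
    show "compose H1 (W i l) (W k j) = compose H1 (W k j) (W i l)"
      \<comment> \<open>The two sides have the same degree up to the order of the summands.\<close>
      by (rule shift_symbol_unique[OF sZZ[OF i l k j, unfolded add.commute[of "deg l"]] sZZ[OF k j i l]])
        (rule anti_comm[OF i k j l lt])
    show "compose H1 (W i l) (W k j) = zero1" if "min k l \<le> max i j"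
      by (rule shift_symbol_unique[OF sZZ[OF i l k j] shift_symbol_zero]) (rule anti_zero[OF i k j l lt that])
    show "compose H1 (W i j) (W k l) = compose H1 (W k l) (W i j)" if "max i j + 1 < min k l"
      by (rule shift_symbol_unique[OF sZZ[OF i j k l, unfolded add.commute[of "deg j"]] sZZ[OF k l i j]])
        (rule diag_comm[OF i k j l lt that])
    show "compose H1 (W i j) (W k l) \<ominus>\<^bsub>B_op H1\<^esub> compose H1 (W k l) (W i j) = compose H1 (W i l) (W k j)"
      if eq: "max i j + 1 = min k l"
    proof -
      have b: "compose H1 (W a a') (W d d') \<in> bounded_ops H1" if "a \<in> ?I" "a' \<in> ?I" "d \<in> ?I" "d' \<in> ?I" for a a' d d'
        by (rule shift_symbol_bounded[OF sZZ[OF that]])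
      note add = shift_symbol_add[OF sZZ[OF k l i j] sZZ[OF i l k j]]
      have "compose H1 (W i j) (W k l) = (\<lambda>x\<in>H1. compose H1 (W k l) (W i j) x + compose H1 (W i l) (W k j) x)"
        by (rule shift_symbol_unique[OF sZZ[OF i j k l, unfolded add.commute[of "deg j"]] add])
          (rule diag_next[OF i k j l lt eq])
      then show ?thesis
        unfolding B_op_minus[OF hilbert_H1 b[OF i j k l] b[OF k l i j]]
        by (intro bounded_ops_eqI[OF bi1(7)[OF b[OF i j k l] b[OF k l i j]] b[OF i l k j]]) simp
    qed
  }
  have "ordprod (B_op H1) (\<lambda>t. W t t) 1 (n+2) = (\<lambda>x\<in>H1. x)"
    using shift_symbol_unique[OF symbol_diag[of 1 "n+2", unfolded deg_sum] shift_symbol_id det] by simp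
  then show "ordprod (B_op H1) (\<lambda>t. W t t) 1 (n+2) = \<one>\<^bsub>B_op H1\<^esub>" by simp
  {
    fix i j r' s assume i: "i \<in> ?I" and j: "j \<in> ?I" and r': "r' \<in> ?I" and s: "s \<in> ?I" and ne: "i \<noteq> r'" "j \<noteq> s"
    show "compose H1 (W i j) (adjoint_op H1 (W r' s)) = compose H1 (adjoint_op H1 (W r' s)) (W i j)"
      by (rule shift_symbol_unique[OF shift_symbol_comp[OF sZ[OF i j] sS[OF r' s], unfolded add.commute[of "deg j"]]
            shift_symbol_comp[OF sS[OF r' s] sZ[OF i j]]])
        (use star_comm[OF i j r' s ne] in \<open>simp add: Zs_def\<close>)
  }
  {
    fix r' s assume r': "r' \<in> ?I" and s: "s \<in> ?I" and lt: "s < r'"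
    have u: "shift_symbol (opprod (\<lambda>t. Z t (t+1)) s r') (\<Sum>t=s..<r'. deg (t+1))
        (ordprod (B_op H1) (\<lambda>t. W t (t+1)) s r')"
      by (rule shift_symbol_opprod) (use r' s in \<open>auto intro!: symbol_Z\<close>)
    note p = shift_symbol_comp[OF shift_symbol_comp[OF symbol_diag[of 1 s] u] symbol_diag[of "r'+1" "n+2"]]
    show "adjoint_op H1 (W r' s) = compose H1 (compose H1 (ordprod (B_op H1) (\<lambda>t. W t t) 1 s)
        (ordprod (B_op H1) (\<lambda>t. W t (t+1)) s r')) (ordprod (B_op H1) (\<lambda>t. W t t) (r'+1) (n+2))"
    proof (rule shift_symbol_unique[OF sS[OF r' s]])
      show "shift_symbol (\<lambda>x. opprod (\<lambda>t. Z t t) 1 s (opprod (\<lambda>t. Z t (t+1)) s r' (opprod (\<lambda>t. Z t t) (r'+1) (n+2) x)))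
        (- deg s) (compose H1 (compose H1 (ordprod (B_op H1) (\<lambda>t. W t t) 1 s)
        (ordprod (B_op H1) (\<lambda>t. W t (t+1)) s r')) (ordprod (B_op H1) (\<lambda>t. W t t) (r'+1) (n+2)))"
        using p deg_sum_omit[of s r'] r' s lt by simp
    qed (use star_lower[OF r' s lt] in \<open>simp add: Zs_def\<close>)
  }
  {
    fix r' s assume r': "r' \<in> ?I" and s: "s \<in> ?I" and lt: "r' < s"
    have u: "shift_symbol (opprod (\<lambda>t. Z (t+1) t) r' s) (\<Sum>t=r'..<s. deg t)
        (ordprod (B_op H1) (\<lambda>t. W (t+1) t) r' s)"
      by (rule shift_symbol_opprod) (use r' s in \<open>auto intro!: symbol_Z\<close>)
    note p = shift_symbol_comp[OF shift_symbol_comp[OF symbol_diag[of 1 r'] u] symbol_diag[of "s+1" "n+2"]]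
    show "adjoint_op H1 (W r' s) = compose H1 (compose H1 (ordprod (B_op H1) (\<lambda>t. W t t) 1 r')
        (ordprod (B_op H1) (\<lambda>t. W (t+1) t) r' s)) (ordprod (B_op H1) (\<lambda>t. W t t) (s+1) (n+2))"
    proof (rule shift_symbol_unique[OF sS[OF r' s]])
      show "shift_symbol (\<lambda>x. opprod (\<lambda>t. Z t t) 1 r' (opprod (\<lambda>t. Z (t+1) t) r' s (opprod (\<lambda>t. Z t t) (s+1) (n+2) x)))
        (- deg s) (compose H1 (compose H1 (ordprod (B_op H1) (\<lambda>t. W t t) 1 r')
        (ordprod (B_op H1) (\<lambda>t. W (t+1) t) r' s)) (ordprod (B_op H1) (\<lambda>t. W t t) (s+1) (n+2)))"
        using p deg_sum_omit'[of r' s] r' s lt by simp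
    qed (use star_upper[OF r' s lt] in \<open>simp add: Zs_def\<close>)
  }
  {
    fix s assume s: "s \<in> ?I"
    note p = shift_symbol_comp[OF symbol_diag[of 1 s] symbol_diag[of "s+1" "n+2"]]
    show "adjoint_op H1 (W s s) = compose H1 (ordprod (B_op H1) (\<lambda>t. W t t) 1 s)
        (ordprod (B_op H1) (\<lambda>t. W t t) (s+1) (n+2))"
    proof (rule shift_symbol_unique[OF sS[OF s s]])
      show "shift_symbol (\<lambda>x. opprod (\<lambda>t. Z t t) 1 s (opprod (\<lambda>t. Z t t) (s+1) (n+2) x))
        (- deg s) (compose H1 (ordprod (B_op H1) (\<lambda>t. W t t) 1 s) (ordprod (B_op H1) (\<lambda>t. W t t) (s+1) (n+2)))"
        using p deg_sum_omit[of s s] s by simp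
    qed (use star_diag[OF s] in \<open>simp add: Zs_def\<close>)
  }
qed

end

section \<open>Transport along a unitary\<close>

lemma representation_transport:
  assumes \<pi>: "representation A H \<pi>" and L: "hilbert_subspace L" and U: "blin H L U" and img: "U ` H = L"
    and inner: "\<And>x y. x \<in> H \<Longrightarrow> y \<in> H \<Longrightarrow> cinner (U x) (U y) = cinner x y"
  obtains \<rho> where "representation A L \<rho>" "unitarily_equivalent A H \<pi> L \<rho>"
    "\<And>a x. a \<in> carrier A \<Longrightarrow> x \<in> H \<Longrightarrow> \<rho> a (U x) = U (\<pi> a x)"
proof -
  note p = representationD[OF \<pi>]
  note Hs = hilbert_subspaceD[OF p(1)]
  have inj: "inj_on U H"
  proof (rule inj_onI)
    fix x y assume xy: "x \<in> H" "y \<in> H" "U x = U y"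
    have "U (x - y) = 0" using blin_diff[OF U Hs(2) xy(1,2)] xy(3) by simp
    then have "cinner (x - y) (x - y) = 0" using inner[of "x - y" "x - y"] Hs(5)[OF xy(1,2)] by simp
    then show "x = y" by (simp add: cinner_self_eq_0)
  qed
  define V where "V = inv_into H U"
  have VU: "V (U x) = x" if "x \<in> H" for x unfolding V_def by (rule inv_into_f_f[OF inj that])
  have UV: "U (V \<xi>) = \<xi>" and VH: "V \<xi> \<in> H" if "\<xi> \<in> L" for \<xi>
    using that img unfolding V_def by (auto intro: f_inv_into_f inv_into_into)
  have bV: "blin L H V"
  proof (rule blinI)
    fix \<xi> \<eta> assume "\<xi> \<in> L" "\<eta> \<in> L"
    then obtain x y where "x \<in> H" "y \<in> H" "\<xi> = U x" "\<eta> = U y" using img by blast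
    then show "V (\<xi> + \<eta>) = V \<xi> + V \<eta>" using VU[of "x + y"] blinD(2)[OF U, of x y] Hs(4) by (simp add: VU)
  next
    fix \<xi> c assume "\<xi> \<in> L"
    then obtain x where "x \<in> H" "\<xi> = U x" using img by blast
    then show "V (c *\<^sub>C \<xi>) = c *\<^sub>C V \<xi>" using VU[of "c *\<^sub>C x"] blinD(3)[OF U, of x c] Hs(7) by (simp add: VU)
  next
    fix \<xi> assume "\<xi> \<in> L"
    then obtain x where "x \<in> H" "\<xi> = U x" using img by blast
    then show "norm (V \<xi>) \<le> 1 * norm \<xi>" using norm_eq_of_cinner_eq[OF inner[of x x]] by (simp add: VU)
  qed (rule VH)
  define \<rho> where "\<rho> a = (\<lambda>\<xi>\<in>L. U (\<pi> a (V \<xi>)))" for a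
  have \<rho>U: "\<rho> a (U x) = U (\<pi> a x)" if "x \<in> H" for a x
    using that img by (auto simp: \<rho>_def VU)
  have bo: "\<rho> a \<in> bounded_ops L" if "a \<in> carrier A" for a
    unfolding \<rho>_def
    by (rule restrict_bounded_ops[OF blin_comp[OF blin_comp[OF bV bounded_ops_blin[OF p(2)[OF that]]] U]])
      (rule hilbert_subspaceD(2)[OF L])
  have UL: "U x \<in> L" if "x \<in> H" for x using that img by blast
  have "\<rho> \<in> ring_hom A (B_op L)"
  proof (rule ring_hom_memI)
    show "\<rho> a \<in> carrier (B_op L)" if "a \<in> carrier A" for a using bo[OF that] by simp
    show "\<rho> (a \<otimes>\<^bsub>A\<^esub> b) = \<rho> a \<otimes>\<^bsub>B_op L\<^esub> \<rho> b" if ab: "a \<in> carrier A" "b \<in> carrier A" for a b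
      unfolding B_op_simps compose_def \<rho>_def
      by (rule restrict_ext) (use ab VH in \<open>simp add: p(3) p(8) VU UL\<close>)
    show "\<rho> (a \<oplus>\<^bsub>A\<^esub> b) = \<rho> a \<oplus>\<^bsub>B_op L\<^esub> \<rho> b" if ab: "a \<in> carrier A" "b \<in> carrier A" for a b
      unfolding B_op_simps \<rho>_def
      by (rule restrict_ext) (use ab VH in \<open>simp add: p(4) p(8) blinD(2)[OF U]\<close>)
    show "\<rho> \<one>\<^bsub>A\<^esub> = \<one>\<^bsub>B_op L\<^esub>"
      unfolding B_op_simps \<rho>_def by (rule restrict_ext) (simp add: p(5) VH UV)
  qed
  moreover have "\<rho> (c \<odot>\<^bsub>A\<^esub> a) = c \<odot>\<^bsub>B_op L\<^esub> \<rho> a" if "a \<in> carrier A" for c a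
    unfolding B_op_simps \<rho>_def
    by (rule restrict_ext) (use that VH in \<open>simp add: p(6) p(8) blinD(3)[OF U]\<close>)
  moreover have "\<rho> (cstar A a) = cstar (B_op L) (\<rho> a)" if a: "a \<in> carrier A" for a
    unfolding B_op_simps
  proof -
    have b: "\<pi> (cstar A a) \<in> bounded_ops H" using p(7)[OF a] adjoint_props(1)[OF p(1) p(2)[OF a]] by simp
    have "\<rho> (cstar A a) \<in> bounded_ops L"
      unfolding \<rho>_def
      by (rule restrict_bounded_ops[OF blin_comp[OF blin_comp[OF bV bounded_ops_blin[OF b]] U]])
        (rule hilbert_subspaceD(2)[OF L])
    then show "\<rho> (cstar A a) = adjoint_op L (\<rho> a)"
    proof (rule adjoint_op_eqI[OF L, symmetric])
      fix \<xi> \<eta> assume "\<xi> \<in> L" "\<eta> \<in> L"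
      then obtain x y where xy: "x \<in> H" "y \<in> H" "\<xi> = U x" "\<eta> = U y" using img by blast
      have "cinner (\<pi> a x) y = cinner x (\<pi> (cstar A a) y)"
        using adjoint_props(2)[OF p(1) p(2)[OF a] xy(1,2)] p(7)[OF a] by simp
      then show "cinner (\<rho> a \<xi>) \<eta> = cinner \<xi> (\<rho> (cstar A a) \<eta>)"
        using xy a bounded_ops_mem[OF b xy(2)] by (simp add: \<rho>U inner p(8))
    qed
  qed
  ultimately have rep: "representation A L \<rho>"
    using L by (simp add: representation_def unital_star_hom_def)
  have "bij_betw U H L" using inj img by (simp add: bij_betw_def)
  then have "unitarily_equivalent A H \<pi> L \<rho>"
    unfolding unitarily_equivalent_def using blinD(2,3)[OF U] inner \<rho>U by (intro exI[of _ U]) simp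
  with rep \<rho>U show ?thesis using that by blast
qed

context SU0_ops
begin

text \<open>The star relations express each adjoint as a product of generators, so invariance under
  the generators already implies invariance under their adjoints.\<close>

lemma Zs_invariant:
  assumes Z: "\<And>i j x. 1 \<le> i \<Longrightarrow> i \<le> n+1 \<Longrightarrow> 1 \<le> j \<Longrightarrow> j \<le> n+1 \<Longrightarrow> x \<in> K \<Longrightarrow> Z i j x \<in> K"
    and K: "K \<subseteq> H" and ij: "i \<in> {1..n+1}" "j \<in> {1..n+1}" and x: "x \<in> K"
  shows "adjoint_op H (Z i j) x \<in> K"
proof -
  have d: "opprod (\<lambda>t. Z t t) a b y \<in> K" if "1 \<le> a" "b \<le> n+2" "y \<in> K" for a b y
    by (rule opprod_mem) (use that in \<open>auto intro!: Z\<close>)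
  have u: "opprod (\<lambda>t. Z t (t+1)) a b y \<in> K" if "1 \<le> a" "b \<le> n+1" "y \<in> K" for a b y
    by (rule opprod_mem) (use that in \<open>auto intro!: Z\<close>)
  have l: "opprod (\<lambda>t. Z (t+1) t) a b y \<in> K" if "1 \<le> a" "b \<le> n+1" "y \<in> K" for a b y
    by (rule opprod_mem) (use that in \<open>auto intro!: Z\<close>)
  have xH: "x \<in> H" using x K by blast
  consider "i < j" | "i = j" | "j < i" by linarith
  then show ?thesis
  proof cases
    case 1
    show ?thesis unfolding star_upper[OF ij 1 xH] using ij x 1 by (intro d l) auto
  next
    case 2
    show ?thesis unfolding 2[symmetric] star_diag[OF ij(1) xH] using ij x by (intro d) auto
  next
    case 3
    show ?thesis unfolding star_lower[OF ij 3 xH] using ij x 3 by (intro d u) auto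
  qed
qed

end

section \<open>The unitary onto the tensor product and irreducibility of the first factor\<close>

context SU0_total
begin

lemma tensor_unitary:
  obtains U where "blin H (tensor_ell2 H1) U" "U ` H = tensor_ell2 H1"
    "\<And>x y. x \<in> H \<Longrightarrow> y \<in> H \<Longrightarrow> cinner (U x) (U y) = cinner x y"
    "\<And>k x. x \<in> H1 \<Longrightarrow> U (J k x) = ell2_at k x"
proof -
  let ?I = "(UNIV :: nat set) \<times> H1"
  have "cinner ((\<lambda>(k, x). J k x) i) ((\<lambda>(k, x). J k x) j)
      = cinner ((\<lambda>(k, x). ell2_at k x) i) ((\<lambda>(k, x). ell2_at k x) j)" if "i \<in> ?I" "j \<in> ?I" for i j
    using that by (cases i; cases j) (simp add: J_gram cinner_ell2_at)
  then obtain U where U: "blin (clspan ((\<lambda>(k, x). J k x) ` ?I)) (clspan ((\<lambda>(k, x). ell2_at k x) ` ?I)) U"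
    "\<And>i. i \<in> ?I \<Longrightarrow> U ((\<lambda>(k, x). J k x) i) = (\<lambda>(k, x). ell2_at k x) i"
    "\<And>u v. u \<in> clspan ((\<lambda>(k, x). J k x) ` ?I) \<Longrightarrow> v \<in> clspan ((\<lambda>(k, x). J k x) ` ?I) \<Longrightarrow> cinner (U u) (U v) = cinner u v"
    "U ` clspan ((\<lambda>(k, x). J k x) ` ?I) = clspan ((\<lambda>(k, x). ell2_at k x) ` ?I)"
    using gram_isometry[of ?I "\<lambda>(k, x). J k x" "\<lambda>(k, x). ell2_at k x"] by blast
  have UJ: "U (J k x) = ell2_at k x" if "x \<in> H1" for k x using U(2)[of "(k, x)"] that by simp
  note U' = U(1,3,4)[folded J_total tensor_ell2_at[OF hilbert_H1]]
  show ?thesis by (rule that[OF U'(1,3,2) UJ])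
qed

text \<open>Under \<psi> column \<open>j\<close> has its diagonal entry and, for \<open>j\<close>
  equal to \<open>r\<close> or \<open>r+1\<close>, one neighbour. So at most two terms survive;
  whether the neighbour lies between \<open>min i j\<close> and \<open>max i j\<close> is decided by
  \<open>i \<le> r\<close>, in agreement with \<open>forms\<close>.\<close>

lemma sum_psi_terms:
  assumes i: "1 \<le> i" "i \<le> n+1" and j: "1 \<le> j" "j \<le> n+1" and x: "x \<in> H1" and U: "blin H L U"
    and UJ: "\<And>k x. x \<in> H1 \<Longrightarrow> U (J k x) = ell2_at k x"
  shows "(\<Sum>k=min i j..max i j. reindex_op (psi_index r k j) (W i k) (ell2_at m x)) = U (Z i j (J m x))"
proof -
  let ?T = "\<lambda>k. reindex_op (psi_index r k j) (W i k) (ell2_at m x)" and ?S = "{min i j..max i j}"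
  have Wb: "W i k \<in> bounded_ops H1" if "k \<in> ?S" for k using W_bounded[OF i] i j that by auto
  note Wm = bounded_ops_mem[OF Wb x]
  have at: "?T k = ell2_at p (W i k x)" if "k \<in> ?S" "psi_index r k j p = Some m" for k p
    using reindex_op_at(1)[OF hilbert_H1 bounded_ops_blin[OF Wb[OF that(1)]] inj_psi_index x that(2)] .
  have zero: "?T k = 0" if "k \<in> ?S" "\<And>p. psi_index r k j p \<noteq> Some m" for k
    using reindex_op_at(2)[OF hilbert_H1 bounded_ops_blin[OF Wb[OF that(1)]] inj_psi_index x that(2)] .
  consider "j = r" | "j = r+1" | "j \<noteq> r" "j \<noteq> r+1" by blast
  then show ?thesis
  proof cases
    case 1
    have Tr: "?T r = (if m = 0 then 0 else ell2_at (m-1) (W i r x))"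
    proof (cases m)
      case 0
      then show ?thesis using zero[of r] 1 by (simp add: psi_index_def)
    next
      case (Suc p)
      then show ?thesis using at[of r p] 1 by (simp add: psi_index_def)
    qed
    have other: "?T k = 0" if "k \<in> ?S" "k \<noteq> r" "k \<noteq> r+1" for k
      by (rule zero[OF that(1)]) (use that 1 in \<open>simp add: psi_index_def\<close>)
    note f = W_forms(1)[OF i, unfolded down_form_def]
    show ?thesis
    proof (cases "i \<le> r")
      case True
      have "sum ?T ?S = ?T r" by (rule sum_single_term) (use 1 True other in auto)
      moreover have "Z i r (J m x) = (if m = 0 then 0 else J (m-1) (W i r x))"
        using f True x J_zero by (cases m) auto
      moreover have "W i r x \<in> H1" using Wm[of r] 1 by simp
      ultimately show ?thesis using 1 Tr UJ blin_zero[OF U Hs(2)] by simp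
    next
      case False
      have S: "r \<in> ?S" "r+1 \<in> ?S" using 1 False by auto
      have "sum ?T ?S = sum ?T {r, r+1}"
        by (rule sum.mono_neutral_right) (use S other in auto)
      then have "sum ?T ?S = ?T r + ?T (r+1)" by simp
      moreover have "?T (r+1) = (if m = 0 then ell2_at 0 (W i (r+1) x) else 0)"
        using at[OF S(2), of 0] zero[OF S(2)] 1 by (cases m) (simp_all add: psi_index_def)
      moreover have "Z i r (J m x) = (if m = 0 then J 0 (W i (r+1) x) else J (m-1) (W i r x))"
        using f False x by (cases m) auto
      moreover have "W i r x \<in> H1" "W i (r+1) x \<in> H1" using Wm S by auto
      ultimately show ?thesis using 1 Tr UJ by simp
    qed
  next
    case 2
    have S: "r+1 \<in> ?S" using 2 by auto
    have T1: "?T (r+1) = ell2_at (Suc m) (W i (r+1) x)"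
      using at[OF S, of "Suc m"] 2 by (simp add: psi_index_def)
    have other: "?T k = 0" if "k \<in> ?S" "k \<noteq> r" "k \<noteq> r+1" for k
      by (rule zero[OF that(1)]) (use that 2 in \<open>simp add: psi_index_def\<close>)
    have w1: "W i (r+1) x \<in> H1" by (rule Wm[OF S])
    note f = W_forms(2)[OF i, unfolded up_form_def]
    show ?thesis
    proof (cases "i \<le> r")
      case True
      have Sr: "r \<in> ?S" using 2 True by auto
      have "sum ?T ?S = sum ?T {r, r+1}"
        by (rule sum.mono_neutral_right) (use S Sr other in auto)
      then have "sum ?T ?S = ?T r + ?T (r+1)" by simp
      moreover have "?T r = (if m = 0 then ell2_at 0 (W i r x) else 0)"
        using at[OF Sr, of 0] zero[OF Sr] 2 by (cases m) (simp_all add: psi_index_def)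
      moreover have "Z i (r+1) (J m x) = J (Suc m) (W i (r+1) x) + (if m = 0 then J 0 (W i r x) else 0)"
        using f True x by simp
      moreover have wr: "W i r x \<in> H1" by (rule Wm[OF Sr])
      moreover have "U (J (Suc m) (W i (r+1) x) + (if m = 0 then J 0 (W i r x) else 0))
          = ell2_at (Suc m) (W i (r+1) x) + (if m = 0 then ell2_at 0 (W i r x) else 0)"
        using blinD(2)[OF U J_mem[OF w1] J_mem[OF wr]] UJ[OF w1] UJ[OF wr] by simp
      ultimately show ?thesis using 2 T1 by (simp add: add.commute)
    next
      case False
      have "sum ?T ?S = ?T (r+1)" by (rule sum_single_term) (use 2 S False other in auto)
      moreover have "Z i (r+1) (J m x) = J (Suc m) (W i (r+1) x)"
        using f False x by (simp add: J_zero)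
      ultimately show ?thesis using 2 T1 UJ[OF w1] by simp
    qed
  next
    case 3
    have S: "j \<in> ?S" by auto
    have "sum ?T ?S = ?T j"
    proof (rule sum_single_term)
      show "?T k = 0" if "k \<in> ?S" "k \<noteq> j" for k
        by (rule zero[OF that(1)]) (use that 3 in \<open>simp add: psi_index_def\<close>)
    qed (use S in auto)
    also have "\<dots> = ell2_at m (W i j x)" by (rule at[OF S]) (use 3 in \<open>simp add: psi_index_def\<close>)
    also have "\<dots> = U (Z i j (J m x))"
      using W_act0[OF i j 3] x UJ[OF Wm[OF S], of m] by (simp add: act_def)
    finally show ?thesis .
  qed
qed

lemma W_row_zero:
  assumes "1 \<le> j" "j \<le> r"
  shows "W (n+1) j = zero1"
proof (rule bounded_ops_eqI[OF W_bounded bi1(2)])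
  fix x assume x: "x \<in> H1"
  have Wx: "W (n+1) j x \<in> H1" using bounded_ops_mem[OF W_bounded x, of "n+1" j] assms rn by simp
  have "J 0 (W (n+1) j x) = 0"
  proof (cases "j = r")
    case True
    obtain t where "down_form (c r) zero1 t" using forms_row by blast
    \<comment> \<open>\<open>W\<close> was chosen by \<open>SOME\<close>, so its value is recovered
      by comparing two tensor forms; level 1 is free of the P_0 term.\<close>
    then have "c r (J (Suc 0) x) = J 0 (zero1 x)" using x unfolding down_form_def by blast
    then show ?thesis
      using W_forms(1)[of "n+1"] True x rn by (simp add: c_def down_form_def J_zero)
  next
    case False
    then have "act (c j) 0 0 (W (n+1) j)" using W_act0[of "n+1" j] assms rn by (simp add: c_def)
    then have "c j (J (0+0) x) = J (0+0) (W (n+1) j x)" using x unfolding act_def by blast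
    then show ?thesis using c_below[of j "J 0 x"] assms False J_mem[OF x] by simp
  qed
  then show "W (n+1) j x = zero1 x" using J_inj[OF Wx H1s(3), of 0] J_zero x by simp
qed (use assms rn in auto)

text \<open>In tensor form \<open>c r\<close> is \<open>W (n+1) (r+1) \<otimes> P_0\<close>, since
  the coefficient in column \<open>r\<close> vanishes. It would be zero together with this
  coefficient.\<close>

lemma W_row_nonzero:
  assumes "y \<in> H" "c r y \<noteq> 0"
  shows "W (n+1) (r+1) \<noteq> zero1"
proof
  assume z: "W (n+1) (r+1) = zero1"
  have f: "down_form (c r) zero1 zero1"
    using W_forms(1)[of "n+1"] W_row_zero[of r] z r1 rn by (simp add: c_def)
  have J0: "c r (J k x) = 0" if "x \<in> H1" for k x
    using f that unfolding down_form_def by (cases k) (auto simp: J_zero)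
  have bc: "blin H H (c r)" by (rule c_blin) (use r_bounds in auto)
  have "c r y = 0"
  proof (rule clspan_blin_eqI[of "(\<lambda>(k, x). J k x) ` (UNIV \<times> H1)" H "c r" H "\<lambda>x. 0"])
    show "c r x = 0" if "x \<in> (\<lambda>(k, x). J k x) ` (UNIV \<times> H1)" for x using that J0 by auto
  qed (use bc blin_const_0[OF Hs(2)] assms(1) in \<open>simp_all only: J_total[symmetric]\<close>)
  then show False using assms(2) by simp
qed

lemma H0_H1: "h \<in> H0 \<Longrightarrow> h \<in> H1"
  using pm_H1[of "\<lambda>_. 0" h] mon_exp_zero[of "r+1" "n+2" "\<lambda>_. 0" c h] by simp

text \<open>The subspace \<open>M \<otimes> l^2\<close> is invariant because every generator is a
  sum of coefficients tensored with operators on the second factor. If it is everything,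
  \<open>M\<close> is recovered as the set of its bottom coordinates.\<close>

lemma W_irreducible:
  assumes irr: "\<And>K. \<lbrakk>hilbert_subspace K; K \<subseteq> H;
      \<And>i j x. \<lbrakk>1 \<le> i; i \<le> n+1; 1 \<le> j; j \<le> n+1; x \<in> K\<rbrakk> \<Longrightarrow> Z i j x \<in> K\<rbrakk> \<Longrightarrow> K = {0} \<or> K = H"
    and M: "hilbert_subspace M" "M \<subseteq> H1"
    and inv: "\<And>i j x. \<lbrakk>1 \<le> i; i \<le> n+1; 1 \<le> j; j \<le> n+1; x \<in> M\<rbrakk> \<Longrightarrow> W i j x \<in> M"
  shows "M = {0} \<or> M = H1"
proof -
  note Ms = hilbert_subspaceD[OF M(1)]
  let ?G = "(\<lambda>(k, x). J k x) ` (UNIV \<times> M)"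
  define K where "K = clspan ?G"
  have hK: "hilbert_subspace K" unfolding K_def by (rule hilbert_subspace_clspan)
  note Ks = hilbert_subspaceD[OF hK]
  have JK: "J k x \<in> K" if "x \<in> M" for k x
    unfolding K_def using clspan_superset[of ?G] that by blast
  have KH: "K \<subseteq> H" unfolding K_def by (rule clspan_minimal[OF _ H]) (use J_mem M(2) in auto)
  have bK: "blin K L T" if "blin H L T" for L and T :: "'h \<Rightarrow> 'h" using that KH unfolding blin_def by blast
  have ZJ: "Z i j (J k x) \<in> K" if ij: "1 \<le> i" "i \<le> n+1" "1 \<le> j" "j \<le> n+1" and x: "x \<in> M" for i j k x
  proof -
    have x1: "x \<in> H1" using x M(2) by blast
    have Wm: "W i r x \<in> M" "W i (r+1) x \<in> M" "W i j x \<in> M" using inv ij x r_bounds by auto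
    consider "j = r" | "j = r+1" | "j \<noteq> r" "j \<noteq> r+1" by blast
    then show ?thesis
    proof cases
      case 1
      have f: "Z i r (J 0 x) = J 0 ((if i \<le> r then zero1 else W i (r+1)) x)"
        "Z i r (J (Suc l) x) = J l (W i r x)" for l
        using W_forms(1)[OF ij(1,2)] x1 unfolding down_form_def by blast+
      have "(if i \<le> r then zero1 else W i (r+1)) x \<in> M" using Wm(2) Ms(3) x1 by simp
      then show ?thesis unfolding 1 using JK[OF Wm(1)] JK by (cases k) (simp_all only: f)
    next
      case 2
      have f: "Z i (r+1) (J k x) = J (Suc k) (W i (r+1) x)
          + (if k = 0 then J 0 ((if i \<le> r then W i r else zero1) x) else 0)"
        using W_forms(2)[OF ij(1,2)] x1 unfolding up_form_def by blast
      have "(if i \<le> r then W i r else zero1) x \<in> M" using Wm(1) Ms(3) x1 by simp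
      then have "(if k = 0 then J 0 ((if i \<le> r then W i r else zero1) x) else 0) \<in> K"
        using JK Ks(3) by simp
      then show ?thesis unfolding 2 f by (intro Ks(4) JK Wm(2))
    next
      case 3
      then show ?thesis using W_act0[OF ij 3] x1 JK[OF Wm(3)] by (simp add: act_def)
    qed
  qed
  have "Z i j x \<in> K" if ij: "1 \<le> i" "i \<le> n+1" "1 \<le> j" "j \<le> n+1" and x: "x \<in> K" for i j x
  proof (rule clspan_image_subset[of ?G H "Z i j", OF _ hK])
    show "blin (clspan ?G) H (Z i j)" using bK[OF Z_blin[OF ij]] unfolding K_def .
    show "Z i j y \<in> K" if "y \<in> ?G" for y using that ZJ[OF ij] by auto
    show "x \<in> clspan ?G" using x unfolding K_def .
  qed
  from irr[OF hK KH this] show ?thesis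
  proof
    assume K0: "K = {0}"
    have "x = 0" if "x \<in> M" for x
    proof (rule J_inj[of x 0 0])
      show "J 0 x = J 0 0" using JK[OF that, of 0] K0 J_zero by simp
    qed (use that M(2) H1s(3) in blast)+
    then show ?thesis using Ms(3) by blast
  next
    assume KeqH: "K = H"
    obtain U where U: "blin H (tensor_ell2 H1) U" "\<And>k x. x \<in> H1 \<Longrightarrow> U (J k x) = ell2_at k x"
      by (rule tensor_unitary) (rule that)
    have nth0: "blin (tensor_ell2 H1) UNIV (\<lambda>\<xi>. ell2_nth \<xi> 0)"
      by (rule blinI[where B = 1]) (simp_all add: ell2_nth_simps norm_ell2_nth_le)
    \<comment> \<open>Reading off the coordinate at \<open>e_0\<close> is bounded and sends each
      generator \<open>J k x\<close> of \<open>K\<close> to \<open>x\<close> or 0, hence all of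
      \<open>K\<close> into the closed space \<open>M\<close>; on \<open>J 0 x\<close> it returns
      \<open>x\<close>.\<close>
    have bE: "blin H UNIV (\<lambda>y. ell2_nth (U y) 0)" by (rule blin_comp[OF U(1) nth0])
    have "x \<in> M" if x: "x \<in> H1" for x
    proof -
      have "ell2_nth (U (J 0 x)) 0 \<in> M"
      proof (rule clspan_image_subset[of ?G UNIV "\<lambda>y. ell2_nth (U y) 0", OF _ M(1)])
        show "blin (clspan ?G) UNIV (\<lambda>y. ell2_nth (U y) 0)" using bE KeqH unfolding K_def by simp
        show "ell2_nth (U y) 0 \<in> M" if "y \<in> ?G" for y
        proof -
          obtain k x where e: "y = J k x" and x: "x \<in> M" using \<open>y \<in> ?G\<close> by auto
          have "U y = ell2_at k x" unfolding e by (rule U(2)) (use x M(2) in blast)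
          then show ?thesis using x Ms(3) by (simp add: ell2_nth_at)
        qed
        show "J 0 x \<in> clspan ?G" using KeqH J_mem[OF x] unfolding K_def by simp
      qed
      then show ?thesis using U(2)[OF x, of 0] by (simp add: ell2_nth_at)
    qed
    then show ?thesis using M(2) by blast
  qed
qed

end

section \<open>Decomposition of an irreducible representation\<close>

theorem theorem7p1:
  fixes n r :: nat
    and A :: "'a cstar_struct"
    and z :: "nat \<Rightarrow> nat \<Rightarrow> 'a"
    and H :: "'h::chilbert_space set"
    and \<pi> :: "'a \<Rightarrow> 'h \<Rightarrow> 'h"
    and \<psi> :: "'a \<Rightarrow> complex ell2 \<Rightarrow> complex ell2"
  assumes n: "n \<ge> 2"
    and A: "is_C_SU0 TYPE('h \<Rightarrow> 'h) n A z"
    and \<pi>: "irreducible_representation A H \<pi>"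
    and r: "r = rep_index n z H \<pi>" "r \<le> n"
    and \<psi>: "is_psi n A z r \<psi>"
  shows "\<exists>(H\<^sub>1 :: 'h set) \<pi>\<^sub>1 \<rho>.
    irreducible_representation A H\<^sub>1 \<pi>\<^sub>1 \<and> rep_index n z H\<^sub>1 \<pi>\<^sub>1 = r + 1
    \<and> is_conv n A z H\<^sub>1 \<pi>\<^sub>1 \<psi> \<rho>
    \<and> unitarily_equivalent A H \<pi> (tensor_ell2 H\<^sub>1) \<rho>"
proof -
  have cA: "unital_cstar_algebra A" and rel: "SU0_relations n A z"
    and generated: "\<And>S. unital_cstar_subalgebra A S \<Longrightarrow> (\<forall>i\<in>{1..n+1}. \<forall>j\<in>{1..n+1}. z i j \<in> S) \<Longrightarrow> S = carrier A"
    and univ: "\<And>(B :: ('h \<Rightarrow> 'h) cstar_struct) w. unital_cstar_algebra B \<Longrightarrow> SU0_relations n B w \<Longrightarrow>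
        (\<exists>\<phi>. unital_star_hom A B \<phi> \<and> (\<forall>i\<in>{1..n+1}. \<forall>j\<in>{1..n+1}. \<phi> (z i j) = w i j))"
    using A unfolding is_C_SU0_def by blast+
  have rep: "representation A H \<pi>" and H0: "H \<noteq> {0}"
    and irr: "\<And>M. hilbert_subspace M \<Longrightarrow> M \<subseteq> H \<Longrightarrow> (\<And>a x. a \<in> carrier A \<Longrightarrow> x \<in> M \<Longrightarrow> \<pi> a x \<in> M) \<Longrightarrow> M = {0} \<or> M = H"
    using \<pi> unfolding irreducible_representation_def by blast+
  have H: "hilbert_subspace H" by (rule representationD(1)[OF rep])
  have zA: "z i j \<in> carrier A" if "i \<in> {1..n+1}" "j \<in> {1..n+1}" for i j
    by (rule SU0_relationsD(1)[OF rel that])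
  define Z where "Z i j = \<pi> (z i j)" for i j
  have hom: "unital_star_hom A (B_op H) \<pi>" using rep by (simp add: representation_def)
  have "SU0_relations n (B_op H) Z"
    unfolding Z_def by (rule SU0_relations_hom[OF cA unital_cstar_algebra_B_op[OF H] hom rel])
  then have "SU0_ops n H Z" using SU0_relations_B_op[OF H] by blast
  then interpret SU0_ops n H Z .
  \<comment> \<open>Irreducibility restated for the generators, the form in which both
    \<open>pm_span\<close> and the spaces arising from \<open>H1\<close> are tested.\<close>
  have irrZ: "K = {0} \<or> K = H" if K: "hilbert_subspace K" "K \<subseteq> H"
    and inv: "\<And>i j x. \<lbrakk>1 \<le> i; i \<le> n+1; 1 \<le> j; j \<le> n+1; x \<in> K\<rbrakk> \<Longrightarrow> Z i j x \<in> K" for K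
  proof (rule irr[OF K])
    fix a x assume a: "a \<in> carrier A" and x: "x \<in> K"
    let ?G = "{z i j | i j. i \<in> {1..n+1} \<and> j \<in> {1..n+1}}"
    show "\<pi> a x \<in> K"
    proof (rule representation_invariant[OF cA rep _ _ K _ _ a x, of ?G])
      show "S = carrier A" if "unital_cstar_subalgebra A S" "?G \<subseteq> S" for S
        by (rule generated[OF that(1)]) (use that(2) in blast)
      show "?G \<subseteq> carrier A" using zA by blast
      fix g y assume "g \<in> ?G" and y: "y \<in> K"
      then obtain i j where ij: "i \<in> {1..n+1}" "j \<in> {1..n+1}" and g: "g = z i j" by blast
      show "\<pi> g y \<in> K" using inv[of i j y] ij y unfolding g Z_def by simp
      have "adjoint_op H (Z i j) y \<in> K" by (rule Zs_invariant[OF inv K(2) ij y])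
      then show "\<pi> (cstar A g) y \<in> K" using representationD(7)[OF rep zA[OF ij]] unfolding g Z_def by simp
    qed
  qed
  let ?S = "{i \<in> {1..n+1}. \<pi> (z (n+1) i) \<noteq> \<zero>\<^bsub>B_op H\<^esub>}"
  have zeroI: "\<pi> (z (n+1) i) = \<zero>\<^bsub>B_op H\<^esub> \<longleftrightarrow> (\<forall>x\<in>H. c i x = 0)" if "i \<in> {1..n+1}" for i
    using bounded_ops_ext_iff[OF H c_bounded[of i] bounded_ops_intros(2)[OF H]] that
    by (simp add: c_def Z_def)
  \<comment> \<open>\<open>Min\<close> needs a nonempty set: \<open>c (n+1)\<close> is an isometry
    on \<open>H \<noteq> {0}\<close>, so the corner entry is nonzero.\<close>
  have "?S \<noteq> {}"
  proof
    assume "?S = {}"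
    then have z0: "\<pi> (z (n+1) (n+1)) = \<zero>\<^bsub>B_op H\<^esub>" by auto
    have "c (n+1) x = 0" if "x \<in> H" for x using iffD1[OF zeroI z0] that by simp
    then have "x = 0" if "x \<in> H" for x
      using cs_c_last[OF that] that lin_zero(4)[of "n+1"] by simp
    then show False using H0 hilbert_subspaceD(3)[OF H] by blast
  qed
  moreover have "finite ?S" by simp
  ultimately have rS: "r \<in> ?S" and rmin: "\<And>i. i \<in> ?S \<Longrightarrow> r \<le> i"
    unfolding r(1) rep_index_def using Min_in Min_le by blast+
  have r1: "1 \<le> r" using rS by simp
  obtain y where y: "y \<in> H" "c r y \<noteq> 0" using rS zeroI[of r] by auto
  interpret SU0_row n H Z r
  proof
    show "c j x = 0" if "1 \<le> j" "j < r" "x \<in> H" for j x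
      using zeroI[of j] rmin[of j] that r(2) by fastforce
  qed (use r1 r(2) in auto)
  have "pm_span = {0} \<or> pm_span = H" by (rule irrZ[OF hilbert_pm_span pm_span_H Z_pm_span])
  \<comment> \<open>The monomial with all exponents 0 shows that \<open>pm_span\<close> contains
    \<open>H0\<close>, and \<open>c r y\<close> is a nonzero vector there.\<close>
  moreover have "c r y \<in> pm_span"
    using pm_in_span[OF c_H0[OF y(1)], of "\<lambda>_. 0"] mon_exp_zero[of "r+1" "n+2" "\<lambda>_. 0" c "c r y"] by simp
  ultimately have "pm_span = H" using y(2) by blast
  then interpret SU0_total n H Z r by unfold_locales
  let ?L = "tensor_ell2 H1"
  \<comment> \<open>\<open>H1\<close> lies in the type of \<open>H\<close>, so
    \<open>B_op H1\<close> is among the algebras for which universality was assumed.\<close>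
  obtain \<phi> where \<phi>: "unital_star_hom A (B_op H1) \<phi>" "\<forall>i\<in>{1..n+1}. \<forall>j\<in>{1..n+1}. \<phi> (z i j) = W i j"
    using univ[OF unital_cstar_algebra_B_op[OF hilbert_H1] W_relations] by blast
  have rep1: "representation A H1 \<phi>" using \<phi>(1) hilbert_H1 by (simp add: representation_def)
  have "M = {0} \<or> M = H1" if M: "hilbert_subspace M" "M \<subseteq> H1" and inv: "\<forall>a\<in>carrier A. \<phi> a ` M \<subseteq> M" for M
  proof (rule W_irreducible[OF irrZ M])
    fix i j x assume ij: "1 \<le> i" "i \<le> n+1" "1 \<le> j" "j \<le> n+1" and x: "x \<in> M"
    have "\<phi> (z i j) x \<in> M" using inv zA[of i j] ij x by auto
    then show "W i j x \<in> M" using \<phi>(2) ij by simp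
  qed
  moreover have "H1 \<noteq> {0}" using H0_H1[OF c_H0[OF y(1)]] y(2) by blast
  ultimately have irr1: "irreducible_representation A H1 \<phi>"
    using rep1 unfolding irreducible_representation_def by blast
  have index: "rep_index n z H1 \<phi> = r + 1"
    unfolding rep_index_def
  proof (rule Min_eqI)
    show "r + 1 \<in> {i \<in> {1..n+1}. \<phi> (z (n+1) i) \<noteq> \<zero>\<^bsub>B_op H1\<^esub>}"
      using \<phi>(2) W_row_nonzero[OF y] r(2) by simp
    show "r + 1 \<le> i" if "i \<in> {i \<in> {1..n+1}. \<phi> (z (n+1) i) \<noteq> \<zero>\<^bsub>B_op H1\<^esub>}" for i
      using that \<phi>(2) W_row_zero[of i] by fastforce
  qed simp
  obtain U where U: "blin H ?L U" "U ` H = ?L"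
    "\<And>x y. x \<in> H \<Longrightarrow> y \<in> H \<Longrightarrow> cinner (U x) (U y) = cinner x y"
    "\<And>k x. x \<in> H1 \<Longrightarrow> U (J k x) = ell2_at k x"
    by (rule tensor_unitary) (rule that)
  obtain \<rho> where \<rho>: "representation A ?L \<rho>" "unitarily_equivalent A H \<pi> ?L \<rho>"
    "\<And>a x. a \<in> carrier A \<Longrightarrow> x \<in> H \<Longrightarrow> \<rho> a (U x) = U (\<pi> a x)"
    using representation_transport[OF rep hilbert_subspace_tensor_ell2 U(1-3)] by blast
  have "\<rho> (z i j) = (\<lambda>\<xi>\<in>?L. \<Sum>k=min i j..max i j. op_tensor H1 (\<phi> (z i k)) (\<psi> (z k j)) \<xi>)"
    if i: "i \<in> {1..n+1}" and j: "j \<in> {1..n+1}" for i j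
  proof -
    have kI: "k \<in> {1..n+1}" if "k \<in> {min i j..max i j}" for k using that i j by auto
    have Wb: "W i k \<in> bounded_ops H1" if "k \<in> {min i j..max i j}" for k
      using W_bounded[of i k] i kI[OF that] by simp
    have op: "op_tensor H1 (\<phi> (z i k)) (\<psi> (z k j)) = restrict (reindex_op (psi_index r k j) (W i k)) ?L"
      if k: "k \<in> {min i j..max i j}" for k
    proof -
      have "\<phi> (z i k) = W i k" using \<phi>(2) i kI[OF k] by blast
      moreover have "\<psi> (z k j) = psi_gen r k j" using \<psi> kI[OF k] j unfolding is_psi_def by blast
      ultimately show ?thesis
        using op_tensor_reindex[OF hilbert_H1 Wb[OF k] inj_psi_index] by (simp only: psi_gen_reindex)
    qed
    have Ls: "csubspace ?L" by (rule hilbert_subspaceD(2)[OF hilbert_subspace_tensor_ell2])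
    let ?R = "\<lambda>\<xi>. \<Sum>k=min i j..max i j. reindex_op (psi_index r k j) (W i k) \<xi>"
    have bR: "blin ?L ?L ?R"
      by (rule blin_finite_sum[OF blin_reindex_op[OF hilbert_H1 bounded_ops_blin[OF Wb] inj_psi_index] Ls])
    have b\<rho>: "\<rho> (z i j) \<in> bounded_ops ?L" by (rule representationD(2)[OF \<rho>(1) zA[OF i j]])
    have "\<rho> (z i j) = restrict ?R ?L"
    proof (rule bounded_ops_eqI[OF b\<rho> restrict_bounded_ops[OF bR Ls]])
      fix \<xi> assume \<xi>: "\<xi> \<in> ?L"
      have "\<rho> (z i j) \<xi> = ?R \<xi>"
      proof (rule tensor_ell2_eqI[OF hilbert_H1 bounded_ops_blin[OF b\<rho>] bR _ \<xi>])
        fix m x assume x: "x \<in> H1"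
        have "\<rho> (z i j) (ell2_at m x) = U (Z i j (J m x))"
          using \<rho>(3)[OF zA[OF i j] J_mem[OF x], of m] U(4)[OF x] by (simp add: Z_def)
        also have "\<dots> = ?R (ell2_at m x)"
          by (rule sum_psi_terms[symmetric, OF _ _ _ _ x U(1,4)]) (use i j in auto)
        finally show "\<rho> (z i j) (ell2_at m x) = ?R (ell2_at m x)" .
      qed
      then show "\<rho> (z i j) \<xi> = restrict ?R ?L \<xi>" using \<xi> by simp
    qed
    also have "\<dots> = (\<lambda>\<xi>\<in>?L. \<Sum>k=min i j..max i j. op_tensor H1 (\<phi> (z i k)) (\<psi> (z k j)) \<xi>)"
      by (rule restrict_ext, rule sum.cong[OF refl]) (simp add: op)
    finally show ?thesis .
  qed
  then have "is_conv n A z H1 \<phi> \<psi> \<rho>" using \<rho>(1) by (simp add: is_conv_def)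
  then show ?thesis using irr1 index \<rho>(2) by blast
qed

end
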